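(* Let $\mathcal M,\mathcal N,\mathcal P$ be monoidal categories. Let $\mathcal C$ be an $(\mathcal N,\mathcal M)$-biactegory, $\mathcal D$ an $(\mathcal M,\mathcal P)$-biactegory and $\mathcal E$ an $(\mathcal N,\mathcal P)$-biactegory. Then the category $[\mathcal D,\mathcal E]_{\mathcal P}$ of (right) $\mathcal P$-linear maps $\mathcal D\to\mathcal E$ has a canonical $(\mathcal N,\mathcal M)$-biactegory structure, and is such that $$\mathcal N\text{-}\mathrm{Act}\text{-}\mathcal P\,(\mathcal C\otimes_{\mathcal M}\mathcal D,\;\mathcal E)\;\cong\;\mathcal N\text{-}\mathrm{Act}\text{-}\mathcal M\,(\mathcal C,\;[\mathcal D,\mathcal E]_{\mathcal P}).$$
   Context: Actegories. For a monoidal category $(\mathcal M,j,\otimes,\lambda,\rho,\alpha)$ a left $\mathcal M$-actegory is a category $\mathcal C$ with a functor $\bullet:\mathcal M\times\mathcal C\to\mathcal C$ and natural isomorphisms $\eta_c:c\to j\bullet c$, $\mu_{m,n,c}:m\bullet(n\bullet c)\to(m\otimes n)\bullet c$ such that $(\alpha_{m,n,p}\bullet c)\circ\mu_{m\otimes n,p,c}\circ\mu_{m,n,p\bullet c}=\mu_{m,n\otimes p,c}\circ(m\bullet\mu_{n,p,c})$, $\mu_{j,m,c}\circ\eta_{m\bullet c}=\lambda_m^{-1}\bullet c$, $\mu_{m,j,c}\circ(m\bullet\eta_c)=\rho_m^{-1}\bullet c$. A right $\mathcal M$-actegory is a left $\mathcal M^{\mathrm{rev}}$-actegory ($\mathcal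 M^{\mathrm{rev}}$ has product $m\otimes^{\mathrm{rev}}n=n\otimes m$); its action is written on the right, with $\eta_c:c\to c\star j$ and $\mu_{c,m,n}:(c\star m)\star n\to c\star(m\otimes n)$. Linear functors. A (strong) $\mathcal M$-linear functor between left $\mathcal M$-actegories $(\mathcal C,\bullet)\to(\mathcal D,\bullet')$ is a functor $F$ with a natural isomorphism $\ell_{m,c}:m\bullet'F(c)\to F(m\bullet c)$ such that $F(\mu_{m,n,c})\circ\ell_{m,n\bullet c}\circ(m\bullet'\ell_{n,c})=\ell_{m\otimes n,c}\circ\mu'_{m,n,F(c)}$ and $\ell_{j,c}\circ\eta'_{F(c)}=F(\eta_c)$. A linear transformation $(F,\ell)\Rightarrow(G,\nu)$ is a natural transformation $\xi$ with $\xi_{m\bullet c}\circ\ell_{m,c}=\nu_{m,c}\circ(m\bullet'\xi_c)$. Similarly on the right. Biactegories. An $(\mathcal M,\mathcal N)$-biactegory is a category $\mathcal C$ with a left $\mathcal M$-action $\bullet$, a right $\mathcal N$-action $\star$ and a natural isomorphism $\zeta_{m,c,n}:m\bullet(c\star n)\to(m\bullet c)\star n$ (bimodulator) such that: $(\mu^\bullet_{m,m',c}\star n)\circ\zeta_{m,m'\bullet c,n}\circ(m\bullet\zeta_{m',c,n})=\zeta_{m\otimes m',c,n}\circ\mu^\bullet_{m,m',c\star n}$; $\zeta_{m,c,n\otimes n'}\circ(m\bullet\mu^\star_{c,n,n'})=\mu^\star_{m\bullet c,n,n'}\circ(\zeta_{m,c,n}\star n')\circ\zeta_{m,c\star n,n'}$;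 $\zeta_{j,c,n}\circ\eta^\bullet_{c\star n}=\eta^\bullet_c\star n$; $\zeta_{m,c,j}\circ(m\bullet\eta^\star_c)=\eta^\star_{m\bullet c}$ (here $j$ denotes either monoidal unit). A (strong) bilinear functor is a functor $F$ with a left linear structure $\ell$ and a right linear structure $r_{c,n}:F(c)\star'n\to F(c\star n)$, both invertible, such that $r_{m\bullet c,n}\circ(\ell_{m,c}\star'n)\circ\zeta'_{m,F(c),n}=F(\zeta_{m,c,n})\circ\ell_{m,c\star n}\circ(m\bullet'r_{c,n})$. A bilinear transformation is a natural transformation linear on both sides. $\mathcal M\text{-}\mathrm{Act}\text{-}\mathcal N$ is the 2-category of $(\mathcal M,\mathcal N)$-biactegories, (strong) bilinear functors and bilinear transformations. Tensor product. For a right $\mathcal M$-actegory $(\mathcal C,\star)$ and a left $\mathcal M$-actegory $(\mathcal D,\bullet)$, an $\mathcal M$-balanced functor $F:\mathcal C\times\mathcal D\to\mathcal X$ is a functor with a natural isomorphism $\varepsilon_{c,m,d}:F(c\star m,d)\to F(c,m\bullet d)$ such that $F(c,\mu_{m,n,d})\circ\varepsilon_{c,m,n\bullet d}\circ\varepsilon_{c\star m,n,d}=\varepsilon_{c,m\otimes n,d}\circ F(\mu_{c,m,n},d)$ and $\varepsilon_{c,j,d}\circ F(\eta_c,d)=F(c,\eta_d)$. A balanced transformation $(F,\varepsilon)\Rightarrow(G,\vartheta)$ is a natural transformation $\xi$ with $\vartheta_{c,m,d}\circ\xi_{c\star m,d}=\xi_{c,m\bullet d}\circ\varepsilon_{c,m,d}$.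 These form $\mathrm{Bal}(\mathcal C\times\mathcal D,\mathcal X)$, and $\mathcal C\otimes_{\mathcal M}\mathcal D$ is the category representing it: $\mathrm{Bal}(\mathcal C\times\mathcal D,\mathcal X)\cong\mathbf{Cat}(\mathcal C\otimes_{\mathcal M}\mathcal D,\mathcal X)$ naturally in $\mathcal X$. If $\mathcal C$ is an $(\mathcal N,\mathcal M)$-biactegory and $\mathcal D$ an $(\mathcal M,\mathcal P)$-biactegory, $\mathcal C\otimes_{\mathcal M}\mathcal D$ is an $(\mathcal N,\mathcal P)$-biactegory, with left action inherited from $\mathcal C$ and right action from $\mathcal D$. The canonical structure on $[\mathcal D,\mathcal E]_{\mathcal P}$ (objects: strong right $\mathcal P$-linear functors; morphisms: right $\mathcal P$-linear transformations) is given by $(n\bullet F)(d)=n\bullet F(d)$ and $(F\bullet m)(d)=F(m\bullet d)$. *)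

theory Defs
  imports "HOL-Library.FuncSet"
begin

section \<open>Categories, functors, natural transformations\<close>

text \<open>Composition is in applicative order: \<open>g \<cdot>\<^bsub>C\<^esub> f\<close> is \<open>g\<close> after \<open>f\<close>.\<close>

record ('o, 'a) cat =
  Ob :: "'o set"
  Arr :: "'a set"
  Dom :: "'a \<Rightarrow> 'o"
  Cod :: "'a \<Rightarrow> 'o"
  Id :: "'o \<Rightarrow> 'a"
  Comp :: "'a \<Rightarrow> 'a \<Rightarrow> 'a" (infixr \<open>\<cdot>\<index>\<close> 65)

definition hom :: "('o, 'a, 'z) cat_scheme \<Rightarrow> 'o \<Rightarrow> 'o \<Rightarrow> 'a set" where
  "hom C x y = {f \<in> Arr C. Dom C f = x \<and> Cod C f = y}"

locale category =
  fixes C :: "('o, 'a, 'z) cat_scheme"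
  assumes Dom_in: "f \<in> Arr C \<Longrightarrow> Dom C f \<in> Ob C"
    and Cod_in: "f \<in> Arr C \<Longrightarrow> Cod C f \<in> Ob C"
    and Id_hom: "x \<in> Ob C \<Longrightarrow> Id C x \<in> hom C x x"
    and Comp_hom: "f \<in> hom C x y \<Longrightarrow> g \<in> hom C y z \<Longrightarrow> g \<cdot>\<^bsub>C\<^esub> f \<in> hom C x z"
    and Id_left: "f \<in> hom C x y \<Longrightarrow> Id C y \<cdot>\<^bsub>C\<^esub> f = f"
    and Id_right: "f \<in> hom C x y \<Longrightarrow> f \<cdot>\<^bsub>C\<^esub> Id C x = f"
    and Comp_assoc: "f \<in> hom C w x \<Longrightarrow> g \<in> hom C x y \<Longrightarrow> h \<in> hom C y z \<Longrightarrow>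
      (h \<cdot>\<^bsub>C\<^esub> g) \<cdot>\<^bsub>C\<^esub> f = h \<cdot>\<^bsub>C\<^esub> (g \<cdot>\<^bsub>C\<^esub> f)"

definition inverse_arrows :: "('o, 'a, 'z) cat_scheme \<Rightarrow> 'a \<Rightarrow> 'a \<Rightarrow> bool" where
  "inverse_arrows C f g \<longleftrightarrow> f \<in> Arr C \<and> g \<in> hom C (Cod C f) (Dom C f) \<and>
     g \<cdot>\<^bsub>C\<^esub> f = Id C (Dom C f) \<and> f \<cdot>\<^bsub>C\<^esub> g = Id C (Cod C f)"

definition iso_arr :: "('o, 'a, 'z) cat_scheme \<Rightarrow> 'a \<Rightarrow> bool" where
  "iso_arr C f \<longleftrightarrow> (\<exists>g. inverse_arrows C f g)"

definition inv_arr :: "('o, 'a, 'z) cat_scheme \<Rightarrow> 'a \<Rightarrow> 'a" where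
  "inv_arr C f = (THE g. inverse_arrows C f g)"

definition prod_cat ::
  "('o1, 'a1, 'z1) cat_scheme \<Rightarrow> ('o2, 'a2, 'z2) cat_scheme \<Rightarrow> ('o1 \<times> 'o2, 'a1 \<times> 'a2) cat" where
  "prod_cat A B =
    \<lparr>Ob = Ob A \<times> Ob B, Arr = Arr A \<times> Arr B,
     Dom = \<lambda>(f, g). (Dom A f, Dom B g), Cod = \<lambda>(f, g). (Cod A f, Cod B g),
     Id = \<lambda>(x, y). (Id A x, Id B y),
     Comp = \<lambda>(f', g') (f, g). (f' \<cdot>\<^bsub>A\<^esub> f, g' \<cdot>\<^bsub>B\<^esub> g)\<rparr>"

record ('o1, 'a1, 'o2, 'a2) fctr =
  fo :: "'o1 \<Rightarrow> 'o2"
  fm :: "'a1 \<Rightarrow> 'a2"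

locale cat_functor = A: category A + B: category B
  for A :: "('o1, 'a1, 'z1) cat_scheme" and B :: "('o2, 'a2, 'z2) cat_scheme" +
  fixes F :: "('o1, 'a1, 'o2, 'a2, 'z) fctr_scheme"
  assumes fo_in: "x \<in> Ob A \<Longrightarrow> fo F x \<in> Ob B"
    and fm_hom: "f \<in> hom A x y \<Longrightarrow> fm F f \<in> hom B (fo F x) (fo F y)"
    and fm_Id: "x \<in> Ob A \<Longrightarrow> fm F (Id A x) = Id B (fo F x)"
    and fm_Comp: "f \<in> hom A x y \<Longrightarrow> g \<in> hom A y z \<Longrightarrow> fm F (g \<cdot>\<^bsub>A\<^esub> f) = fm F g \<cdot>\<^bsub>B\<^esub> fm F f"

definition cat_iso ::
  "('o1, 'a1, 'z1) cat_scheme \<Rightarrow> ('o2, 'a2, 'z2) cat_scheme \<Rightarrow> ('o1, 'a1, 'o2, 'a2) fctr \<Rightarrow> bool" where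
  "cat_iso A B F \<longleftrightarrow> cat_functor A B F \<and> bij_betw (fo F) (Ob A) (Ob B) \<and> bij_betw (fm F) (Arr A) (Arr B)"

definition isomorphic_cats ::
  "('o1, 'a1, 'z1) cat_scheme \<Rightarrow> ('o2, 'a2, 'z2) cat_scheme \<Rightarrow> bool" (infix \<open>\<cong>\<close> 50) where
  "A \<cong> B \<longleftrightarrow> (\<exists>F. cat_iso A B F)"

definition nat_trans ::
  "('o1, 'a1, 'z1) cat_scheme \<Rightarrow> ('o2, 'a2, 'z2) cat_scheme \<Rightarrow>
   ('o1, 'a1, 'o2, 'a2, 'z) fctr_scheme \<Rightarrow> ('o1, 'a1, 'o2, 'a2, 'z) fctr_scheme \<Rightarrow> ('o1 \<Rightarrow> 'a2) \<Rightarrow> bool" where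
  "nat_trans A B F G \<xi> \<longleftrightarrow>
     (\<forall>x\<in>Ob A. \<xi> x \<in> hom B (fo F x) (fo G x)) \<and>
     (\<forall>f\<in>Arr A. \<xi> (Cod A f) \<cdot>\<^bsub>B\<^esub> fm F f = fm G f \<cdot>\<^bsub>B\<^esub> \<xi> (Dom A f))"

text \<open>
  Categories whose objects are functors (possibly with extra structure) need equality of objects
  and arrows to mean equality on the carriers. All functions involved are therefore required to be
  \<open>extensional\<close>, i.e. \<open>undefined\<close> off their domain, and arrows of such a category carry
  their source and target.
\<close>

definition ext_functor ::
  "('o1, 'a1, 'z1) cat_scheme \<Rightarrow> ('o1, 'a1, 'o2, 'a2, 'z) fctr_scheme \<Rightarrow> bool" where
  "ext_functor A F \<longleftrightarrow> fo F \<in> extensional (Ob A) \<and> fm F \<in> extensional (Arr A)"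

record ('f, 'o, 'a) trans =
  Src :: 'f
  Tgt :: 'f
  Cmp :: "'o \<Rightarrow> 'a"

text \<open>The category with objects \<open>S\<close> (functors \<open>A \<rightarrow> B\<close> with structure) and with arrows the natural
  transformations satisfying \<open>Q\<close>, under vertical composition.\<close>

definition fun_cat ::
  "('o1, 'a1, 'z1) cat_scheme \<Rightarrow> ('o2, 'a2, 'z2) cat_scheme \<Rightarrow>
   ('o1, 'a1, 'o2, 'a2, 'z) fctr_scheme set \<Rightarrow>
   (('o1, 'a1, 'o2, 'a2, 'z) fctr_scheme \<Rightarrow> ('o1, 'a1, 'o2, 'a2, 'z) fctr_scheme \<Rightarrow> ('o1 \<Rightarrow> 'a2) \<Rightarrow> bool) \<Rightarrow>
   (('o1, 'a1, 'o2, 'a2, 'z) fctr_scheme, (('o1, 'a1, 'o2, 'a2, 'z) fctr_scheme, 'o1, 'a2) trans) cat" where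
  "fun_cat A B S Q =
    \<lparr>Ob = S,
     Arr = {\<tau>. Src \<tau> \<in> S \<and> Tgt \<tau> \<in> S \<and> Cmp \<tau> \<in> extensional (Ob A) \<and>
               nat_trans A B (Src \<tau>) (Tgt \<tau>) (Cmp \<tau>) \<and> Q (Src \<tau>) (Tgt \<tau>) (Cmp \<tau>)},
     Dom = Src, Cod = Tgt,
     Id = \<lambda>F. \<lparr>Src = F, Tgt = F, Cmp = \<lambda>x\<in>Ob A. Id B (fo F x)\<rparr>,
     Comp = \<lambda>\<tau> \<sigma>. \<lparr>Src = Src \<sigma>, Tgt = Tgt \<tau>, Cmp = \<lambda>x\<in>Ob A. Cmp \<tau> x \<cdot>\<^bsub>B\<^esub> Cmp \<sigma> x\<rparr>\<rparr>"

definition Cat ::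
  "('o1, 'a1, 'z1) cat_scheme \<Rightarrow> ('o2, 'a2, 'z2) cat_scheme \<Rightarrow>
   (('o1, 'a1, 'o2, 'a2) fctr, (('o1, 'a1, 'o2, 'a2) fctr, 'o1, 'a2) trans) cat" where
  "Cat A B = fun_cat A B {F. cat_functor A B F \<and> ext_functor A F} (\<lambda>_ _ _. True)"


section \<open>Monoidal categories\<close>

text \<open>Here \<open>alpha M m n p : (m \<otimes> n) \<otimes> p \<rightarrow> m \<otimes> (n \<otimes> p)\<close>, \<open>lam M m : j \<otimes> m \<rightarrow> m\<close>,
  \<open>rho M m : m \<otimes> j \<rightarrow> m\<close>; \<open>\<otimes>\<close> acts on objects and \<open>\<boxtimes>\<close> on arrows.\<close>

record ('o, 'a) monoidal = "('o, 'a) cat" +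
  unit :: 'o (\<open>j\<index>\<close>)
  tens_o :: "'o \<Rightarrow> 'o \<Rightarrow> 'o" (infixl \<open>\<otimes>\<index>\<close> 70)
  tens_a :: "'a \<Rightarrow> 'a \<Rightarrow> 'a" (infixl \<open>\<boxtimes>\<index>\<close> 70)
  alpha :: "'o \<Rightarrow> 'o \<Rightarrow> 'o \<Rightarrow> 'a"
  lam :: "'o \<Rightarrow> 'a"
  rho :: "'o \<Rightarrow> 'a"

locale monoidal_category = category M
  for M :: "('o, 'a) monoidal" +
  assumes tens_functor:
      "cat_functor (prod_cat M M) M \<lparr>fo = \<lambda>(m, n). m \<otimes>\<^bsub>M\<^esub> n, fm = \<lambda>(f, g). f \<boxtimes>\<^bsub>M\<^esub> g\<rparr>"
    and unit_in: "j\<^bsub>M\<^esub> \<in> Ob M"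
    and alpha_hom: "m \<in> Ob M \<Longrightarrow> n \<in> Ob M \<Longrightarrow> p \<in> Ob M \<Longrightarrow>
      alpha M m n p \<in> hom M ((m \<otimes>\<^bsub>M\<^esub> n) \<otimes>\<^bsub>M\<^esub> p) (m \<otimes>\<^bsub>M\<^esub> (n \<otimes>\<^bsub>M\<^esub> p))"
    and alpha_iso: "m \<in> Ob M \<Longrightarrow> n \<in> Ob M \<Longrightarrow> p \<in> Ob M \<Longrightarrow> iso_arr M (alpha M m n p)"
    and alpha_nat: "f \<in> hom M m m' \<Longrightarrow> g \<in> hom M n n' \<Longrightarrow> h \<in> hom M p p' \<Longrightarrow>
      alpha M m' n' p' \<cdot>\<^bsub>M\<^esub> ((f \<boxtimes>\<^bsub>M\<^esub> g) \<boxtimes>\<^bsub>M\<^esub> h) = (f \<boxtimes>\<^bsub>M\<^esub> (g \<boxtimes>\<^bsub>M\<^esub> h)) \<cdot>\<^bsub>M\<^esub> alpha M m n p"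
    and lam_hom: "m \<in> Ob M \<Longrightarrow> lam M m \<in> hom M (j\<^bsub>M\<^esub> \<otimes>\<^bsub>M\<^esub> m) m"
    and lam_iso: "m \<in> Ob M \<Longrightarrow> iso_arr M (lam M m)"
    and lam_nat: "f \<in> hom M m n \<Longrightarrow> lam M n \<cdot>\<^bsub>M\<^esub> (Id M j\<^bsub>M\<^esub> \<boxtimes>\<^bsub>M\<^esub> f) = f \<cdot>\<^bsub>M\<^esub> lam M m"
    and rho_hom: "m \<in> Ob M \<Longrightarrow> rho M m \<in> hom M (m \<otimes>\<^bsub>M\<^esub> j\<^bsub>M\<^esub>) m"
    and rho_iso: "m \<in> Ob M \<Longrightarrow> iso_arr M (rho M m)"
    and rho_nat: "f \<in> hom M m n \<Longrightarrow> rho M n \<cdot>\<^bsub>M\<^esub> (f \<boxtimes>\<^bsub>M\<^esub> Id M j\<^bsub>M\<^esub>) = f \<cdot>\<^bsub>M\<^esub> rho M m"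
    and pentagon: "m \<in> Ob M \<Longrightarrow> n \<in> Ob M \<Longrightarrow> p \<in> Ob M \<Longrightarrow> q \<in> Ob M \<Longrightarrow>
      alpha M m n (p \<otimes>\<^bsub>M\<^esub> q) \<cdot>\<^bsub>M\<^esub> alpha M (m \<otimes>\<^bsub>M\<^esub> n) p q =
      (Id M m \<boxtimes>\<^bsub>M\<^esub> alpha M n p q) \<cdot>\<^bsub>M\<^esub> alpha M m (n \<otimes>\<^bsub>M\<^esub> p) q \<cdot>\<^bsub>M\<^esub> (alpha M m n p \<boxtimes>\<^bsub>M\<^esub> Id M q)"
    and triangle: "m \<in> Ob M \<Longrightarrow> n \<in> Ob M \<Longrightarrow>
      (Id M m \<boxtimes>\<^bsub>M\<^esub> lam M n) \<cdot>\<^bsub>M\<^esub> alpha M m j\<^bsub>M\<^esub> n = rho M m \<boxtimes>\<^bsub>M\<^esub> Id M n"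

definition mrev :: "('o, 'a) monoidal \<Rightarrow> ('o, 'a) monoidal" where
  "mrev M = M\<lparr>tens_o := \<lambda>m n. n \<otimes>\<^bsub>M\<^esub> m, tens_a := \<lambda>f g. g \<boxtimes>\<^bsub>M\<^esub> f,
              alpha := \<lambda>m n p. inv_arr M (alpha M p n m), lam := rho M, rho := lam M\<rparr>"


section \<open>Actegories\<close>

text \<open>Data of an action: \<open>\<bullet>\<close> acts on objects, \<open>\<odot>\<close> on arrows, \<open>eta A c : c \<rightarrow> j \<bullet> c\<close> and
  \<open>mu A m n c : m \<bullet> (n \<bullet> c) \<rightarrow> (m \<otimes> n) \<bullet> c\<close>.\<close>

record ('mo, 'ma, 'o, 'a) action =
  act_o :: "'mo \<Rightarrow> 'o \<Rightarrow> 'o" (infixr \<open>\<bullet>\<index>\<close> 75)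
  act_a :: "'ma \<Rightarrow> 'a \<Rightarrow> 'a" (infixr \<open>\<odot>\<index>\<close> 75)
  eta :: "'o \<Rightarrow> 'a"
  mu :: "'mo \<Rightarrow> 'mo \<Rightarrow> 'o \<Rightarrow> 'a"

locale left_actegory = M: monoidal_category M + C: category C
  for M :: "('mo, 'ma) monoidal" and C :: "('o, 'a, 'z) cat_scheme" +
  fixes A :: "('mo, 'ma, 'o, 'a) action"
  assumes act_functor:
      "cat_functor (prod_cat M C) C \<lparr>fo = \<lambda>(m, c). m \<bullet>\<^bsub>A\<^esub> c, fm = \<lambda>(f, g). f \<odot>\<^bsub>A\<^esub> g\<rparr>"
    and eta_hom: "c \<in> Ob C \<Longrightarrow> eta A c \<in> hom C c (j\<^bsub>M\<^esub> \<bullet>\<^bsub>A\<^esub> c)"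
    and eta_iso: "c \<in> Ob C \<Longrightarrow> iso_arr C (eta A c)"
    and eta_nat: "h \<in> hom C c d \<Longrightarrow> eta A d \<cdot>\<^bsub>C\<^esub> h = (Id M j\<^bsub>M\<^esub> \<odot>\<^bsub>A\<^esub> h) \<cdot>\<^bsub>C\<^esub> eta A c"
    and mu_hom: "m \<in> Ob M \<Longrightarrow> n \<in> Ob M \<Longrightarrow> c \<in> Ob C \<Longrightarrow>
      mu A m n c \<in> hom C (m \<bullet>\<^bsub>A\<^esub> n \<bullet>\<^bsub>A\<^esub> c) ((m \<otimes>\<^bsub>M\<^esub> n) \<bullet>\<^bsub>A\<^esub> c)"
    and mu_iso: "m \<in> Ob M \<Longrightarrow> n \<in> Ob M \<Longrightarrow> c \<in> Ob C \<Longrightarrow> iso_arr C (mu A m n c)"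
    and mu_nat: "f \<in> hom M m m' \<Longrightarrow> g \<in> hom M n n' \<Longrightarrow> h \<in> hom C c c' \<Longrightarrow>
      mu A m' n' c' \<cdot>\<^bsub>C\<^esub> (f \<odot>\<^bsub>A\<^esub> g \<odot>\<^bsub>A\<^esub> h) = ((f \<boxtimes>\<^bsub>M\<^esub> g) \<odot>\<^bsub>A\<^esub> h) \<cdot>\<^bsub>C\<^esub> mu A m n c"
    and act_assoc: "m \<in> Ob M \<Longrightarrow> n \<in> Ob M \<Longrightarrow> p \<in> Ob M \<Longrightarrow> c \<in> Ob C \<Longrightarrow>
      (alpha M m n p \<odot>\<^bsub>A\<^esub> Id C c) \<cdot>\<^bsub>C\<^esub> mu A (m \<otimes>\<^bsub>M\<^esub> n) p c \<cdot>\<^bsub>C\<^esub> mu A m n (p \<bullet>\<^bsub>A\<^esub> c) =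
      mu A m (n \<otimes>\<^bsub>M\<^esub> p) c \<cdot>\<^bsub>C\<^esub> (Id M m \<odot>\<^bsub>A\<^esub> mu A n p c)"
    and act_unit_left: "m \<in> Ob M \<Longrightarrow> c \<in> Ob C \<Longrightarrow>
      mu A j\<^bsub>M\<^esub> m c \<cdot>\<^bsub>C\<^esub> eta A (m \<bullet>\<^bsub>A\<^esub> c) = inv_arr M (lam M m) \<odot>\<^bsub>A\<^esub> Id C c"
    and act_unit_right: "m \<in> Ob M \<Longrightarrow> c \<in> Ob C \<Longrightarrow>
      mu A m j\<^bsub>M\<^esub> c \<cdot>\<^bsub>C\<^esub> (Id M m \<odot>\<^bsub>A\<^esub> eta A c) = inv_arr M (rho M m) \<odot>\<^bsub>A\<^esub> Id C c"

text \<open>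
  A right \<open>M\<close>-action is a left action of \<open>mrev M\<close>, written on the right. In particular
  \<open>rmu A c m n : (c \<star> m) \<star> n \<rightarrow> c \<star> (m \<otimes> n)\<close> is the left multiplicator at \<open>n, m\<close>.
\<close>

abbreviation ract_o :: "('mo, 'ma, 'o, 'a) action \<Rightarrow> 'o \<Rightarrow> 'mo \<Rightarrow> 'o" (infixl \<open>\<star>\<index>\<close> 75) where
  "c \<star>\<^bsub>A\<^esub> m \<equiv> m \<bullet>\<^bsub>A\<^esub> c"

abbreviation ract_a :: "('mo, 'ma, 'o, 'a) action \<Rightarrow> 'a \<Rightarrow> 'ma \<Rightarrow> 'a" (infixl \<open>\<diamondop>\<index>\<close> 75) where
  "g \<diamondop>\<^bsub>A\<^esub> f \<equiv> f \<odot>\<^bsub>A\<^esub> g"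

abbreviation rmu :: "('mo, 'ma, 'o, 'a) action \<Rightarrow> 'o \<Rightarrow> 'mo \<Rightarrow> 'mo \<Rightarrow> 'a" where
  "rmu A c m n \<equiv> mu A n m c"

abbreviation right_actegory ::
  "('mo, 'ma) monoidal \<Rightarrow> ('o, 'a, 'z) cat_scheme \<Rightarrow> ('mo, 'ma, 'o, 'a) action \<Rightarrow> bool" where
  "right_actegory M C A \<equiv> left_actegory (mrev M) C A"


section \<open>Linear functors\<close>

locale left_linear =
  C: left_actegory M C A + D: left_actegory M D B + F: cat_functor C D F
  for M :: "('mo, 'ma) monoidal"
    and C :: "('co, 'ca, 'z1) cat_scheme" and A :: "('mo, 'ma, 'co, 'ca) action"
    and D :: "('do, 'da, 'z2) cat_scheme" and B :: "('mo, 'ma, 'do, 'da) action"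
    and F :: "('co, 'ca, 'do, 'da, 'z) fctr_scheme" +
  fixes l :: "'mo \<times> 'co \<Rightarrow> 'da"
  assumes lin_hom: "m \<in> Ob M \<Longrightarrow> c \<in> Ob C \<Longrightarrow> l (m, c) \<in> hom D (m \<bullet>\<^bsub>B\<^esub> fo F c) (fo F (m \<bullet>\<^bsub>A\<^esub> c))"
    and lin_iso: "m \<in> Ob M \<Longrightarrow> c \<in> Ob C \<Longrightarrow> iso_arr D (l (m, c))"
    and lin_nat: "f \<in> hom M m m' \<Longrightarrow> g \<in> hom C c c' \<Longrightarrow>
      l (m', c') \<cdot>\<^bsub>D\<^esub> (f \<odot>\<^bsub>B\<^esub> fm F g) = fm F (f \<odot>\<^bsub>A\<^esub> g) \<cdot>\<^bsub>D\<^esub> l (m, c)"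
    and lin_mu: "m \<in> Ob M \<Longrightarrow> n \<in> Ob M \<Longrightarrow> c \<in> Ob C \<Longrightarrow>
      fm F (mu A m n c) \<cdot>\<^bsub>D\<^esub> l (m, n \<bullet>\<^bsub>A\<^esub> c) \<cdot>\<^bsub>D\<^esub> (Id M m \<odot>\<^bsub>B\<^esub> l (n, c)) =
      l (m \<otimes>\<^bsub>M\<^esub> n, c) \<cdot>\<^bsub>D\<^esub> mu B m n (fo F c)"
    and lin_eta: "c \<in> Ob C \<Longrightarrow> l (j\<^bsub>M\<^esub>, c) \<cdot>\<^bsub>D\<^esub> eta B (fo F c) = fm F (eta A c)"

definition left_linear_trans ::
  "('mo, 'ma) monoidal \<Rightarrow>
   ('co, 'ca, 'z1) cat_scheme \<Rightarrow> ('mo, 'ma, 'co, 'ca) action \<Rightarrow>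
   ('do, 'da, 'z2) cat_scheme \<Rightarrow> ('mo, 'ma, 'do, 'da) action \<Rightarrow>
   ('mo \<times> 'co \<Rightarrow> 'da) \<Rightarrow> ('mo \<times> 'co \<Rightarrow> 'da) \<Rightarrow> ('co \<Rightarrow> 'da) \<Rightarrow> bool" where
  "left_linear_trans M C A D B l \<nu> \<xi> \<longleftrightarrow>
     (\<forall>m\<in>Ob M. \<forall>c\<in>Ob C. \<xi> (m \<bullet>\<^bsub>A\<^esub> c) \<cdot>\<^bsub>D\<^esub> l (m, c) = \<nu> (m, c) \<cdot>\<^bsub>D\<^esub> (Id M m \<odot>\<^bsub>B\<^esub> \<xi> c))"

abbreviation right_linear ::
  "('mo, 'ma) monoidal \<Rightarrow>
   ('co, 'ca, 'z1) cat_scheme \<Rightarrow> ('mo, 'ma, 'co, 'ca) action \<Rightarrow>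
   ('do, 'da, 'z2) cat_scheme \<Rightarrow> ('mo, 'ma, 'do, 'da) action \<Rightarrow>
   ('co, 'ca, 'do, 'da, 'z) fctr_scheme \<Rightarrow> ('co \<times> 'mo \<Rightarrow> 'da) \<Rightarrow> bool" where
  "right_linear M C A D B F r \<equiv> left_linear (mrev M) C A D B F (\<lambda>(m, c). r (c, m))"

abbreviation right_linear_trans ::
  "('mo, 'ma) monoidal \<Rightarrow>
   ('co, 'ca, 'z1) cat_scheme \<Rightarrow> ('mo, 'ma, 'co, 'ca) action \<Rightarrow>
   ('do, 'da, 'z2) cat_scheme \<Rightarrow> ('mo, 'ma, 'do, 'da) action \<Rightarrow>
   ('co \<times> 'mo \<Rightarrow> 'da) \<Rightarrow> ('co \<times> 'mo \<Rightarrow> 'da) \<Rightarrow> ('co \<Rightarrow> 'da) \<Rightarrow> bool" where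
  "right_linear_trans M C A D B r s \<xi> \<equiv>
     left_linear_trans (mrev M) C A D B (\<lambda>(m, c). r (c, m)) (\<lambda>(m, c). s (c, m)) \<xi>"


section \<open>Biactegories\<close>

record ('lo, 'la, 'ro, 'ra, 'o, 'a) biact = "('o, 'a) cat" +
  Lact :: "('lo, 'la, 'o, 'a) action"
  Ract :: "('ro, 'ra, 'o, 'a) action"
  zeta :: "'lo \<Rightarrow> 'o \<Rightarrow> 'ro \<Rightarrow> 'a"

locale biactegory =
  L: left_actegory M C "Lact C" + R: left_actegory "mrev N" C "Ract C" + N: monoidal_category N
  for M :: "('mo, 'ma) monoidal" and N :: "('no, 'na) monoidal"
    and C :: "('mo, 'ma, 'no, 'na, 'o, 'a) biact" +
  assumes zeta_hom: "m \<in> Ob M \<Longrightarrow> c \<in> Ob C \<Longrightarrow> n \<in> Ob N \<Longrightarrow>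
      zeta C m c n \<in> hom C (m \<bullet>\<^bsub>Lact C\<^esub> (c \<star>\<^bsub>Ract C\<^esub> n)) ((m \<bullet>\<^bsub>Lact C\<^esub> c) \<star>\<^bsub>Ract C\<^esub> n)"
    and zeta_iso: "m \<in> Ob M \<Longrightarrow> c \<in> Ob C \<Longrightarrow> n \<in> Ob N \<Longrightarrow> iso_arr C (zeta C m c n)"
    and zeta_nat: "f \<in> hom M m m' \<Longrightarrow> g \<in> hom C c c' \<Longrightarrow> h \<in> hom N n n' \<Longrightarrow>
      zeta C m' c' n' \<cdot>\<^bsub>C\<^esub> (f \<odot>\<^bsub>Lact C\<^esub> (g \<diamondop>\<^bsub>Ract C\<^esub> h)) =
      ((f \<odot>\<^bsub>Lact C\<^esub> g) \<diamondop>\<^bsub>Ract C\<^esub> h) \<cdot>\<^bsub>C\<^esub> zeta C m c n"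
    and zeta_left: "m \<in> Ob M \<Longrightarrow> m' \<in> Ob M \<Longrightarrow> c \<in> Ob C \<Longrightarrow> n \<in> Ob N \<Longrightarrow>
      (mu (Lact C) m m' c \<diamondop>\<^bsub>Ract C\<^esub> Id N n) \<cdot>\<^bsub>C\<^esub> zeta C m (m' \<bullet>\<^bsub>Lact C\<^esub> c) n
        \<cdot>\<^bsub>C\<^esub> (Id M m \<odot>\<^bsub>Lact C\<^esub> zeta C m' c n) =
      zeta C (m \<otimes>\<^bsub>M\<^esub> m') c n \<cdot>\<^bsub>C\<^esub> mu (Lact C) m m' (c \<star>\<^bsub>Ract C\<^esub> n)"
    and zeta_right: "m \<in> Ob M \<Longrightarrow> c \<in> Ob C \<Longrightarrow> n \<in> Ob N \<Longrightarrow> n' \<in> Ob N \<Longrightarrow>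
      zeta C m c (n \<otimes>\<^bsub>N\<^esub> n') \<cdot>\<^bsub>C\<^esub> (Id M m \<odot>\<^bsub>Lact C\<^esub> rmu (Ract C) c n n') =
      rmu (Ract C) (m \<bullet>\<^bsub>Lact C\<^esub> c) n n' \<cdot>\<^bsub>C\<^esub> (zeta C m c n \<diamondop>\<^bsub>Ract C\<^esub> Id N n')
        \<cdot>\<^bsub>C\<^esub> zeta C m (c \<star>\<^bsub>Ract C\<^esub> n) n'"
    and zeta_unit_left: "c \<in> Ob C \<Longrightarrow> n \<in> Ob N \<Longrightarrow>
      zeta C j\<^bsub>M\<^esub> c n \<cdot>\<^bsub>C\<^esub> eta (Lact C) (c \<star>\<^bsub>Ract C\<^esub> n) = eta (Lact C) c \<diamondop>\<^bsub>Ract C\<^esub> Id N n"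
    and zeta_unit_right: "m \<in> Ob M \<Longrightarrow> c \<in> Ob C \<Longrightarrow>
      zeta C m c j\<^bsub>N\<^esub> \<cdot>\<^bsub>C\<^esub> (Id M m \<odot>\<^bsub>Lact C\<^esub> eta (Ract C) c) = eta (Ract C) (m \<bullet>\<^bsub>Lact C\<^esub> c)"

record ('co, 'ca, 'do, 'da, 'mo, 'no) bilin = "('co, 'ca, 'do, 'da) fctr" +
  bl :: "'mo \<times> 'co \<Rightarrow> 'da"
  br :: "'co \<times> 'no \<Rightarrow> 'da"

definition bilinear_functor ::
  "('mo, 'ma) monoidal \<Rightarrow> ('no, 'na) monoidal \<Rightarrow>
   ('mo, 'ma, 'no, 'na, 'co, 'ca) biact \<Rightarrow> ('mo, 'ma, 'no, 'na, 'do, 'da) biact \<Rightarrow>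
   ('co, 'ca, 'do, 'da, 'mo, 'no) bilin \<Rightarrow> bool" where
  "bilinear_functor M N C D F \<longleftrightarrow>
     left_linear M C (Lact C) D (Lact D) F (bl F) \<and>
     right_linear N C (Ract C) D (Ract D) F (br F) \<and>
     (\<forall>m\<in>Ob M. \<forall>c\<in>Ob C. \<forall>n\<in>Ob N.
        br F (m \<bullet>\<^bsub>Lact C\<^esub> c, n) \<cdot>\<^bsub>D\<^esub> (bl F (m, c) \<diamondop>\<^bsub>Ract D\<^esub> Id N n) \<cdot>\<^bsub>D\<^esub> zeta D m (fo F c) n =
        fm F (zeta C m c n) \<cdot>\<^bsub>D\<^esub> bl F (m, c \<star>\<^bsub>Ract C\<^esub> n) \<cdot>\<^bsub>D\<^esub> (Id M m \<odot>\<^bsub>Lact D\<^esub> br F (c, n)))"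

definition Act ::
  "('mo, 'ma) monoidal \<Rightarrow> ('no, 'na) monoidal \<Rightarrow>
   ('mo, 'ma, 'no, 'na, 'co, 'ca) biact \<Rightarrow> ('mo, 'ma, 'no, 'na, 'do, 'da) biact \<Rightarrow>
   (('co, 'ca, 'do, 'da, 'mo, 'no) bilin, (('co, 'ca, 'do, 'da, 'mo, 'no) bilin, 'co, 'da) trans) cat" where
  "Act M N C D = fun_cat C D
     {F. bilinear_functor M N C D F \<and> ext_functor C F \<and>
         bl F \<in> extensional (Ob M \<times> Ob C) \<and> br F \<in> extensional (Ob C \<times> Ob N)}
     (\<lambda>F G \<xi>. left_linear_trans M C (Lact C) D (Lact D) (bl F) (bl G) \<xi> \<and>
              right_linear_trans N C (Ract C) D (Ract D) (br F) (br G) \<xi>)"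


section \<open>The biactegory of right linear functors\<close>

record ('do, 'da, 'eo, 'ea, 'po) rlin = "('do, 'da, 'eo, 'ea) fctr" +
  rs :: "'do \<times> 'po \<Rightarrow> 'ea"

definition RLin ::
  "('po, 'pa) monoidal \<Rightarrow>
   ('do, 'da, 'z1) cat_scheme \<Rightarrow> ('po, 'pa, 'do, 'da) action \<Rightarrow>
   ('eo, 'ea, 'z2) cat_scheme \<Rightarrow> ('po, 'pa, 'eo, 'ea) action \<Rightarrow>
   (('do, 'da, 'eo, 'ea, 'po) rlin, (('do, 'da, 'eo, 'ea, 'po) rlin, 'do, 'ea) trans) cat" where
  "RLin P D A E B = fun_cat D E
     {F. right_linear P D A E B F (rs F) \<and> ext_functor D F \<and> rs F \<in> extensional (Ob D \<times> Ob P)}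
     (\<lambda>F G \<xi>. right_linear_trans P D A E B (rs F) (rs G) \<xi>)"

text \<open>\<open>(n \<bullet> F)(d) = n \<bullet> F(d)\<close>, with right linear structure
  \<open>(n \<bullet> F(d)) \<star> p \<rightarrow> n \<bullet> (F(d) \<star> p) \<rightarrow> n \<bullet> F(d \<star> p)\<close>.\<close>

definition lhom ::
  "('no, 'na) monoidal \<Rightarrow> ('po, 'pa) monoidal \<Rightarrow>
   ('mo, 'ma, 'po, 'pa, 'do, 'da) biact \<Rightarrow> ('no, 'na, 'po, 'pa, 'eo, 'ea) biact \<Rightarrow>
   'no \<Rightarrow> ('do, 'da, 'eo, 'ea, 'po) rlin \<Rightarrow> ('do, 'da, 'eo, 'ea, 'po) rlin" where
  "lhom N P D E n F =
    \<lparr>fo = \<lambda>d\<in>Ob D. n \<bullet>\<^bsub>Lact E\<^esub> fo F d,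
     fm = \<lambda>f\<in>Arr D. Id N n \<odot>\<^bsub>Lact E\<^esub> fm F f,
     rs = \<lambda>(d, p)\<in>Ob D \<times> Ob P.
            (Id N n \<odot>\<^bsub>Lact E\<^esub> rs F (d, p)) \<cdot>\<^bsub>E\<^esub> inv_arr E (zeta E n (fo F d) p)\<rparr>"

text \<open>\<open>(F \<star> m)(d) = F(m \<bullet> d)\<close>, with right linear structure
  \<open>F(m \<bullet> d) \<star> p \<rightarrow> F((m \<bullet> d) \<star> p) \<rightarrow> F(m \<bullet> (d \<star> p))\<close>.\<close>

definition rhom ::
  "('mo, 'ma) monoidal \<Rightarrow> ('po, 'pa) monoidal \<Rightarrow>
   ('mo, 'ma, 'po, 'pa, 'do, 'da) biact \<Rightarrow> ('no, 'na, 'po, 'pa, 'eo, 'ea) biact \<Rightarrow>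
   ('do, 'da, 'eo, 'ea, 'po) rlin \<Rightarrow> 'mo \<Rightarrow> ('do, 'da, 'eo, 'ea, 'po) rlin" where
  "rhom M P D E F m =
    \<lparr>fo = \<lambda>d\<in>Ob D. fo F (m \<bullet>\<^bsub>Lact D\<^esub> d),
     fm = \<lambda>f\<in>Arr D. fm F (Id M m \<odot>\<^bsub>Lact D\<^esub> f),
     rs = \<lambda>(d, p)\<in>Ob D \<times> Ob P.
            fm F (inv_arr D (zeta D m d p)) \<cdot>\<^bsub>E\<^esub> rs F (m \<bullet>\<^bsub>Lact D\<^esub> d, p)\<rparr>"

text \<open>The bimodulator is the identity: \<open>n \<bullet> (F \<star> m)\<close> and \<open>(n \<bullet> F) \<star> m\<close> are the same functor.
  In the right action, \<open>mu\<close> at \<open>m, n\<close> has type \<open>(F \<star> n) \<star> m \<rightarrow> F \<star> (n \<otimes> m)\<close>.\<close>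

definition hom_biact ::
  "('no, 'na) monoidal \<Rightarrow> ('mo, 'ma) monoidal \<Rightarrow> ('po, 'pa) monoidal \<Rightarrow>
   ('mo, 'ma, 'po, 'pa, 'do, 'da) biact \<Rightarrow> ('no, 'na, 'po, 'pa, 'eo, 'ea) biact \<Rightarrow>
   ('no, 'na, 'mo, 'ma,
    ('do, 'da, 'eo, 'ea, 'po) rlin, (('do, 'da, 'eo, 'ea, 'po) rlin, 'do, 'ea) trans) biact" where
  "hom_biact N M P D E = cat.extend (RLin P D (Ract D) E (Ract E))
    \<lparr>Lact =
       \<lparr>act_o = lhom N P D E,
        act_a = \<lambda>f \<xi>. \<lparr>Src = lhom N P D E (Dom N f) (Src \<xi>), Tgt = lhom N P D E (Cod N f) (Tgt \<xi>),
                      Cmp = \<lambda>d\<in>Ob D. f \<odot>\<^bsub>Lact E\<^esub> Cmp \<xi> d\<rparr>,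
        eta = \<lambda>F. \<lparr>Src = F, Tgt = lhom N P D E j\<^bsub>N\<^esub> F, Cmp = \<lambda>d\<in>Ob D. eta (Lact E) (fo F d)\<rparr>,
        mu = \<lambda>n n' F. \<lparr>Src = lhom N P D E n (lhom N P D E n' F), Tgt = lhom N P D E (n \<otimes>\<^bsub>N\<^esub> n') F,
                       Cmp = \<lambda>d\<in>Ob D. mu (Lact E) n n' (fo F d)\<rparr>\<rparr>,
     Ract =
       \<lparr>act_o = \<lambda>m F. rhom M P D E F m,
        act_a = \<lambda>f \<xi>. \<lparr>Src = rhom M P D E (Src \<xi>) (Dom M f), Tgt = rhom M P D E (Tgt \<xi>) (Cod M f),
                      Cmp = \<lambda>d\<in>Ob D. fm (Tgt \<xi>) (f \<odot>\<^bsub>Lact D\<^esub> Id D d)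
                                       \<cdot>\<^bsub>E\<^esub> Cmp \<xi> (Dom M f \<bullet>\<^bsub>Lact D\<^esub> d)\<rparr>,
        eta = \<lambda>F. \<lparr>Src = F, Tgt = rhom M P D E F j\<^bsub>M\<^esub>, Cmp = \<lambda>d\<in>Ob D. fm F (eta (Lact D) d)\<rparr>,
        mu = \<lambda>m n F. \<lparr>Src = rhom M P D E (rhom M P D E F n) m, Tgt = rhom M P D E F (n \<otimes>\<^bsub>M\<^esub> m),
                      Cmp = \<lambda>d\<in>Ob D. fm F (mu (Lact D) n m d)\<rparr>\<rparr>,
     zeta = \<lambda>n F m. \<lparr>Src = lhom N P D E n (rhom M P D E F m), Tgt = rhom M P D E (lhom N P D E n F) m,
                     Cmp = \<lambda>d\<in>Ob D. Id E (n \<bullet>\<^bsub>Lact E\<^esub> fo F (m \<bullet>\<^bsub>Lact D\<^esub> d))\<rparr>\<rparr>"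


section \<open>Balanced functors and the tensor product\<close>

record ('co, 'ca, 'do, 'da, 'mo, 'xo, 'xa) bal = "('co \<times> 'do, 'ca \<times> 'da, 'xo, 'xa) fctr" +
  eps :: "'co \<times> 'mo \<times> 'do \<Rightarrow> 'xa"

locale balanced_functor =
  C: left_actegory "mrev M" C A + D: left_actegory M D B + F: cat_functor "prod_cat C D" X F
  for M :: "('mo, 'ma) monoidal"
    and C :: "('co, 'ca, 'z1) cat_scheme" and A :: "('mo, 'ma, 'co, 'ca) action"
    and D :: "('do, 'da, 'z2) cat_scheme" and B :: "('mo, 'ma, 'do, 'da) action"
    and X :: "('xo, 'xa, 'z3) cat_scheme"
    and F :: "('co, 'ca, 'do, 'da, 'mo, 'xo, 'xa) bal" +
  assumes eps_hom: "c \<in> Ob C \<Longrightarrow> m \<in> Ob M \<Longrightarrow> d \<in> Ob D \<Longrightarrow>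
      eps F (c, m, d) \<in> hom X (fo F (c \<star>\<^bsub>A\<^esub> m, d)) (fo F (c, m \<bullet>\<^bsub>B\<^esub> d))"
    and eps_iso: "c \<in> Ob C \<Longrightarrow> m \<in> Ob M \<Longrightarrow> d \<in> Ob D \<Longrightarrow> iso_arr X (eps F (c, m, d))"
    and eps_nat: "f \<in> hom C c c' \<Longrightarrow> g \<in> hom M m m' \<Longrightarrow> h \<in> hom D d d' \<Longrightarrow>
      eps F (c', m', d') \<cdot>\<^bsub>X\<^esub> fm F (f \<diamondop>\<^bsub>A\<^esub> g, h) = fm F (f, g \<odot>\<^bsub>B\<^esub> h) \<cdot>\<^bsub>X\<^esub> eps F (c, m, d)"
    and eps_mu: "c \<in> Ob C \<Longrightarrow> m \<in> Ob M \<Longrightarrow> n \<in> Ob M \<Longrightarrow> d \<in> Ob D \<Longrightarrow>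
      fm F (Id C c, mu B m n d) \<cdot>\<^bsub>X\<^esub> eps F (c, m, n \<bullet>\<^bsub>B\<^esub> d) \<cdot>\<^bsub>X\<^esub> eps F (c \<star>\<^bsub>A\<^esub> m, n, d) =
      eps F (c, m \<otimes>\<^bsub>M\<^esub> n, d) \<cdot>\<^bsub>X\<^esub> fm F (rmu A c m n, Id D d)"
    and eps_eta: "c \<in> Ob C \<Longrightarrow> d \<in> Ob D \<Longrightarrow>
      eps F (c, j\<^bsub>M\<^esub>, d) \<cdot>\<^bsub>X\<^esub> fm F (eta A c, Id D d) = fm F (Id C c, eta B d)"

definition Bal ::
  "('mo, 'ma) monoidal \<Rightarrow>
   ('co, 'ca, 'z1) cat_scheme \<Rightarrow> ('mo, 'ma, 'co, 'ca) action \<Rightarrow>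
   ('do, 'da, 'z2) cat_scheme \<Rightarrow> ('mo, 'ma, 'do, 'da) action \<Rightarrow>
   ('xo, 'xa, 'z3) cat_scheme \<Rightarrow>
   (('co, 'ca, 'do, 'da, 'mo, 'xo, 'xa) bal,
    (('co, 'ca, 'do, 'da, 'mo, 'xo, 'xa) bal, 'co \<times> 'do, 'xa) trans) cat" where
  "Bal M C A D B X = fun_cat (prod_cat C D) X
     {F. balanced_functor M C A D B X F \<and> ext_functor (prod_cat C D) F \<and>
         eps F \<in> extensional (Ob C \<times> Ob M \<times> Ob D)}
     (\<lambda>F G \<xi>. \<forall>c\<in>Ob C. \<forall>m\<in>Ob M. \<forall>d\<in>Ob D.
        eps G (c, m, d) \<cdot>\<^bsub>X\<^esub> \<xi> (c \<star>\<^bsub>A\<^esub> m, d) = \<xi> (c, m \<bullet>\<^bsub>B\<^esub> d) \<cdot>\<^bsub>X\<^esub> eps F (c, m, d))"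

definition bal_comp ::
  "('mo, 'ma) monoidal \<Rightarrow> ('co, 'ca, 'z1) cat_scheme \<Rightarrow> ('do, 'da, 'z2) cat_scheme \<Rightarrow>
   ('co, 'ca, 'do, 'da, 'mo, 'to, 'ta) bal \<Rightarrow> ('to, 'ta, 'xo, 'xa) fctr \<Rightarrow>
   ('co, 'ca, 'do, 'da, 'mo, 'xo, 'xa) bal" where
  "bal_comp M C D U H =
    \<lparr>fo = \<lambda>x\<in>Ob C \<times> Ob D. fo H (fo U x),
     fm = \<lambda>f\<in>Arr C \<times> Arr D. fm H (fm U f),
     eps = \<lambda>y\<in>Ob C \<times> Ob M \<times> Ob D. fm H (eps U y)\<rparr>"

definition bal_comp_functor ::
  "('mo, 'ma) monoidal \<Rightarrow> ('co, 'ca, 'z1) cat_scheme \<Rightarrow> ('do, 'da, 'z2) cat_scheme \<Rightarrow>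
   ('co, 'ca, 'do, 'da, 'mo, 'to, 'ta) bal \<Rightarrow>
   (('to, 'ta, 'xo, 'xa) fctr, (('to, 'ta, 'xo, 'xa) fctr, 'to, 'xa) trans,
    ('co, 'ca, 'do, 'da, 'mo, 'xo, 'xa) bal,
    (('co, 'ca, 'do, 'da, 'mo, 'xo, 'xa) bal, 'co \<times> 'do, 'xa) trans) fctr" where
  "bal_comp_functor M C D U =
    \<lparr>fo = bal_comp M C D U,
     fm = \<lambda>\<xi>. \<lparr>Src = bal_comp M C D U (Src \<xi>), Tgt = bal_comp M C D U (Tgt \<xi>),
               Cmp = \<lambda>x\<in>Ob C \<times> Ob D. Cmp \<xi> (fo U x)\<rparr>\<rparr>"

text \<open>
  \<open>(T, U)\<close> represents balanced functors into \<open>X\<close>: composition with \<open>U\<close> is an isomorphism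
  \<open>Cat(T, X) \<cong> Bal(C \<times> D, X)\<close>. By the Yoneda lemma, an isomorphism natural in \<open>X\<close> is always of this
  form, \<open>U\<close> being the balanced functor corresponding to the identity of \<open>T\<close>.
\<close>

definition represents_Bal ::
  "('mo, 'ma) monoidal \<Rightarrow>
   ('co, 'ca, 'z1) cat_scheme \<Rightarrow> ('mo, 'ma, 'co, 'ca) action \<Rightarrow>
   ('do, 'da, 'z2) cat_scheme \<Rightarrow> ('mo, 'ma, 'do, 'da) action \<Rightarrow>
   ('to, 'ta) cat \<Rightarrow> ('co, 'ca, 'do, 'da, 'mo, 'to, 'ta) bal \<Rightarrow> ('xo, 'xa) cat \<Rightarrow> bool" where
  "represents_Bal M C A D B T U X \<longleftrightarrow>
     cat_iso (Cat T X) (Bal M C A D B X) (bal_comp_functor M C D U)"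

text \<open>For balanced functors into \<open>T\<close> itself, and balanced transformations between them: the functors
  \<open>T \<rightarrow> T\<close> and natural transformations which they correspond to under the universal property.\<close>

definition lift_fun ::
  "('mo, 'ma) monoidal \<Rightarrow> ('co, 'ca, 'z1) cat_scheme \<Rightarrow> ('do, 'da, 'z2) cat_scheme \<Rightarrow>
   ('to, 'ta) cat \<Rightarrow> ('co, 'ca, 'do, 'da, 'mo, 'to, 'ta) bal \<Rightarrow>
   ('co, 'ca, 'do, 'da, 'mo, 'to, 'ta) bal \<Rightarrow> ('to, 'ta, 'to, 'ta) fctr" where
  "lift_fun M C D T U G = inv_into (Ob (Cat T T)) (fo (bal_comp_functor M C D U)) G"

definition lift_trans ::
  "('mo, 'ma) monoidal \<Rightarrow> ('co, 'ca, 'z1) cat_scheme \<Rightarrow> ('do, 'da, 'z2) cat_scheme \<Rightarrow>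
   ('to, 'ta) cat \<Rightarrow> ('co, 'ca, 'do, 'da, 'mo, 'to, 'ta) bal \<Rightarrow>
   (('co, 'ca, 'do, 'da, 'mo, 'to, 'ta) bal, 'co \<times> 'do, 'ta) trans \<Rightarrow> 'to \<Rightarrow> 'ta" where
  "lift_trans M C D T U \<beta> = Cmp (inv_into (Arr (Cat T T)) (fm (bal_comp_functor M C D U)) \<beta>)"

text \<open>The left action of \<open>C\<close> on generators: \<open>n \<bullet> U(c, d) = U(n \<bullet> c, d)\<close>, balanced via
  \<open>U(n \<bullet> (c \<star> m), d) \<rightarrow> U((n \<bullet> c) \<star> m, d) \<rightarrow> U(n \<bullet> c, m \<bullet> d)\<close>.\<close>

definition lgen ::
  "('no, 'na) monoidal \<Rightarrow> ('mo, 'ma) monoidal \<Rightarrow>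
   ('no, 'na, 'mo, 'ma, 'co, 'ca) biact \<Rightarrow> ('mo, 'ma, 'po, 'pa, 'do, 'da) biact \<Rightarrow>
   ('to, 'ta) cat \<Rightarrow> ('co, 'ca, 'do, 'da, 'mo, 'to, 'ta) bal \<Rightarrow>
   'no \<Rightarrow> ('co, 'ca, 'do, 'da, 'mo, 'to, 'ta) bal" where
  "lgen N M C D T U n =
    \<lparr>fo = \<lambda>(c, d)\<in>Ob C \<times> Ob D. fo U (n \<bullet>\<^bsub>Lact C\<^esub> c, d),
     fm = \<lambda>(f, g)\<in>Arr C \<times> Arr D. fm U (Id N n \<odot>\<^bsub>Lact C\<^esub> f, g),
     eps = \<lambda>(c, m, d)\<in>Ob C \<times> Ob M \<times> Ob D.
             eps U (n \<bullet>\<^bsub>Lact C\<^esub> c, m, d) \<cdot>\<^bsub>T\<^esub> fm U (zeta C n c m, Id D d)\<rparr>"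

text \<open>The right action of \<open>D\<close> on generators: \<open>U(c, d) \<star> p = U(c, d \<star> p)\<close>, balanced via
  \<open>U(c \<star> m, d \<star> p) \<rightarrow> U(c, m \<bullet> (d \<star> p)) \<rightarrow> U(c, (m \<bullet> d) \<star> p)\<close>.\<close>

definition rgen ::
  "('mo, 'ma) monoidal \<Rightarrow> ('po, 'pa) monoidal \<Rightarrow>
   ('no, 'na, 'mo, 'ma, 'co, 'ca) biact \<Rightarrow> ('mo, 'ma, 'po, 'pa, 'do, 'da) biact \<Rightarrow>
   ('to, 'ta) cat \<Rightarrow> ('co, 'ca, 'do, 'da, 'mo, 'to, 'ta) bal \<Rightarrow>
   'po \<Rightarrow> ('co, 'ca, 'do, 'da, 'mo, 'to, 'ta) bal" where
  "rgen M P C D T U p =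
    \<lparr>fo = \<lambda>(c, d)\<in>Ob C \<times> Ob D. fo U (c, d \<star>\<^bsub>Ract D\<^esub> p),
     fm = \<lambda>(f, g)\<in>Arr C \<times> Arr D. fm U (f, g \<diamondop>\<^bsub>Ract D\<^esub> Id P p),
     eps = \<lambda>(c, m, d)\<in>Ob C \<times> Ob M \<times> Ob D.
             fm U (Id C c, zeta D m d p) \<cdot>\<^bsub>T\<^esub> eps U (c, m, d \<star>\<^bsub>Ract D\<^esub> p)\<rparr>"

text \<open>The action on \<open>T\<close> of the monoidal category \<open>K\<close> induced by an action on generators: \<open>gen\<close> gives
  the balanced functors, \<open>ga\<close>, \<open>ge\<close>, \<open>gm\<close> the components of the balanced transformations
  \<open>gen k \<Rightarrow> gen k'\<close> (for \<open>f : k \<rightarrow> k'\<close>), \<open>U \<Rightarrow> gen j\<close> and \<open>k \<bullet> gen k' \<Rightarrow> gen (k \<otimes> k')\<close>.\<close>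

definition induced_action ::
  "('mo, 'ma) monoidal \<Rightarrow> ('co, 'ca, 'z1) cat_scheme \<Rightarrow> ('do, 'da, 'z2) cat_scheme \<Rightarrow>
   ('to, 'ta) cat \<Rightarrow> ('co, 'ca, 'do, 'da, 'mo, 'to, 'ta) bal \<Rightarrow>
   ('ko, 'ka) monoidal \<Rightarrow> ('ko \<Rightarrow> ('co, 'ca, 'do, 'da, 'mo, 'to, 'ta) bal) \<Rightarrow>
   ('ka \<Rightarrow> 'co \<times> 'do \<Rightarrow> 'ta) \<Rightarrow> ('co \<times> 'do \<Rightarrow> 'ta) \<Rightarrow> ('ko \<Rightarrow> 'ko \<Rightarrow> 'co \<times> 'do \<Rightarrow> 'ta) \<Rightarrow>
   ('ko, 'ka, 'to, 'ta) action" where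
  "induced_action M C D T U K gen ga ge gm =
    \<lparr>act_o = \<lambda>k. fo (lift_fun M C D T U (gen k)),
     act_a = \<lambda>f g.
       lift_trans M C D T U
         \<lparr>Src = gen (Dom K f), Tgt = gen (Cod K f), Cmp = restrict (ga f) (Ob C \<times> Ob D)\<rparr> (Cod T g)
       \<cdot>\<^bsub>T\<^esub> fm (lift_fun M C D T U (gen (Dom K f))) g,
     eta = lift_trans M C D T U
       \<lparr>Src = U, Tgt = gen j\<^bsub>K\<^esub>, Cmp = restrict ge (Ob C \<times> Ob D)\<rparr>,
     mu = \<lambda>k k'. lift_trans M C D T U
       \<lparr>Src = bal_comp M C D (gen k') (lift_fun M C D T U (gen k)), Tgt = gen (k \<otimes>\<^bsub>K\<^esub> k'),
        Cmp = restrict (gm k k') (Ob C \<times> Ob D)\<rparr>\<rparr>"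

text \<open>The biactegory structure on the tensor product \<open>T\<close>, with universal balanced functor \<open>U\<close>. On
  generators the bimodulator is the identity, as
  \<open>n \<bullet> (U(c, d) \<star> p) = U(n \<bullet> c, d \<star> p) = (n \<bullet> U(c, d)) \<star> p\<close>.\<close>

definition tensor_biact ::
  "('no, 'na) monoidal \<Rightarrow> ('mo, 'ma) monoidal \<Rightarrow> ('po, 'pa) monoidal \<Rightarrow>
   ('no, 'na, 'mo, 'ma, 'co, 'ca) biact \<Rightarrow> ('mo, 'ma, 'po, 'pa, 'do, 'da) biact \<Rightarrow>
   ('to, 'ta) cat \<Rightarrow> ('co, 'ca, 'do, 'da, 'mo, 'to, 'ta) bal \<Rightarrow>
   ('no, 'na, 'po, 'pa, 'to, 'ta) biact" where
  "tensor_biact N M P C D T U = cat.extend T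
    \<lparr>Lact = induced_action M C D T U N (lgen N M C D T U)
       (\<lambda>f (c, d). fm U (f \<odot>\<^bsub>Lact C\<^esub> Id C c, Id D d))
       (\<lambda>(c, d). fm U (eta (Lact C) c, Id D d))
       (\<lambda>n n' (c, d). fm U (mu (Lact C) n n' c, Id D d)),
     Ract = induced_action M C D T U (mrev P) (rgen M P C D T U)
       (\<lambda>f (c, d). fm U (Id C c, f \<odot>\<^bsub>Ract D\<^esub> Id D d))
       (\<lambda>(c, d). fm U (Id C c, eta (Ract D) d))
       (\<lambda>p p' (c, d). fm U (Id C c, mu (Ract D) p p' d)),
     zeta = \<lambda>n t p. lift_trans M C D T U
       \<lparr>Src = bal_comp M C D (rgen M P C D T U p) (lift_fun M C D T U (lgen N M C D T U n)),
        Tgt = bal_comp M C D (lgen N M C D T U n) (lift_fun M C D T U (rgen M P C D T U p)),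
        Cmp = \<lambda>(c, d)\<in>Ob C \<times> Ob D. Id T (fo U (n \<bullet>\<^bsub>Lact C\<^esub> c, d \<star>\<^bsub>Ract D\<^esub> p))\<rparr> t\<rparr>"

end

theory Submission
  imports Defs
begin

text \<open>
  Everything about \<open>C \<otimes>\<^bsub>M\<^esub> D\<close> is tested on generators: by the universal property, a functor out
  of \<open>T\<close> is determined by its composite with \<open>U\<close>, and natural transformations between functors out of \<open>T\<close>
  correspond to balanced transformations between their composites with \<open>U\<close>; in particular, two of them are equal
  as soon as they agree on the objects \<open>U(c, d)\<close>, and one of them is invertible as soon as it is so there.
  Hence the induced actions inherit their coherence laws from \<open>C\<close> and \<open>D\<close>.

  A bilinear functor \<open>H\<close> on \<open>T\<close> is sent to \<open>c \<mapsto> H(U(c, -))\<close>. The left linear structure of \<open>H\<close> becomes that of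
  its image, the right linear structure of \<open>H\<close> makes each \<open>H(U(c, -))\<close> right linear, and the inverse of the
  balancing \<open>U(c \<star> m, d) \<rightarrow> U(c, m \<bullet> d)\<close> becomes the right linear structure of the image. Conversely, a bilinear
  functor \<open>K\<close> from \<open>C\<close> gives the balanced functor \<open>(c, d) \<mapsto> K(c)(d)\<close>, which lifts to \<open>T\<close>; its linear structures
  are lifted as natural transformations.
\<close>

section \<open>Categories and functors\<close>

text \<open>What is proved is an isomorphism of categories, not an equivalence, so constructions
  must be inverted up to equality of records. This is why functors are cut down to their carriers
  and why identifications end in extensionality arguments. Representability is used for two targets
  only: \<open>T\<close> itself, which yields the actions on the tensor product, and
  \<open>E\<close>, which yields the isomorphism. Both actions on \<open>T\<close> are instances of
  one construction, an action on the product of \<open>C\<close> and \<open>D\<close> pushed along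
  \<open>U\<close>, and right actions are left actions of \<open>mrev\<close>; hence many arguments
  are made once. The bimodulators of \<open>T\<close> and of the functor biactegory are identities,
  so their coherence becomes strict commutation of two actions. The bimodulators of
  \<open>C\<close>, \<open>D\<close> and \<open>E\<close> do the real work: they enter through the
  balancings of the translated generators and through the right linear structures of
  \<open>lhom\<close> and \<open>rhom\<close>. A linear structure is lifted to \<open>T\<close> for
  one acting object at a time; its naturality in that object is a separate law, again tested on
  generators.\<close>

lemma hom_iff: "f \<in> hom C x y \<longleftrightarrow> f \<in> Arr C \<and> Dom C f = x \<and> Cod C f = y"
  by (auto simp: hom_def)

text \<open>Typing is carried by \<open>Arr\<close>, \<open>Dom\<close> and \<open>Cod\<close>
  instead of \<open>hom\<close>: composability is then an equation between objects, which the
  simplifier can decide without guessing intermediate objects.\<close>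

lemma categoryI:
  assumes "\<And>f. f \<in> Arr C \<Longrightarrow> Dom C f \<in> Ob C" "\<And>f. f \<in> Arr C \<Longrightarrow> Cod C f \<in> Ob C"
    and "\<And>x. x \<in> Ob C \<Longrightarrow> Id C x \<in> Arr C \<and> Dom C (Id C x) = x \<and> Cod C (Id C x) = x"
    and "\<And>f g. f \<in> Arr C \<Longrightarrow> g \<in> Arr C \<Longrightarrow> Cod C f = Dom C g \<Longrightarrow>
      g \<cdot>\<^bsub>C\<^esub> f \<in> Arr C \<and> Dom C (g \<cdot>\<^bsub>C\<^esub> f) = Dom C f \<and> Cod C (g \<cdot>\<^bsub>C\<^esub> f) = Cod C g"
    and "\<And>f. f \<in> Arr C \<Longrightarrow> Id C (Cod C f) \<cdot>\<^bsub>C\<^esub> f = f" "\<And>f. f \<in> Arr C \<Longrightarrow> f \<cdot>\<^bsub>C\<^esub> Id C (Dom C f) = f"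
    and "\<And>f g h. f \<in> Arr C \<Longrightarrow> g \<in> Arr C \<Longrightarrow> h \<in> Arr C \<Longrightarrow> Cod C f = Dom C g \<Longrightarrow> Cod C g = Dom C h \<Longrightarrow>
      (h \<cdot>\<^bsub>C\<^esub> g) \<cdot>\<^bsub>C\<^esub> f = h \<cdot>\<^bsub>C\<^esub> (g \<cdot>\<^bsub>C\<^esub> f)"
  shows "category C"
  using assms by unfold_locales (auto simp: hom_iff)

context category
begin

declare Dom_in [simp] Cod_in [simp]

lemma id_arr [simp]:
  assumes "x \<in> Ob C"
  shows "Id C x \<in> Arr C" "Dom C (Id C x) = x" "Cod C (Id C x) = x"
  using Id_hom[OF assms] by (auto simp: hom_iff)

lemma comp_arr [simp]:
  assumes "f \<in> Arr C" "g \<in> Arr C" "Cod C f = Dom C g"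
  shows "g \<cdot>\<^bsub>C\<^esub> f \<in> Arr C" "Dom C (g \<cdot>\<^bsub>C\<^esub> f) = Dom C f" "Cod C (g \<cdot>\<^bsub>C\<^esub> f) = Cod C g"
  using Comp_hom[of f "Dom C f" "Dom C g" g "Cod C g"] assms by (auto simp: hom_iff)

lemma id_comp [simp]: "f \<in> Arr C \<Longrightarrow> Cod C f = y \<Longrightarrow> Id C y \<cdot>\<^bsub>C\<^esub> f = f"
  using Id_left[of f "Dom C f" y] by (auto simp: hom_iff)

lemma comp_id [simp]: "f \<in> Arr C \<Longrightarrow> Dom C f = x \<Longrightarrow> f \<cdot>\<^bsub>C\<^esub> Id C x = f"
  using Id_right[of f x "Cod C f"] by (auto simp: hom_iff)

text \<open>Composites are normalised to right-nested form; later computations are rewriting modulo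
  this normal form.\<close>

lemma assoc [simp]:
  assumes "f \<in> Arr C" "g \<in> Arr C" "h \<in> Arr C" "Cod C f = Dom C g" "Cod C g = Dom C h"
  shows "(h \<cdot>\<^bsub>C\<^esub> g) \<cdot>\<^bsub>C\<^esub> f = h \<cdot>\<^bsub>C\<^esub> (g \<cdot>\<^bsub>C\<^esub> f)"
  using Comp_assoc[of f "Dom C f" "Dom C g" g "Dom C h" h "Cod C h"] assms by (auto simp: hom_iff)

text \<open>In right-nested form an equation for a composite of \<open>g\<close> and
  \<open>f\<close> no longer matches when something precedes \<open>f\<close>. This version carries
  the tail \<open>z\<close>, so that a law can be applied inside a longer chain.\<close>

lemma pre:
  assumes "g \<cdot>\<^bsub>C\<^esub> f = h" and "f \<in> Arr C" "g \<in> Arr C" "Cod C f = Dom C g" "z \<in> Arr C" "Cod C z = Dom C f"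
  shows "g \<cdot>\<^bsub>C\<^esub> f \<cdot>\<^bsub>C\<^esub> z = h \<cdot>\<^bsub>C\<^esub> z"
  using assms by (metis assoc)

lemma pre3:
  assumes "g \<cdot>\<^bsub>C\<^esub> f \<cdot>\<^bsub>C\<^esub> e = h" and "e \<in> Arr C" "f \<in> Arr C" "g \<in> Arr C" "Cod C e = Dom C f" "Cod C f = Dom C g"
    "z \<in> Arr C" "Cod C z = Dom C e"
  shows "g \<cdot>\<^bsub>C\<^esub> f \<cdot>\<^bsub>C\<^esub> e \<cdot>\<^bsub>C\<^esub> z = h \<cdot>\<^bsub>C\<^esub> z"
  using assms by (metis assoc comp_arr)

lemma inverse_arrows_unique:
  assumes "inverse_arrows C f g" "inverse_arrows C f h"
  shows "g = h"
proof -
  have "g = g \<cdot>\<^bsub>C\<^esub> (f \<cdot>\<^bsub>C\<^esub> h)" using assms by (simp add: inverse_arrows_def hom_iff)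
  also have "\<dots> = (g \<cdot>\<^bsub>C\<^esub> f) \<cdot>\<^bsub>C\<^esub> h" using assms by (subst assoc) (auto simp: inverse_arrows_def hom_iff)
  also have "\<dots> = h" using assms by (simp add: inverse_arrows_def hom_iff)
  finally show ?thesis .
qed

lemma inverse_inv_arr: "iso_arr C f \<Longrightarrow> inverse_arrows C f (inv_arr C f)"
  unfolding iso_arr_def inv_arr_def by (metis inverse_arrows_unique theI)

lemma iso_arr_arr: "iso_arr C f \<Longrightarrow> f \<in> Arr C"
  by (auto simp: iso_arr_def inverse_arrows_def)

lemma inv_arr_arr [simp]:
  assumes "iso_arr C f"
  shows "inv_arr C f \<in> Arr C" "Dom C (inv_arr C f) = Cod C f" "Cod C (inv_arr C f) = Dom C f"
  using inverse_inv_arr[OF assms] by (auto simp: inverse_arrows_def hom_iff)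

text \<open>The first rule matches any \<open>x\<close> and asks for \<open>x = f\<close>: the
  simplifier may then prove that the two arrows agree instead of having to match them
  literally.\<close>

lemma inv_comp [simp]:
  assumes "iso_arr C f"
  shows "x = f \<Longrightarrow> inv_arr C f \<cdot>\<^bsub>C\<^esub> x = Id C (Dom C f)" "f \<cdot>\<^bsub>C\<^esub> inv_arr C f = Id C (Cod C f)"
  using inverse_inv_arr[OF assms] by (auto simp: inverse_arrows_def hom_iff)

lemma inv_comp_pre [simp]:
  assumes "iso_arr C f" "z \<in> Arr C"
  shows "Cod C z = Dom C f \<Longrightarrow> inv_arr C f \<cdot>\<^bsub>C\<^esub> f \<cdot>\<^bsub>C\<^esub> z = z"
    "Cod C z = Cod C f \<Longrightarrow> f \<cdot>\<^bsub>C\<^esub> inv_arr C f \<cdot>\<^bsub>C\<^esub> z = z"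
  using iso_arr_arr[OF assms(1)] assms by (simp_all flip: assoc)

lemma iso_arrI:
  assumes "f \<in> Arr C" "g \<in> Arr C" "Dom C g = Cod C f" "Cod C g = Dom C f"
    "g \<cdot>\<^bsub>C\<^esub> f = Id C (Dom C f)" "f \<cdot>\<^bsub>C\<^esub> g = Id C (Cod C f)"
  shows "iso_arr C f" "inv_arr C f = g"
proof -
  have *: "inverse_arrows C f g" using assms by (auto simp: inverse_arrows_def hom_iff)
  then show "iso_arr C f" by (auto simp: iso_arr_def)
  then show "inv_arr C f = g" using * inverse_inv_arr inverse_arrows_unique by blast
qed

lemma iso_id [simp]: 
  assumes "x \<in> Ob C" shows "iso_arr C (Id C x)" "inv_arr C (Id C x) = Id C x"
  using iso_arrI[of "Id C x" "Id C x"] assms by simp_all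

lemma iso_inv [simp]: 
  assumes "iso_arr C f" shows "iso_arr C (inv_arr C f)" "inv_arr C (inv_arr C f) = f"
  using iso_arrI[of "inv_arr C f" f] assms iso_arr_arr[OF assms] by simp_all

lemma iso_comp:
  assumes "iso_arr C f" "iso_arr C g" "Cod C f = Dom C g"
  shows "iso_arr C (g \<cdot>\<^bsub>C\<^esub> f)" "inv_arr C (g \<cdot>\<^bsub>C\<^esub> f) = inv_arr C f \<cdot>\<^bsub>C\<^esub> inv_arr C g"
  using iso_arrI[of "g \<cdot>\<^bsub>C\<^esub> f" "inv_arr C f \<cdot>\<^bsub>C\<^esub> inv_arr C g"] assms iso_arr_arr[of f] iso_arr_arr[of g]
  by simp_all

text \<open>Obtained by composing the square with both inverses. Nearly all later laws about
  inverted data (bimodulators, balancings, inverse transformations) are instances, which avoids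
  repeated cancellation arguments.\<close>

lemma inv_square:
  assumes "iso_arr C f" "iso_arr C g" "x \<in> Arr C" "y \<in> Arr C"
    "Dom C x = Dom C f" "Cod C x = Dom C g" "Dom C y = Cod C f" "Cod C y = Cod C g"
    "g \<cdot>\<^bsub>C\<^esub> x = y \<cdot>\<^bsub>C\<^esub> f"
  shows "inv_arr C g \<cdot>\<^bsub>C\<^esub> y = x \<cdot>\<^bsub>C\<^esub> inv_arr C f"
proof -
  have "inv_arr C g \<cdot>\<^bsub>C\<^esub> (g \<cdot>\<^bsub>C\<^esub> x) \<cdot>\<^bsub>C\<^esub> inv_arr C f = inv_arr C g \<cdot>\<^bsub>C\<^esub> (y \<cdot>\<^bsub>C\<^esub> f) \<cdot>\<^bsub>C\<^esub> inv_arr C f"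
    by (simp only: assms(9))
  then show ?thesis using assms(1-8) iso_arr_arr[of f] iso_arr_arr[of g] by simp
qed

end

lemma nat_trans_iff: "nat_trans A B F G \<xi> \<longleftrightarrow>
   (\<forall>x\<in>Ob A. \<xi> x \<in> Arr B \<and> Dom B (\<xi> x) = fo F x \<and> Cod B (\<xi> x) = fo G x) \<and>
   (\<forall>f\<in>Arr A. \<xi> (Cod A f) \<cdot>\<^bsub>B\<^esub> fm F f = fm G f \<cdot>\<^bsub>B\<^esub> \<xi> (Dom A f))"
  by (auto simp: nat_trans_def hom_iff)

lemma cat_functorI:
  assumes "category A" "category B" "\<And>x. x \<in> Ob A \<Longrightarrow> fo F x \<in> Ob B"
    "\<And>f. f \<in> Arr A \<Longrightarrow> fm F f \<in> Arr B \<and> Dom B (fm F f) = fo F (Dom A f) \<and> Cod B (fm F f) = fo F (Cod A f)"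
    "\<And>x. x \<in> Ob A \<Longrightarrow> fm F (Id A x) = Id B (fo F x)"
    "\<And>f g. f \<in> Arr A \<Longrightarrow> g \<in> Arr A \<Longrightarrow> Cod A f = Dom A g \<Longrightarrow> fm F (g \<cdot>\<^bsub>A\<^esub> f) = fm F g \<cdot>\<^bsub>B\<^esub> fm F f"
  shows "cat_functor A B F"
  using assms by (auto intro!: cat_functor.intro simp: cat_functor_axioms_def hom_iff)

context cat_functor
begin

declare fo_in [simp] fm_Id [simp]

lemma fm_arr [simp]:
  assumes "f \<in> Arr A"
  shows "fm F f \<in> Arr B" "Dom B (fm F f) = fo F (Dom A f)" "Cod B (fm F f) = fo F (Cod A f)"
  using fm_hom[of f "Dom A f" "Cod A f"] assms by (auto simp: hom_iff)

lemma fm_comp [simp]: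
  "f \<in> Arr A \<Longrightarrow> g \<in> Arr A \<Longrightarrow> Cod A f = Dom A g \<Longrightarrow> fm F (g \<cdot>\<^bsub>A\<^esub> f) = fm F g \<cdot>\<^bsub>B\<^esub> fm F f"
  using fm_Comp[of f "Dom A f" "Dom A g" g "Cod A g"] by (auto simp: hom_iff)

text \<open>Oriented so that inverses are pushed inside functors, where the inverse laws of the
  source category apply.\<close>

lemma fm_iso [simp]:
  assumes "iso_arr A f"
  shows "iso_arr B (fm F f)" "inv_arr B (fm F f) = fm F (inv_arr A f)"
proof -
  note f = assms A.iso_arr_arr[OF assms]
  have "fm F (inv_arr A f) \<cdot>\<^bsub>B\<^esub> fm F f = Id B (fo F (Dom A f))"
    "fm F f \<cdot>\<^bsub>B\<^esub> fm F (inv_arr A f) = Id B (fo F (Cod A f))"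
    using f by (simp_all flip: fm_comp)
  then show "iso_arr B (fm F f)" "inv_arr B (fm F f) = fm F (inv_arr A f)"
    using f B.iso_arrI[of "fm F f" "fm F (inv_arr A f)"] by simp_all
qed

end

lemma prod_cat_simps [simp]:
  "Ob (prod_cat A B) = Ob A \<times> Ob B" "Arr (prod_cat A B) = Arr A \<times> Arr B"
  "Dom (prod_cat A B) (f, g) = (Dom A f, Dom B g)" "Cod (prod_cat A B) (f, g) = (Cod A f, Cod B g)"
  "Id (prod_cat A B) (x, y) = (Id A x, Id B y)"
  "(f', g') \<cdot>\<^bsub>prod_cat A B\<^esub> (f, g) = (f' \<cdot>\<^bsub>A\<^esub> f, g' \<cdot>\<^bsub>B\<^esub> g)"
  by (simp_all add: prod_cat_def)

lemma category_prod_cat [simp]: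
  assumes "category A" "category B" shows "category (prod_cat A B)"
proof -
  interpret A: category A by fact
  interpret B: category B by fact
  show ?thesis by (rule categoryI) auto
qed

lemma iso_arr_prod:
  assumes "category A" "category B" "iso_arr A f" "iso_arr B g"
  shows "iso_arr (prod_cat A B) (f, g)" "inv_arr (prod_cat A B) (f, g) = (inv_arr A f, inv_arr B g)"
proof -
  interpret A: category A by fact
  interpret B: category B by fact
  interpret AB: category "prod_cat A B" using assms by simp
  show "iso_arr (prod_cat A B) (f, g)" "inv_arr (prod_cat A B) (f, g) = (inv_arr A f, inv_arr B g)"
    using AB.iso_arrI[of "(f, g)" "(inv_arr A f, inv_arr B g)"] assms A.iso_arr_arr B.iso_arr_arr
    by auto
qed

section \<open>Categories of functors\<close>

lemma fun_cat_simps [simp]: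
  "Ob (fun_cat A B S Q) = S" "Dom (fun_cat A B S Q) = Src" "Cod (fun_cat A B S Q) = Tgt"
  "Id (fun_cat A B S Q) F = \<lparr>Src = F, Tgt = F, Cmp = \<lambda>x\<in>Ob A. Id B (fo F x)\<rparr>"
  "\<tau> \<cdot>\<^bsub>fun_cat A B S Q\<^esub> \<sigma> = \<lparr>Src = Src \<sigma>, Tgt = Tgt \<tau>, Cmp = \<lambda>x\<in>Ob A. Cmp \<tau> x \<cdot>\<^bsub>B\<^esub> Cmp \<sigma> x\<rparr>"
  by (simp_all add: fun_cat_def)

lemma Arr_fun_cat:
  "\<tau> \<in> Arr (fun_cat A B S Q) \<longleftrightarrow> Src \<tau> \<in> S \<and> Tgt \<tau> \<in> S \<and> Cmp \<tau> \<in> extensional (Ob A) \<and>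
     nat_trans A B (Src \<tau>) (Tgt \<tau>) (Cmp \<tau>) \<and> Q (Src \<tau>) (Tgt \<tau>) (Cmp \<tau>)"
  by (simp add: fun_cat_def)

text \<open>The payoff of extensionality: arrows of functor categories carry their endpoints, so
  equal endpoints and equal components on the carrier give equal records.\<close>

lemma trans_eqI:
  fixes \<tau> \<sigma> :: "('f, 'o, 'a) trans"
  assumes "Src \<tau> = Src \<sigma>" "Tgt \<tau> = Tgt \<sigma>" "Cmp \<tau> \<in> extensional X" "Cmp \<sigma> \<in> extensional X"
    "\<And>x. x \<in> X \<Longrightarrow> Cmp \<tau> x = Cmp \<sigma> x"
  shows "\<tau> = \<sigma>"
  using assms by (cases \<tau>; cases \<sigma>) (auto intro: extensionalityI)

text \<open>The closure conditions on \<open>Q\<close> make the transformations a category whose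
  isomorphisms are detected pointwise: by \<open>Q_inv\<close>, a pointwise inverse of a
  \<open>Q\<close>-transformation is again one.\<close>

locale functor_category = A: category A + B: category B
  for A :: "('o1, 'a1, 'z1) cat_scheme" and B :: "('o2, 'a2, 'z2) cat_scheme" +
  fixes S :: "('o1, 'a1, 'o2, 'a2, 'z) fctr_scheme set"
    and Q :: "('o1, 'a1, 'o2, 'a2, 'z) fctr_scheme \<Rightarrow> ('o1, 'a1, 'o2, 'a2, 'z) fctr_scheme \<Rightarrow> ('o1 \<Rightarrow> 'a2) \<Rightarrow> bool"
  assumes S_functor: "F \<in> S \<Longrightarrow> cat_functor A B F"
    and Q_Id: "F \<in> S \<Longrightarrow> Q F F (\<lambda>x\<in>Ob A. Id B (fo F x))"
    and Q_Comp: "F \<in> S \<Longrightarrow> G \<in> S \<Longrightarrow> H \<in> S \<Longrightarrow> nat_trans A B F G \<sigma> \<Longrightarrow> nat_trans A B G H \<tau> \<Longrightarrow>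
      Q F G \<sigma> \<Longrightarrow> Q G H \<tau> \<Longrightarrow> Q F H (\<lambda>x\<in>Ob A. \<tau> x \<cdot>\<^bsub>B\<^esub> \<sigma> x)"
    and Q_inv: "F \<in> S \<Longrightarrow> G \<in> S \<Longrightarrow> nat_trans A B F G \<sigma> \<Longrightarrow> (\<And>x. x \<in> Ob A \<Longrightarrow> iso_arr B (\<sigma> x)) \<Longrightarrow> Q F G \<sigma> \<Longrightarrow>
      Q G F (\<lambda>x\<in>Ob A. inv_arr B (\<sigma> x))"
begin

lemma Cmp_arr:
  assumes "\<tau> \<in> Arr (fun_cat A B S Q)" "x \<in> Ob A"
  shows "Cmp \<tau> x \<in> Arr B" "Dom B (Cmp \<tau> x) = fo (Src \<tau>) x" "Cod B (Cmp \<tau> x) = fo (Tgt \<tau>) x"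
  using assms by (auto simp: Arr_fun_cat nat_trans_iff)

lemma Cmp_nat:
  assumes "\<tau> \<in> Arr (fun_cat A B S Q)" "f \<in> Arr A"
  shows "Cmp \<tau> (Cod A f) \<cdot>\<^bsub>B\<^esub> fm (Src \<tau>) f = fm (Tgt \<tau>) f \<cdot>\<^bsub>B\<^esub> Cmp \<tau> (Dom A f)"
  using assms by (auto simp: Arr_fun_cat nat_trans_iff)

lemma Id_in_Arr: "F \<in> S \<Longrightarrow> Id (fun_cat A B S Q) F \<in> Arr (fun_cat A B S Q)"
proof -
  assume F: "F \<in> S"
  then interpret F: cat_functor A B F by (rule S_functor)
  show ?thesis using F Q_Id[OF F] by (simp add: Arr_fun_cat nat_trans_iff)
qed

lemma Comp_in_Arr:
  assumes "\<sigma> \<in> Arr (fun_cat A B S Q)" "\<tau> \<in> Arr (fun_cat A B S Q)" "Tgt \<sigma> = Src \<tau>"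
  shows "\<tau> \<cdot>\<^bsub>fun_cat A B S Q\<^esub> \<sigma> \<in> Arr (fun_cat A B S Q)"
proof -
  from assms have S: "Src \<sigma> \<in> S" "Src \<tau> \<in> S" "Tgt \<tau> \<in> S" by (auto simp: Arr_fun_cat)
  interpret F: cat_functor A B "Src \<sigma>" using S S_functor by blast
  interpret G: cat_functor A B "Src \<tau>" using S S_functor by blast
  interpret H: cat_functor A B "Tgt \<tau>" using S S_functor by blast
  note [simp] = Cmp_arr[OF assms(1)] Cmp_arr[OF assms(2)]
  have "nat_trans A B (Src \<sigma>) (Tgt \<tau>) (\<lambda>x\<in>Ob A. Cmp \<tau> x \<cdot>\<^bsub>B\<^esub> Cmp \<sigma> x)"
    using Cmp_nat[OF assms(1)] B.pre[OF Cmp_nat[OF assms(2)]] assms(3)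
    by (auto simp: nat_trans_iff)
  then show ?thesis
    using assms Q_Comp[of "Src \<sigma>" "Src \<tau>" "Tgt \<tau>" "Cmp \<sigma>" "Cmp \<tau>"] by (auto simp: Arr_fun_cat)
qed

lemma category_fun_cat: "category (fun_cat A B S Q)" (is "category ?F")
proof (rule categoryI)
  fix f assume f: "f \<in> Arr ?F"
  then show "Dom ?F f \<in> Ob ?F" "Cod ?F f \<in> Ob ?F" by (auto simp: Arr_fun_cat)
  show "Id ?F (Cod ?F f) \<cdot>\<^bsub>?F\<^esub> f = f" "f \<cdot>\<^bsub>?F\<^esub> Id ?F (Dom ?F f) = f"
    using Cmp_arr[OF f] f by (auto intro!: trans_eqI[where X="Ob A"] simp: Arr_fun_cat)
next
  fix F assume "F \<in> Ob ?F"
  then show "Id ?F F \<in> Arr ?F \<and> Dom ?F (Id ?F F) = F \<and> Cod ?F (Id ?F F) = F"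
    using Id_in_Arr by simp
next
  fix f g assume "f \<in> Arr ?F" "g \<in> Arr ?F" "Cod ?F f = Dom ?F g"
  then show "g \<cdot>\<^bsub>?F\<^esub> f \<in> Arr ?F \<and> Dom ?F (g \<cdot>\<^bsub>?F\<^esub> f) = Dom ?F f \<and> Cod ?F (g \<cdot>\<^bsub>?F\<^esub> f) = Cod ?F g"
    using Comp_in_Arr[of f g] by simp
next
  fix f g h assume "f \<in> Arr ?F" "g \<in> Arr ?F" "h \<in> Arr ?F" "Cod ?F f = Dom ?F g" "Cod ?F g = Dom ?F h"
  then show "(h \<cdot>\<^bsub>?F\<^esub> g) \<cdot>\<^bsub>?F\<^esub> f = h \<cdot>\<^bsub>?F\<^esub> (g \<cdot>\<^bsub>?F\<^esub> f)"
    by (auto intro!: trans_eqI[where X="Ob A"] restrict_ext simp: Cmp_arr)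
qed

text \<open>Naturality of the pointwise inverse is \<open>inv_square\<close> and its membership is
  \<open>Q_inv\<close>; the two composites are identities component by component.\<close>

lemma iso_arr_fun_cat:
  assumes \<tau>: "\<tau> \<in> Arr (fun_cat A B S Q)" and iso: "\<And>x. x \<in> Ob A \<Longrightarrow> iso_arr B (Cmp \<tau> x)"
  shows "iso_arr (fun_cat A B S Q) \<tau>"
    "inv_arr (fun_cat A B S Q) \<tau> = \<lparr>Src = Tgt \<tau>, Tgt = Src \<tau>, Cmp = \<lambda>x\<in>Ob A. inv_arr B (Cmp \<tau> x)\<rparr>"
proof -
  interpret F: category "fun_cat A B S Q" by (rule category_fun_cat)
  from \<tau> have S: "Src \<tau> \<in> S" "Tgt \<tau> \<in> S" by (auto simp: Arr_fun_cat)
  interpret F1: cat_functor A B "Src \<tau>" using S S_functor by blast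
  interpret F2: cat_functor A B "Tgt \<tau>" using S S_functor by blast
  let ?\<sigma> = "\<lparr>Src = Tgt \<tau>, Tgt = Src \<tau>, Cmp = \<lambda>x\<in>Ob A. inv_arr B (Cmp \<tau> x)\<rparr>"
  note [simp] = Cmp_arr[OF \<tau>] iso
  have 1: "?\<sigma> \<in> Arr (fun_cat A B S Q)"
    using \<tau> Q_inv[of "Src \<tau>" "Tgt \<tau>" "Cmp \<tau>"] 
    by (auto simp: Arr_fun_cat nat_trans_iff intro!: B.inv_square)
  have "?\<sigma> \<cdot>\<^bsub>fun_cat A B S Q\<^esub> \<tau> = Id (fun_cat A B S Q) (Src \<tau>)"
    "\<tau> \<cdot>\<^bsub>fun_cat A B S Q\<^esub> ?\<sigma> = Id (fun_cat A B S Q) (Tgt \<tau>)"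
     by (auto intro!: trans_eqI[where X="Ob A"])
  with F.iso_arrI[of \<tau> ?\<sigma>] \<tau> 1 show "iso_arr (fun_cat A B S Q) \<tau>" "inv_arr (fun_cat A B S Q) \<tau> = ?\<sigma>"
    by simp_all
qed

end

section \<open>Actions\<close>

lemma mrev_simps [simp]:
  "Ob (mrev M) = Ob M" "Arr (mrev M) = Arr M" "Dom (mrev M) = Dom M" "Cod (mrev M) = Cod M"
  "Id (mrev M) = Id M" "Comp (mrev M) = Comp M" "unit (mrev M) = unit M"
  "m \<otimes>\<^bsub>mrev M\<^esub> n = n \<otimes>\<^bsub>M\<^esub> m" "f \<boxtimes>\<^bsub>mrev M\<^esub> g = g \<boxtimes>\<^bsub>M\<^esub> f"
  "alpha (mrev M) m n p = inv_arr M (alpha M p n m)" "lam (mrev M) = rho M" "rho (mrev M) = lam M"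
  by (simp_all add: mrev_def)

lemma inv_arr_mrev [simp]: "inv_arr (mrev M) = inv_arr M" "iso_arr (mrev M) = iso_arr M" "hom (mrev M) = hom M"
  by (simp_all add: fun_eq_iff inv_arr_def iso_arr_def inverse_arrows_def hom_def)

context monoidal_category
begin

declare unit_in [simp] alpha_iso [simp] lam_iso [simp] rho_iso [simp]

lemma tens_in [simp]: "m \<in> Ob M \<Longrightarrow> n \<in> Ob M \<Longrightarrow> m \<otimes>\<^bsub>M\<^esub> n \<in> Ob M"
  using cat_functor.fo_in[OF tens_functor, of "(m, n)"] by simp

lemma tens_arr [simp]:
  assumes "f \<in> Arr M" "g \<in> Arr M"
  shows "f \<boxtimes>\<^bsub>M\<^esub> g \<in> Arr M" "Dom M (f \<boxtimes>\<^bsub>M\<^esub> g) = Dom M f \<otimes>\<^bsub>M\<^esub> Dom M g" "Cod M (f \<boxtimes>\<^bsub>M\<^esub> g) = Cod M f \<otimes>\<^bsub>M\<^esub> Cod M g"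
  using cat_functor.fm_arr[OF tens_functor, of "(f, g)"] assms by simp_all

lemma tens_id [simp]: "m \<in> Ob M \<Longrightarrow> n \<in> Ob M \<Longrightarrow> Id M m \<boxtimes>\<^bsub>M\<^esub> Id M n = Id M (m \<otimes>\<^bsub>M\<^esub> n)"
  using cat_functor.fm_Id[OF tens_functor, of "(m, n)"] by simp

lemma alpha_arr [simp]:
  assumes "m \<in> Ob M" "n \<in> Ob M" "p \<in> Ob M"
  shows "alpha M m n p \<in> Arr M" "Dom M (alpha M m n p) = (m \<otimes>\<^bsub>M\<^esub> n) \<otimes>\<^bsub>M\<^esub> p"
    "Cod M (alpha M m n p) = m \<otimes>\<^bsub>M\<^esub> (n \<otimes>\<^bsub>M\<^esub> p)"
  using alpha_hom[OF assms] by (auto simp: hom_iff)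

lemma lam_rho_arr [simp]:
  assumes "m \<in> Ob M"
  shows "lam M m \<in> Arr M" "Dom M (lam M m) = j\<^bsub>M\<^esub> \<otimes>\<^bsub>M\<^esub> m" "Cod M (lam M m) = m"
    "rho M m \<in> Arr M" "Dom M (rho M m) = m \<otimes>\<^bsub>M\<^esub> j\<^bsub>M\<^esub>" "Cod M (rho M m) = m"
  using lam_hom[OF assms] rho_hom[OF assms] by (auto simp: hom_iff)

end

lemma left_actegoryI:
  assumes "monoidal_category M" "category C"
    and "\<And>m c. m \<in> Ob M \<Longrightarrow> c \<in> Ob C \<Longrightarrow> m \<bullet>\<^bsub>A\<^esub> c \<in> Ob C"
    and "\<And>f g. f \<in> Arr M \<Longrightarrow> g \<in> Arr C \<Longrightarrow> f \<odot>\<^bsub>A\<^esub> g \<in> Arr C \<and> Dom C (f \<odot>\<^bsub>A\<^esub> g) = Dom M f \<bullet>\<^bsub>A\<^esub> Dom C g \<and>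
      Cod C (f \<odot>\<^bsub>A\<^esub> g) = Cod M f \<bullet>\<^bsub>A\<^esub> Cod C g"
    and "\<And>m c. m \<in> Ob M \<Longrightarrow> c \<in> Ob C \<Longrightarrow> Id M m \<odot>\<^bsub>A\<^esub> Id C c = Id C (m \<bullet>\<^bsub>A\<^esub> c)"
    and "\<And>f g f' g'. f \<in> Arr M \<Longrightarrow> f' \<in> Arr M \<Longrightarrow> g \<in> Arr C \<Longrightarrow> g' \<in> Arr C \<Longrightarrow> Cod M f = Dom M f' \<Longrightarrow>
      Cod C g = Dom C g' \<Longrightarrow> (f' \<cdot>\<^bsub>M\<^esub> f) \<odot>\<^bsub>A\<^esub> (g' \<cdot>\<^bsub>C\<^esub> g) = (f' \<odot>\<^bsub>A\<^esub> g') \<cdot>\<^bsub>C\<^esub> (f \<odot>\<^bsub>A\<^esub> g)"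
    and "\<And>c. c \<in> Ob C \<Longrightarrow> eta A c \<in> Arr C \<and> Dom C (eta A c) = c \<and> Cod C (eta A c) = j\<^bsub>M\<^esub> \<bullet>\<^bsub>A\<^esub> c"
    and "\<And>c. c \<in> Ob C \<Longrightarrow> iso_arr C (eta A c)"
    and "\<And>h. h \<in> Arr C \<Longrightarrow> eta A (Cod C h) \<cdot>\<^bsub>C\<^esub> h = (Id M j\<^bsub>M\<^esub> \<odot>\<^bsub>A\<^esub> h) \<cdot>\<^bsub>C\<^esub> eta A (Dom C h)"
    and "\<And>m n c. m \<in> Ob M \<Longrightarrow> n \<in> Ob M \<Longrightarrow> c \<in> Ob C \<Longrightarrow>
      mu A m n c \<in> Arr C \<and> Dom C (mu A m n c) = m \<bullet>\<^bsub>A\<^esub> n \<bullet>\<^bsub>A\<^esub> c \<and> Cod C (mu A m n c) = (m \<otimes>\<^bsub>M\<^esub> n) \<bullet>\<^bsub>A\<^esub> c"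
    and "\<And>m n c. m \<in> Ob M \<Longrightarrow> n \<in> Ob M \<Longrightarrow> c \<in> Ob C \<Longrightarrow> iso_arr C (mu A m n c)"
    and "\<And>f g h. f \<in> Arr M \<Longrightarrow> g \<in> Arr M \<Longrightarrow> h \<in> Arr C \<Longrightarrow>
      mu A (Cod M f) (Cod M g) (Cod C h) \<cdot>\<^bsub>C\<^esub> (f \<odot>\<^bsub>A\<^esub> g \<odot>\<^bsub>A\<^esub> h) =
      ((f \<boxtimes>\<^bsub>M\<^esub> g) \<odot>\<^bsub>A\<^esub> h) \<cdot>\<^bsub>C\<^esub> mu A (Dom M f) (Dom M g) (Dom C h)"
    and "\<And>m n p c. m \<in> Ob M \<Longrightarrow> n \<in> Ob M \<Longrightarrow> p \<in> Ob M \<Longrightarrow> c \<in> Ob C \<Longrightarrow>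
      (alpha M m n p \<odot>\<^bsub>A\<^esub> Id C c) \<cdot>\<^bsub>C\<^esub> mu A (m \<otimes>\<^bsub>M\<^esub> n) p c \<cdot>\<^bsub>C\<^esub> mu A m n (p \<bullet>\<^bsub>A\<^esub> c) =
      mu A m (n \<otimes>\<^bsub>M\<^esub> p) c \<cdot>\<^bsub>C\<^esub> (Id M m \<odot>\<^bsub>A\<^esub> mu A n p c)"
    and "\<And>m c. m \<in> Ob M \<Longrightarrow> c \<in> Ob C \<Longrightarrow>
      mu A j\<^bsub>M\<^esub> m c \<cdot>\<^bsub>C\<^esub> eta A (m \<bullet>\<^bsub>A\<^esub> c) = inv_arr M (lam M m) \<odot>\<^bsub>A\<^esub> Id C c"
    and "\<And>m c. m \<in> Ob M \<Longrightarrow> c \<in> Ob C \<Longrightarrow>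
      mu A m j\<^bsub>M\<^esub> c \<cdot>\<^bsub>C\<^esub> (Id M m \<odot>\<^bsub>A\<^esub> eta A c) = inv_arr M (rho M m) \<odot>\<^bsub>A\<^esub> Id C c"
  shows "left_actegory M C A"
proof (rule left_actegory.intro)
  show "monoidal_category M" "category C" by fact+
  interpret M: monoidal_category M by fact
  interpret C: category C by fact
  show "left_actegory_axioms M C A"
    using assms by unfold_locales
     (auto simp: hom_iff intro!: cat_functorI category_prod_cat M.category_axioms)
qed

context left_actegory
begin

declare eta_iso [simp] mu_iso [simp]

lemma act_ob [simp]: "m \<in> Ob M \<Longrightarrow> c \<in> Ob C \<Longrightarrow> m \<bullet>\<^bsub>A\<^esub> c \<in> Ob C"
  using cat_functor.fo_in[OF act_functor, of "(m, c)"] by simp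

lemma act_arr [simp]:
  assumes "f \<in> Arr M" "g \<in> Arr C"
  shows "f \<odot>\<^bsub>A\<^esub> g \<in> Arr C" "Dom C (f \<odot>\<^bsub>A\<^esub> g) = Dom M f \<bullet>\<^bsub>A\<^esub> Dom C g" "Cod C (f \<odot>\<^bsub>A\<^esub> g) = Cod M f \<bullet>\<^bsub>A\<^esub> Cod C g"
  using cat_functor.fm_arr[OF act_functor, of "(f, g)"] assms by simp_all

lemma act_id [simp]: "m \<in> Ob M \<Longrightarrow> c \<in> Ob C \<Longrightarrow> Id M m \<odot>\<^bsub>A\<^esub> Id C c = Id C (m \<bullet>\<^bsub>A\<^esub> c)"
  using cat_functor.fm_Id[OF act_functor, of "(m, c)"] by simp

lemma act_comp:
  assumes "f \<in> Arr M" "f' \<in> Arr M" "g \<in> Arr C" "g' \<in> Arr C" "Cod M f = Dom M f'" "Cod C g = Dom C g'"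
  shows "(f' \<cdot>\<^bsub>M\<^esub> f) \<odot>\<^bsub>A\<^esub> (g' \<cdot>\<^bsub>C\<^esub> g) = (f' \<odot>\<^bsub>A\<^esub> g') \<cdot>\<^bsub>C\<^esub> (f \<odot>\<^bsub>A\<^esub> g)"
  using cat_functor.fm_comp[OF act_functor, of "(f, g)" "(f', g')"] assms by simp

lemma act_comp_right [simp]:
  assumes "m \<in> Ob M" "g \<in> Arr C" "g' \<in> Arr C" "Cod C g = Dom C g'"
  shows "Id M m \<odot>\<^bsub>A\<^esub> (g' \<cdot>\<^bsub>C\<^esub> g) = (Id M m \<odot>\<^bsub>A\<^esub> g') \<cdot>\<^bsub>C\<^esub> (Id M m \<odot>\<^bsub>A\<^esub> g)"
  using act_comp[of "Id M m" "Id M m" g g'] assms by simp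

lemma act_comp_left [simp]:
  assumes "c \<in> Ob C" "f \<in> Arr M" "f' \<in> Arr M" "Cod M f = Dom M f'"
  shows "(f' \<cdot>\<^bsub>M\<^esub> f) \<odot>\<^bsub>A\<^esub> Id C c = (f' \<odot>\<^bsub>A\<^esub> Id C c) \<cdot>\<^bsub>C\<^esub> (f \<odot>\<^bsub>A\<^esub> Id C c)"
  using act_comp[of f f' "Id C c" "Id C c"] assms by simp

text \<open>Interchange: acting first in one variable and then in the other gives the joint action
  in either order. Objects enter as variables with equations, so the rule applies whatever their
  syntactic form.\<close>

lemma act_merge:
  assumes "f \<in> Arr M" "g \<in> Arr C"
  shows "y = Cod C g \<Longrightarrow> x = Dom M f \<Longrightarrow> (f \<odot>\<^bsub>A\<^esub> Id C y) \<cdot>\<^bsub>C\<^esub> (Id M x \<odot>\<^bsub>A\<^esub> g) = f \<odot>\<^bsub>A\<^esub> g"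
    "y = Dom C g \<Longrightarrow> x = Cod M f \<Longrightarrow> (Id M x \<odot>\<^bsub>A\<^esub> g) \<cdot>\<^bsub>C\<^esub> (f \<odot>\<^bsub>A\<^esub> Id C y) = f \<odot>\<^bsub>A\<^esub> g"
  using assms act_comp[of "Id M (Dom M f)" f g "Id C (Cod C g)"] act_comp[of f "Id M (Cod M f)" "Id C (Dom C g)" g]
  by simp_all

lemma act_iso [simp]:
  assumes "iso_arr M f" "iso_arr C g"
  shows "iso_arr C (f \<odot>\<^bsub>A\<^esub> g)" "inv_arr C (f \<odot>\<^bsub>A\<^esub> g) = inv_arr M f \<odot>\<^bsub>A\<^esub> inv_arr C g"
  using C.iso_arrI[of "f \<odot>\<^bsub>A\<^esub> g" "inv_arr M f \<odot>\<^bsub>A\<^esub> inv_arr C g"] assms M.iso_arr_arr[of f] C.iso_arr_arr[of g]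
  by (simp_all flip: act_comp)

lemma eta_arr [simp]:
  assumes "c \<in> Ob C" shows "eta A c \<in> Arr C" "Dom C (eta A c) = c" "Cod C (eta A c) = j\<^bsub>M\<^esub> \<bullet>\<^bsub>A\<^esub> c"
  using eta_hom[OF assms] by (auto simp: hom_iff)

lemma mu_arr [simp]:
  assumes "m \<in> Ob M" "n \<in> Ob M" "c \<in> Ob C"
  shows "mu A m n c \<in> Arr C" "Dom C (mu A m n c) = m \<bullet>\<^bsub>A\<^esub> n \<bullet>\<^bsub>A\<^esub> c" "Cod C (mu A m n c) = (m \<otimes>\<^bsub>M\<^esub> n) \<bullet>\<^bsub>A\<^esub> c"
  using mu_hom[OF assms] by (auto simp: hom_iff)

lemma eta_natural: "h \<in> Arr C \<Longrightarrow> y = Cod C h \<Longrightarrow> eta A y \<cdot>\<^bsub>C\<^esub> h = (Id M j\<^bsub>M\<^esub> \<odot>\<^bsub>A\<^esub> h) \<cdot>\<^bsub>C\<^esub> eta A (Dom C h)"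
  using eta_nat[of h] by (auto simp: hom_iff)

lemma mu_natural:
  assumes "f \<in> Arr M" "g \<in> Arr M" "h \<in> Arr C" "m = Cod M f" "n = Cod M g" "c = Cod C h"
  shows "mu A m n c \<cdot>\<^bsub>C\<^esub> (f \<odot>\<^bsub>A\<^esub> g \<odot>\<^bsub>A\<^esub> h) =
      ((f \<boxtimes>\<^bsub>M\<^esub> g) \<odot>\<^bsub>A\<^esub> h) \<cdot>\<^bsub>C\<^esub> mu A (Dom M f) (Dom M g) (Dom C h)"
  using mu_nat[of f _ m g _ n h _ c] assms by (auto simp: hom_iff)

end

context left_actegory
begin

text \<open>Applies the functor \<open>m \<bullet> -\<close> to a commuting square, in the split
  form which the simp rule \<open>act_comp_right\<close> produces.\<close>

lemma act_eq:
  assumes "g \<cdot>\<^bsub>C\<^esub> f = k \<cdot>\<^bsub>C\<^esub> h" "m \<in> Ob M" "f \<in> Arr C" "g \<in> Arr C" "h \<in> Arr C" "k \<in> Arr C"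
    "Cod C f = Dom C g" "Cod C h = Dom C k"
  shows "(Id M m \<odot>\<^bsub>A\<^esub> g) \<cdot>\<^bsub>C\<^esub> (Id M m \<odot>\<^bsub>A\<^esub> f) = (Id M m \<odot>\<^bsub>A\<^esub> k) \<cdot>\<^bsub>C\<^esub> (Id M m \<odot>\<^bsub>A\<^esub> h)"
proof -
  have "Id M m \<odot>\<^bsub>A\<^esub> (g \<cdot>\<^bsub>C\<^esub> f) = Id M m \<odot>\<^bsub>A\<^esub> (k \<cdot>\<^bsub>C\<^esub> h)" by (simp only: assms(1))
  then show ?thesis using assms(2-) by simp
qed

text \<open>Works against the simp rule \<open>act_comp_right\<close>, collecting factors under one
  action; uses of it therefore remove that rule.\<close>

lemma act_absorb:
  assumes "f \<in> Arr M" "x \<in> Arr C" "y \<in> Arr C"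
  shows "m = Dom M f \<Longrightarrow> Cod C y = Dom C x \<Longrightarrow> (f \<odot>\<^bsub>A\<^esub> x) \<cdot>\<^bsub>C\<^esub> (Id M m \<odot>\<^bsub>A\<^esub> y) = f \<odot>\<^bsub>A\<^esub> (x \<cdot>\<^bsub>C\<^esub> y)"
    "n = Cod M f \<Longrightarrow> Cod C x = Dom C y \<Longrightarrow> (Id M n \<odot>\<^bsub>A\<^esub> y) \<cdot>\<^bsub>C\<^esub> (f \<odot>\<^bsub>A\<^esub> x) = f \<odot>\<^bsub>A\<^esub> (y \<cdot>\<^bsub>C\<^esub> x)"
  using assms by (simp_all flip: act_comp)

end

section \<open>Rewriting rules for right actions and inverse bimodulators\<close>

context biactegory
begin

declare zeta_iso [simp]

text \<open>Facts on the right action speak of \<open>mrev N\<close>, but the simplifier turns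
  \<open>Id (mrev N)\<close> and its companions into those of \<open>N\<close>; unless unfolded in
  advance, the left sides would not match.\<close>

lemmas R_simps = R.act_ob R.act_arr R.act_id R.act_comp_right R.act_comp_left R.act_iso
  R.eta_arr R.mu_arr R.eta_iso R.mu_iso

lemmas [simp] = R_simps [unfolded mrev_simps inv_arr_mrev]

lemmas R_natural = R.eta_natural [unfolded mrev_simps] R.mu_natural [unfolded mrev_simps]
lemmas R_eq = R.act_eq [unfolded mrev_simps]

lemma zeta_arr [simp]:
  assumes "m \<in> Ob M" "c \<in> Ob C" "n \<in> Ob N"
  shows "zeta C m c n \<in> Arr C" "Dom C (zeta C m c n) = m \<bullet>\<^bsub>Lact C\<^esub> n \<bullet>\<^bsub>Ract C\<^esub> c"
    "Cod C (zeta C m c n) = n \<bullet>\<^bsub>Ract C\<^esub> m \<bullet>\<^bsub>Lact C\<^esub> c"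
  using zeta_hom[OF assms] by (auto simp: hom_iff)

lemma zeta_natural:
  assumes "f \<in> Arr M" "g \<in> Arr C" "h \<in> Arr N" "m = Cod M f" "c = Cod C g" "n = Cod N h"
  shows "zeta C m c n \<cdot>\<^bsub>C\<^esub> (f \<odot>\<^bsub>Lact C\<^esub> h \<odot>\<^bsub>Ract C\<^esub> g) =
    (h \<odot>\<^bsub>Ract C\<^esub> f \<odot>\<^bsub>Lact C\<^esub> g) \<cdot>\<^bsub>C\<^esub> zeta C (Dom M f) (Dom C g) (Dom N h)"
  using zeta_nat[of f _ m g _ c h _ n] assms by (auto simp: hom_iff)

text \<open>The inverse direction \<open>(m \<bullet> c) \<star> n \<rightarrow> m \<bullet> (c
  \<star> n)\<close> matters because the right linear structures of \<open>lhom\<close> and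
  \<open>rhom\<close> are made of it.\<close>

lemma zeta_inv_natural:
  assumes "f \<in> Arr M" "g \<in> Arr C" "h \<in> Arr N" "m = Cod M f" "c = Cod C g" "n = Cod N h"
  shows "inv_arr C (zeta C m c n) \<cdot>\<^bsub>C\<^esub> (h \<odot>\<^bsub>Ract C\<^esub> f \<odot>\<^bsub>Lact C\<^esub> g) =
    (f \<odot>\<^bsub>Lact C\<^esub> h \<odot>\<^bsub>Ract C\<^esub> g) \<cdot>\<^bsub>C\<^esub> inv_arr C (zeta C (Dom M f) (Dom C g) (Dom N h))"
  using assms by (intro L.C.inv_square) (simp_all add: zeta_natural)

text \<open>\<open>zeta_left\<close> is read as a square with two invertible sides, one of them a
  composite of two bimodulators, and inverted by \<open>inv_square\<close>.\<close>

lemma zeta_inv_left: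
  assumes "m \<in> Ob M" "m' \<in> Ob M" "c \<in> Ob C" "n \<in> Ob N"
  shows "inv_arr C (zeta C (m \<otimes>\<^bsub>M\<^esub> m') c n) \<cdot>\<^bsub>C\<^esub> (Id N n \<odot>\<^bsub>Ract C\<^esub> mu (Lact C) m m' c) =
    mu (Lact C) m m' (n \<bullet>\<^bsub>Ract C\<^esub> c) \<cdot>\<^bsub>C\<^esub> (Id M m \<odot>\<^bsub>Lact C\<^esub> inv_arr C (zeta C m' c n))
      \<cdot>\<^bsub>C\<^esub> inv_arr C (zeta C m (m' \<bullet>\<^bsub>Lact C\<^esub> c) n)"
  using L.C.inv_square[of "zeta C m (m' \<bullet>\<^bsub>Lact C\<^esub> c) n \<cdot>\<^bsub>C\<^esub> (Id M m \<odot>\<^bsub>Lact C\<^esub> zeta C m' c n)"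
      "zeta C (m \<otimes>\<^bsub>M\<^esub> m') c n" "mu (Lact C) m m' (n \<bullet>\<^bsub>Ract C\<^esub> c)" "Id N n \<odot>\<^bsub>Ract C\<^esub> mu (Lact C) m m' c"]
    assms zeta_left[OF assms] by (simp add: L.C.iso_comp)

lemma zeta_inv_right:
  assumes "m \<in> Ob M" "c \<in> Ob C" "n \<in> Ob N" "n' \<in> Ob N"
  shows "inv_arr C (zeta C m c (n \<otimes>\<^bsub>N\<^esub> n')) \<cdot>\<^bsub>C\<^esub> mu (Ract C) n' n (m \<bullet>\<^bsub>Lact C\<^esub> c) =
    (Id M m \<odot>\<^bsub>Lact C\<^esub> mu (Ract C) n' n c) \<cdot>\<^bsub>C\<^esub> inv_arr C (zeta C m (n \<bullet>\<^bsub>Ract C\<^esub> c) n')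
      \<cdot>\<^bsub>C\<^esub> (Id N n' \<odot>\<^bsub>Ract C\<^esub> inv_arr C (zeta C m c n))"
  using L.C.inv_square[of "(Id N n' \<odot>\<^bsub>Ract C\<^esub> zeta C m c n) \<cdot>\<^bsub>C\<^esub> zeta C m (n \<bullet>\<^bsub>Ract C\<^esub> c) n'"
      "zeta C m c (n \<otimes>\<^bsub>N\<^esub> n')" "Id M m \<odot>\<^bsub>Lact C\<^esub> mu (Ract C) n' n c" "mu (Ract C) n' n (m \<bullet>\<^bsub>Lact C\<^esub> c)"]
    assms zeta_right[OF assms] by (simp add: L.C.iso_comp)

lemma zeta_inv_unit_left:
  assumes "c \<in> Ob C" "n \<in> Ob N"
  shows "inv_arr C (zeta C j\<^bsub>M\<^esub> c n) \<cdot>\<^bsub>C\<^esub> (Id N n \<odot>\<^bsub>Ract C\<^esub> eta (Lact C) c) = eta (Lact C) (n \<bullet>\<^bsub>Ract C\<^esub> c)"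
  using assms by (simp flip: zeta_unit_left)

lemma zeta_inv_unit_right:
  assumes "m \<in> Ob M" "c \<in> Ob C"
  shows "inv_arr C (zeta C m c j\<^bsub>N\<^esub>) \<cdot>\<^bsub>C\<^esub> eta (Ract C) (m \<bullet>\<^bsub>Lact C\<^esub> c) = Id M m \<odot>\<^bsub>Lact C\<^esub> eta (Ract C) c"
  using assms by (simp flip: zeta_unit_right)

end

section \<open>The biactegory of right linear functors\<close>

text \<open>That \<open>mrev M\<close> is monoidal is taken as part of the data instead of being
  derived from \<open>M\<close>; in the theorem it comes with the right action of \<open>M\<close>
  on \<open>C\<close>.\<close>

locale hom_data = D: biactegory M P D + E: biactegory N P E + Mr: monoidal_category "mrev M"
  for N :: "('no, 'na) monoidal" and M :: "('mo, 'ma) monoidal" and P :: "('po, 'pa) monoidal"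
    and D :: "('mo, 'ma, 'po, 'pa, 'do, 'da) biact" and E :: "('no, 'na, 'po, 'pa, 'eo, 'ea) biact"
begin

text \<open>A subscript marks a left action, a superscript a right action, also written on the left.\<close>

abbreviation comp_D (infixr \<open>\<cdot>\<^sub>D\<close> 65) where "comp_D \<equiv> Comp D"
abbreviation lact_D_o (infixr \<open>\<bullet>\<^sub>D\<close> 75) where "lact_D_o \<equiv> act_o (Lact D)"
abbreviation ract_D_o (infixr \<open>\<bullet>\<^sup>D\<close> 75) where "ract_D_o \<equiv> act_o (Ract D)"
abbreviation lact_D_a (infixr \<open>\<odot>\<^sub>D\<close> 75) where "lact_D_a \<equiv> act_a (Lact D)"
abbreviation ract_D_a (infixr \<open>\<odot>\<^sup>D\<close> 75) where "ract_D_a \<equiv> act_a (Ract D)"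
abbreviation comp_E (infixr \<open>\<cdot>\<^sub>E\<close> 65) where "comp_E \<equiv> Comp E"
abbreviation lact_E_o (infixr \<open>\<bullet>\<^sub>E\<close> 75) where "lact_E_o \<equiv> act_o (Lact E)"
abbreviation ract_E_o (infixr \<open>\<bullet>\<^sup>E\<close> 75) where "ract_E_o \<equiv> act_o (Ract E)"
abbreviation lact_E_a (infixr \<open>\<odot>\<^sub>E\<close> 75) where "lact_E_a \<equiv> act_a (Lact E)"
abbreviation ract_E_a (infixr \<open>\<odot>\<^sup>E\<close> 75) where "ract_E_a \<equiv> act_a (Ract E)"

abbreviation "RL \<equiv> RLin P D (Ract D) E (Ract E)"

lemma RL_simps [simp]:
  "Dom RL = Src" "Cod RL = Tgt"
  "Id RL F = \<lparr>Src = F, Tgt = F, Cmp = \<lambda>x\<in>Ob D. Id E (fo F x)\<rparr>"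
  "\<tau> \<cdot>\<^bsub>RL\<^esub> \<sigma> = \<lparr>Src = Src \<sigma>, Tgt = Tgt \<tau>, Cmp = \<lambda>x\<in>Ob D. Cmp \<tau> x \<cdot>\<^sub>E Cmp \<sigma> x\<rparr>"
  by (simp_all add: RLin_def)

text \<open>Removes \<open>mrev P\<close> and \<open>hom\<close> from the definition and puts the
  arguments of the linear structure in the order \<open>(d, p)\<close>; below, right linear functors
  are handled through these equations.\<close>

lemma Ob_RL: "F \<in> Ob RL \<longleftrightarrow> cat_functor D E F \<and> fo F \<in> extensional (Ob D) \<and> fm F \<in> extensional (Arr D) \<and>
    rs F \<in> extensional (Ob D \<times> Ob P) \<and>
    (\<forall>d\<in>Ob D. \<forall>p\<in>Ob P. iso_arr E (rs F (d, p)) \<and> Dom E (rs F (d, p)) = p \<bullet>\<^sup>E fo F d \<and>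
       Cod E (rs F (d, p)) = fo F (p \<bullet>\<^sup>D d)) \<and>
    (\<forall>f\<in>Arr P. \<forall>g\<in>Arr D. rs F (Cod D g, Cod P f) \<cdot>\<^sub>E (f \<odot>\<^sup>E fm F g) =
       fm F (f \<odot>\<^sup>D g) \<cdot>\<^sub>E rs F (Dom D g, Dom P f)) \<and>
    (\<forall>p\<in>Ob P. \<forall>q\<in>Ob P. \<forall>d\<in>Ob D.
       fm F (mu (Ract D) p q d) \<cdot>\<^sub>E rs F (q \<bullet>\<^sup>D d, p) \<cdot>\<^sub>E (Id P p \<odot>\<^sup>E rs F (d, q)) =
       rs F (d, q \<otimes>\<^bsub>P\<^esub> p) \<cdot>\<^sub>E mu (Ract E) p q (fo F d)) \<and>
    (\<forall>d\<in>Ob D. rs F (d, j\<^bsub>P\<^esub>) \<cdot>\<^sub>E eta (Ract E) (fo F d) = fm F (eta (Ract D) d))"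
  (is "?L \<longleftrightarrow> ?R")
proof
  assume L: ?L
  then interpret F: left_linear "mrev P" D "Ract D" E "Ract E" F "\<lambda>(p, d). rs F (d, p)"
    by (simp add: RLin_def)
  have ext: "fo F \<in> extensional (Ob D)" "fm F \<in> extensional (Arr D)" "rs F \<in> extensional (Ob D \<times> Ob P)"
    using L by (simp_all add: RLin_def ext_functor_def)
  have hom: "rs F (d, p) \<in> hom E (p \<bullet>\<^sup>E fo F d) (fo F (p \<bullet>\<^sup>D d))" "iso_arr E (rs F (d, p))"
    if "d \<in> Ob D" "p \<in> Ob P" for d p
    using F.lin_hom[of p d] F.lin_iso[of p d] that by simp_all
  have nat: "rs F (Cod D g, Cod P f) \<cdot>\<^sub>E (f \<odot>\<^sup>E fm F g) =
       fm F (f \<odot>\<^sup>D g) \<cdot>\<^sub>E rs F (Dom D g, Dom P f)" if "f \<in> Arr P" "g \<in> Arr D" for f g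
    using F.lin_nat[of f "Dom P f" "Cod P f" g "Dom D g" "Cod D g"] that by (simp add: hom_iff)
  have mu: "fm F (mu (Ract D) p q d) \<cdot>\<^sub>E rs F (q \<bullet>\<^sup>D d, p) \<cdot>\<^sub>E (Id P p \<odot>\<^sup>E rs F (d, q)) =
       rs F (d, q \<otimes>\<^bsub>P\<^esub> p) \<cdot>\<^sub>E mu (Ract E) p q (fo F d)" if "p \<in> Ob P" "q \<in> Ob P" "d \<in> Ob D" for p q d
    using F.lin_mu[of p q d] that by simp
  have eta: "rs F (d, j\<^bsub>P\<^esub>) \<cdot>\<^sub>E eta (Ract E) (fo F d) = fm F (eta (Ract D) d)" if "d \<in> Ob D" for d
    using F.lin_eta[of d] that by simp
  show ?R
    using ext hom nat mu eta F.F.cat_functor_axioms by (simp add: hom_iff)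
next
  assume R: ?R
  then have "left_linear_axioms (mrev P) D (Ract D) E (Ract E) F (\<lambda>(p, d). rs F (d, p))"
    by unfold_locales (auto simp: hom_iff E.L.C.iso_arr_arr)
  with R show ?L
    using D.R.left_actegory_axioms E.R.left_actegory_axioms
    by (simp add: RLin_def ext_functor_def left_linear_def)
qed

lemma RL_functor: "F \<in> Ob RL \<Longrightarrow> cat_functor D E F"
  by (simp add: Ob_RL)

lemma RL_functor_simps [simp]:
  assumes "F \<in> Ob RL"
  shows "d \<in> Ob D \<Longrightarrow> fo F d \<in> Ob E"
    "f \<in> Arr D \<Longrightarrow> fm F f \<in> Arr E" "f \<in> Arr D \<Longrightarrow> Dom E (fm F f) = fo F (Dom D f)"
    "f \<in> Arr D \<Longrightarrow> Cod E (fm F f) = fo F (Cod D f)"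
    "d \<in> Ob D \<Longrightarrow> fm F (Id D d) = Id E (fo F d)"
    "f \<in> Arr D \<Longrightarrow> g \<in> Arr D \<Longrightarrow> Cod D f = Dom D g \<Longrightarrow> fm F (g \<cdot>\<^sub>D f) = fm F g \<cdot>\<^sub>E fm F f"
    "iso_arr D f \<Longrightarrow> iso_arr E (fm F f)" "iso_arr D f \<Longrightarrow> inv_arr E (fm F f) = fm F (inv_arr D f)"
proof -
  interpret cat_functor D E F by (rule RL_functor[OF assms])
  show "d \<in> Ob D \<Longrightarrow> fo F d \<in> Ob E"
    "f \<in> Arr D \<Longrightarrow> fm F f \<in> Arr E" "f \<in> Arr D \<Longrightarrow> Dom E (fm F f) = fo F (Dom D f)"
    "f \<in> Arr D \<Longrightarrow> Cod E (fm F f) = fo F (Cod D f)"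
    "d \<in> Ob D \<Longrightarrow> fm F (Id D d) = Id E (fo F d)"
    "f \<in> Arr D \<Longrightarrow> g \<in> Arr D \<Longrightarrow> Cod D f = Dom D g \<Longrightarrow> fm F (g \<cdot>\<^sub>D f) = fm F g \<cdot>\<^sub>E fm F f"
    "iso_arr D f \<Longrightarrow> iso_arr E (fm F f)" "iso_arr D f \<Longrightarrow> inv_arr E (fm F f) = fm F (inv_arr D f)"
    by simp_all
qed

lemma rs_arr [simp]:
  assumes "F \<in> Ob RL" "d \<in> Ob D" "p \<in> Ob P"
  shows "iso_arr E (rs F (d, p))" "rs F (d, p) \<in> Arr E" "Dom E (rs F (d, p)) = p \<bullet>\<^sup>E fo F d"
    "Cod E (rs F (d, p)) = fo F (p \<bullet>\<^sup>D d)"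
  using assms E.L.C.iso_arr_arr unfolding Ob_RL by blast+

lemma rs_natural:
  assumes "F \<in> Ob RL" "f \<in> Arr P" "g \<in> Arr D" "d = Cod D g" "p = Cod P f"
  shows "rs F (d, p) \<cdot>\<^sub>E (f \<odot>\<^sup>E fm F g) = fm F (f \<odot>\<^sup>D g) \<cdot>\<^sub>E rs F (Dom D g, Dom P f)"
  using assms unfolding Ob_RL by blast

lemma rs_mu:
  assumes "F \<in> Ob RL" "p \<in> Ob P" "q \<in> Ob P" "d \<in> Ob D"
  shows "fm F (mu (Ract D) p q d) \<cdot>\<^sub>E rs F (q \<bullet>\<^sup>D d, p) \<cdot>\<^sub>E (Id P p \<odot>\<^sup>E rs F (d, q)) =
       rs F (d, q \<otimes>\<^bsub>P\<^esub> p) \<cdot>\<^sub>E mu (Ract E) p q (fo F d)"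
  using assms unfolding Ob_RL by blast

lemma rs_eta: "F \<in> Ob RL \<Longrightarrow> d \<in> Ob D \<Longrightarrow>
    rs F (d, j\<^bsub>P\<^esub>) \<cdot>\<^sub>E eta (Ract E) (fo F d) = fm F (eta (Ract D) d)"
  unfolding Ob_RL by blast

lemma Ob_RL_I:
  assumes "cat_functor D E F" "fo F \<in> extensional (Ob D)" "fm F \<in> extensional (Arr D)"
    "rs F \<in> extensional (Ob D \<times> Ob P)"
    "\<And>d p. d\<in>Ob D \<Longrightarrow> p\<in>Ob P \<Longrightarrow> iso_arr E (rs F (d, p)) \<and> Dom E (rs F (d, p)) = p \<bullet>\<^sup>E fo F d \<and>
       Cod E (rs F (d, p)) = fo F (p \<bullet>\<^sup>D d)"
    "\<And>f g. f\<in>Arr P \<Longrightarrow> g\<in>Arr D \<Longrightarrow> rs F (Cod D g, Cod P f) \<cdot>\<^sub>E (f \<odot>\<^sup>E fm F g) =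
       fm F (f \<odot>\<^sup>D g) \<cdot>\<^sub>E rs F (Dom D g, Dom P f)"
    "\<And>p q d. p\<in>Ob P \<Longrightarrow> q\<in>Ob P \<Longrightarrow> d\<in>Ob D \<Longrightarrow>
       fm F (mu (Ract D) p q d) \<cdot>\<^sub>E rs F (q \<bullet>\<^sup>D d, p) \<cdot>\<^sub>E (Id P p \<odot>\<^sup>E rs F (d, q)) =
       rs F (d, q \<otimes>\<^bsub>P\<^esub> p) \<cdot>\<^sub>E mu (Ract E) p q (fo F d)"
    "\<And>d. d\<in>Ob D \<Longrightarrow> rs F (d, j\<^bsub>P\<^esub>) \<cdot>\<^sub>E eta (Ract E) (fo F d) = fm F (eta (Ract D) d)"
  shows "F \<in> Ob RL"
  unfolding Ob_RL using assms by blast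

lemma Arr_RL: "\<xi> \<in> Arr RL \<longleftrightarrow> Src \<xi> \<in> Ob RL \<and> Tgt \<xi> \<in> Ob RL \<and> Cmp \<xi> \<in> extensional (Ob D) \<and>
    (\<forall>d\<in>Ob D. Cmp \<xi> d \<in> Arr E \<and> Dom E (Cmp \<xi> d) = fo (Src \<xi>) d \<and> Cod E (Cmp \<xi> d) = fo (Tgt \<xi>) d) \<and>
    (\<forall>f\<in>Arr D. Cmp \<xi> (Cod D f) \<cdot>\<^sub>E fm (Src \<xi>) f = fm (Tgt \<xi>) f \<cdot>\<^sub>E Cmp \<xi> (Dom D f)) \<and>
    (\<forall>d\<in>Ob D. \<forall>p\<in>Ob P. Cmp \<xi> (p \<bullet>\<^sup>D d) \<cdot>\<^sub>E rs (Src \<xi>) (d, p) =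
       rs (Tgt \<xi>) (d, p) \<cdot>\<^sub>E (Id P p \<odot>\<^sup>E Cmp \<xi> d))"
  unfolding RLin_def Arr_fun_cat nat_trans_iff left_linear_trans_def fun_cat_simps mrev_simps prod.case
  by blast

lemma Arr_RL_I:
  assumes "Src \<xi> \<in> Ob RL" "Tgt \<xi> \<in> Ob RL" "Cmp \<xi> \<in> extensional (Ob D)"
    "\<And>d. d\<in>Ob D \<Longrightarrow> Cmp \<xi> d \<in> Arr E \<and> Dom E (Cmp \<xi> d) = fo (Src \<xi>) d \<and> Cod E (Cmp \<xi> d) = fo (Tgt \<xi>) d"
    "\<And>f. f\<in>Arr D \<Longrightarrow> Cmp \<xi> (Cod D f) \<cdot>\<^sub>E fm (Src \<xi>) f = fm (Tgt \<xi>) f \<cdot>\<^sub>E Cmp \<xi> (Dom D f)"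
    "\<And>d p. d\<in>Ob D \<Longrightarrow> p\<in>Ob P \<Longrightarrow> Cmp \<xi> (p \<bullet>\<^sup>D d) \<cdot>\<^sub>E rs (Src \<xi>) (d, p) =
       rs (Tgt \<xi>) (d, p) \<cdot>\<^sub>E (Id P p \<odot>\<^sup>E Cmp \<xi> d)"
  shows "\<xi> \<in> Arr RL"
  unfolding Arr_RL using assms by blast

lemma RL_Cmp [simp]:
  assumes "\<xi> \<in> Arr RL"
  shows "Src \<xi> \<in> Ob RL" "Tgt \<xi> \<in> Ob RL" "Cmp \<xi> \<in> extensional (Ob D)"
    "d \<in> Ob D \<Longrightarrow> Cmp \<xi> d \<in> Arr E" "d \<in> Ob D \<Longrightarrow> Dom E (Cmp \<xi> d) = fo (Src \<xi>) d"
    "d \<in> Ob D \<Longrightarrow> Cod E (Cmp \<xi> d) = fo (Tgt \<xi>) d"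
  using assms unfolding Arr_RL by blast+

lemma RL_Cmp_natural: "\<xi> \<in> Arr RL \<Longrightarrow> f \<in> Arr D \<Longrightarrow> d = Cod D f \<Longrightarrow>
    Cmp \<xi> d \<cdot>\<^sub>E fm (Src \<xi>) f = fm (Tgt \<xi>) f \<cdot>\<^sub>E Cmp \<xi> (Dom D f)"
  unfolding Arr_RL by blast

lemma RL_Cmp_linear: "\<xi> \<in> Arr RL \<Longrightarrow> d \<in> Ob D \<Longrightarrow> p \<in> Ob P \<Longrightarrow>
    Cmp \<xi> (p \<bullet>\<^sup>D d) \<cdot>\<^sub>E rs (Src \<xi>) (d, p) = rs (Tgt \<xi>) (d, p) \<cdot>\<^sub>E (Id P p \<odot>\<^sup>E Cmp \<xi> d)"
  unfolding Arr_RL by blast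

text \<open>Linearity squares can be pasted, and inverted by \<open>inv_square\<close>. The latter
  gives \<open>Q_inv\<close>, so that units and multiplicators on \<open>RL\<close> only have to be
  invertible pointwise.\<close>

lemma functor_category_RL:
  "functor_category D E (Ob RL) (\<lambda>F G \<xi>. right_linear_trans P D (Ract D) E (Ract E) (rs F) (rs G) \<xi>)"
proof (intro functor_category.intro functor_category_axioms.intro)
  show "category D" "category E" by unfold_locales
  show "cat_functor D E F" if "F \<in> Ob RL" for F using that by (rule RL_functor)
  show "right_linear_trans P D (Ract D) E (Ract E) (rs F) (rs F) (\<lambda>x\<in>Ob D. Id E (fo F x))"
    if "F \<in> Ob RL" for F
    using that by (simp add: left_linear_trans_def)
next
  fix F G H \<sigma> \<tau>
  assume FGH: "F \<in> Ob RL" "G \<in> Ob RL" "H \<in> Ob RL"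
    and \<sigma>: "nat_trans D E F G \<sigma>" "right_linear_trans P D (Ract D) E (Ract E) (rs F) (rs G) \<sigma>"
    and \<tau>: "nat_trans D E G H \<tau>" "right_linear_trans P D (Ract D) E (Ract E) (rs G) (rs H) \<tau>"
  then have [simp]: "\<And>d. d \<in> Ob D \<Longrightarrow> \<sigma> d \<in> Arr E" "\<And>d. d \<in> Ob D \<Longrightarrow> Dom E (\<sigma> d) = fo F d"
    "\<And>d. d \<in> Ob D \<Longrightarrow> Cod E (\<sigma> d) = fo G d" "\<And>d. d \<in> Ob D \<Longrightarrow> \<tau> d \<in> Arr E"
    "\<And>d. d \<in> Ob D \<Longrightarrow> Dom E (\<tau> d) = fo G d" "\<And>d. d \<in> Ob D \<Longrightarrow> Cod E (\<tau> d) = fo H d"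
    by (simp_all add: nat_trans_iff)
  have "\<And>d p. d \<in> Ob D \<Longrightarrow> p \<in> Ob P \<Longrightarrow> \<sigma> (p \<bullet>\<^sup>D d) \<cdot>\<^sub>E rs F (d, p) = rs G (d, p) \<cdot>\<^sub>E (Id P p \<odot>\<^sup>E \<sigma> d)"
    and \<tau>': "\<And>d p. d \<in> Ob D \<Longrightarrow> p \<in> Ob P \<Longrightarrow> \<tau> (p \<bullet>\<^sup>D d) \<cdot>\<^sub>E rs G (d, p) = rs H (d, p) \<cdot>\<^sub>E (Id P p \<odot>\<^sup>E \<tau> d)"
    using \<sigma>(2) \<tau>(2) by (simp_all add: left_linear_trans_def)
  then show "right_linear_trans P D (Ract D) E (Ract E) (rs F) (rs H) (\<lambda>x\<in>Ob D. \<tau> x \<cdot>\<^sub>E \<sigma> x)"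
    using FGH by (simp add: left_linear_trans_def E.L.C.pre[OF \<tau>'])
next
  fix F G \<sigma>
  assume FG: "F \<in> Ob RL" "G \<in> Ob RL"
    and \<sigma>: "nat_trans D E F G \<sigma>" "right_linear_trans P D (Ract D) E (Ract E) (rs F) (rs G) \<sigma>"
    and [simp]: "\<And>x. x \<in> Ob D \<Longrightarrow> iso_arr E (\<sigma> x)"
  then have [simp]: "\<And>d. d \<in> Ob D \<Longrightarrow> \<sigma> d \<in> Arr E" "\<And>d. d \<in> Ob D \<Longrightarrow> Dom E (\<sigma> d) = fo F d"
    "\<And>d. d \<in> Ob D \<Longrightarrow> Cod E (\<sigma> d) = fo G d"
    by (simp_all add: nat_trans_iff)
  have "inv_arr E (\<sigma> (p \<bullet>\<^sup>D d)) \<cdot>\<^sub>E rs G (d, p) = rs F (d, p) \<cdot>\<^sub>E inv_arr E (Id P p \<odot>\<^sup>E \<sigma> d)"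
    if "d \<in> Ob D" "p \<in> Ob P" for d p
    using FG that \<sigma>(2) by (intro E.L.C.inv_square) (simp_all add: left_linear_trans_def)
  then show "right_linear_trans P D (Ract D) E (Ract E) (rs G) (rs F) (\<lambda>x\<in>Ob D. inv_arr E (\<sigma> x))"
    by (simp add: left_linear_trans_def)
qed

sublocale RL: functor_category D E "Ob RL" "\<lambda>F G \<xi>. right_linear_trans P D (Ract D) E (Ract E) (rs F) (rs G) \<xi>"
  by (rule functor_category_RL)

lemma RL_eq: "fun_cat D E (Ob RL) (\<lambda>F G \<xi>. right_linear_trans P D (Ract D) E (Ract E) (rs F) (rs G) \<xi>) = RL"
  by (simp add: RLin_def)

sublocale RC: category RL
  using RL.category_fun_cat by (simp add: RL_eq)

lemmas iso_RL = RL.iso_arr_fun_cat[unfolded RL_eq]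

lemma RL_eqI:
  assumes "\<xi> \<in> Arr RL" "\<xi>' \<in> Arr RL" "Src \<xi> = Src \<xi>'" "Tgt \<xi> = Tgt \<xi>'" "\<And>d. d \<in> Ob D \<Longrightarrow> Cmp \<xi> d = Cmp \<xi>' d"
  shows "\<xi> = \<xi>'"
  using assms by (intro trans_eqI[where X="Ob D"]) simp_all

subsection \<open>The two actions on functors\<close>

lemma lhom_simps [simp]:
  "d \<in> Ob D \<Longrightarrow> fo (lhom N P D E n F) d = n \<bullet>\<^sub>E fo F d"
  "f \<in> Arr D \<Longrightarrow> fm (lhom N P D E n F) f = Id N n \<odot>\<^sub>E fm F f"
  "d \<in> Ob D \<Longrightarrow> p \<in> Ob P \<Longrightarrow> rs (lhom N P D E n F) (d, p) =
     (Id N n \<odot>\<^sub>E rs F (d, p)) \<cdot>\<^sub>E inv_arr E (zeta E n (fo F d) p)"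
  by (simp_all add: lhom_def)

lemma rhom_simps [simp]:
  "d \<in> Ob D \<Longrightarrow> fo (rhom M P D E F m) d = fo F (m \<bullet>\<^sub>D d)"
  "f \<in> Arr D \<Longrightarrow> fm (rhom M P D E F m) f = fm F (Id M m \<odot>\<^sub>D f)"
  "d \<in> Ob D \<Longrightarrow> p \<in> Ob P \<Longrightarrow> rs (rhom M P D E F m) (d, p) =
     fm F (inv_arr D (zeta D m d p)) \<cdot>\<^sub>E rs F (m \<bullet>\<^sub>D d, p)"
  by (simp_all add: rhom_def)

text \<open>Each axiom splits in the same way: the inverse bimodulator of \<open>E\<close> is moved
  by one of its own laws, and what remains is the corresponding axiom of \<open>F\<close> under
  \<open>n \<bullet> -\<close>.\<close>

lemma lhom_in [simp]:
  assumes n: "n \<in> Ob N" and F: "F \<in> Ob RL"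
  shows "lhom N P D E n F \<in> Ob RL"
proof (rule Ob_RL_I)
  show "cat_functor D E (lhom N P D E n F)"
    using assms by (intro cat_functorI) (simp_all add: D.L.C.category_axioms E.L.C.category_axioms)
  show "fo (lhom N P D E n F) \<in> extensional (Ob D)" "fm (lhom N P D E n F) \<in> extensional (Arr D)"
    "rs (lhom N P D E n F) \<in> extensional (Ob D \<times> Ob P)"
    by (simp_all add: lhom_def)
next
  fix d p assume "d \<in> Ob D" "p \<in> Ob P"
  then show "iso_arr E (rs (lhom N P D E n F) (d, p)) \<and>
       Dom E (rs (lhom N P D E n F) (d, p)) = p \<bullet>\<^sup>E fo (lhom N P D E n F) d \<and>
       Cod E (rs (lhom N P D E n F) (d, p)) = fo (lhom N P D E n F) (p \<bullet>\<^sup>D d)"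
    using assms by (simp add: E.L.C.iso_comp)
next
  fix f g assume fg: "f \<in> Arr P" "g \<in> Arr D"
  have "rs (lhom N P D E n F) (Cod D g, Cod P f) \<cdot>\<^sub>E (f \<odot>\<^sup>E fm (lhom N P D E n F) g)
    = (Id N n \<odot>\<^sub>E rs F (Cod D g, Cod P f)) \<cdot>\<^sub>E (Id N n \<odot>\<^sub>E f \<odot>\<^sup>E fm F g) \<cdot>\<^sub>E
      inv_arr E (zeta E n (fo F (Dom D g)) (Dom P f))"
    using fg assms by (simp add: E.zeta_inv_natural)
  also have "\<dots> = (Id N n \<odot>\<^sub>E fm F (f \<odot>\<^sup>D g)) \<cdot>\<^sub>E (Id N n \<odot>\<^sub>E rs F (Dom D g, Dom P f)) \<cdot>\<^sub>E
      inv_arr E (zeta E n (fo F (Dom D g)) (Dom P f))"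
    using fg assms by (simp add: E.L.C.pre[OF E.L.act_eq[OF rs_natural]])
  finally show "rs (lhom N P D E n F) (Cod D g, Cod P f) \<cdot>\<^sub>E (f \<odot>\<^sup>E fm (lhom N P D E n F) g) =
       fm (lhom N P D E n F) (f \<odot>\<^sup>D g) \<cdot>\<^sub>E rs (lhom N P D E n F) (Dom D g, Dom P f)"
    using fg assms by simp
next
  fix p q d assume pqd: "p \<in> Ob P" "q \<in> Ob P" "d \<in> Ob D"
  let ?z = "\<lambda>c p. inv_arr E (zeta E n c p)" and ?n = "\<lambda>f. Id N n \<odot>\<^sub>E f"
  \<comment> \<open>Naturality of the bimodulator collects both inverses on the right, where
    \<open>zeta_inv_right\<close> will fuse them into the one at the product of \<open>q\<close> and
    \<open>p\<close>.\<close>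
  have "fm (lhom N P D E n F) (mu (Ract D) p q d) \<cdot>\<^sub>E rs (lhom N P D E n F) (q \<bullet>\<^sup>D d, p)
      \<cdot>\<^sub>E (Id P p \<odot>\<^sup>E rs (lhom N P D E n F) (d, q))
    = ?n (fm F (mu (Ract D) p q d)) \<cdot>\<^sub>E ?n (rs F (q \<bullet>\<^sup>D d, p))
       \<cdot>\<^sub>E ?n (Id P p \<odot>\<^sup>E rs F (d, q)) \<cdot>\<^sub>E ?z (q \<bullet>\<^sup>E fo F d) p \<cdot>\<^sub>E (Id P p \<odot>\<^sup>E ?z (fo F d) q)"
    using pqd assms by (simp add: E.L.C.pre[OF E.zeta_inv_natural])
  also have "\<dots> = ?n (rs F (d, q \<otimes>\<^bsub>P\<^esub> p) \<cdot>\<^sub>E mu (Ract E) p q (fo F d)) \<cdot>\<^sub>E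
      ?z (q \<bullet>\<^sup>E fo F d) p \<cdot>\<^sub>E (Id P p \<odot>\<^sup>E ?z (fo F d) q)"
    using pqd assms by (simp flip: rs_mu)
  also have "\<dots> = ?n (rs F (d, q \<otimes>\<^bsub>P\<^esub> p)) \<cdot>\<^sub>E ?z (fo F d) (q \<otimes>\<^bsub>P\<^esub> p) \<cdot>\<^sub>E mu (Ract E) p q (n \<bullet>\<^sub>E fo F d)"
    using pqd assms by (simp add: E.zeta_inv_right)
  finally show "fm (lhom N P D E n F) (mu (Ract D) p q d) \<cdot>\<^sub>E rs (lhom N P D E n F) (q \<bullet>\<^sup>D d, p)
      \<cdot>\<^sub>E (Id P p \<odot>\<^sup>E rs (lhom N P D E n F) (d, q)) =
    rs (lhom N P D E n F) (d, q \<otimes>\<^bsub>P\<^esub> p) \<cdot>\<^sub>E mu (Ract E) p q (fo (lhom N P D E n F) d)"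
    using pqd assms by simp
next
  fix d assume "d \<in> Ob D"
  then show "rs (lhom N P D E n F) (d, j\<^bsub>P\<^esub>) \<cdot>\<^sub>E eta (Ract E) (fo (lhom N P D E n F) d) =
      fm (lhom N P D E n F) (eta (Ract D) d)"
    using assms by (simp add: E.zeta_inv_unit_right flip: rs_eta)
qed

text \<open>Dual to \<open>lhom_in\<close>: the inverse bimodulator is now that of \<open>D\<close>
  and sits inside \<open>F\<close>, so its laws are applied under \<open>fm F\<close> and combined
  with the axioms of \<open>F\<close> at \<open>m \<bullet> d\<close>.\<close>

lemma rhom_in [simp]:
  assumes m: "m \<in> Ob M" and F: "F \<in> Ob RL"
  shows "rhom M P D E F m \<in> Ob RL"
proof (rule Ob_RL_I)
  show "cat_functor D E (rhom M P D E F m)"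
    using assms by (intro cat_functorI) (simp_all add: D.L.C.category_axioms E.L.C.category_axioms)
  show "fo (rhom M P D E F m) \<in> extensional (Ob D)" "fm (rhom M P D E F m) \<in> extensional (Arr D)"
    "rs (rhom M P D E F m) \<in> extensional (Ob D \<times> Ob P)"
    by (simp_all add: rhom_def)
next
  fix d p assume "d \<in> Ob D" "p \<in> Ob P"
  then show "iso_arr E (rs (rhom M P D E F m) (d, p)) \<and>
       Dom E (rs (rhom M P D E F m) (d, p)) = p \<bullet>\<^sup>E fo (rhom M P D E F m) d \<and>
       Cod E (rs (rhom M P D E F m) (d, p)) = fo (rhom M P D E F m) (p \<bullet>\<^sup>D d)"
    using assms by (simp add: E.L.C.iso_comp)
next
  fix f g assume fg: "f \<in> Arr P" "g \<in> Arr D"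
  have "rs (rhom M P D E F m) (Cod D g, Cod P f) \<cdot>\<^sub>E (f \<odot>\<^sup>E fm (rhom M P D E F m) g)
    = fm F (inv_arr D (zeta D m (Cod D g) (Cod P f)) \<cdot>\<^sub>D (f \<odot>\<^sup>D Id M m \<odot>\<^sub>D g)) \<cdot>\<^sub>E
       rs F (m \<bullet>\<^sub>D Dom D g, Dom P f)"
    using fg assms by (simp add: rs_natural)
  also have "\<dots> = fm F ((Id M m \<odot>\<^sub>D f \<odot>\<^sup>D g) \<cdot>\<^sub>D inv_arr D (zeta D m (Dom D g) (Dom P f))) \<cdot>\<^sub>E
       rs F (m \<bullet>\<^sub>D Dom D g, Dom P f)"
    using fg assms by (subst D.zeta_inv_natural) simp_all
  finally show "rs (rhom M P D E F m) (Cod D g, Cod P f) \<cdot>\<^sub>E (f \<odot>\<^sup>E fm (rhom M P D E F m) g) =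
       fm (rhom M P D E F m) (f \<odot>\<^sup>D g) \<cdot>\<^sub>E rs (rhom M P D E F m) (Dom D g, Dom P f)"
    using fg assms by simp
next
  fix p q d assume pqd: "p \<in> Ob P" "q \<in> Ob P" "d \<in> Ob D"
  let ?z = "\<lambda>c p. inv_arr D (zeta D m c p)" and ?n = "\<lambda>f. Id N n \<odot>\<^sub>E f"
  \<comment> \<open>Naturality of \<open>rs F\<close> gathers both inverse bimodulators under one
    application of \<open>F\<close>, where \<open>zeta_inv_right\<close> of \<open>D\<close>
    applies.\<close>
  have "fm (rhom M P D E F m) (mu (Ract D) p q d) \<cdot>\<^sub>E rs (rhom M P D E F m) (q \<bullet>\<^sup>D d, p)
      \<cdot>\<^sub>E (Id P p \<odot>\<^sup>E rs (rhom M P D E F m) (d, q))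
    = fm F ((Id M m \<odot>\<^sub>D mu (Ract D) p q d) \<cdot>\<^sub>D ?z (q \<bullet>\<^sup>D d) p \<cdot>\<^sub>D (Id P p \<odot>\<^sup>D ?z d q)) \<cdot>\<^sub>E
       rs F (q \<bullet>\<^sup>D m \<bullet>\<^sub>D d, p) \<cdot>\<^sub>E (Id P p \<odot>\<^sup>E rs F (m \<bullet>\<^sub>D d, q))"
    using pqd assms by (simp add: E.L.C.pre[OF rs_natural])
  also have "\<dots> = fm F (?z d (q \<otimes>\<^bsub>P\<^esub> p)) \<cdot>\<^sub>E fm F (mu (Ract D) p q (m \<bullet>\<^sub>D d)) \<cdot>\<^sub>E
       rs F (q \<bullet>\<^sup>D m \<bullet>\<^sub>D d, p) \<cdot>\<^sub>E (Id P p \<odot>\<^sup>E rs F (m \<bullet>\<^sub>D d, q))"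
    using pqd assms by (simp flip: D.zeta_inv_right)
  also have "\<dots> = fm F (?z d (q \<otimes>\<^bsub>P\<^esub> p)) \<cdot>\<^sub>E rs F (m \<bullet>\<^sub>D d, q \<otimes>\<^bsub>P\<^esub> p) \<cdot>\<^sub>E mu (Ract E) p q (fo F (m \<bullet>\<^sub>D d))"
    using pqd assms by (simp add: rs_mu)
  finally show "fm (rhom M P D E F m) (mu (Ract D) p q d) \<cdot>\<^sub>E rs (rhom M P D E F m) (q \<bullet>\<^sup>D d, p)
      \<cdot>\<^sub>E (Id P p \<odot>\<^sup>E rs (rhom M P D E F m) (d, q)) =
    rs (rhom M P D E F m) (d, q \<otimes>\<^bsub>P\<^esub> p) \<cdot>\<^sub>E mu (Ract E) p q (fo (rhom M P D E F m) d)"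
    using pqd assms by simp
next
  fix d assume "d \<in> Ob D"
  then show "rs (rhom M P D E F m) (d, j\<^bsub>P\<^esub>) \<cdot>\<^sub>E eta (Ract E) (fo (rhom M P D E F m) d) =
      fm (rhom M P D E F m) (eta (Ract D) d)"
    using assms by (simp add: rs_eta flip: D.zeta_inv_unit_right)
qed

end

lemma extend_simps [simp]:
  "Ob (cat.extend T x) = Ob T" "Arr (cat.extend T x) = Arr T" "Dom (cat.extend T x) = Dom T"
  "Cod (cat.extend T x) = Cod T" "Id (cat.extend T x) = Id T" "Comp (cat.extend T x) = Comp T"
  by (simp_all add: cat.extend_def)

text \<open>All these notions read only the six category fields, so adding actions to a record
  changes none of them.\<close>

lemma extend_iff [simp]:
  "hom (cat.extend T x) = hom T" "category (cat.extend T x) = category T"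
  "inv_arr (cat.extend T x) = inv_arr T" "iso_arr (cat.extend T x) = iso_arr T"
  "prod_cat A (cat.extend T x) = prod_cat A T"
  by (simp_all add: fun_eq_iff hom_def category_def inv_arr_def iso_arr_def inverse_arrows_def prod_cat_def)

lemma left_actegory_extend [simp]: "left_actegory M (cat.extend T x) A = left_actegory M T A"
  by (simp add: left_actegory_def left_actegory_axioms_def cat_functor_def cat_functor_axioms_def)

lemma biactegoryI:
  assumes "left_actegory M C (Lact C)" "left_actegory (mrev N) C (Ract C)" "monoidal_category N"
    and "\<And>m c n. m \<in> Ob M \<Longrightarrow> c \<in> Ob C \<Longrightarrow> n \<in> Ob N \<Longrightarrow>
      zeta C m c n \<in> Arr C \<and> Dom C (zeta C m c n) = m \<bullet>\<^bsub>Lact C\<^esub> n \<bullet>\<^bsub>Ract C\<^esub> c \<and>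
      Cod C (zeta C m c n) = n \<bullet>\<^bsub>Ract C\<^esub> m \<bullet>\<^bsub>Lact C\<^esub> c"
    and "\<And>m c n. m \<in> Ob M \<Longrightarrow> c \<in> Ob C \<Longrightarrow> n \<in> Ob N \<Longrightarrow> iso_arr C (zeta C m c n)"
    and "\<And>f g h. f \<in> Arr M \<Longrightarrow> g \<in> Arr C \<Longrightarrow> h \<in> Arr N \<Longrightarrow>
      zeta C (Cod M f) (Cod C g) (Cod N h) \<cdot>\<^bsub>C\<^esub> (f \<odot>\<^bsub>Lact C\<^esub> h \<odot>\<^bsub>Ract C\<^esub> g) =
      (h \<odot>\<^bsub>Ract C\<^esub> f \<odot>\<^bsub>Lact C\<^esub> g) \<cdot>\<^bsub>C\<^esub> zeta C (Dom M f) (Dom C g) (Dom N h)"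
    and "\<And>m m' c n. m \<in> Ob M \<Longrightarrow> m' \<in> Ob M \<Longrightarrow> c \<in> Ob C \<Longrightarrow> n \<in> Ob N \<Longrightarrow>
      (Id N n \<odot>\<^bsub>Ract C\<^esub> mu (Lact C) m m' c) \<cdot>\<^bsub>C\<^esub> zeta C m (m' \<bullet>\<^bsub>Lact C\<^esub> c) n
        \<cdot>\<^bsub>C\<^esub> (Id M m \<odot>\<^bsub>Lact C\<^esub> zeta C m' c n) =
      zeta C (m \<otimes>\<^bsub>M\<^esub> m') c n \<cdot>\<^bsub>C\<^esub> mu (Lact C) m m' (n \<bullet>\<^bsub>Ract C\<^esub> c)"
    and "\<And>m c n n'. m \<in> Ob M \<Longrightarrow> c \<in> Ob C \<Longrightarrow> n \<in> Ob N \<Longrightarrow> n' \<in> Ob N \<Longrightarrow>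
      zeta C m c (n \<otimes>\<^bsub>N\<^esub> n') \<cdot>\<^bsub>C\<^esub> (Id M m \<odot>\<^bsub>Lact C\<^esub> mu (Ract C) n' n c) =
      mu (Ract C) n' n (m \<bullet>\<^bsub>Lact C\<^esub> c) \<cdot>\<^bsub>C\<^esub> (Id N n' \<odot>\<^bsub>Ract C\<^esub> zeta C m c n)
        \<cdot>\<^bsub>C\<^esub> zeta C m (n \<bullet>\<^bsub>Ract C\<^esub> c) n'"
    and "\<And>c n. c \<in> Ob C \<Longrightarrow> n \<in> Ob N \<Longrightarrow>
      zeta C j\<^bsub>M\<^esub> c n \<cdot>\<^bsub>C\<^esub> eta (Lact C) (n \<bullet>\<^bsub>Ract C\<^esub> c) = Id N n \<odot>\<^bsub>Ract C\<^esub> eta (Lact C) c"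
    and "\<And>m c. m \<in> Ob M \<Longrightarrow> c \<in> Ob C \<Longrightarrow>
      zeta C m c j\<^bsub>N\<^esub> \<cdot>\<^bsub>C\<^esub> (Id M m \<odot>\<^bsub>Lact C\<^esub> eta (Ract C) c) = eta (Ract C) (m \<bullet>\<^bsub>Lact C\<^esub> c)"
  shows "biactegory M N C"
proof (intro biactegory.intro)
  show "biactegory_axioms M N C"
    using assms(4-) by unfold_locales (auto simp: hom_iff)
qed fact+

section \<open>The two actions on right linear functors and their identity bimodulator\<close>

context hom_data
begin

abbreviation "HB \<equiv> hom_biact N M P D E"
abbreviation "lH \<equiv> lhom N P D E"
abbreviation "rH \<equiv> rhom M P D E"

lemma HB_simps [simp]:
  "Ob HB = Ob RL" "Arr HB = Arr RL" "Dom HB = Src" "Cod HB = Tgt" "Id HB = Id RL" "Comp HB = Comp RL"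
  "iso_arr HB = iso_arr RL"
  by (simp_all add: hom_biact_def)

lemma HB_left [simp]:
  "act_o (Lact HB) = lH"
  "f \<odot>\<^bsub>Lact HB\<^esub> \<xi> = \<lparr>Src = lH (Dom N f) (Src \<xi>), Tgt = lH (Cod N f) (Tgt \<xi>), Cmp = \<lambda>d\<in>Ob D. f \<odot>\<^sub>E Cmp \<xi> d\<rparr>"
  "eta (Lact HB) F = \<lparr>Src = F, Tgt = lH j\<^bsub>N\<^esub> F, Cmp = \<lambda>d\<in>Ob D. eta (Lact E) (fo F d)\<rparr>"
  "mu (Lact HB) n n' F = \<lparr>Src = lH n (lH n' F), Tgt = lH (n \<otimes>\<^bsub>N\<^esub> n') F,
     Cmp = \<lambda>d\<in>Ob D. mu (Lact E) n n' (fo F d)\<rparr>"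
  by (simp_all add: hom_biact_def cat.extend_def)

lemma HB_right [simp]:
  "m \<bullet>\<^bsub>Ract HB\<^esub> F = rH F m"
  "f \<odot>\<^bsub>Ract HB\<^esub> \<xi> = \<lparr>Src = rH (Src \<xi>) (Dom M f), Tgt = rH (Tgt \<xi>) (Cod M f),
     Cmp = \<lambda>d\<in>Ob D. fm (Tgt \<xi>) (f \<odot>\<^sub>D Id D d) \<cdot>\<^sub>E Cmp \<xi> (Dom M f \<bullet>\<^sub>D d)\<rparr>"
  "eta (Ract HB) F = \<lparr>Src = F, Tgt = rH F j\<^bsub>M\<^esub>, Cmp = \<lambda>d\<in>Ob D. fm F (eta (Lact D) d)\<rparr>"
  "mu (Ract HB) m n F = \<lparr>Src = rH (rH F n) m, Tgt = rH F (n \<otimes>\<^bsub>M\<^esub> m), Cmp = \<lambda>d\<in>Ob D. fm F (mu (Lact D) n m d)\<rparr>"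
  by (simp_all add: hom_biact_def cat.extend_def)

lemma zeta_HB [simp]:
  "zeta HB n F m = \<lparr>Src = lH n (rH F m), Tgt = rH (lH n F) m,
     Cmp = \<lambda>d\<in>Ob D. Id E (n \<bullet>\<^sub>E fo F (m \<bullet>\<^sub>D d))\<rparr>"
  by (simp add: hom_biact_def cat.extend_def)

text \<open>For linearity, the inverse bimodulator is moved past \<open>f\<close> by naturality and
  everything is absorbed into a single action of \<open>f\<close>, inside which the linearity of
  \<xi> applies.\<close>

lemma left_act_arr:
  assumes f: "f \<in> Arr N" and \<xi>: "\<xi> \<in> Arr RL"
  shows "f \<odot>\<^bsub>Lact HB\<^esub> \<xi> \<in> Arr RL"
proof (rule Arr_RL_I)
  fix d p assume dp: "d \<in> Ob D" "p \<in> Ob P"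
  let ?z = "\<lambda>n F. inv_arr E (zeta E n (fo F d) p)"
  have "(Id N (Cod N f) \<odot>\<^sub>E rs (Tgt \<xi>) (d, p)) \<cdot>\<^sub>E ?z (Cod N f) (Tgt \<xi>) \<cdot>\<^sub>E (Id P p \<odot>\<^sup>E f \<odot>\<^sub>E Cmp \<xi> d)
    = (f \<odot>\<^sub>E (Cmp \<xi> (p \<bullet>\<^sup>D d) \<cdot>\<^sub>E rs (Src \<xi>) (d, p))) \<cdot>\<^sub>E ?z (Dom N f) (Src \<xi>)"
    using assms dp by (simp add: E.zeta_inv_natural E.L.C.pre[OF E.L.act_absorb(2)] RL_Cmp_linear del: E.L.act_comp_right)
  then show "Cmp (f \<odot>\<^bsub>Lact HB\<^esub> \<xi>) (p \<bullet>\<^sup>D d) \<cdot>\<^sub>E rs (Src (f \<odot>\<^bsub>Lact HB\<^esub> \<xi>)) (d, p) =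
       rs (Tgt (f \<odot>\<^bsub>Lact HB\<^esub> \<xi>)) (d, p) \<cdot>\<^sub>E (Id P p \<odot>\<^sup>E Cmp (f \<odot>\<^bsub>Lact HB\<^esub> \<xi>) d)"
    using assms dp by (simp add: E.L.C.pre[OF E.L.act_absorb(1)] del: E.L.act_comp_right)
qed (use assms in \<open>auto simp: E.L.act_absorb RL_Cmp_natural simp del: E.L.act_comp_right\<close>)

text \<open>Right linearity is the unit law of the bimodulator of \<open>E\<close> together with
  naturality of the unit; invertibility is pointwise by \<open>iso_RL\<close>.\<close>

lemma left_eta_arr:
  assumes "F \<in> Ob RL"
  shows "eta (Lact HB) F \<in> Arr RL" "iso_arr RL (eta (Lact HB) F)"
proof -
  show 1: "eta (Lact HB) F \<in> Arr RL"
  proof (rule Arr_RL_I)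
    fix d p assume dp: "d \<in> Ob D" "p \<in> Ob P"
    then show "Cmp (eta (Lact HB) F) (p \<bullet>\<^sup>D d) \<cdot>\<^sub>E rs (Src (eta (Lact HB) F)) (d, p) =
       rs (Tgt (eta (Lact HB) F)) (d, p) \<cdot>\<^sub>E (Id P p \<odot>\<^sup>E Cmp (eta (Lact HB) F) d)"
      using assms by (simp add: E.zeta_inv_unit_left E.L.eta_natural)
  qed (use assms in \<open>simp_all add: E.L.eta_natural\<close>)
  show "iso_arr RL (eta (Lact HB) F)"
    using assms by (intro iso_RL(1)[OF 1]) simp
qed

text \<open>Right linearity is \<open>zeta_inv_left\<close>, after which naturality of the
  multiplicator of \<open>E\<close> carries \<open>rs F\<close> across.\<close>

lemma left_mu_arr:
  assumes "n \<in> Ob N" "n' \<in> Ob N" "F \<in> Ob RL"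
  shows "mu (Lact HB) n n' F \<in> Arr RL" "iso_arr RL (mu (Lact HB) n n' F)"
proof -
  show 1: "mu (Lact HB) n n' F \<in> Arr RL"
  proof (rule Arr_RL_I)
    fix d p assume dp: "d \<in> Ob D" "p \<in> Ob P"
    let ?z = "\<lambda>n c. inv_arr E (zeta E n c p)"
    have "(Id N (n \<otimes>\<^bsub>N\<^esub> n') \<odot>\<^sub>E rs F (d, p)) \<cdot>\<^sub>E ?z (n \<otimes>\<^bsub>N\<^esub> n') (fo F d) \<cdot>\<^sub>E (Id P p \<odot>\<^sup>E mu (Lact E) n n' (fo F d))
      = mu (Lact E) n n' (fo F (p \<bullet>\<^sup>D d)) \<cdot>\<^sub>E (Id N n \<odot>\<^sub>E ((Id N n' \<odot>\<^sub>E rs F (d, p)) \<cdot>\<^sub>E ?z n' (fo F d)))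
         \<cdot>\<^sub>E ?z n (n' \<bullet>\<^sub>E fo F d)"
      using assms dp by (simp add: E.zeta_inv_left E.L.C.pre[OF E.L.mu_natural])
    then show "Cmp (mu (Lact HB) n n' F) (p \<bullet>\<^sup>D d) \<cdot>\<^sub>E rs (Src (mu (Lact HB) n n' F)) (d, p) =
       rs (Tgt (mu (Lact HB) n n' F)) (d, p) \<cdot>\<^sub>E (Id P p \<odot>\<^sup>E Cmp (mu (Lact HB) n n' F) d)"
      using assms dp by simp
  qed (use assms in \<open>simp_all add: E.L.mu_natural\<close>)
  show "iso_arr RL (mu (Lact HB) n n' F)"
    using assms by (intro iso_RL(1)[OF 1]) simp
qed

text \<open>Both sides of a law are families over \<open>d\<close>, and at \<open>d\<close> they are
  the law for \<open>Lact E\<close> at the object \<open>F(d)\<close>. Only membership in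
  \<open>RL\<close> called for separate arguments.\<close>

lemma left_actegory_hom: "left_actegory N RL (Lact HB)"
proof (rule left_actegoryI)
  show "monoidal_category N" "category RL" by unfold_locales
  fix f g assume "f \<in> Arr N" "g \<in> Arr RL"
  with left_act_arr[OF this] show "f \<odot>\<^bsub>Lact HB\<^esub> g \<in> Arr RL \<and> Dom RL (f \<odot>\<^bsub>Lact HB\<^esub> g) = Dom N f \<bullet>\<^bsub>Lact HB\<^esub> Dom RL g \<and>
      Cod RL (f \<odot>\<^bsub>Lact HB\<^esub> g) = Cod N f \<bullet>\<^bsub>Lact HB\<^esub> Cod RL g" by simp
next
  fix F assume "F \<in> Ob RL"
  with left_eta_arr[OF this] show "eta (Lact HB) F \<in> Arr RL \<and> Dom RL (eta (Lact HB) F) = F \<and>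
      Cod RL (eta (Lact HB) F) = j\<^bsub>N\<^esub> \<bullet>\<^bsub>Lact HB\<^esub> F" by simp
next
  fix n n' F assume "n \<in> Ob N" "n' \<in> Ob N" "F \<in> Ob RL"
  with left_mu_arr[OF this] show "mu (Lact HB) n n' F \<in> Arr RL \<and>
      Dom RL (mu (Lact HB) n n' F) = n \<bullet>\<^bsub>Lact HB\<^esub> n' \<bullet>\<^bsub>Lact HB\<^esub> F \<and>
      Cod RL (mu (Lact HB) n n' F) = (n \<otimes>\<^bsub>N\<^esub> n') \<bullet>\<^bsub>Lact HB\<^esub> F" by simp
qed (use left_eta_arr(2) left_mu_arr(2) in
  \<open>auto intro!: restrict_ext simp: E.L.act_comp E.L.eta_natural E.L.mu_natural E.L.act_assoc
     E.L.act_unit_left E.L.act_unit_right\<close>)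

text \<open>Unlike on the left, a component mixes \<open>D\<close> and \<open>E\<close>: it is \<xi>
  at a shifted object, followed by the target functor at a shift along \<open>f\<close>. Naturality
  rests on interchange in \<open>D\<close>, linearity on naturality of the bimodulator of
  \<open>D\<close> and linearity of \<xi>.\<close>

lemma right_act_arr:
  assumes f: "f \<in> Arr M" and \<xi>: "\<xi> \<in> Arr RL"
  shows "f \<odot>\<^bsub>Ract HB\<^esub> \<xi> \<in> Arr RL"
proof (rule Arr_RL_I)
  fix g assume g: "g \<in> Arr D"
  have "fm (Tgt \<xi>) (f \<odot>\<^sub>D Id D (Cod D g)) \<cdot>\<^sub>E Cmp \<xi> (Dom M f \<bullet>\<^sub>D Cod D g) \<cdot>\<^sub>E fm (Src \<xi>) (Id M (Dom M f) \<odot>\<^sub>D g)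
    = fm (Tgt \<xi>) ((f \<odot>\<^sub>D Id D (Cod D g)) \<cdot>\<^sub>D (Id M (Dom M f) \<odot>\<^sub>D g)) \<cdot>\<^sub>E Cmp \<xi> (Dom M f \<bullet>\<^sub>D Dom D g)"
    using assms g by (simp add: RL_Cmp_natural)
  \<comment> \<open>Both composites in \<open>D\<close> are the joint action of \<open>f\<close> and
    \<open>g\<close>, so they may be exchanged under the target functor.\<close>
  also have "\<dots> = fm (Tgt \<xi>) ((Id M (Cod M f) \<odot>\<^sub>D g) \<cdot>\<^sub>D (f \<odot>\<^sub>D Id D (Dom D g))) \<cdot>\<^sub>E Cmp \<xi> (Dom M f \<bullet>\<^sub>D Dom D g)"
    using assms g by (simp only: D.L.act_merge)
  finally show "Cmp (f \<odot>\<^bsub>Ract HB\<^esub> \<xi>) (Cod D g) \<cdot>\<^sub>E fm (Src (f \<odot>\<^bsub>Ract HB\<^esub> \<xi>)) g =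
       fm (Tgt (f \<odot>\<^bsub>Ract HB\<^esub> \<xi>)) g \<cdot>\<^sub>E Cmp (f \<odot>\<^bsub>Ract HB\<^esub> \<xi>) (Dom D g)"
    using assms g by simp
next
  fix d p assume dp: "d \<in> Ob D" "p \<in> Ob P"
  let ?z = "\<lambda>m. inv_arr D (zeta D m d p)" and ?m = "Dom M f" and ?m' = "Cod M f"
  have "fm (Tgt \<xi>) (?z ?m') \<cdot>\<^sub>E rs (Tgt \<xi>) (?m' \<bullet>\<^sub>D d, p)
      \<cdot>\<^sub>E (Id P p \<odot>\<^sup>E fm (Tgt \<xi>) (f \<odot>\<^sub>D Id D d)) \<cdot>\<^sub>E (Id P p \<odot>\<^sup>E Cmp \<xi> (?m \<bullet>\<^sub>D d))
    = fm (Tgt \<xi>) (?z ?m' \<cdot>\<^sub>D (Id P p \<odot>\<^sup>D f \<odot>\<^sub>D Id D d)) \<cdot>\<^sub>E rs (Tgt \<xi>) (?m \<bullet>\<^sub>D d, p)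
       \<cdot>\<^sub>E (Id P p \<odot>\<^sup>E Cmp \<xi> (?m \<bullet>\<^sub>D d))"
    using assms dp by (simp add: E.L.C.pre[OF rs_natural])
  also have "\<dots> = fm (Tgt \<xi>) ((f \<odot>\<^sub>D Id D (p \<bullet>\<^sup>D d)) \<cdot>\<^sub>D ?z ?m) \<cdot>\<^sub>E
       Cmp \<xi> (p \<bullet>\<^sup>D ?m \<bullet>\<^sub>D d) \<cdot>\<^sub>E rs (Src \<xi>) (?m \<bullet>\<^sub>D d, p)"
    using assms dp by (simp add: D.zeta_inv_natural RL_Cmp_linear)
  \<comment> \<open>Naturality of \<xi> at the inverse bimodulator replaces the target functor by
    the source functor there.\<close>
  also have "\<dots> = fm (Tgt \<xi>) (f \<odot>\<^sub>D Id D (p \<bullet>\<^sup>D d)) \<cdot>\<^sub>E Cmp \<xi> (?m \<bullet>\<^sub>D p \<bullet>\<^sup>D d) \<cdot>\<^sub>E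
       fm (Src \<xi>) (?z ?m) \<cdot>\<^sub>E rs (Src \<xi>) (?m \<bullet>\<^sub>D d, p)"
    using assms dp by (simp add: E.L.C.pre[OF RL_Cmp_natural])
  finally show "Cmp (f \<odot>\<^bsub>Ract HB\<^esub> \<xi>) (p \<bullet>\<^sup>D d) \<cdot>\<^sub>E rs (Src (f \<odot>\<^bsub>Ract HB\<^esub> \<xi>)) (d, p) =
       rs (Tgt (f \<odot>\<^bsub>Ract HB\<^esub> \<xi>)) (d, p) \<cdot>\<^sub>E (Id P p \<odot>\<^sup>E Cmp (f \<odot>\<^bsub>Ract HB\<^esub> \<xi>) d)"
    using assms dp by simp
qed (use assms in auto)

text \<open>The structure of the right action is \<open>F\<close> applied to structure of
  \<open>D\<close>: naturality is that of the unit of \<open>Lact D\<close> under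
  \<open>fm F\<close>, and linearity is \<open>zeta_inv_unit_left\<close> of
  \<open>D\<close>.\<close>

lemma right_eta_arr:
  assumes F: "F \<in> Ob RL"
  shows "eta (Ract HB) F \<in> Arr RL" "iso_arr RL (eta (Ract HB) F)"
proof -
  interpret F: cat_functor D E F by (rule RL_functor[OF F])
  show 1: "eta (Ract HB) F \<in> Arr RL"
  proof (rule Arr_RL_I)
    fix f assume f: "f \<in> Arr D"
    have "fm F (eta (Lact D) (Cod D f) \<cdot>\<^sub>D f) = fm F ((Id M j\<^bsub>M\<^esub> \<odot>\<^sub>D f) \<cdot>\<^sub>D eta (Lact D) (Dom D f))"
      using f by (simp only: D.L.eta_natural)
    then show "Cmp (eta (Ract HB) F) (Cod D f) \<cdot>\<^sub>E fm (Src (eta (Ract HB) F)) f =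
      fm (Tgt (eta (Ract HB) F)) f \<cdot>\<^sub>E Cmp (eta (Ract HB) F) (Dom D f)"
      using f assms by simp
  next
    fix d p assume dp: "d \<in> Ob D" "p \<in> Ob P"
    have "fm F (inv_arr D (zeta D j\<^bsub>M\<^esub> d p)) \<cdot>\<^sub>E rs F (j\<^bsub>M\<^esub> \<bullet>\<^sub>D d, p) \<cdot>\<^sub>E (Id P p \<odot>\<^sup>E fm F (eta (Lact D) d))
       = fm F (inv_arr D (zeta D j\<^bsub>M\<^esub> d p) \<cdot>\<^sub>D (Id P p \<odot>\<^sup>D eta (Lact D) d)) \<cdot>\<^sub>E rs F (d, p)"
      using assms dp by (simp add: rs_natural)
    then show "Cmp (eta (Ract HB) F) (p \<bullet>\<^sup>D d) \<cdot>\<^sub>E rs (Src (eta (Ract HB) F)) (d, p) =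
       rs (Tgt (eta (Ract HB) F)) (d, p) \<cdot>\<^sub>E (Id P p \<odot>\<^sup>E Cmp (eta (Ract HB) F) d)"
      using assms dp by (simp only: D.zeta_inv_unit_left) simp
  qed (use assms in simp_all)
  show "iso_arr RL (eta (Ract HB) F)"
    using assms by (intro iso_RL(1)[OF 1]) simp
qed

text \<open>Precomposition reverses the order: \<open>(F \<star> n) \<star> m\<close> has the value
  \<open>F(n \<bullet> (m \<bullet> d))\<close> at \<open>d\<close>, hence the multiplicator of
  \<open>D\<close> at \<open>n, m\<close>. Linearity is \<open>zeta_inv_left\<close> of
  \<open>D\<close> under \<open>F\<close>.\<close>

lemma right_mu_arr:
  assumes "m \<in> Ob M" "n \<in> Ob M" and F: "F \<in> Ob RL"
  shows "mu (Ract HB) m n F \<in> Arr RL" "iso_arr RL (mu (Ract HB) m n F)"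
proof -
  interpret F: cat_functor D E F by (rule RL_functor[OF F])
  show 1: "mu (Ract HB) m n F \<in> Arr RL"
  proof (rule Arr_RL_I)
    fix f assume f: "f \<in> Arr D"
    have "fm F (mu (Lact D) n m (Cod D f) \<cdot>\<^sub>D (Id M n \<odot>\<^sub>D Id M m \<odot>\<^sub>D f)) =
      fm F ((Id M (n \<otimes>\<^bsub>M\<^esub> m) \<odot>\<^sub>D f) \<cdot>\<^sub>D mu (Lact D) n m (Dom D f))"
      using f assms by (subst D.L.mu_natural) simp_all
    then show "Cmp (mu (Ract HB) m n F) (Cod D f) \<cdot>\<^sub>E fm (Src (mu (Ract HB) m n F)) f =
      fm (Tgt (mu (Ract HB) m n F)) f \<cdot>\<^sub>E Cmp (mu (Ract HB) m n F) (Dom D f)"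
      using f assms by simp
  next
    fix d p assume dp: "d \<in> Ob D" "p \<in> Ob P"
    have "fm F (inv_arr D (zeta D (n \<otimes>\<^bsub>M\<^esub> m) d p)) \<cdot>\<^sub>E rs F ((n \<otimes>\<^bsub>M\<^esub> m) \<bullet>\<^sub>D d, p) \<cdot>\<^sub>E (Id P p \<odot>\<^sup>E fm F (mu (Lact D) n m d))
       = fm F (inv_arr D (zeta D (n \<otimes>\<^bsub>M\<^esub> m) d p) \<cdot>\<^sub>D (Id P p \<odot>\<^sup>D mu (Lact D) n m d)) \<cdot>\<^sub>E rs F (n \<bullet>\<^sub>D m \<bullet>\<^sub>D d, p)"
      using assms dp by (simp add: rs_natural)
    also have "\<dots> = fm F (mu (Lact D) n m (p \<bullet>\<^sup>D d)) \<cdot>\<^sub>E fm F (Id M n \<odot>\<^sub>D inv_arr D (zeta D m d p)) \<cdot>\<^sub>E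
      fm F (inv_arr D (zeta D n (m \<bullet>\<^sub>D d) p)) \<cdot>\<^sub>E rs F (n \<bullet>\<^sub>D m \<bullet>\<^sub>D d, p)"
      using assms dp by (subst D.zeta_inv_left) simp_all
    finally show "Cmp (mu (Ract HB) m n F) (p \<bullet>\<^sup>D d) \<cdot>\<^sub>E rs (Src (mu (Ract HB) m n F)) (d, p) =
       rs (Tgt (mu (Ract HB) m n F)) (d, p) \<cdot>\<^sub>E (Id P p \<odot>\<^sup>E Cmp (mu (Ract HB) m n F) d)"
      using assms dp by simp
  qed (use assms in simp_all)
  show "iso_arr RL (mu (Ract HB) m n F)"
    using assms by (intro iso_RL(1)[OF 1]) simp
qed

text \<open>In \<open>D\<close> the two arrows of \<open>M\<close> merge into one iterated action,
  to which naturality of the multiplicator applies; naturality of \<open>h\<close> then carries its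
  component past the multiplicator.\<close>

lemma right_mu_natural:
  assumes "f \<in> Arr M" "g \<in> Arr M" "h \<in> Arr RL" "d \<in> Ob D"
  shows "Cmp (mu (Ract HB) (Cod M f) (Cod M g) (Tgt h)) d \<cdot>\<^sub>E Cmp (f \<odot>\<^bsub>Ract HB\<^esub> g \<odot>\<^bsub>Ract HB\<^esub> h) d =
    Cmp ((g \<boxtimes>\<^bsub>M\<^esub> f) \<odot>\<^bsub>Ract HB\<^esub> h) d \<cdot>\<^sub>E Cmp (mu (Ract HB) (Dom M f) (Dom M g) (Src h)) d"
proof -
  note [simp] = assms
  let ?H = "Tgt h"
  have "mu (Lact D) (Cod M g) (Cod M f) d \<cdot>\<^sub>D (Id M (Cod M g) \<odot>\<^sub>D f \<odot>\<^sub>D Id D d) \<cdot>\<^sub>D (g \<odot>\<^sub>D Id D (Dom M f \<bullet>\<^sub>D d))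
    = mu (Lact D) (Cod M g) (Cod M f) d \<cdot>\<^sub>D (g \<odot>\<^sub>D f \<odot>\<^sub>D Id D d)"
    by (simp add: D.L.act_merge)
  also have "\<dots> = ((g \<boxtimes>\<^bsub>M\<^esub> f) \<odot>\<^sub>D Id D d) \<cdot>\<^sub>D mu (Lact D) (Dom M g) (Dom M f) d"
    by (subst D.L.mu_natural) simp_all
  finally have *: "fm ?H (mu (Lact D) (Cod M g) (Cod M f) d \<cdot>\<^sub>D (Id M (Cod M g) \<odot>\<^sub>D f \<odot>\<^sub>D Id D d)
      \<cdot>\<^sub>D (g \<odot>\<^sub>D Id D (Dom M f \<bullet>\<^sub>D d))) =
    fm ?H (((g \<boxtimes>\<^bsub>M\<^esub> f) \<odot>\<^sub>D Id D d) \<cdot>\<^sub>D mu (Lact D) (Dom M g) (Dom M f) d)" by simp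
  have **: "fm ?H (mu (Lact D) (Cod M g) (Cod M f) d) \<cdot>\<^sub>E fm ?H (Id M (Cod M g) \<odot>\<^sub>D f \<odot>\<^sub>D Id D d)
      \<cdot>\<^sub>E fm ?H (g \<odot>\<^sub>D Id D (Dom M f \<bullet>\<^sub>D d)) =
    fm ?H ((g \<boxtimes>\<^bsub>M\<^esub> f) \<odot>\<^sub>D Id D d) \<cdot>\<^sub>E fm ?H (mu (Lact D) (Dom M g) (Dom M f) d)"
    using * by simp
  show ?thesis
    by (simp add: E.L.C.pre3[OF **] RL_Cmp_natural)
qed

lemma right_actegory_hom: "left_actegory (mrev M) RL (Ract HB)"
proof (rule left_actegoryI)
  show "monoidal_category (mrev M)" "category RL" by unfold_locales
  fix f g assume fg: "f \<in> Arr (mrev M)" "g \<in> Arr RL"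
  then show "f \<odot>\<^bsub>Ract HB\<^esub> g \<in> Arr RL \<and> Dom RL (f \<odot>\<^bsub>Ract HB\<^esub> g) = Dom (mrev M) f \<bullet>\<^bsub>Ract HB\<^esub> Dom RL g \<and>
      Cod RL (f \<odot>\<^bsub>Ract HB\<^esub> g) = Cod (mrev M) f \<bullet>\<^bsub>Ract HB\<^esub> Cod RL g" using right_act_arr[of f g] by simp
  fix f' g' assume fg': "f' \<in> Arr (mrev M)" "g' \<in> Arr RL" "Cod (mrev M) f = Dom (mrev M) f'" "Cod RL g = Dom RL g'"
  \<comment> \<open>Functoriality in the pair does not hold factor by factor: naturality of
    \<open>g'\<close> at the shift along \<open>f\<close> is what brings the two shifts next to each
    other.\<close>
  have "fm (Tgt g') (f' \<odot>\<^sub>D Id D d) \<cdot>\<^sub>E fm (Tgt g') (f \<odot>\<^sub>D Id D d) \<cdot>\<^sub>E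
        Cmp g' (Dom M f \<bullet>\<^sub>D d) \<cdot>\<^sub>E Cmp g (Dom M f \<bullet>\<^sub>D d) =
     fm (Tgt g') (f' \<odot>\<^sub>D Id D d) \<cdot>\<^sub>E Cmp g' (Dom M f' \<bullet>\<^sub>D d) \<cdot>\<^sub>E
       fm (Tgt g) (f \<odot>\<^sub>D Id D d) \<cdot>\<^sub>E Cmp g (Dom M f \<bullet>\<^sub>D d)" if "d \<in> Ob D" for d
    using that fg fg' E.L.C.pre[OF RL_Cmp_natural[of g' "f \<odot>\<^sub>D Id D d"]] by simp
  then show "(f' \<cdot>\<^bsub>mrev M\<^esub> f) \<odot>\<^bsub>Ract HB\<^esub> (g' \<cdot>\<^bsub>RL\<^esub> g) = (f' \<odot>\<^bsub>Ract HB\<^esub> g') \<cdot>\<^bsub>RL\<^esub> (f \<odot>\<^bsub>Ract HB\<^esub> g)"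
    using fg fg' by (auto intro!: restrict_ext)
next
  fix F assume "F \<in> Ob RL"
  with right_eta_arr[OF this] show "eta (Ract HB) F \<in> Arr RL \<and> Dom RL (eta (Ract HB) F) = F \<and>
      Cod RL (eta (Ract HB) F) = j\<^bsub>mrev M\<^esub> \<bullet>\<^bsub>Ract HB\<^esub> F" by simp
next
  fix n n' F assume "n \<in> Ob (mrev M)" "n' \<in> Ob (mrev M)" "F \<in> Ob RL"
  with right_mu_arr[of n n' F] show "mu (Ract HB) n n' F \<in> Arr RL \<and>
      Dom RL (mu (Ract HB) n n' F) = n \<bullet>\<^bsub>Ract HB\<^esub> n' \<bullet>\<^bsub>Ract HB\<^esub> F \<and>
      Cod RL (mu (Ract HB) n n' F) = (n \<otimes>\<^bsub>mrev M\<^esub> n') \<bullet>\<^bsub>Ract HB\<^esub> F" by simp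
next
  fix f g h assume fgh: "f \<in> Arr (mrev M)" "g \<in> Arr (mrev M)" "h \<in> Arr RL"
  then show "mu (Ract HB) (Cod (mrev M) f) (Cod (mrev M) g) (Cod RL h) \<cdot>\<^bsub>RL\<^esub> (f \<odot>\<^bsub>Ract HB\<^esub> g \<odot>\<^bsub>Ract HB\<^esub> h) =
      ((f \<boxtimes>\<^bsub>mrev M\<^esub> g) \<odot>\<^bsub>Ract HB\<^esub> h) \<cdot>\<^bsub>RL\<^esub> mu (Ract HB) (Dom (mrev M) f) (Dom (mrev M) g) (Dom RL h)"
    using right_mu_natural[of f g h] by (auto intro!: restrict_ext simp del: HB_right(2,4)) (simp_all)
next
  fix m n p F assume mnp: "m \<in> Ob (mrev M)" "n \<in> Ob (mrev M)" "p \<in> Ob (mrev M)" "F \<in> Ob RL"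
  \<comment> \<open>The associator of \<open>mrev M\<close> is an inverse, so the law wanted is
    \<open>act_assoc\<close> of \<open>D\<close> with the associator moved to the other side, seen
    through \<open>F\<close>.\<close>
  have "fm F ((inv_arr M (alpha M p n m) \<odot>\<^sub>D Id D d) \<cdot>\<^sub>D mu (Lact D) p (n \<otimes>\<^bsub>M\<^esub> m) d \<cdot>\<^sub>D (Id M p \<odot>\<^sub>D mu (Lact D) n m d)) =
     fm F (mu (Lact D) (p \<otimes>\<^bsub>M\<^esub> n) m d \<cdot>\<^sub>D mu (Lact D) p n (m \<bullet>\<^sub>D d))" if "d \<in> Ob D" for d
  proof -
    have "inv_arr M (alpha M p n m) \<odot>\<^sub>D Id D d = inv_arr D (alpha M p n m \<odot>\<^sub>D Id D d)"
      using mnp that by simp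
    then show ?thesis using mnp that by (simp del: D.L.act_iso(2) flip: D.L.act_assoc) 
  qed
  then show "(alpha (mrev M) m n p \<odot>\<^bsub>Ract HB\<^esub> Id RL F) \<cdot>\<^bsub>RL\<^esub> mu (Ract HB) (m \<otimes>\<^bsub>mrev M\<^esub> n) p F \<cdot>\<^bsub>RL\<^esub> mu (Ract HB) m n (p \<bullet>\<^bsub>Ract HB\<^esub> F) =
      mu (Ract HB) m (n \<otimes>\<^bsub>mrev M\<^esub> p) F \<cdot>\<^bsub>RL\<^esub> (Id (mrev M) m \<odot>\<^bsub>Ract HB\<^esub> mu (Ract HB) n p F)"
    using mnp by (auto intro!: restrict_ext)
next
  fix m F assume mF: "m \<in> Ob (mrev M)" "F \<in> Ob RL"
  \<comment> \<open>The two unit laws trade places, because \<open>mrev\<close> swaps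
    \<open>lam\<close> and \<open>rho\<close>.\<close>
  have "fm F (mu (Lact D) m j\<^bsub>M\<^esub> d \<cdot>\<^sub>D (Id M m \<odot>\<^sub>D eta (Lact D) d)) = fm F (inv_arr M (rho M m) \<odot>\<^sub>D Id D d)"
    "fm F (mu (Lact D) j\<^bsub>M\<^esub> m d \<cdot>\<^sub>D eta (Lact D) (m \<bullet>\<^sub>D d)) = fm F (inv_arr M (lam M m) \<odot>\<^sub>D Id D d)"
    if "d \<in> Ob D" for d
    using mF that by (simp_all only: D.L.act_unit_right D.L.act_unit_left mrev_simps)
  then show "mu (Ract HB) j\<^bsub>mrev M\<^esub> m F \<cdot>\<^bsub>RL\<^esub> eta (Ract HB) (m \<bullet>\<^bsub>Ract HB\<^esub> F) = inv_arr (mrev M) (lam (mrev M) m) \<odot>\<^bsub>Ract HB\<^esub> Id RL F"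
    "mu (Ract HB) m j\<^bsub>mrev M\<^esub> F \<cdot>\<^bsub>RL\<^esub> (Id (mrev M) m \<odot>\<^bsub>Ract HB\<^esub> eta (Ract HB) F) = inv_arr (mrev M) (rho (mrev M) m) \<odot>\<^bsub>Ract HB\<^esub> Id RL F"
    using mF by (auto intro!: restrict_ext)
qed (use right_eta_arr(2) right_mu_arr(2) in \<open>auto intro!: restrict_ext simp: RL_Cmp_natural\<close>)

text \<open>An equality of records, right linear structures included: in both orders the structure
  applies the inverse bimodulator of \<open>E\<close>, then \<open>rs F\<close> at
  \<open>m \<bullet> d\<close>, then \<open>F\<close> of the inverse bimodulator of
  \<open>D\<close>, the last two under \<open>n \<bullet> -\<close>. This makes an identity
  bimodulator well typed.\<close>

lemma lhom_rhom: "F \<in> Ob RL \<Longrightarrow> n \<in> Ob N \<Longrightarrow> m \<in> Ob M \<Longrightarrow> lH n (rH F m) = rH (lH n F) m"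
  by (auto simp: lhom_def rhom_def intro!: restrict_ext)

lemma zeta_HB_arr:
  assumes "F \<in> Ob RL" "n \<in> Ob N" "m \<in> Ob M"
  shows "zeta HB n F m = Id RL (lH n (rH F m))"
  using lhom_rhom[OF assms] assms by (auto intro!: restrict_ext)

text \<open>As the bimodulator is an identity, each of its laws says that the same arrow of
  \<open>E\<close> arises whichever of the two actions is applied first.\<close>

lemma biactegory_hom: "biactegory N M HB"
proof (rule biactegoryI)
  show "left_actegory N HB (Lact HB)" "left_actegory (mrev M) HB (Ract HB)"
    using left_actegory_hom right_actegory_hom by (simp_all add: hom_biact_def del: HB_left HB_right)
  show "monoidal_category M" by unfold_locales
  fix m F n assume "m \<in> Ob N" "F \<in> Ob HB" "n \<in> Ob M"
  then have F: "m \<in> Ob N" "F \<in> Ob RL" "n \<in> Ob M" by simp_all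
  then show "zeta HB m F n \<in> Arr HB \<and> Dom HB (zeta HB m F n) = m \<bullet>\<^bsub>Lact HB\<^esub> n \<bullet>\<^bsub>Ract HB\<^esub> F \<and>
      Cod HB (zeta HB m F n) = n \<bullet>\<^bsub>Ract HB\<^esub> m \<bullet>\<^bsub>Lact HB\<^esub> F"
    using RC.id_arr[of "lH m (rH F n)"] by (simp add: zeta_HB_arr lhom_rhom del: zeta_HB)
  show "iso_arr HB (zeta HB m F n)"
    using F RC.iso_id[of "lH m (rH F n)"] by (simp add: zeta_HB_arr del: zeta_HB RL_simps)
qed (auto intro!: restrict_ext simp: E.L.act_absorb lhom_rhom simp del: E.L.act_comp_right)

end

section \<open>Balanced functors and the universal property\<close>

locale bifunctor = A: category A + B: category B + F: cat_functor "prod_cat A B" X F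
  for A :: "('o1, 'a1, 'z1) cat_scheme" and B :: "('o2, 'a2, 'z2) cat_scheme"
    and X :: "('o, 'a, 'z3) cat_scheme" and F :: "('o1 \<times> 'o2, 'a1 \<times> 'a2, 'o, 'a, 'z) fctr_scheme"
begin

lemma bi_ob [simp]: "a \<in> Ob A \<Longrightarrow> b \<in> Ob B \<Longrightarrow> fo F (a, b) \<in> Ob X"
  using F.fo_in[of "(a, b)"] by simp

lemma bi_arr [simp]:
  assumes "f \<in> Arr A" "g \<in> Arr B"
  shows "fm F (f, g) \<in> Arr X" "Dom X (fm F (f, g)) = fo F (Dom A f, Dom B g)"
    "Cod X (fm F (f, g)) = fo F (Cod A f, Cod B g)"
  using F.fm_arr[of "(f, g)"] assms by simp_all

lemma bi_id [simp]: "a \<in> Ob A \<Longrightarrow> b \<in> Ob B \<Longrightarrow> fm F (Id A a, Id B b) = Id X (fo F (a, b))"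
  using F.fm_Id[of "(a, b)"] by simp

lemma bi_comp:
  assumes "f \<in> Arr A" "f' \<in> Arr A" "g \<in> Arr B" "g' \<in> Arr B" "Cod A f = Dom A f'" "Cod B g = Dom B g'"
  shows "fm F (f' \<cdot>\<^bsub>A\<^esub> f, g' \<cdot>\<^bsub>B\<^esub> g) = fm F (f', g') \<cdot>\<^bsub>X\<^esub> fm F (f, g)"
  using F.fm_comp[of "(f, g)" "(f', g')"] assms by simp

text \<open>Reverses the splitting rules below and is often used with those removed, to bring two
  factors into one pair where a law of a single variable applies.\<close>

lemma bi_merge:
  assumes "f \<in> Arr A" "f' \<in> Arr A" "g \<in> Arr B" "g' \<in> Arr B" "Cod A f = Dom A f'" "Cod B g = Dom B g'"
  shows "fm F (f', g') \<cdot>\<^bsub>X\<^esub> fm F (f, g) = fm F (f' \<cdot>\<^bsub>A\<^esub> f, g' \<cdot>\<^bsub>B\<^esub> g)"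
  using assms by (simp add: bi_comp)

lemma bi_comp_left [simp]:
  assumes "b \<in> Ob B" "f \<in> Arr A" "f' \<in> Arr A" "Cod A f = Dom A f'"
  shows "fm F (f' \<cdot>\<^bsub>A\<^esub> f, Id B b) = fm F (f', Id B b) \<cdot>\<^bsub>X\<^esub> fm F (f, Id B b)"
  using bi_comp[of f f' "Id B b" "Id B b"] assms by simp

lemma bi_comp_right [simp]:
  assumes "a \<in> Ob A" "g \<in> Arr B" "g' \<in> Arr B" "Cod B g = Dom B g'"
  shows "fm F (Id A a, g' \<cdot>\<^bsub>B\<^esub> g) = fm F (Id A a, g') \<cdot>\<^bsub>X\<^esub> fm F (Id A a, g)"
  using bi_comp[of "Id A a" "Id A a" g g'] assms by simp

lemma bi_iso [simp]:
  assumes "iso_arr A f" "iso_arr B g"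
  shows "iso_arr X (fm F (f, g))" "inv_arr X (fm F (f, g)) = fm F (inv_arr A f, inv_arr B g)"
  using F.fm_iso[of "(f, g)"] iso_arr_prod[of A B f g] assms A.category_axioms B.category_axioms by simp_all

end

sublocale balanced_functor \<subseteq> bifunctor C D X F
  by unfold_locales

context balanced_functor
begin

declare eps_iso [simp]

lemma eps_arr [simp]:
  assumes "c \<in> Ob C" "m \<in> Ob M" "d \<in> Ob D"
  shows "eps F (c, m, d) \<in> Arr X" "Dom X (eps F (c, m, d)) = fo F (m \<bullet>\<^bsub>A\<^esub> c, d)"
    "Cod X (eps F (c, m, d)) = fo F (c, m \<bullet>\<^bsub>B\<^esub> d)"
  using eps_hom[OF assms] by (simp_all add: hom_iff)

lemma eps_natural:
  assumes "f \<in> Arr C" "g \<in> Arr M" "h \<in> Arr D" "c = Cod C f" "m = Cod M g" "d = Cod D h"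
  shows "eps F (c, m, d) \<cdot>\<^bsub>X\<^esub> fm F (g \<odot>\<^bsub>A\<^esub> f, h) = fm F (f, g \<odot>\<^bsub>B\<^esub> h) \<cdot>\<^bsub>X\<^esub> eps F (Dom C f, Dom M g, Dom D h)"
  using eps_nat[of f _ c g _ m h _ d] assms by (simp add: hom_iff)

end

lemma balanced_functorI:
  assumes "left_actegory (mrev M) C A" "left_actegory M D B" "cat_functor (prod_cat C D) X F"
    and "\<And>c m d. c \<in> Ob C \<Longrightarrow> m \<in> Ob M \<Longrightarrow> d \<in> Ob D \<Longrightarrow> eps F (c, m, d) \<in> Arr X \<and>
      Dom X (eps F (c, m, d)) = fo F (m \<bullet>\<^bsub>A\<^esub> c, d) \<and> Cod X (eps F (c, m, d)) = fo F (c, m \<bullet>\<^bsub>B\<^esub> d)"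
    and "\<And>c m d. c \<in> Ob C \<Longrightarrow> m \<in> Ob M \<Longrightarrow> d \<in> Ob D \<Longrightarrow> iso_arr X (eps F (c, m, d))"
    and "\<And>f g h. f \<in> Arr C \<Longrightarrow> g \<in> Arr M \<Longrightarrow> h \<in> Arr D \<Longrightarrow>
      eps F (Cod C f, Cod M g, Cod D h) \<cdot>\<^bsub>X\<^esub> fm F (g \<odot>\<^bsub>A\<^esub> f, h) =
      fm F (f, g \<odot>\<^bsub>B\<^esub> h) \<cdot>\<^bsub>X\<^esub> eps F (Dom C f, Dom M g, Dom D h)"
    and "\<And>c m n d. c \<in> Ob C \<Longrightarrow> m \<in> Ob M \<Longrightarrow> n \<in> Ob M \<Longrightarrow> d \<in> Ob D \<Longrightarrow>
      fm F (Id C c, mu B m n d) \<cdot>\<^bsub>X\<^esub> eps F (c, m, n \<bullet>\<^bsub>B\<^esub> d) \<cdot>\<^bsub>X\<^esub> eps F (m \<bullet>\<^bsub>A\<^esub> c, n, d) =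
      eps F (c, m \<otimes>\<^bsub>M\<^esub> n, d) \<cdot>\<^bsub>X\<^esub> fm F (mu A n m c, Id D d)"
    and "\<And>c d. c \<in> Ob C \<Longrightarrow> d \<in> Ob D \<Longrightarrow> eps F (c, j\<^bsub>M\<^esub>, d) \<cdot>\<^bsub>X\<^esub> fm F (eta A c, Id D d) = fm F (Id C c, eta B d)"
  shows "balanced_functor M C A D B X F"
proof (intro balanced_functor.intro)
  show "balanced_functor_axioms M C A D B X F"
    using assms(4-) by unfold_locales (auto simp: hom_iff)
qed fact+

lemma truncate_simps [simp]:
  "Ob (cat.truncate X) = Ob X" "Arr (cat.truncate X) = Arr X" "Dom (cat.truncate X) = Dom X"
  "Cod (cat.truncate X) = Cod X" "Id (cat.truncate X) = Id X" "Comp (cat.truncate X) = Comp X"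
  by (simp_all add: cat.truncate_def)

lemma truncate_iff:
  "hom (cat.truncate X) = hom X" "category (cat.truncate X) = category X"
  "iso_arr (cat.truncate X) = iso_arr X" "nat_trans Y (cat.truncate X) = nat_trans Y X"
  "cat_functor Y (cat.truncate X) = cat_functor Y X" "fun_cat Y (cat.truncate X) S Q = fun_cat Y X S Q"
  by (simp_all add: fun_eq_iff hom_def category_def iso_arr_def inverse_arrows_def nat_trans_def
      cat_functor_def cat_functor_axioms_def fun_cat_def)

text \<open>\<open>represents_Bal\<close> is stated for bare category records, whereas
  \<open>E\<close> is a biactegory; forgetting its actions changes neither side of the universal
  property.\<close>

lemma Cat_truncate: "Cat Y (cat.truncate X) = Cat Y X"
  by (simp add: Cat_def truncate_iff)

lemma Bal_truncate: "Bal M C A D B (cat.truncate X) = Bal M C A D B X"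
  by (simp add: Bal_def truncate_iff balanced_functor_def balanced_functor_axioms_def)

text \<open>The universal property for one target \<open>X\<close> of arbitrary types. HOL cannot
  quantify over those types, so the targets \<open>T\<close> and \<open>E\<close> become two
  instances.\<close>

locale tensor_univ =
  U: balanced_functor M C A D B T U + X: category X
  for M :: "('mo, 'ma) monoidal"
    and C :: "('co, 'ca, 'z1) cat_scheme" and A :: "('mo, 'ma, 'co, 'ca) action"
    and D :: "('do, 'da, 'z2) cat_scheme" and B :: "('mo, 'ma, 'do, 'da) action"
    and T :: "('to, 'ta) cat" and U :: "('co, 'ca, 'do, 'da, 'mo, 'to, 'ta) bal"
    and X :: "('xo, 'xa, 'z3) cat_scheme" +
  assumes rep: "represents_Bal M C A D B T U (cat.truncate X)"
begin

lemma comp_iso: "cat_iso (Cat T X) (Bal M C A D B X) (bal_comp_functor M C D U)"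
  using rep by (simp add: represents_Bal_def Cat_truncate Bal_truncate)

lemma bal_comp_bij: "bij_betw (bal_comp M C D U) (Ob (Cat T X)) (Ob (Bal M C A D B X))"
  using comp_iso by (simp add: cat_iso_def bal_comp_functor_def)

lemma bal_comp_arr_bij: "bij_betw (fm (bal_comp_functor M C D U)) (Arr (Cat T X)) (Arr (Bal M C A D B X))"
  using comp_iso by (simp add: cat_iso_def)

lemma Ob_Cat: "H \<in> Ob (Cat T X) \<longleftrightarrow> cat_functor T X H \<and> fo H \<in> extensional (Ob T) \<and> fm H \<in> extensional (Arr T)"
  by (simp add: Cat_def ext_functor_def)

lemma Ob_Bal: "F \<in> Ob (Bal M C A D B X) \<longleftrightarrow> balanced_functor M C A D B X F \<and>
   fo F \<in> extensional (Ob C \<times> Ob D) \<and> fm F \<in> extensional (Arr C \<times> Arr D) \<and>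
   eps F \<in> extensional (Ob C \<times> Ob M \<times> Ob D)"
  by (simp add: Bal_def ext_functor_def)

text \<open>The existence half of the universal property on objects; \<open>functor_eqI\<close> is
  the uniqueness half.\<close>

lemma lift_exists:
  assumes "G \<in> Ob (Bal M C A D B X)"
  shows "\<exists>H. cat_functor T X H \<and> fo H \<in> extensional (Ob T) \<and> fm H \<in> extensional (Arr T) \<and> bal_comp M C D U H = G"
proof -
  have "G \<in> bal_comp M C D U ` Ob (Cat T X)"
    using assms bal_comp_bij by (simp add: bij_betw_def)
  then show ?thesis by (auto simp: Ob_Cat)
qed

lemma bal_comp_in: "H \<in> Ob (Cat T X) \<Longrightarrow> bal_comp M C D U H \<in> Ob (Bal M C A D B X)"
  using bal_comp_bij by (auto simp: bij_betw_def)

lemma functor_eqI: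
  assumes "cat_functor T X H" "fo H \<in> extensional (Ob T)" "fm H \<in> extensional (Arr T)"
    "cat_functor T X H'" "fo H' \<in> extensional (Ob T)" "fm H' \<in> extensional (Arr T)"
    "bal_comp M C D U H = bal_comp M C D U H'"
  shows "H = H'"
  using assms bal_comp_bij by (auto simp: bij_betw_def inj_on_def Ob_Cat)

text \<open>Functors that arise by composition need not be \<open>undefined\<close> off the carrier
  and then are not objects of \<open>Cat T X\<close>; the restricted copy is. Since
  \<open>nat_trans\<close> reads values on the carrier only, the copy has the same natural
  transformations.\<close>

definition restr :: "('to, 'ta, 'xo, 'xa) fctr \<Rightarrow> ('to, 'ta, 'xo, 'xa) fctr" where
  "restr H = \<lparr>fo = restrict (fo H) (Ob T), fm = restrict (fm H) (Arr T)\<rparr>"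

lemma restr_in:
  fixes H :: "('to, 'ta, 'xo, 'xa) fctr" 
  assumes "cat_functor T X H" shows "restr H \<in> Ob (Cat T X)"
proof -
  interpret H: cat_functor T X H by fact
  show ?thesis by (simp add: Ob_Cat restr_def) (intro cat_functorI; simp add: U.F.B.category_axioms X.category_axioms)
qed

lemma restr_Cat:
  fixes H H' :: "('to, 'ta, 'xo, 'xa) fctr"
  assumes "cat_functor T X H" "cat_functor T X H'"
  shows "\<lparr>Src = restr H, Tgt = restr H', Cmp = restrict \<xi> (Ob T)\<rparr> \<in> Arr (Cat T X) \<longleftrightarrow> nat_trans T X H H' \<xi>"
proof -
  interpret H: cat_functor T X H by fact
  show ?thesis using restr_in[OF assms(1)] restr_in[OF assms(2)]
    by (simp add: Cat_def Arr_fun_cat) (auto simp: nat_trans_iff restr_def)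
qed

text \<open>Surjectivity on arrows of composition with \<open>U\<close>: the three conditions on
  \<beta> say that it is a balanced transformation between the composites.\<close>

lemma nat_lift:
  fixes H H' :: "('to, 'ta, 'xo, 'xa) fctr"
  assumes H: "cat_functor T X H" "cat_functor T X H'"
    and \<beta>: "\<And>c d. c \<in> Ob C \<Longrightarrow> d \<in> Ob D \<Longrightarrow> \<beta> c d \<in> Arr X \<and> Dom X (\<beta> c d) = fo H (fo U (c, d)) \<and>
      Cod X (\<beta> c d) = fo H' (fo U (c, d))"
    "\<And>f g. f \<in> Arr C \<Longrightarrow> g \<in> Arr D \<Longrightarrow> \<beta> (Cod C f) (Cod D g) \<cdot>\<^bsub>X\<^esub> fm H (fm U (f, g)) =
      fm H' (fm U (f, g)) \<cdot>\<^bsub>X\<^esub> \<beta> (Dom C f) (Dom D g)"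
    "\<And>c m d. c \<in> Ob C \<Longrightarrow> m \<in> Ob M \<Longrightarrow> d \<in> Ob D \<Longrightarrow>
      fm H' (eps U (c, m, d)) \<cdot>\<^bsub>X\<^esub> \<beta> (m \<bullet>\<^bsub>A\<^esub> c) d = \<beta> c (m \<bullet>\<^bsub>B\<^esub> d) \<cdot>\<^bsub>X\<^esub> fm H (eps U (c, m, d))"
  shows "\<exists>\<xi>. nat_trans T X H H' \<xi> \<and> (\<forall>c\<in>Ob C. \<forall>d\<in>Ob D. \<xi> (fo U (c, d)) = \<beta> c d)"
proof -
  interpret H: cat_functor T X H by fact
  interpret H': cat_functor T X H' by fact
  let ?\<tau> = "\<lparr>Src = bal_comp M C D U (restr H), Tgt = bal_comp M C D U (restr H'),
    Cmp = \<lambda>(c, d)\<in>Ob C \<times> Ob D. \<beta> c d\<rparr>"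
  have "?\<tau> \<in> Arr (Bal M C A D B X)"
    using bal_comp_in[OF restr_in[OF H(1)]] bal_comp_in[OF restr_in[OF H(2)]]
    by (simp add: Bal_def Arr_fun_cat) (auto simp: nat_trans_iff restr_def bal_comp_def \<beta>)
  then have "?\<tau> \<in> fm (bal_comp_functor M C D U) ` Arr (Cat T X)"
    using bal_comp_arr_bij by (simp add: bij_betw_def)
  then obtain \<sigma> where \<sigma>: "\<sigma> \<in> Arr (Cat T X)" "fm (bal_comp_functor M C D U) \<sigma> = ?\<tau>" by auto
  then have S: "Src \<sigma> \<in> Ob (Cat T X)" "Tgt \<sigma> \<in> Ob (Cat T X)" "nat_trans T X (Src \<sigma>) (Tgt \<sigma>) (Cmp \<sigma>)"
    by (auto simp: Cat_def Arr_fun_cat)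
  have "bal_comp M C D U (Src \<sigma>) = bal_comp M C D U (restr H)" "bal_comp M C D U (Tgt \<sigma>) = bal_comp M C D U (restr H')"
    and C: "(\<lambda>x\<in>Ob C \<times> Ob D. Cmp \<sigma> (fo U x)) = (\<lambda>(c, d)\<in>Ob C \<times> Ob D. \<beta> c d)"
    using \<sigma>(2) by (simp_all add: bal_comp_functor_def)
  \<comment> \<open>Surjectivity only gives an arrow between some two functors; injectivity on
    objects identifies them with the given ones.\<close>
  then have eq: "Src \<sigma> = restr H" "Tgt \<sigma> = restr H'"
    using S restr_in[OF H(1)] restr_in[OF H(2)] functor_eqI by (auto simp: Ob_Cat)
  have "nat_trans T X H H' (Cmp \<sigma>)"
    using S(3) unfolding eq by (auto simp: nat_trans_iff restr_def)
  moreover have "Cmp \<sigma> (fo U (c, d)) = \<beta> c d" if "c \<in> Ob C" "d \<in> Ob D" for c d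
    using fun_cong[OF C, of "(c, d)"] that by simp
  ultimately show ?thesis by blast
qed

text \<open>Injectivity on arrows of composition with \<open>U\<close>. The price of testing on
  generators is that both families must first be shown natural in \<open>t\<close>, between the same
  two functors.\<close>

lemma nat_eqI:
  fixes H H' :: "('to, 'ta, 'xo, 'xa) fctr"
  assumes H: "cat_functor T X H" "cat_functor T X H'"
    and \<xi>: "nat_trans T X H H' \<xi>" "nat_trans T X H H' \<xi>'"
    and eq: "\<And>c d. c \<in> Ob C \<Longrightarrow> d \<in> Ob D \<Longrightarrow> \<xi> (fo U (c, d)) = \<xi>' (fo U (c, d))" and t: "t \<in> Ob T"
  shows "\<xi> t = \<xi>' t"
proof -
  let ?a = "\<lambda>\<xi>. \<lparr>Src = restr H, Tgt = restr H', Cmp = restrict \<xi> (Ob T)\<rparr>"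
  have "?a \<xi> \<in> Arr (Cat T X)" "?a \<xi>' \<in> Arr (Cat T X)"
    using restr_Cat[OF H] \<xi> by simp_all
  moreover have "fm (bal_comp_functor M C D U) (?a \<xi>) = fm (bal_comp_functor M C D U) (?a \<xi>')"
    using eq by (auto simp: bal_comp_functor_def intro!: restrict_ext)
  ultimately have "?a \<xi> = ?a \<xi>'" using bal_comp_arr_bij by (auto simp: bij_betw_def inj_on_def)
  then have "restrict \<xi> (Ob T) = restrict \<xi>' (Ob T)" by simp
  then show ?thesis using t by (metis restrict_apply')
qed

text \<open>The inverses on generators form a balanced transformation in the opposite direction,
  which lifts; \<open>nat_eqI\<close> shows that the lift is inverse at every \<open>t\<close>, not
  only at generators.\<close>

lemma nat_isoI:
  fixes H H' :: "('to, 'ta, 'xo, 'xa) fctr"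
  assumes H: "cat_functor T X H" "cat_functor T X H'"
    and \<xi>: "nat_trans T X H H' \<xi>"
    and iso: "\<And>c d. c \<in> Ob C \<Longrightarrow> d \<in> Ob D \<Longrightarrow> iso_arr X (\<xi> (fo U (c, d)))" and t: "t \<in> Ob T"
  shows "iso_arr X (\<xi> t)"
proof -
  interpret H: cat_functor T X H by fact
  interpret H': cat_functor T X H' by fact
  have \<xi>t [simp]: "\<xi> t \<in> Arr X" "Dom X (\<xi> t) = fo H t" "Cod X (\<xi> t) = fo H' t" if "t \<in> Ob T" for t
    using \<xi> that by (auto simp: nat_trans_iff)
  have \<xi>n: "\<xi> y \<cdot>\<^bsub>X\<^esub> fm H f = fm H' f \<cdot>\<^bsub>X\<^esub> \<xi> (Dom T f)" if "f \<in> Arr T" "y = Cod T f" for f y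
    using \<xi> that by (auto simp: nat_trans_iff)
  note [simp] = iso
  have "\<exists>\<xi>'. nat_trans T X H' H \<xi>' \<and> (\<forall>c\<in>Ob C. \<forall>d\<in>Ob D. \<xi>' (fo U (c, d)) = inv_arr X (\<xi> (fo U (c, d))))"
  proof (rule nat_lift[OF H(2,1)])
    fix f g assume "f \<in> Arr C" "g \<in> Arr D"
    then show "inv_arr X (\<xi> (fo U (Cod C f, Cod D g))) \<cdot>\<^bsub>X\<^esub> fm H' (fm U (f, g)) =
      fm H (fm U (f, g)) \<cdot>\<^bsub>X\<^esub> inv_arr X (\<xi> (fo U (Dom C f, Dom D g)))"
      by (intro X.inv_square) (simp_all add: \<xi>n)
  next
    fix c m d assume "c \<in> Ob C" "m \<in> Ob M" "d \<in> Ob D"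
    then show "fm H (eps U (c, m, d)) \<cdot>\<^bsub>X\<^esub> inv_arr X (\<xi> (fo U (m \<bullet>\<^bsub>A\<^esub> c, d))) =
      inv_arr X (\<xi> (fo U (c, m \<bullet>\<^bsub>B\<^esub> d))) \<cdot>\<^bsub>X\<^esub> fm H' (eps U (c, m, d))"
      using U.C.act_ob[of m c] by (intro X.inv_square[symmetric]) (simp_all add: \<xi>n)
  qed simp
  then obtain \<xi>' where \<xi>': "nat_trans T X H' H \<xi>'" "\<And>c d. c \<in> Ob C \<Longrightarrow> d \<in> Ob D \<Longrightarrow> \<xi>' (fo U (c, d)) = inv_arr X (\<xi> (fo U (c, d)))"
    by blast
  then have \<xi>'t [simp]: "\<xi>' t \<in> Arr X" "Dom X (\<xi>' t) = fo H' t" "Cod X (\<xi>' t) = fo H t" if "t \<in> Ob T" for t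
    using that by (auto simp: nat_trans_iff)
  have \<xi>'n: "\<xi>' y \<cdot>\<^bsub>X\<^esub> fm H' f = fm H f \<cdot>\<^bsub>X\<^esub> \<xi>' (Dom T f)" if "f \<in> Arr T" "y = Cod T f" for f y
    using \<xi>' that by (auto simp: nat_trans_iff)
  have "\<xi>' t \<cdot>\<^bsub>X\<^esub> \<xi> t = Id X (fo H t)"
    by (rule nat_eqI[OF H(1,1) _ _ _ t]) (simp_all add: nat_trans_iff \<xi>'(2) \<xi>n X.pre[OF \<xi>'n])
  moreover have "\<xi> t \<cdot>\<^bsub>X\<^esub> \<xi>' t = Id X (fo H' t)"
    by (rule nat_eqI[OF H(2,2) _ _ _ t]) (simp_all add: nat_trans_iff \<xi>'(2) \<xi>'n X.pre[OF \<xi>n])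
  ultimately show ?thesis using t by (intro X.iso_arrI(1)[of "\<xi> t" "\<xi>' t"]) simp_all
qed

end

section \<open>Actions induced from generators\<close>

text \<open>Restricted to the carrier of \<open>A\<close>, so that composites are objects of
  \<open>Cat\<close> and can be compared by \<open>functor_eqI\<close>.\<close>

definition comp_fctr :: "('o1, 'a1, 'z1) cat_scheme \<Rightarrow> ('o2, 'a2, 'o3, 'a3) fctr \<Rightarrow> ('o1, 'a1, 'o2, 'a2) fctr \<Rightarrow>
    ('o1, 'a1, 'o3, 'a3) fctr" where
  "comp_fctr A G F = \<lparr>fo = \<lambda>x\<in>Ob A. fo G (fo F x), fm = \<lambda>f\<in>Arr A. fm G (fm F f)\<rparr>"

lemma comp_fctr_simps [simp]:
  "x \<in> Ob A \<Longrightarrow> fo (comp_fctr A G F) x = fo G (fo F x)" "f \<in> Arr A \<Longrightarrow> fm (comp_fctr A G F) f = fm G (fm F f)"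
  "fo (comp_fctr A G F) \<in> extensional (Ob A)" "fm (comp_fctr A G F) \<in> extensional (Arr A)"
  by (simp_all add: comp_fctr_def)

lemma cat_functor_comp_fctr:
  assumes "cat_functor A B F" "cat_functor B C G"
  shows "cat_functor A C (comp_fctr A G F)"
proof -
  interpret F: cat_functor A B F by fact
  interpret G: cat_functor B C G by fact
  show ?thesis by (rule cat_functorI) (simp_all add: F.A.category_axioms G.B.category_axioms)
qed

definition id_fctr :: "('o, 'a, 'z) cat_scheme \<Rightarrow> ('o, 'a, 'o, 'a) fctr" where
  "id_fctr A = \<lparr>fo = \<lambda>x\<in>Ob A. x, fm = \<lambda>f\<in>Arr A. f\<rparr>"

lemma id_fctr_simps [simp]:
  "x \<in> Ob A \<Longrightarrow> fo (id_fctr A) x = x" "f \<in> Arr A \<Longrightarrow> fm (id_fctr A) f = f"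
  "fo (id_fctr A) \<in> extensional (Ob A)" "fm (id_fctr A) \<in> extensional (Arr A)"
  by (simp_all add: id_fctr_def)

lemma cat_functor_id_fctr:
  assumes "category A" shows "cat_functor A A (id_fctr A)"
proof -
  interpret category A by fact
  show ?thesis by (rule cat_functorI) (simp_all add: category_axioms)
qed

text \<open>The target is \<open>T\<close> itself. Membership of \<open>U\<close> in
  \<open>Bal\<close> adds that \<open>U\<close> is extensional, which makes the identity functor the
  lift of \<open>U\<close> on the nose.\<close>

locale tensor_self = tensor_univ M C A D B T U T
  for M :: "('mo, 'ma) monoidal"
    and C :: "('co, 'ca, 'z1) cat_scheme" and A :: "('mo, 'ma, 'co, 'ca) action"
    and D :: "('do, 'da, 'z2) cat_scheme" and B :: "('mo, 'ma, 'do, 'da) action"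
    and T :: "('to, 'ta) cat" and U :: "('co, 'ca, 'do, 'da, 'mo, 'to, 'ta) bal" +
  assumes U_in: "U \<in> Ob (Bal M C A D B T)"
begin

abbreviation comp_T (infixr \<open>\<cdot>\<^sub>T\<close> 65) where "comp_T \<equiv> Comp T"

lemma id_fctr_in: "id_fctr T \<in> Ob (Cat T T)" and bal_comp_id_fctr: "bal_comp M C D U (id_fctr T) = U"
proof -
  show "id_fctr T \<in> Ob (Cat T T)" using cat_functor_id_fctr U.F.B.category_axioms by (simp add: Ob_Cat)
  show "bal_comp M C D U (id_fctr T) = U"
  proof (rule bal.equality)
    have ext: "fo U \<in> extensional (Ob C \<times> Ob D)" "fm U \<in> extensional (Arr C \<times> Arr D)"
      "eps U \<in> extensional (Ob C \<times> Ob M \<times> Ob D)"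
      using U_in by (simp_all add: Ob_Bal)
    show "fo (bal_comp M C D U (id_fctr T)) = fo U"
      by (rule extensionalityI[OF _ ext(1)]) (auto simp: bal_comp_def)
    show "fm (bal_comp M C D U (id_fctr T)) = fm U"
      by (rule extensionalityI[OF _ ext(2)]) (auto simp: bal_comp_def)
    show "eps (bal_comp M C D U (id_fctr T)) = eps U"
      by (rule extensionalityI[OF _ ext(3)]) (auto simp: bal_comp_def)
  qed simp
qed

text \<open>\<open>lift_trans\<close> is an \<open>inv_into\<close>, about which nothing is known
  until a preimage is exhibited: \<open>nat_lift\<close> supplies one, and injectivity shows that it
  is the value. \<open>H\<close> and \<open>H'\<close> are any known lifts of \<open>S\<close> and
  \<open>S'\<close>.\<close>

lemma lift_trans_nat:
  assumes H: "H \<in> Ob (Cat T T)" "H' \<in> Ob (Cat T T)" "bal_comp M C D U H = S" "bal_comp M C D U H' = S'"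
    and \<beta>: "\<And>c d. c \<in> Ob C \<Longrightarrow> d \<in> Ob D \<Longrightarrow> \<beta> (c, d) \<in> Arr T \<and> Dom T (\<beta> (c, d)) = fo S (c, d) \<and>
      Cod T (\<beta> (c, d)) = fo S' (c, d)"
    "\<And>f g. f \<in> Arr C \<Longrightarrow> g \<in> Arr D \<Longrightarrow> \<beta> (Cod C f, Cod D g) \<cdot>\<^sub>T fm S (f, g) =
      fm S' (f, g) \<cdot>\<^sub>T \<beta> (Dom C f, Dom D g)"
    "\<And>c m d. c \<in> Ob C \<Longrightarrow> m \<in> Ob M \<Longrightarrow> d \<in> Ob D \<Longrightarrow>
      eps S' (c, m, d) \<cdot>\<^sub>T \<beta> (m \<bullet>\<^bsub>A\<^esub> c, d) = \<beta> (c, m \<bullet>\<^bsub>B\<^esub> d) \<cdot>\<^sub>T eps S (c, m, d)"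
  defines "\<xi> \<equiv> lift_trans M C D T U \<lparr>Src = S, Tgt = S', Cmp = restrict \<beta> (Ob C \<times> Ob D)\<rparr>"
  shows "nat_trans T T H H' \<xi>" "\<And>x. x \<in> Ob C \<times> Ob D \<Longrightarrow> \<xi> (fo U x) = \<beta> x"
proof -
  have H': "cat_functor T T H" "cat_functor T T H'" using H by (simp_all add: Ob_Cat)
  have "\<exists>\<xi>. nat_trans T T H H' \<xi> \<and> (\<forall>c\<in>Ob C. \<forall>d\<in>Ob D. \<xi> (fo U (c, d)) = \<beta> (c, d))"
  proof (rule nat_lift[OF H'])
    have S: "fo S (c, d) = fo H (fo U (c, d))" "fo S' (c, d) = fo H' (fo U (c, d))"
      if "c \<in> Ob C" "d \<in> Ob D" for c d
      using that by (simp_all add: bal_comp_def flip: H(3,4))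
    have "fm S (f, g) = fm H (fm U (f, g))" "fm S' (f, g) = fm H' (fm U (f, g))"
      if "f \<in> Arr C" "g \<in> Arr D" for f g
      using that by (simp_all add: bal_comp_def flip: H(3,4))
    then show "\<beta> (Cod C f, Cod D g) \<cdot>\<^sub>T fm H (fm U (f, g)) = fm H' (fm U (f, g)) \<cdot>\<^sub>T \<beta> (Dom C f, Dom D g)"
      if "f \<in> Arr C" "g \<in> Arr D" for f g
      using \<beta>(2)[OF that] that by simp
    have "eps S (c, m, d) = fm H (eps U (c, m, d))" "eps S' (c, m, d) = fm H' (eps U (c, m, d))"
      if "c \<in> Ob C" "m \<in> Ob M" "d \<in> Ob D" for c m d
      using that by (simp_all add: bal_comp_def flip: H(3,4))
    then show "fm H' (eps U (c, m, d)) \<cdot>\<^sub>T \<beta> (m \<bullet>\<^bsub>A\<^esub> c, d) = \<beta> (c, m \<bullet>\<^bsub>B\<^esub> d) \<cdot>\<^sub>T fm H (eps U (c, m, d))"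
      if "c \<in> Ob C" "m \<in> Ob M" "d \<in> Ob D" for c m d
      using \<beta>(3)[OF that] that by simp
    show "\<beta> (c, d) \<in> Arr T \<and> Dom T (\<beta> (c, d)) = fo H (fo U (c, d)) \<and> Cod T (\<beta> (c, d)) = fo H' (fo U (c, d))"
      if "c \<in> Ob C" "d \<in> Ob D" for c d
      using \<beta>(1)[OF that] S[OF that] by simp
  qed
  then obtain \<zeta> where \<zeta>: "nat_trans T T H H' \<zeta>" "\<And>c d. c \<in> Ob C \<Longrightarrow> d \<in> Ob D \<Longrightarrow> \<zeta> (fo U (c, d)) = \<beta> (c, d)"
    by blast
  let ?\<sigma> = "\<lparr>Src = H, Tgt = H', Cmp = restrict \<zeta> (Ob T)\<rparr>"
  have \<sigma>: "?\<sigma> \<in> Arr (Cat T T)"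
    using H(1,2) \<zeta>(1) by (simp add: Cat_def Arr_fun_cat nat_trans_iff)
  have "(\<lambda>x\<in>Ob C \<times> Ob D. restrict \<zeta> (Ob T) (fo U x)) = restrict \<beta> (Ob C \<times> Ob D)"
    using \<zeta>(2) by (intro restrict_ext) auto
  then have eq: "fm (bal_comp_functor M C D U) ?\<sigma> = \<lparr>Src = S, Tgt = S', Cmp = restrict \<beta> (Ob C \<times> Ob D)\<rparr>"
    using H(3,4) by (simp add: bal_comp_functor_def)
  have "inj_on (fm (bal_comp_functor M C D U)) (Arr (Cat T T))"
    using bal_comp_arr_bij by (simp add: bij_betw_def)
  from inv_into_f_f[OF this \<sigma>] have \<xi>: "\<xi> = restrict \<zeta> (Ob T)"
    unfolding \<xi>_def lift_trans_def eq by simp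
  show "nat_trans T T H H' \<xi>" using \<zeta>(1) unfolding \<xi> by (simp add: nat_trans_iff)
  show "\<xi> (fo U x) = \<beta> x" if "x \<in> Ob C \<times> Ob D" for x using that \<zeta>(2) unfolding \<xi> by auto
qed

lemma nat_eqI':
  fixes H H' :: "('to, 'ta, 'to, 'ta) fctr"
  assumes H: "cat_functor T T H" "cat_functor T T H'"
    and \<xi>: "nat_trans T T H H' \<xi>" "nat_trans T T H H' \<xi>'"
    and eq: "\<And>x. x \<in> Ob C \<times> Ob D \<Longrightarrow> \<xi> (fo U x) = \<xi>' (fo U x)" and t: "t \<in> Ob T"
  shows "\<xi> t = \<xi>' t"
  by (rule nat_eqI[OF H \<xi> _ t]) (simp add: eq)

lemma nat_isoI':
  fixes H H' :: "('to, 'ta, 'to, 'ta) fctr"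
  assumes H: "cat_functor T T H" "cat_functor T T H'"
    and \<xi>: "nat_trans T T H H' \<xi>"
    and eq: "\<And>x. x \<in> Ob C \<times> Ob D \<Longrightarrow> iso_arr T (\<xi> (fo U x))" and t: "t \<in> Ob T"
  shows "iso_arr T (\<xi> t)"
  by (rule nat_isoI[OF H \<xi> _ t]) (simp add: eq)

end

text \<open>Common to both actions on \<open>T\<close>: as a functor, \<open>gen k\<close> is
  \<open>U\<close> after \<open>k \<bullet> -\<close> for an action \<open>G\<close> on the product
  category. The balancing of \<open>gen k\<close> is left open, since it differs between the left
  and the right case.\<close>

locale gen_functors = tensor_self M C A D B T U + G: left_actegory K "prod_cat C D" G
  for M :: "('mo, 'ma) monoidal"
    and C :: "('co, 'ca, 'z1) cat_scheme" and A :: "('mo, 'ma, 'co, 'ca) action"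
    and D :: "('do, 'da, 'z2) cat_scheme" and B :: "('mo, 'ma, 'do, 'da) action"
    and T :: "('to, 'ta) cat" and U :: "('co, 'ca, 'do, 'da, 'mo, 'to, 'ta) bal"
    and K :: "('ko, 'ka) monoidal" and G :: "('ko, 'ka, 'co \<times> 'do, 'ca \<times> 'da) action" +
  fixes gen :: "'ko \<Rightarrow> ('co, 'ca, 'do, 'da, 'mo, 'to, 'ta) bal"
  assumes gen_in: "k \<in> Ob K \<Longrightarrow> gen k \<in> Ob (Bal M C A D B T)"
    and gen_fo: "k \<in> Ob K \<Longrightarrow> x \<in> Ob C \<times> Ob D \<Longrightarrow> fo (gen k) x = fo U (k \<bullet>\<^bsub>G\<^esub> x)"
    and gen_fm: "k \<in> Ob K \<Longrightarrow> f \<in> Arr C \<times> Arr D \<Longrightarrow> fm (gen k) f = fm U (Id K k \<odot>\<^bsub>G\<^esub> f)"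
begin

text \<open>\<open>prod_cat_simps\<close> rewrites the carriers of \<open>prod_cat C D\<close> to
  set products, so the facts are restated in that form.\<close>

lemmas PC_simps [simp] = U.F.A.id_arr(1) [unfolded prod_cat_simps(1,2)] U.F.A.comp_arr(1) [unfolded prod_cat_simps(1,2)]
  U.F.A.Dom_in [unfolded prod_cat_simps(1,2)] U.F.A.Cod_in [unfolded prod_cat_simps(1,2)]
  G.act_ob [unfolded prod_cat_simps(1,2)] G.act_arr(1) [unfolded prod_cat_simps(1,2)]
  G.eta_arr(1) [unfolded prod_cat_simps(1,2)] G.mu_arr(1) [unfolded prod_cat_simps(1,2)]

abbreviation "L k \<equiv> lift_fun M C D T U (gen k)"

lemma L_in: assumes "k \<in> Ob K" shows "L k \<in> Ob (Cat T T)" "bal_comp M C D U (L k) = gen k"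
proof -
  have "gen k \<in> bal_comp M C D U ` Ob (Cat T T)"
    using gen_in[OF assms] bal_comp_bij by (simp add: bij_betw_def)
  then show "L k \<in> Ob (Cat T T)" "bal_comp M C D U (L k) = gen k"
    by (simp_all add: lift_fun_def bal_comp_functor_def inv_into_into f_inv_into_f)
qed

lemma L_functor: "k \<in> Ob K \<Longrightarrow> cat_functor T T (L k)"
  using L_in by (simp add: Ob_Cat)

lemma L_simps [simp]:
  assumes "k \<in> Ob K"
  shows "t \<in> Ob T \<Longrightarrow> fo (L k) t \<in> Ob T" "f \<in> Arr T \<Longrightarrow> fm (L k) f \<in> Arr T"
    "f \<in> Arr T \<Longrightarrow> Dom T (fm (L k) f) = fo (L k) (Dom T f)"
    "f \<in> Arr T \<Longrightarrow> Cod T (fm (L k) f) = fo (L k) (Cod T f)"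
    "t \<in> Ob T \<Longrightarrow> fm (L k) (Id T t) = Id T (fo (L k) t)"
    "f \<in> Arr T \<Longrightarrow> g \<in> Arr T \<Longrightarrow> Cod T f = Dom T g \<Longrightarrow> fm (L k) (g \<cdot>\<^sub>T f) = fm (L k) g \<cdot>\<^sub>T fm (L k) f"
    "iso_arr T f \<Longrightarrow> iso_arr T (fm (L k) f)"
proof -
  interpret cat_functor T T "L k" by (rule L_functor[OF assms])
  show "t \<in> Ob T \<Longrightarrow> fo (L k) t \<in> Ob T" "f \<in> Arr T \<Longrightarrow> fm (L k) f \<in> Arr T"
    "f \<in> Arr T \<Longrightarrow> Dom T (fm (L k) f) = fo (L k) (Dom T f)"
    "f \<in> Arr T \<Longrightarrow> Cod T (fm (L k) f) = fo (L k) (Cod T f)"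
    "t \<in> Ob T \<Longrightarrow> fm (L k) (Id T t) = Id T (fo (L k) t)"
    "f \<in> Arr T \<Longrightarrow> g \<in> Arr T \<Longrightarrow> Cod T f = Dom T g \<Longrightarrow> fm (L k) (g \<cdot>\<^sub>T f) = fm (L k) g \<cdot>\<^sub>T fm (L k) f"
    "iso_arr T f \<Longrightarrow> iso_arr T (fm (L k) f)"
    by simp_all
qed

text \<open>On generators the lifted functor acts by \<open>G\<close>; with this rule a test at
  \<open>U x\<close> becomes an equation in the product category under \<open>U\<close>.\<close>

lemma L_U [simp]:
  assumes "k \<in> Ob K"
  shows "x \<in> Ob C \<times> Ob D \<Longrightarrow> fo (L k) (fo U x) = fo U (k \<bullet>\<^bsub>G\<^esub> x)"
    "f \<in> Arr C \<times> Arr D \<Longrightarrow> fm (L k) (fm U f) = fm U (Id K k \<odot>\<^bsub>G\<^esub> f)"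
proof -
  have "fo (bal_comp M C D U (L k)) x = fo (L k) (fo U x)" if "x \<in> Ob C \<times> Ob D"
    using that by (simp add: bal_comp_def)
  then show "x \<in> Ob C \<times> Ob D \<Longrightarrow> fo (L k) (fo U x) = fo U (k \<bullet>\<^bsub>G\<^esub> x)"
    using gen_fo[OF assms] by (simp add: L_in(2)[OF assms])
  have "fm (bal_comp M C D U (L k)) f = fm (L k) (fm U f)" if "f \<in> Arr C \<times> Arr D"
    using that by (simp add: bal_comp_def)
  then show "f \<in> Arr C \<times> Arr D \<Longrightarrow> fm (L k) (fm U f) = fm U (Id K k \<odot>\<^bsub>G\<^esub> f)"
    using gen_fm[OF assms] by (simp add: L_in(2)[OF assms])
qed

text \<open>By construction the lift sends the balancing of \<open>U\<close> to that of
  \<open>gen k\<close>. This is where the bimodulators of \<open>C\<close> and \<open>D\<close> will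
  enter.\<close>

lemma L_eps:
  assumes "k \<in> Ob K" "c \<in> Ob C" "m \<in> Ob M" "d \<in> Ob D"
  shows "fm (L k) (eps U (c, m, d)) = eps (gen k) (c, m, d)"
proof -
  have "eps (bal_comp M C D U (L k)) (c, m, d) = fm (L k) (eps U (c, m, d))"
    using assms by (simp add: bal_comp_def)
  then show ?thesis by (simp add: L_in(2)[OF assms(1)])
qed

end

text \<open>The first three assumptions identify the data on generators with the image under
  \<open>U\<close> of the structure of \<open>G\<close>; the last three say that these families are
  balanced, which the action \<open>G\<close> alone does not provide.\<close>

locale gen_action = gen_functors M C A D B T U K G gen
  for M :: "('mo, 'ma) monoidal"
    and C :: "('co, 'ca, 'z1) cat_scheme" and A :: "('mo, 'ma, 'co, 'ca) action"
    and D :: "('do, 'da, 'z2) cat_scheme" and B :: "('mo, 'ma, 'do, 'da) action"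
    and T :: "('to, 'ta) cat" and U :: "('co, 'ca, 'do, 'da, 'mo, 'to, 'ta) bal"
    and K :: "('ko, 'ka) monoidal" and G :: "('ko, 'ka, 'co \<times> 'do, 'ca \<times> 'da) action"
    and gen :: "'ko \<Rightarrow> ('co, 'ca, 'do, 'da, 'mo, 'to, 'ta) bal" +
  fixes ga :: "'ka \<Rightarrow> 'co \<times> 'do \<Rightarrow> 'ta" and ge :: "'co \<times> 'do \<Rightarrow> 'ta" and gm :: "'ko \<Rightarrow> 'ko \<Rightarrow> 'co \<times> 'do \<Rightarrow> 'ta"
  assumes ga: "f \<in> Arr K \<Longrightarrow> x \<in> Ob C \<times> Ob D \<Longrightarrow> ga f x = fm U (f \<odot>\<^bsub>G\<^esub> Id (prod_cat C D) x)"
    and ge: "x \<in> Ob C \<times> Ob D \<Longrightarrow> ge x = fm U (eta G x)"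
    and gm: "k \<in> Ob K \<Longrightarrow> k' \<in> Ob K \<Longrightarrow> x \<in> Ob C \<times> Ob D \<Longrightarrow> gm k k' x = fm U (mu G k k' x)"
    and ga_bal: "f \<in> Arr K \<Longrightarrow> c \<in> Ob C \<Longrightarrow> m \<in> Ob M \<Longrightarrow> d \<in> Ob D \<Longrightarrow>
      eps (gen (Cod K f)) (c, m, d) \<cdot>\<^sub>T ga f (m \<bullet>\<^bsub>A\<^esub> c, d) = ga f (c, m \<bullet>\<^bsub>B\<^esub> d) \<cdot>\<^sub>T eps (gen (Dom K f)) (c, m, d)"
    and ge_bal: "c \<in> Ob C \<Longrightarrow> m \<in> Ob M \<Longrightarrow> d \<in> Ob D \<Longrightarrow>
      eps (gen j\<^bsub>K\<^esub>) (c, m, d) \<cdot>\<^sub>T ge (m \<bullet>\<^bsub>A\<^esub> c, d) = ge (c, m \<bullet>\<^bsub>B\<^esub> d) \<cdot>\<^sub>T eps U (c, m, d)"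
    and gm_bal: "k \<in> Ob K \<Longrightarrow> k' \<in> Ob K \<Longrightarrow> c \<in> Ob C \<Longrightarrow> m \<in> Ob M \<Longrightarrow> d \<in> Ob D \<Longrightarrow>
      eps (gen (k \<otimes>\<^bsub>K\<^esub> k')) (c, m, d) \<cdot>\<^sub>T gm k k' (m \<bullet>\<^bsub>A\<^esub> c, d) =
      gm k k' (c, m \<bullet>\<^bsub>B\<^esub> d) \<cdot>\<^sub>T fm (L k) (eps (gen k') (c, m, d))"
begin

abbreviation "ACT \<equiv> induced_action M C D T U K gen ga ge gm"

text \<open>The action on arrows of \<open>T\<close> factors into a functor in the variable of
  \<open>T\<close> and this transformation in the variable of \<open>K\<close>, so the two can be
  lifted separately.\<close>

definition act_trans :: "'ka \<Rightarrow> 'to \<Rightarrow> 'ta" where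
  "act_trans f = lift_trans M C D T U \<lparr>Src = gen (Dom K f), Tgt = gen (Cod K f), Cmp = restrict (ga f) (Ob C \<times> Ob D)\<rparr>"

lemma ACT_o [simp]: "k \<bullet>\<^bsub>ACT\<^esub> t = fo (L k) t"
  by (simp add: induced_action_def)

lemma ACT_a: "f \<odot>\<^bsub>ACT\<^esub> g = act_trans f (Cod T g) \<cdot>\<^sub>T fm (L (Dom K f)) g"
  by (simp add: induced_action_def act_trans_def)

lemma act_trans_nat:
  assumes f: "f \<in> Arr K"
  shows "nat_trans T T (L (Dom K f)) (L (Cod K f)) (act_trans f)"
    "\<And>x. x \<in> Ob C \<times> Ob D \<Longrightarrow> act_trans f (fo U x) = fm U (f \<odot>\<^bsub>G\<^esub> Id (prod_cat C D) x)"
proof -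
  \<comment> \<open>Interchange in the product category: both sides are \<open>U\<close> of the
    joint action of \<open>f\<close> and \<open>g\<close>.\<close>
  have *: "fm U (f \<odot>\<^bsub>G\<^esub> Id (prod_cat C D) (Cod (prod_cat C D) g)) \<cdot>\<^sub>T fm U (Id K (Dom K f) \<odot>\<^bsub>G\<^esub> g) =
      fm U (Id K (Cod K f) \<odot>\<^bsub>G\<^esub> g) \<cdot>\<^sub>T fm U (f \<odot>\<^bsub>G\<^esub> Id (prod_cat C D) (Dom (prod_cat C D) g))"
    if "g \<in> Arr C \<times> Arr D" for g
    using f that by (simp add: G.act_merge flip: U.F.fm_comp)
  have 1: "ga f (c, d) \<in> Arr T \<and> Dom T (ga f (c, d)) = fo (gen (Dom K f)) (c, d) \<and>
      Cod T (ga f (c, d)) = fo (gen (Cod K f)) (c, d)" if "c \<in> Ob C" "d \<in> Ob D" for c d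
    using f that by (simp add: ga gen_fo del: prod_cat_simps(5))
  have 2: "ga f (Cod C g, Cod D h) \<cdot>\<^sub>T fm (gen (Dom K f)) (g, h) =
      fm (gen (Cod K f)) (g, h) \<cdot>\<^sub>T ga f (Dom C g, Dom D h)" if "g \<in> Arr C" "h \<in> Arr D" for g h
    using f that *[of "(g, h)"] by (simp add: ga gen_fm)
  note n = lift_trans_nat[OF L_in(1)[of "Dom K f"] L_in(1)[of "Cod K f"] L_in(2) L_in(2) 1 2 ga_bal[OF f], folded act_trans_def]
  show "nat_trans T T (L (Dom K f)) (L (Cod K f)) (act_trans f)" using n(1) f by simp
  show "act_trans f (fo U x) = fm U (f \<odot>\<^bsub>G\<^esub> Id (prod_cat C D) x)" if "x \<in> Ob C \<times> Ob D" for x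
    using n(2) f that by (simp add: ga)
qed

lemma act_trans_arr [simp]:
  assumes "f \<in> Arr K" "t \<in> Ob T"
  shows "act_trans f t \<in> Arr T" "Dom T (act_trans f t) = fo (L (Dom K f)) t" "Cod T (act_trans f t) = fo (L (Cod K f)) t"
  using act_trans_nat(1)[OF assms(1)] assms(2) by (simp_all add: nat_trans_iff)

lemma act_trans_natural: "f \<in> Arr K \<Longrightarrow> g \<in> Arr T \<Longrightarrow> t = Cod T g \<Longrightarrow>
    act_trans f t \<cdot>\<^sub>T fm (L (Dom K f)) g = fm (L (Cod K f)) g \<cdot>\<^sub>T act_trans f (Dom T g)"
  using act_trans_nat(1)[of f] by (simp add: nat_trans_iff)

declare act_trans_nat(2) [simp]

text \<open>The source is \<open>id_fctr T\<close>, being the lift of \<open>U\<close>; the family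
  on generators is balanced by \<open>ge_bal\<close>.\<close>

lemma eta_nat_trans: "nat_trans T T (id_fctr T) (L j\<^bsub>K\<^esub>) (eta ACT)"
  and eta_U [simp]: "\<And>x. x \<in> Ob C \<times> Ob D \<Longrightarrow> eta ACT (fo U x) = fm U (eta G x)"
proof -
  have eq: "eta ACT = lift_trans M C D T U \<lparr>Src = U, Tgt = gen j\<^bsub>K\<^esub>, Cmp = restrict ge (Ob C \<times> Ob D)\<rparr>"
    by (simp add: induced_action_def)
  have *: "fm U (eta G (Cod (prod_cat C D) g)) \<cdot>\<^sub>T fm U g =
      fm U (Id K j\<^bsub>K\<^esub> \<odot>\<^bsub>G\<^esub> g) \<cdot>\<^sub>T fm U (eta G (Dom (prod_cat C D) g))"
    if "g \<in> Arr C \<times> Arr D" for g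
    using that by (simp add: G.eta_natural flip: U.F.fm_comp)
  have 1: "ge (c, d) \<in> Arr T \<and> Dom T (ge (c, d)) = fo U (c, d) \<and>
      Cod T (ge (c, d)) = fo (gen j\<^bsub>K\<^esub>) (c, d)" if "c \<in> Ob C" "d \<in> Ob D" for c d
    using that by (simp add: ge gen_fo)
  have 2: "ge (Cod C g, Cod D h) \<cdot>\<^sub>T fm U (g, h) = fm (gen j\<^bsub>K\<^esub>) (g, h) \<cdot>\<^sub>T ge (Dom C g, Dom D h)"
    if "g \<in> Arr C" "h \<in> Arr D" for g h
    using that *[of "(g, h)"] by (simp add: ge gen_fm)
  note n = lift_trans_nat[OF id_fctr_in L_in(1)[of "j\<^bsub>K\<^esub>"] bal_comp_id_fctr L_in(2) 1 2 ge_bal, folded eq]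
  show "nat_trans T T (id_fctr T) (L j\<^bsub>K\<^esub>) (eta ACT)" using n(1) by simp
  show "eta ACT (fo U x) = fm U (eta G x)" if "x \<in> Ob C \<times> Ob D" for x
    using n(2) that by (simp add: ge)
qed

lemma eta_ACT_arr [simp]:
  assumes "t \<in> Ob T"
  shows "eta ACT t \<in> Arr T" "Dom T (eta ACT t) = t" "Cod T (eta ACT t) = fo (L j\<^bsub>K\<^esub>) t"
  using eta_nat_trans assms by (simp_all add: nat_trans_iff)

lemma eta_ACT_natural: "g \<in> Arr T \<Longrightarrow> t = Cod T g \<Longrightarrow>
    eta ACT t \<cdot>\<^sub>T g = fm (L j\<^bsub>K\<^esub>) g \<cdot>\<^sub>T eta ACT (Dom T g)"
  using eta_nat_trans by (simp add: nat_trans_iff)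

text \<open>The composite of \<open>L k\<close> after \<open>L k'\<close> is the lift of
  \<open>gen k'\<close> followed by \<open>L k\<close>, so the family \<open>gm k k'\<close> lifts
  to a transformation out of the composite functor.\<close>

lemma mu_nat_trans:
  assumes k: "k \<in> Ob K" "k' \<in> Ob K"
  shows "nat_trans T T (comp_fctr T (L k) (L k')) (L (k \<otimes>\<^bsub>K\<^esub> k')) (mu ACT k k')"
    "\<And>x. x \<in> Ob C \<times> Ob D \<Longrightarrow> mu ACT k k' (fo U x) = fm U (mu G k k' x)"
proof -
  let ?S = "bal_comp M C D (gen k') (L k)"
  have eq: "mu ACT k k' = lift_trans M C D T U \<lparr>Src = ?S, Tgt = gen (k \<otimes>\<^bsub>K\<^esub> k'), Cmp = restrict (gm k k') (Ob C \<times> Ob D)\<rparr>"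
    by (simp add: induced_action_def)
  have *: "fm U (mu G k k' (Cod (prod_cat C D) g)) \<cdot>\<^sub>T fm U (Id K k \<odot>\<^bsub>G\<^esub> Id K k' \<odot>\<^bsub>G\<^esub> g) =
      fm U (Id K (k \<otimes>\<^bsub>K\<^esub> k') \<odot>\<^bsub>G\<^esub> g) \<cdot>\<^sub>T fm U (mu G k k' (Dom (prod_cat C D) g))"
    if "g \<in> Arr C \<times> Arr D" for g
    using k that by (simp add: G.mu_natural flip: U.F.fm_comp)
  have 0: "comp_fctr T (L k) (L k') \<in> Ob (Cat T T)"
    using cat_functor_comp_fctr[OF L_functor[OF k(2)] L_functor[OF k(1)]] by (simp add: Ob_Cat)
  have src: "bal_comp M C D U (comp_fctr T (L k) (L k')) = ?S"
    using k by (auto simp: bal_comp_def L_eps[symmetric] gen_fo gen_fm intro!: restrict_ext)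
  have 1: "gm k k' (c, d) \<in> Arr T \<and> Dom T (gm k k' (c, d)) = fo ?S (c, d) \<and>
      Cod T (gm k k' (c, d)) = fo (gen (k \<otimes>\<^bsub>K\<^esub> k')) (c, d)" if "c \<in> Ob C" "d \<in> Ob D" for c d
    using k that by (simp add: gm gen_fo bal_comp_def)
  have 2: "gm k k' (Cod C g, Cod D h) \<cdot>\<^sub>T fm ?S (g, h) = fm (gen (k \<otimes>\<^bsub>K\<^esub> k')) (g, h) \<cdot>\<^sub>T gm k k' (Dom C g, Dom D h)"
    if "g \<in> Arr C" "h \<in> Arr D" for g h
    using k that *[of "(g, h)"] by (simp add: gm gen_fm bal_comp_def)
  have 3: "eps (gen (k \<otimes>\<^bsub>K\<^esub> k')) (c, m, d) \<cdot>\<^sub>T gm k k' (m \<bullet>\<^bsub>A\<^esub> c, d) = gm k k' (c, m \<bullet>\<^bsub>B\<^esub> d) \<cdot>\<^sub>T eps ?S (c, m, d)"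
    if "c \<in> Ob C" "m \<in> Ob M" "d \<in> Ob D" for c m d
    using gm_bal[OF k that] that by (simp add: bal_comp_def)
  note n = lift_trans_nat[OF 0 L_in(1)[of "k \<otimes>\<^bsub>K\<^esub> k'"] src L_in(2) 1 2 3, folded eq]
  show "nat_trans T T (comp_fctr T (L k) (L k')) (L (k \<otimes>\<^bsub>K\<^esub> k')) (mu ACT k k')" using n(1) k by simp
  show "mu ACT k k' (fo U x) = fm U (mu G k k' x)" if "x \<in> Ob C \<times> Ob D" for x
    using n(2) k that by (simp add: gm)
qed

declare mu_nat_trans(2) [simp]

lemma mu_ACT_arr [simp]:
  assumes "k \<in> Ob K" "k' \<in> Ob K" "t \<in> Ob T"
  shows "mu ACT k k' t \<in> Arr T" "Dom T (mu ACT k k' t) = fo (L k) (fo (L k') t)"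
    "Cod T (mu ACT k k' t) = fo (L (k \<otimes>\<^bsub>K\<^esub> k')) t"
  using mu_nat_trans(1)[OF assms(1,2)] assms(3) by (simp_all add: nat_trans_iff)

lemma mu_ACT_natural: "k \<in> Ob K \<Longrightarrow> k' \<in> Ob K \<Longrightarrow> g \<in> Arr T \<Longrightarrow> t = Cod T g \<Longrightarrow>
    mu ACT k k' t \<cdot>\<^sub>T fm (L k) (fm (L k') g) = fm (L (k \<otimes>\<^bsub>K\<^esub> k')) g \<cdot>\<^sub>T mu ACT k k' (Dom T g)"
  using mu_nat_trans(1)[of k k'] by (simp add: nat_trans_iff)

lemma act_trans_Id [simp]:
  assumes "k \<in> Ob K" "t \<in> Ob T" shows "act_trans (Id K k) t = Id T (fo (L k) t)"
  by (rule nat_eqI'[OF L_functor[of k] L_functor[of k] _ _ _ assms(2)])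
    (use assms(1) act_trans_nat(1)[of "Id K k"] in \<open>simp_all add: nat_trans_iff\<close>)

lemma act_trans_comp:
  assumes "f \<in> Arr K" "g \<in> Arr K" "Cod K f = Dom K g" "t \<in> Ob T"
  shows "act_trans (g \<cdot>\<^bsub>K\<^esub> f) t = act_trans g t \<cdot>\<^sub>T act_trans f t"
  by (rule nat_eqI'[OF L_functor[of "Dom K f"] L_functor[of "Cod K g"] _ _ _ assms(4)])
    (use assms(1-3) act_trans_nat(1)[of "g \<cdot>\<^bsub>K\<^esub> f"] act_trans_natural[of f] U.F.B.pre[OF act_trans_natural[of g]] in
      \<open>simp_all add: nat_trans_iff\<close>)

text \<open>Naturality of \<open>mu\<close> in \<open>K\<close> is not part of the lift, where the
  two objects of \<open>K\<close> are fixed. On generators it reduces to \<open>mu_natural\<close>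
  of \<open>G\<close> at an identity arrow.\<close>

lemma act_trans_mu:
  assumes "f \<in> Arr K" "g \<in> Arr K" "t \<in> Ob T"
  shows "mu ACT (Cod K f) (Cod K g) t \<cdot>\<^sub>T act_trans f (fo (L (Cod K g)) t) \<cdot>\<^sub>T fm (L (Dom K f)) (act_trans g t) =
    act_trans (f \<boxtimes>\<^bsub>K\<^esub> g) t \<cdot>\<^sub>T mu ACT (Dom K f) (Dom K g) t"
proof (rule nat_eqI'[OF cat_functor_comp_fctr[OF L_functor[of "Dom K g"] L_functor[of "Dom K f"]]
      L_functor[of "Cod K f \<otimes>\<^bsub>K\<^esub> Cod K g"] _ _ _ assms(3)])
  have L: "fm (L (Dom K f)) (act_trans g y) \<cdot>\<^sub>T fm (L (Dom K f)) (fm (L (Dom K g)) h) =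
     fm (L (Dom K f)) (fm (L (Cod K g)) h) \<cdot>\<^sub>T fm (L (Dom K f)) (act_trans g (Dom T h))"
    if "h \<in> Arr T" "y = Cod T h" for h y
    using assms that act_trans_natural[of g h y] by (simp flip: L_simps(6))
  show "nat_trans T T (comp_fctr T (L (Dom K f)) (L (Dom K g))) (L (Cod K f \<otimes>\<^bsub>K\<^esub> Cod K g))
    (\<lambda>t. mu ACT (Cod K f) (Cod K g) t \<cdot>\<^sub>T act_trans f (fo (L (Cod K g)) t) \<cdot>\<^sub>T fm (L (Dom K f)) (act_trans g t))"
    using assms by (simp add: nat_trans_iff L U.F.B.pre[OF act_trans_natural] U.F.B.pre[OF mu_ACT_natural])
  show "nat_trans T T (comp_fctr T (L (Dom K f)) (L (Dom K g))) (L (Cod K f \<otimes>\<^bsub>K\<^esub> Cod K g))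
    (\<lambda>t. act_trans (f \<boxtimes>\<^bsub>K\<^esub> g) t \<cdot>\<^sub>T mu ACT (Dom K f) (Dom K g) t)"
    using assms act_trans_natural[of "f \<boxtimes>\<^bsub>K\<^esub> g"] U.F.B.pre[OF act_trans_natural[of "f \<boxtimes>\<^bsub>K\<^esub> g"]]
    by (simp add: nat_trans_iff mu_ACT_natural)
  fix x assume x: "x \<in> Ob C \<times> Ob D"
  have "fm U (mu G (Cod K f) (Cod K g) x \<cdot>\<^bsub>prod_cat C D\<^esub> (f \<odot>\<^bsub>G\<^esub> Id (prod_cat C D) (Cod K g \<bullet>\<^bsub>G\<^esub> x))
      \<cdot>\<^bsub>prod_cat C D\<^esub> (Id K (Dom K f) \<odot>\<^bsub>G\<^esub> g \<odot>\<^bsub>G\<^esub> Id (prod_cat C D) x)) =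
    fm U (((f \<boxtimes>\<^bsub>K\<^esub> g) \<odot>\<^bsub>G\<^esub> Id (prod_cat C D) x) \<cdot>\<^bsub>prod_cat C D\<^esub> mu G (Dom K f) (Dom K g) x)"
    using assms x by (simp add: G.act_merge G.mu_natural del: U.F.fm_comp)
  then show "mu ACT (Cod K f) (Cod K g) (fo U x) \<cdot>\<^sub>T act_trans f (fo (L (Cod K g)) (fo U x)) \<cdot>\<^sub>T fm (L (Dom K f)) (act_trans g (fo U x)) =
    act_trans (f \<boxtimes>\<^bsub>K\<^esub> g) (fo U x) \<cdot>\<^sub>T mu ACT (Dom K f) (Dom K g) (fo U x)"
    using assms x by simp
qed (use assms in simp_all)

text \<open>Both sides are natural between the same two functors, and on generators they are
  \<open>U\<close> of the two sides of \<open>act_assoc\<close> for \<open>G\<close>. The unit laws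
  below follow the same pattern.\<close>

lemma ACT_assoc:
  assumes "m \<in> Ob K" "n \<in> Ob K" "p \<in> Ob K" "t \<in> Ob T"
  shows "act_trans (alpha K m n p) t \<cdot>\<^sub>T mu ACT (m \<otimes>\<^bsub>K\<^esub> n) p t \<cdot>\<^sub>T mu ACT m n (fo (L p) t) =
      mu ACT m (n \<otimes>\<^bsub>K\<^esub> p) t \<cdot>\<^sub>T fm (L m) (mu ACT n p t)"
proof (rule nat_eqI'[OF cat_functor_comp_fctr[OF cat_functor_comp_fctr[OF L_functor[of p] L_functor[of n]] L_functor[of m]]
      L_functor[of "m \<otimes>\<^bsub>K\<^esub> (n \<otimes>\<^bsub>K\<^esub> p)"] _ _ _ assms(4)])
  have L: "fm (L m) (mu ACT n p y) \<cdot>\<^sub>T fm (L m) (fm (L n) (fm (L p) h)) =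
     fm (L m) (fm (L (n \<otimes>\<^bsub>K\<^esub> p)) h) \<cdot>\<^sub>T fm (L m) (mu ACT n p (Dom T h))"
    if "h \<in> Arr T" "y = Cod T h" for h y
    using assms that mu_ACT_natural[of n p h y] by (simp flip: L_simps(6))
  show "nat_trans T T (comp_fctr T (L m) (comp_fctr T (L n) (L p))) (L (m \<otimes>\<^bsub>K\<^esub> (n \<otimes>\<^bsub>K\<^esub> p)))
    (\<lambda>t. mu ACT m (n \<otimes>\<^bsub>K\<^esub> p) t \<cdot>\<^sub>T fm (L m) (mu ACT n p t))"
    using assms by (simp add: nat_trans_iff L U.F.B.pre[OF mu_ACT_natural])
  show "nat_trans T T (comp_fctr T (L m) (comp_fctr T (L n) (L p))) (L (m \<otimes>\<^bsub>K\<^esub> (n \<otimes>\<^bsub>K\<^esub> p)))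
    (\<lambda>t. act_trans (alpha K m n p) t \<cdot>\<^sub>T mu ACT (m \<otimes>\<^bsub>K\<^esub> n) p t \<cdot>\<^sub>T mu ACT m n (fo (L p) t))"
    using assms U.F.B.pre[OF act_trans_natural[of "alpha K m n p"]]
    by (simp add: nat_trans_iff mu_ACT_natural U.F.B.pre[OF mu_ACT_natural])
  fix x assume x: "x \<in> Ob C \<times> Ob D"
  have "fm U ((alpha K m n p \<odot>\<^bsub>G\<^esub> Id (prod_cat C D) x) \<cdot>\<^bsub>prod_cat C D\<^esub> mu G (m \<otimes>\<^bsub>K\<^esub> n) p x \<cdot>\<^bsub>prod_cat C D\<^esub> mu G m n (p \<bullet>\<^bsub>G\<^esub> x)) =
    fm U (mu G m (n \<otimes>\<^bsub>K\<^esub> p) x \<cdot>\<^bsub>prod_cat C D\<^esub> (Id K m \<odot>\<^bsub>G\<^esub> mu G n p x))"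
    using assms x by (simp only: G.act_assoc prod_cat_simps)
  then show "act_trans (alpha K m n p) (fo U x) \<cdot>\<^sub>T mu ACT (m \<otimes>\<^bsub>K\<^esub> n) p (fo U x) \<cdot>\<^sub>T mu ACT m n (fo (L p) (fo U x)) =
      mu ACT m (n \<otimes>\<^bsub>K\<^esub> p) (fo U x) \<cdot>\<^sub>T fm (L m) (mu ACT n p (fo U x))"
    using assms x by simp
qed (use assms in simp_all)

lemma ACT_unit_left:
  assumes "m \<in> Ob K" "t \<in> Ob T"
  shows "mu ACT j\<^bsub>K\<^esub> m t \<cdot>\<^sub>T eta ACT (fo (L m) t) = act_trans (inv_arr K (lam K m)) t"
proof (rule nat_eqI'[OF L_functor[of m] L_functor[of "j\<^bsub>K\<^esub> \<otimes>\<^bsub>K\<^esub> m"] _ _ _ assms(2)])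
  show "nat_trans T T (L m) (L (j\<^bsub>K\<^esub> \<otimes>\<^bsub>K\<^esub> m)) (\<lambda>t. mu ACT j\<^bsub>K\<^esub> m t \<cdot>\<^sub>T eta ACT (fo (L m) t))"
    using assms by (simp add: nat_trans_iff eta_ACT_natural U.F.B.pre[OF mu_ACT_natural])
  show "nat_trans T T (L m) (L (j\<^bsub>K\<^esub> \<otimes>\<^bsub>K\<^esub> m)) (act_trans (inv_arr K (lam K m)))"
    using assms act_trans_nat(1)[of "inv_arr K (lam K m)"] by simp
  fix x assume x: "x \<in> Ob C \<times> Ob D"
  have "fm U (mu G j\<^bsub>K\<^esub> m x \<cdot>\<^bsub>prod_cat C D\<^esub> eta G (m \<bullet>\<^bsub>G\<^esub> x)) = fm U (inv_arr K (lam K m) \<odot>\<^bsub>G\<^esub> Id (prod_cat C D) x)"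
    using assms x by (simp only: G.act_unit_left prod_cat_simps)
  then show "mu ACT j\<^bsub>K\<^esub> m (fo U x) \<cdot>\<^sub>T eta ACT (fo (L m) (fo U x)) = act_trans (inv_arr K (lam K m)) (fo U x)"
    using assms x by simp
qed (use assms in simp_all)

lemma ACT_unit_right:
  assumes "m \<in> Ob K" "t \<in> Ob T"
  shows "mu ACT m j\<^bsub>K\<^esub> t \<cdot>\<^sub>T fm (L m) (eta ACT t) = act_trans (inv_arr K (rho K m)) t"
proof (rule nat_eqI'[OF L_functor[of m] L_functor[of "m \<otimes>\<^bsub>K\<^esub> j\<^bsub>K\<^esub>"] _ _ _ assms(2)])
  have L: "fm (L m) (eta ACT y) \<cdot>\<^sub>T fm (L m) h = fm (L m) (fm (L j\<^bsub>K\<^esub>) h) \<cdot>\<^sub>T fm (L m) (eta ACT (Dom T h))"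
    if "h \<in> Arr T" "y = Cod T h" for h y
    using assms that eta_ACT_natural[of h y] by (simp flip: L_simps(6))
  show "nat_trans T T (L m) (L (m \<otimes>\<^bsub>K\<^esub> j\<^bsub>K\<^esub>)) (\<lambda>t. mu ACT m j\<^bsub>K\<^esub> t \<cdot>\<^sub>T fm (L m) (eta ACT t))"
    using assms by (simp add: nat_trans_iff L U.F.B.pre[OF mu_ACT_natural])
  show "nat_trans T T (L m) (L (m \<otimes>\<^bsub>K\<^esub> j\<^bsub>K\<^esub>)) (act_trans (inv_arr K (rho K m)))"
    using assms act_trans_nat(1)[of "inv_arr K (rho K m)"] by simp
  fix x assume x: "x \<in> Ob C \<times> Ob D"
  have "fm U (mu G m j\<^bsub>K\<^esub> x \<cdot>\<^bsub>prod_cat C D\<^esub> (Id K m \<odot>\<^bsub>G\<^esub> eta G x)) = fm U (inv_arr K (rho K m) \<odot>\<^bsub>G\<^esub> Id (prod_cat C D) x)"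
    using assms x by (simp only: G.act_unit_right prod_cat_simps)
  then show "mu ACT m j\<^bsub>K\<^esub> (fo U x) \<cdot>\<^sub>T fm (L m) (eta ACT (fo U x)) = act_trans (inv_arr K (rho K m)) (fo U x)"
    using assms x by simp
qed (use assms in simp_all)

lemma ACT_Id [simp]: "k \<in> Ob K \<Longrightarrow> g \<in> Arr T \<Longrightarrow> Id K k \<odot>\<^bsub>ACT\<^esub> g = fm (L k) g"
  by (simp add: ACT_a)

lemma ACT_tr [simp]: "f \<in> Arr K \<Longrightarrow> t \<in> Ob T \<Longrightarrow> f \<odot>\<^bsub>ACT\<^esub> Id T t = act_trans f t"
  by (simp add: ACT_a)

lemma left_actegory_induced: "left_actegory K T ACT"
proof (rule left_actegoryI)
  show "monoidal_category K" "category T" by unfold_locales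
  fix c assume c: "c \<in> Ob T"
  \<comment> \<open>Units and multiplicators are invertible on generators, being images under
    \<open>U\<close>; \<open>nat_isoI'\<close> extends this to all of \<open>T\<close>.\<close>
  show "iso_arr T (eta ACT c)"
    by (rule nat_isoI'[OF cat_functor_id_fctr L_functor eta_nat_trans _ c]) (simp_all add: U.F.B.category_axioms)
  fix m n assume "m \<in> Ob K" "n \<in> Ob K"
  with c show "iso_arr T (mu ACT m n c)"
    by (intro nat_isoI'[OF cat_functor_comp_fctr[OF L_functor L_functor] L_functor mu_nat_trans(1) _ c]) simp_all
next
  fix f g f' g' assume fg: "f \<in> Arr K" "f' \<in> Arr K" "g \<in> Arr T" "g' \<in> Arr T" "Cod K f = Dom K f'" "Cod T g = Dom T g'"
  then show "(f' \<cdot>\<^bsub>K\<^esub> f) \<odot>\<^bsub>ACT\<^esub> (g' \<cdot>\<^sub>T g) = (f' \<odot>\<^bsub>ACT\<^esub> g') \<cdot>\<^sub>T (f \<odot>\<^bsub>ACT\<^esub> g)"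
    using U.F.B.pre[OF act_trans_natural[of f g'], symmetric] by (simp add: ACT_a act_trans_comp)
next
  fix f g h assume fg: "f \<in> Arr K" "g \<in> Arr K" "h \<in> Arr T"
  \<comment> \<open>Naturality in three variables is split: \<open>act_trans_mu\<close> handles the
    arrows of \<open>K\<close>, \<open>mu_ACT_natural\<close> the arrow of \<open>T\<close>.\<close>
  have "mu ACT (Cod K f) (Cod K g) (Cod T h) \<cdot>\<^sub>T (f \<odot>\<^bsub>ACT\<^esub> g \<odot>\<^bsub>ACT\<^esub> h) =
    (mu ACT (Cod K f) (Cod K g) (Cod T h) \<cdot>\<^sub>T act_trans f (fo (L (Cod K g)) (Cod T h)) \<cdot>\<^sub>T fm (L (Dom K f)) (act_trans g (Cod T h)))
      \<cdot>\<^sub>T fm (L (Dom K f)) (fm (L (Dom K g)) h)"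
    using fg by (simp add: ACT_a)
  also have "\<dots> = (act_trans (f \<boxtimes>\<^bsub>K\<^esub> g) (Cod T h) \<cdot>\<^sub>T mu ACT (Dom K f) (Dom K g) (Cod T h)) \<cdot>\<^sub>T fm (L (Dom K f)) (fm (L (Dom K g)) h)"
    using fg by (subst act_trans_mu) simp_all
  also have "\<dots> = ((f \<boxtimes>\<^bsub>K\<^esub> g) \<odot>\<^bsub>ACT\<^esub> h) \<cdot>\<^sub>T mu ACT (Dom K f) (Dom K g) (Dom T h)"
    using fg by (simp add: ACT_a mu_ACT_natural)
  finally show "mu ACT (Cod K f) (Cod K g) (Cod T h) \<cdot>\<^sub>T (f \<odot>\<^bsub>ACT\<^esub> g \<odot>\<^bsub>ACT\<^esub> h) =
      ((f \<boxtimes>\<^bsub>K\<^esub> g) \<odot>\<^bsub>ACT\<^esub> h) \<cdot>\<^sub>T mu ACT (Dom K f) (Dom K g) (Dom T h)" .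
qed (simp_all add: ACT_assoc ACT_unit_left ACT_unit_right eta_ACT_natural, simp_all add: ACT_a)

end

section \<open>The biactegory structure on the tensor product\<close>

text \<open>Acting on one factor and trivially on the other puts the left action of \<open>C\<close>
  and the right action of \<open>D\<close> into the form required by \<open>gen_action\<close>, so
  that one construction serves both.\<close>

definition act_fst :: "('do, 'da, 'z) cat_scheme \<Rightarrow> ('mo, 'ma, 'co, 'ca) action \<Rightarrow> ('mo, 'ma, 'co \<times> 'do, 'ca \<times> 'da) action" where
  "act_fst D A = \<lparr>act_o = \<lambda>m (c, d). (m \<bullet>\<^bsub>A\<^esub> c, d), act_a = \<lambda>f (g, h). (f \<odot>\<^bsub>A\<^esub> g, h),
     eta = \<lambda>(c, d). (eta A c, Id D d), mu = \<lambda>m n (c, d). (mu A m n c, Id D d)\<rparr>"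

definition act_snd :: "('co, 'ca, 'z) cat_scheme \<Rightarrow> ('mo, 'ma, 'do, 'da) action \<Rightarrow> ('mo, 'ma, 'co \<times> 'do, 'ca \<times> 'da) action" where
  "act_snd C A = \<lparr>act_o = \<lambda>m (c, d). (c, m \<bullet>\<^bsub>A\<^esub> d), act_a = \<lambda>f (g, h). (g, f \<odot>\<^bsub>A\<^esub> h),
     eta = \<lambda>(c, d). (Id C c, eta A d), mu = \<lambda>m n (c, d). (Id C c, mu A m n d)\<rparr>"

lemma act_fst_simps [simp]:
  "m \<bullet>\<^bsub>act_fst D A\<^esub> (c, d) = (m \<bullet>\<^bsub>A\<^esub> c, d)" "f \<odot>\<^bsub>act_fst D A\<^esub> (g, h) = (f \<odot>\<^bsub>A\<^esub> g, h)"
  "eta (act_fst D A) (c, d) = (eta A c, Id D d)" "mu (act_fst D A) m n (c, d) = (mu A m n c, Id D d)"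
  by (simp_all add: act_fst_def)

lemma act_snd_simps [simp]:
  "m \<bullet>\<^bsub>act_snd C A\<^esub> (c, d) = (c, m \<bullet>\<^bsub>A\<^esub> d)" "f \<odot>\<^bsub>act_snd C A\<^esub> (g, h) = (g, f \<odot>\<^bsub>A\<^esub> h)"
  "eta (act_snd C A) (c, d) = (Id C c, eta A d)" "mu (act_snd C A) m n (c, d) = (Id C c, mu A m n d)"
  by (simp_all add: act_snd_def)

lemma left_actegory_fst:
  assumes "left_actegory K C A" "category D"
  shows "left_actegory K (prod_cat C D) (act_fst D A)"
proof -
  interpret A: left_actegory K C A by fact
  interpret D: category D by fact
  show ?thesis
    by (rule left_actegoryI)
      (auto simp: iso_arr_prod A.C.category_axioms D.category_axioms A.M.monoidal_category_axioms A.act_comp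
        A.eta_natural A.mu_natural A.act_assoc A.act_unit_left A.act_unit_right)
qed

lemma left_actegory_snd:
  assumes "left_actegory K D A" "category C"
  shows "left_actegory K (prod_cat C D) (act_snd C A)"
proof -
  interpret A: left_actegory K D A by fact
  interpret C: category C by fact
  show ?thesis
    by (rule left_actegoryI)
      (auto simp: iso_arr_prod A.C.category_axioms C.category_axioms A.M.monoidal_category_axioms A.act_comp
        A.eta_natural A.mu_natural A.act_assoc A.act_unit_left A.act_unit_right)
qed

locale tensor_data = C: biactegory N M C + D: biactegory M P D +
  tensor_self M C "Ract C" D "Lact D" T U
  for N :: "('no, 'na) monoidal" and M :: "('mo, 'ma) monoidal" and P :: "('po, 'pa) monoidal"
    and C :: "('no, 'na, 'mo, 'ma, 'co, 'ca) biact" and D :: "('mo, 'ma, 'po, 'pa, 'do, 'da) biact"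
    and T :: "('to, 'ta) cat" and U :: "('co, 'ca, 'do, 'da, 'mo, 'to, 'ta) bal"
begin

abbreviation comp_C (infixr \<open>\<cdot>\<^sub>C\<close> 65) where "comp_C \<equiv> Comp C"
abbreviation lact_C_o (infixr \<open>\<bullet>\<^sub>C\<close> 75) where "lact_C_o \<equiv> act_o (Lact C)"
abbreviation ract_C_o (infixr \<open>\<bullet>\<^sup>C\<close> 75) where "ract_C_o \<equiv> act_o (Ract C)"
abbreviation lact_C_a (infixr \<open>\<odot>\<^sub>C\<close> 75) where "lact_C_a \<equiv> act_a (Lact C)"
abbreviation ract_C_a (infixr \<open>\<odot>\<^sup>C\<close> 75) where "ract_C_a \<equiv> act_a (Ract C)"

abbreviation "lg \<equiv> lgen N M C D T U"
abbreviation "rg \<equiv> rgen M P C D T U"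

lemma lgen_simps [simp]:
  "c \<in> Ob C \<Longrightarrow> d \<in> Ob D \<Longrightarrow> fo (lg n) (c, d) = fo U (n \<bullet>\<^sub>C c, d)"
  "f \<in> Arr C \<Longrightarrow> g \<in> Arr D \<Longrightarrow> fm (lg n) (f, g) = fm U (Id N n \<odot>\<^sub>C f, g)"
  "c \<in> Ob C \<Longrightarrow> m \<in> Ob M \<Longrightarrow> d \<in> Ob D \<Longrightarrow> eps (lg n) (c, m, d) =
     eps U (n \<bullet>\<^sub>C c, m, d) \<cdot>\<^sub>T fm U (zeta C n c m, Id D d)"
  by (simp_all add: lgen_def)

lemma rgen_simps [simp]:
  "c \<in> Ob C \<Longrightarrow> d \<in> Ob D \<Longrightarrow> fo (rg p) (c, d) = fo U (c, p \<bullet>\<^bsub>Ract D\<^esub> d)"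
  "f \<in> Arr C \<Longrightarrow> g \<in> Arr D \<Longrightarrow> fm (rg p) (f, g) = fm U (f, Id P p \<odot>\<^bsub>Ract D\<^esub> g)"
  "c \<in> Ob C \<Longrightarrow> m \<in> Ob M \<Longrightarrow> d \<in> Ob D \<Longrightarrow> eps (rg p) (c, m, d) =
     fm U (Id C c, zeta D m d p) \<cdot>\<^sub>T eps U (c, m, p \<bullet>\<^bsub>Ract D\<^esub> d)"
  by (simp_all add: rgen_def)

text \<open>The balancing is that of \<open>U\<close> at \<open>n \<bullet> c\<close>, after the
  bimodulator of \<open>C\<close>. Its laws combine those of \<open>U\<close> with
  \<open>zeta_natural\<close>, \<open>zeta_right\<close> and \<open>zeta_unit_right\<close> of
  \<open>C\<close>.\<close>

lemma lgen_in:
  assumes n: "n \<in> Ob N" shows "lg n \<in> Ob (Bal M C (Ract C) D (Lact D) T)"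
proof -
  have "balanced_functor M C (Ract C) D (Lact D) T (lg n)"
  proof (rule balanced_functorI)
    show "left_actegory (mrev M) C (Ract C)" "left_actegory M D (Lact D)" by unfold_locales
    show "cat_functor (prod_cat C D) T (lg n)"
      using n by (intro cat_functorI)
        (auto simp: U.F.A.category_axioms U.F.B.category_axioms U.bi_comp C.L.act_comp_right)
  next
    fix f g h assume fgh: "f \<in> Arr C" "g \<in> Arr M" "h \<in> Arr D"
    have "eps U (n \<bullet>\<^sub>C Cod C f, Cod M g, Cod D h) \<cdot>\<^sub>T fm U (zeta C n (Cod C f) (Cod M g), Id D (Cod D h))
        \<cdot>\<^sub>T fm U (Id N n \<odot>\<^sub>C g \<odot>\<^sup>C f, h)
      = eps U (n \<bullet>\<^sub>C Cod C f, Cod M g, Cod D h) \<cdot>\<^sub>T fm U (g \<odot>\<^sup>C Id N n \<odot>\<^sub>C f, h)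
        \<cdot>\<^sub>T fm U (zeta C n (Dom C f) (Dom M g), Id D (Dom D h))"
      using n fgh by (simp add: U.bi_merge C.zeta_natural del: U.bi_comp_left U.bi_comp_right)
    also have "\<dots> = fm U (Id N n \<odot>\<^sub>C f, g \<odot>\<^bsub>Lact D\<^esub> h) \<cdot>\<^sub>T eps U (n \<bullet>\<^sub>C Dom C f, Dom M g, Dom D h)
        \<cdot>\<^sub>T fm U (zeta C n (Dom C f) (Dom M g), Id D (Dom D h))"
      using n fgh by (simp add: U.F.B.pre[OF U.eps_natural])
    finally show "eps (lg n) (Cod C f, Cod M g, Cod D h) \<cdot>\<^sub>T fm (lg n) (g \<odot>\<^sup>C f, h) =
      fm (lg n) (f, g \<odot>\<^bsub>Lact D\<^esub> h) \<cdot>\<^sub>T eps (lg n) (Dom C f, Dom M g, Dom D h)"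
      using n fgh by simp
  next
    fix c m m' d assume cd: "c \<in> Ob C" "m \<in> Ob M" "m' \<in> Ob M" "d \<in> Ob D"
    have z: "fm U (zeta C n c (m \<otimes>\<^bsub>M\<^esub> m'), Id D d) \<cdot>\<^sub>T fm U (Id N n \<odot>\<^sub>C mu (Ract C) m' m c, Id D d) =
      fm U (mu (Ract C) m' m (n \<bullet>\<^sub>C c), Id D d) \<cdot>\<^sub>T fm U (Id M m' \<odot>\<^sup>C zeta C n c m, Id D d)
       \<cdot>\<^sub>T fm U (zeta C n (m \<bullet>\<^sup>C c) m', Id D d)"
      using n cd C.zeta_right[of n c m m']
      by (simp flip: U.bi_comp_left)
    \<comment> \<open>Naturality of the balancing of \<open>U\<close> at a bimodulator, which lets
      the two bimodulators meet for \<open>zeta_right\<close>.\<close>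
    have e: "fm U (zeta C n c m, Id D (m' \<bullet>\<^bsub>Lact D\<^esub> d)) \<cdot>\<^sub>T eps U (n \<bullet>\<^sub>C m \<bullet>\<^sup>C c, m', d) =
       eps U (m \<bullet>\<^sup>C n \<bullet>\<^sub>C c, m', d) \<cdot>\<^sub>T fm U (Id M m' \<odot>\<^sup>C zeta C n c m, Id D d)"
      using n cd U.eps_natural[of "zeta C n c m" "Id M m'" "Id D d"] by simp
    have "fm U (Id C (n \<bullet>\<^sub>C c), mu (Lact D) m m' d) \<cdot>\<^sub>T eps U (n \<bullet>\<^sub>C c, m, m' \<bullet>\<^bsub>Lact D\<^esub> d) \<cdot>\<^sub>T
        fm U (zeta C n c m, Id D (m' \<bullet>\<^bsub>Lact D\<^esub> d)) \<cdot>\<^sub>T eps U (n \<bullet>\<^sub>C m \<bullet>\<^sup>C c, m', d) \<cdot>\<^sub>T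
        fm U (zeta C n (m \<bullet>\<^sup>C c) m', Id D d) =
      eps U (n \<bullet>\<^sub>C c, m \<otimes>\<^bsub>M\<^esub> m', d) \<cdot>\<^sub>T fm U (zeta C n c (m \<otimes>\<^bsub>M\<^esub> m'), Id D d) \<cdot>\<^sub>T
        fm U (Id N n \<odot>\<^sub>C mu (Ract C) m' m c, Id D d)"
      using n cd by (simp add: U.F.B.pre[OF e] U.F.B.pre3[OF U.eps_mu] z)
    then show "fm (lg n) (Id C c, mu (Lact D) m m' d) \<cdot>\<^sub>T eps (lg n) (c, m, m' \<bullet>\<^bsub>Lact D\<^esub> d) \<cdot>\<^sub>T eps (lg n) (m \<bullet>\<^sup>C c, m', d) =
      eps (lg n) (c, m \<otimes>\<^bsub>M\<^esub> m', d) \<cdot>\<^sub>T fm (lg n) (mu (Ract C) m' m c, Id D d)"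
      using n cd by simp
  next
    fix c d assume cd: "c \<in> Ob C" "d \<in> Ob D"
    have "fm U (zeta C n c j\<^bsub>M\<^esub>, Id D d) \<cdot>\<^sub>T fm U (Id N n \<odot>\<^sub>C eta (Ract C) c, Id D d) =
      fm U (eta (Ract C) (n \<bullet>\<^sub>C c), Id D d)"
      using n cd C.zeta_unit_right[of n c] by (simp flip: U.bi_comp_left)
    then show "eps (lg n) (c, j\<^bsub>M\<^esub>, d) \<cdot>\<^sub>T fm (lg n) (eta (Ract C) c, Id D d) = fm (lg n) (Id C c, eta (Lact D) d)"
      using n cd by (simp add: U.eps_eta)
  qed (use n in \<open>simp_all add: U.F.B.iso_comp\<close>)
  then show ?thesis by (simp add: Ob_Bal lgen_def)
qed

text \<open>The mirror image: the bimodulator of \<open>D\<close> comes after the balancing, and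
  \<open>zeta_natural\<close>, \<open>zeta_left\<close> and \<open>zeta_unit_left\<close> of
  \<open>D\<close> are used.\<close>

lemma rgen_in:
  assumes p: "p \<in> Ob P" shows "rg p \<in> Ob (Bal M C (Ract C) D (Lact D) T)"
proof -
  have "balanced_functor M C (Ract C) D (Lact D) T (rg p)"
  proof (rule balanced_functorI)
    show "left_actegory (mrev M) C (Ract C)" "left_actegory M D (Lact D)" by unfold_locales
    show "cat_functor (prod_cat C D) T (rg p)"
      using p by (intro cat_functorI)
        (auto simp: U.F.A.category_axioms U.F.B.category_axioms U.bi_comp)
  next
    fix f g h assume fgh: "f \<in> Arr C" "g \<in> Arr M" "h \<in> Arr D"
    have "fm U (Id C (Cod C f), zeta D (Cod M g) (Cod D h) p) \<cdot>\<^sub>T eps U (Cod C f, Cod M g, p \<bullet>\<^bsub>Ract D\<^esub> Cod D h)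
        \<cdot>\<^sub>T fm U (g \<odot>\<^sup>C f, Id P p \<odot>\<^bsub>Ract D\<^esub> h)
      = (fm U (Id C (Cod C f), zeta D (Cod M g) (Cod D h) p) \<cdot>\<^sub>T fm U (f, g \<odot>\<^bsub>Lact D\<^esub> Id P p \<odot>\<^bsub>Ract D\<^esub> h))
        \<cdot>\<^sub>T eps U (Dom C f, Dom M g, p \<bullet>\<^bsub>Ract D\<^esub> Dom D h)"
      using p fgh by (simp add: U.eps_natural)
    also have "fm U (Id C (Cod C f), zeta D (Cod M g) (Cod D h) p) \<cdot>\<^sub>T fm U (f, g \<odot>\<^bsub>Lact D\<^esub> Id P p \<odot>\<^bsub>Ract D\<^esub> h)
      = fm U (f, Id P p \<odot>\<^bsub>Ract D\<^esub> g \<odot>\<^bsub>Lact D\<^esub> h) \<cdot>\<^sub>T fm U (Id C (Dom C f), zeta D (Dom M g) (Dom D h) p)"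
      using p fgh by (simp add: U.bi_merge D.zeta_natural del: U.bi_comp_left U.bi_comp_right)
    finally show "eps (rg p) (Cod C f, Cod M g, Cod D h) \<cdot>\<^sub>T fm (rg p) (g \<odot>\<^sup>C f, h) =
      fm (rg p) (f, g \<odot>\<^bsub>Lact D\<^esub> h) \<cdot>\<^sub>T eps (rg p) (Dom C f, Dom M g, Dom D h)"
      using p fgh by simp
  next
    fix c m n d assume cd: "c \<in> Ob C" "m \<in> Ob M" "n \<in> Ob M" "d \<in> Ob D"
    have z: "fm U (Id C c, Id P p \<odot>\<^bsub>Ract D\<^esub> mu (Lact D) m n d) \<cdot>\<^sub>T fm U (Id C c, zeta D m (n \<bullet>\<^bsub>Lact D\<^esub> d) p)
       \<cdot>\<^sub>T fm U (Id C c, Id M m \<odot>\<^bsub>Lact D\<^esub> zeta D n d p) =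
      fm U (Id C c, zeta D (m \<otimes>\<^bsub>M\<^esub> n) d p) \<cdot>\<^sub>T fm U (Id C c, mu (Lact D) m n (p \<bullet>\<^bsub>Ract D\<^esub> d))"
      using p cd D.zeta_left[of m n d p] by (simp flip: U.bi_comp_right)
    have e: "eps U (c, m, p \<bullet>\<^bsub>Ract D\<^esub> n \<bullet>\<^bsub>Lact D\<^esub> d) \<cdot>\<^sub>T fm U (Id C (m \<bullet>\<^sup>C c), zeta D n d p) =
       fm U (Id C c, Id M m \<odot>\<^bsub>Lact D\<^esub> zeta D n d p) \<cdot>\<^sub>T eps U (c, m, n \<bullet>\<^bsub>Lact D\<^esub> p \<bullet>\<^bsub>Ract D\<^esub> d)"
      using p cd U.eps_natural[of "Id C c" "Id M m" "zeta D n d p"] by simp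
    have "fm U (Id C c, Id P p \<odot>\<^bsub>Ract D\<^esub> mu (Lact D) m n d) \<cdot>\<^sub>T fm U (Id C c, zeta D m (n \<bullet>\<^bsub>Lact D\<^esub> d) p) \<cdot>\<^sub>T
        eps U (c, m, p \<bullet>\<^bsub>Ract D\<^esub> n \<bullet>\<^bsub>Lact D\<^esub> d) \<cdot>\<^sub>T fm U (Id C (m \<bullet>\<^sup>C c), zeta D n d p) \<cdot>\<^sub>T
        eps U (m \<bullet>\<^sup>C c, n, p \<bullet>\<^bsub>Ract D\<^esub> d) =
      fm U (Id C c, zeta D (m \<otimes>\<^bsub>M\<^esub> n) d p) \<cdot>\<^sub>T eps U (c, m \<otimes>\<^bsub>M\<^esub> n, p \<bullet>\<^bsub>Ract D\<^esub> d) \<cdot>\<^sub>T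
        fm U (mu (Ract C) n m c, Id D (p \<bullet>\<^bsub>Ract D\<^esub> d))"
      using p cd by (simp add: U.F.B.pre[OF e] U.F.B.pre3[OF z] U.eps_mu)
    then show "fm (rg p) (Id C c, mu (Lact D) m n d) \<cdot>\<^sub>T eps (rg p) (c, m, n \<bullet>\<^bsub>Lact D\<^esub> d) \<cdot>\<^sub>T eps (rg p) (m \<bullet>\<^sup>C c, n, d) =
      eps (rg p) (c, m \<otimes>\<^bsub>M\<^esub> n, d) \<cdot>\<^sub>T fm (rg p) (mu (Ract C) n m c, Id D d)"
      using p cd by simp
  next
    fix c d assume cd: "c \<in> Ob C" "d \<in> Ob D"
    have "fm U (Id C c, zeta D j\<^bsub>M\<^esub> d p) \<cdot>\<^sub>T fm U (Id C c, eta (Lact D) (p \<bullet>\<^bsub>Ract D\<^esub> d)) =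
      fm U (Id C c, Id P p \<odot>\<^bsub>Ract D\<^esub> eta (Lact D) d)"
      using p cd D.zeta_unit_left[of d p] by (simp flip: U.bi_comp_right)
    then show "eps (rg p) (c, j\<^bsub>M\<^esub>, d) \<cdot>\<^sub>T fm (rg p) (eta (Ract C) c, Id D d) = fm (rg p) (Id C c, eta (Lact D) d)"
      using p cd by (simp add: U.eps_eta)
  qed (use p in \<open>simp_all add: U.F.B.iso_comp\<close>)
  then show ?thesis by (simp add: Ob_Bal rgen_def)
qed

end

section \<open>Balancedness of the action data on generators\<close>

context tensor_data
begin

abbreviation "GL \<equiv> act_fst D (Lact C)"
abbreviation "GR \<equiv> act_snd C (Ract D)"
abbreviation "gaL \<equiv> \<lambda>f (c, d). fm U (f \<odot>\<^sub>C Id C c, Id D d)"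
abbreviation "geL \<equiv> \<lambda>(c, d). fm U (eta (Lact C) c, Id D d)"
abbreviation "gmL \<equiv> \<lambda>n n' (c, d). fm U (mu (Lact C) n n' c, Id D d)"
abbreviation "gaR \<equiv> \<lambda>f (c, d). fm U (Id C c, f \<odot>\<^bsub>Ract D\<^esub> Id D d)"
abbreviation "geR \<equiv> \<lambda>(c, d). fm U (Id C c, eta (Ract D) d)"
abbreviation "gmR \<equiv> \<lambda>p p' (c, d). fm U (Id C c, mu (Ract D) p p' d)"

lemma gen_functors_L: "gen_functors M C (Ract C) D (Lact D) T U N GL lg"
proof (intro gen_functors.intro gen_functors_axioms.intro)
  show "tensor_self M C (Ract C) D (Lact D) T U" by unfold_locales
  show "left_actegory N (prod_cat C D) GL"
    by (rule left_actegory_fst) unfold_locales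
qed (auto simp: lgen_in)

lemma gen_functors_R: "gen_functors M C (Ract C) D (Lact D) T U (mrev P) GR rg"
proof (intro gen_functors.intro gen_functors_axioms.intro)
  show "tensor_self M C (Ract C) D (Lact D) T U" by unfold_locales
  show "left_actegory (mrev P) (prod_cat C D) GR"
    by (rule left_actegory_snd) unfold_locales
qed (auto simp: rgen_in)

text \<open>Balancedness of the three families uses the complementary axioms of the bimodulator of
  \<open>C\<close>: naturality in \<open>N\<close>, \<open>zeta_unit_left\<close> and
  \<open>zeta_left\<close>, each combined with naturality of the balancing of
  \<open>U\<close>.\<close>

lemma gen_action_L: "gen_action M C (Ract C) D (Lact D) T U N GL lg gaL geL gmL"
proof (intro gen_action.intro gen_action_axioms.intro)
  show "gen_functors M C (Ract C) D (Lact D) T U N GL lg" by (rule gen_functors_L)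
  interpret G: gen_functors M C "Ract C" D "Lact D" T U N GL lg by (rule gen_functors_L)
  {
    fix f c m d assume f: "f \<in> Arr N" "c \<in> Ob C" "m \<in> Ob M" "d \<in> Ob D"
    have z: "fm U (zeta C (Cod N f) c m, Id D d) \<cdot>\<^sub>T fm U (f \<odot>\<^sub>C Id C (m \<bullet>\<^sup>C c), Id D d) =
      fm U (Id M m \<odot>\<^sup>C f \<odot>\<^sub>C Id C c, Id D d) \<cdot>\<^sub>T fm U (zeta C (Dom N f) c m, Id D d)"
      using f C.zeta_natural[of f "Id C c" "Id M m"] by (simp flip: U.bi_comp_left)
    have e: "eps U (Cod N f \<bullet>\<^sub>C c, m, d) \<cdot>\<^sub>T fm U (Id M m \<odot>\<^sup>C f \<odot>\<^sub>C Id C c, Id D d) =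
      fm U (f \<odot>\<^sub>C Id C c, Id D (m \<bullet>\<^bsub>Lact D\<^esub> d)) \<cdot>\<^sub>T eps U (Dom N f \<bullet>\<^sub>C c, m, d)"
      using f U.eps_natural[of "f \<odot>\<^sub>C Id C c" "Id M m" "Id D d"] by simp
    show "eps (lg (Cod N f)) (c, m, d) \<cdot>\<^sub>T gaL f (m \<bullet>\<^sup>C c, d) = gaL f (c, m \<bullet>\<^bsub>Lact D\<^esub> d) \<cdot>\<^sub>T eps (lg (Dom N f)) (c, m, d)"
      using f by (simp add: z U.F.B.pre[OF e])
  next
    fix c m d assume f: "c \<in> Ob C" "m \<in> Ob M" "d \<in> Ob D"
    have z: "fm U (zeta C j\<^bsub>N\<^esub> c m, Id D d) \<cdot>\<^sub>T fm U (eta (Lact C) (m \<bullet>\<^sup>C c), Id D d) =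
      fm U (Id M m \<odot>\<^sup>C eta (Lact C) c, Id D d)"
      using f C.zeta_unit_left[of c m] by (simp flip: U.bi_comp_left)
    have e: "eps U (j\<^bsub>N\<^esub> \<bullet>\<^sub>C c, m, d) \<cdot>\<^sub>T fm U (Id M m \<odot>\<^sup>C eta (Lact C) c, Id D d) =
      fm U (eta (Lact C) c, Id D (m \<bullet>\<^bsub>Lact D\<^esub> d)) \<cdot>\<^sub>T eps U (c, m, d)"
      using f U.eps_natural[of "eta (Lact C) c" "Id M m" "Id D d"] by simp
    show "eps (lg j\<^bsub>N\<^esub>) (c, m, d) \<cdot>\<^sub>T geL (m \<bullet>\<^sup>C c, d) = geL (c, m \<bullet>\<^bsub>Lact D\<^esub> d) \<cdot>\<^sub>T eps U (c, m, d)"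
      using f by (simp add: z e)
  next
    fix n n' c m d assume f: "n \<in> Ob N" "n' \<in> Ob N" "c \<in> Ob C" "m \<in> Ob M" "d \<in> Ob D"
    have z: "fm U (zeta C (n \<otimes>\<^bsub>N\<^esub> n') c m, Id D d) \<cdot>\<^sub>T fm U (mu (Lact C) n n' (m \<bullet>\<^sup>C c), Id D d) =
      fm U (Id M m \<odot>\<^sup>C mu (Lact C) n n' c, Id D d) \<cdot>\<^sub>T fm U (zeta C n (n' \<bullet>\<^sub>C c) m, Id D d)
       \<cdot>\<^sub>T fm U (Id N n \<odot>\<^sub>C zeta C n' c m, Id D d)"
      using f C.zeta_left[of n n' c m] by (simp flip: U.bi_comp_left)
    have e: "eps U ((n \<otimes>\<^bsub>N\<^esub> n') \<bullet>\<^sub>C c, m, d) \<cdot>\<^sub>T fm U (Id M m \<odot>\<^sup>C mu (Lact C) n n' c, Id D d) =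
      fm U (mu (Lact C) n n' c, Id D (m \<bullet>\<^bsub>Lact D\<^esub> d)) \<cdot>\<^sub>T eps U (n \<bullet>\<^sub>C n' \<bullet>\<^sub>C c, m, d)"
      using f U.eps_natural[of "mu (Lact C) n n' c" "Id M m" "Id D d"] by simp
    show "eps (lg (n \<otimes>\<^bsub>N\<^esub> n')) (c, m, d) \<cdot>\<^sub>T gmL n n' (m \<bullet>\<^sup>C c, d) =
       gmL n n' (c, m \<bullet>\<^bsub>Lact D\<^esub> d) \<cdot>\<^sub>T fm (G.L n) (eps (lg n') (c, m, d))"
      using f by (simp add: z U.F.B.pre[OF e] G.L_eps)
  }
qed (auto split: prod.splits)

text \<open>Here the axioms on the \<open>P\<close> side of the bimodulator of \<open>D\<close> are
  used: naturality in \<open>P\<close>, \<open>zeta_unit_right\<close> and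
  \<open>zeta_right\<close>, the last with its objects interchanged because of
  \<open>mrev P\<close>.\<close>

lemma gen_action_R: "gen_action M C (Ract C) D (Lact D) T U (mrev P) GR rg gaR geR gmR"
proof (intro gen_action.intro gen_action_axioms.intro)
  show "gen_functors M C (Ract C) D (Lact D) T U (mrev P) GR rg" by (rule gen_functors_R)
  interpret G: gen_functors M C "Ract C" D "Lact D" T U "mrev P" GR rg by (rule gen_functors_R)
  {
    fix f c m d assume f': "f \<in> Arr (mrev P)" and cmd: "c \<in> Ob C" "m \<in> Ob M" "d \<in> Ob D"
    then have f: "f \<in> Arr P" "c \<in> Ob C" "m \<in> Ob M" "d \<in> Ob D" by simp_all
    have z: "fm U (Id C c, zeta D m d (Cod P f)) \<cdot>\<^sub>T fm U (Id C c, Id M m \<odot>\<^bsub>Lact D\<^esub> f \<odot>\<^bsub>Ract D\<^esub> Id D d) =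
      fm U (Id C c, f \<odot>\<^bsub>Ract D\<^esub> Id D (m \<bullet>\<^bsub>Lact D\<^esub> d)) \<cdot>\<^sub>T fm U (Id C c, zeta D m d (Dom P f))"
      using f D.zeta_natural[of "Id M m" "Id D d" f] by (simp flip: U.bi_comp_right)
    have e: "eps U (c, m, Cod P f \<bullet>\<^bsub>Ract D\<^esub> d) \<cdot>\<^sub>T fm U (Id C (m \<bullet>\<^sup>C c), f \<odot>\<^bsub>Ract D\<^esub> Id D d) =
      fm U (Id C c, Id M m \<odot>\<^bsub>Lact D\<^esub> f \<odot>\<^bsub>Ract D\<^esub> Id D d) \<cdot>\<^sub>T eps U (c, m, Dom P f \<bullet>\<^bsub>Ract D\<^esub> d)"
      using f U.eps_natural[of "Id C c" "Id M m" "f \<odot>\<^bsub>Ract D\<^esub> Id D d"] by simp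
    show "eps (rg (Cod (mrev P) f)) (c, m, d) \<cdot>\<^sub>T gaR f (m \<bullet>\<^sup>C c, d) =
        gaR f (c, m \<bullet>\<^bsub>Lact D\<^esub> d) \<cdot>\<^sub>T eps (rg (Dom (mrev P) f)) (c, m, d)"
      using f by (simp add: e U.F.B.pre[OF z])
  next
    fix c m d assume f: "c \<in> Ob C" "m \<in> Ob M" "d \<in> Ob D"
    have z: "fm U (Id C c, zeta D m d j\<^bsub>P\<^esub>) \<cdot>\<^sub>T fm U (Id C c, Id M m \<odot>\<^bsub>Lact D\<^esub> eta (Ract D) d) =
      fm U (Id C c, eta (Ract D) (m \<bullet>\<^bsub>Lact D\<^esub> d))"
      using f D.zeta_unit_right[of m d] by (simp flip: U.bi_comp_right)
    have e: "eps U (c, m, j\<^bsub>P\<^esub> \<bullet>\<^bsub>Ract D\<^esub> d) \<cdot>\<^sub>T fm U (Id C (m \<bullet>\<^sup>C c), eta (Ract D) d) =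
      fm U (Id C c, Id M m \<odot>\<^bsub>Lact D\<^esub> eta (Ract D) d) \<cdot>\<^sub>T eps U (c, m, d)"
      using f U.eps_natural[of "Id C c" "Id M m" "eta (Ract D) d"] by simp
    show "eps (rg j\<^bsub>mrev P\<^esub>) (c, m, d) \<cdot>\<^sub>T geR (m \<bullet>\<^sup>C c, d) = geR (c, m \<bullet>\<^bsub>Lact D\<^esub> d) \<cdot>\<^sub>T eps U (c, m, d)"
      using f by (simp add: e U.F.B.pre[OF z])
  next
    fix p p' c m d assume f': "p \<in> Ob (mrev P)" "p' \<in> Ob (mrev P)" and cmd: "c \<in> Ob C" "m \<in> Ob M" "d \<in> Ob D"
    then have f: "p \<in> Ob P" "p' \<in> Ob P" "c \<in> Ob C" "m \<in> Ob M" "d \<in> Ob D" by simp_all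
    have z: "fm U (Id C c, zeta D m d (p' \<otimes>\<^bsub>P\<^esub> p)) \<cdot>\<^sub>T fm U (Id C c, Id M m \<odot>\<^bsub>Lact D\<^esub> mu (Ract D) p p' d) =
      fm U (Id C c, mu (Ract D) p p' (m \<bullet>\<^bsub>Lact D\<^esub> d)) \<cdot>\<^sub>T fm U (Id C c, Id P p \<odot>\<^bsub>Ract D\<^esub> zeta D m d p')
       \<cdot>\<^sub>T fm U (Id C c, zeta D m (p' \<bullet>\<^bsub>Ract D\<^esub> d) p)"
      using f D.zeta_right[of m d p' p] by (simp flip: U.bi_comp_right)
    have e: "eps U (c, m, (p' \<otimes>\<^bsub>P\<^esub> p) \<bullet>\<^bsub>Ract D\<^esub> d) \<cdot>\<^sub>T fm U (Id C (m \<bullet>\<^sup>C c), mu (Ract D) p p' d) =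
      fm U (Id C c, Id M m \<odot>\<^bsub>Lact D\<^esub> mu (Ract D) p p' d) \<cdot>\<^sub>T eps U (c, m, p \<bullet>\<^bsub>Ract D\<^esub> p' \<bullet>\<^bsub>Ract D\<^esub> d)"
      using f U.eps_natural[of "Id C c" "Id M m" "mu (Ract D) p p' d"] by simp
    show "eps (rg (p \<otimes>\<^bsub>mrev P\<^esub> p')) (c, m, d) \<cdot>\<^sub>T gmR p p' (m \<bullet>\<^sup>C c, d) =
       gmR p p' (c, m \<bullet>\<^bsub>Lact D\<^esub> d) \<cdot>\<^sub>T fm (G.L p) (eps (rg p') (c, m, d))"
      using f by (simp add: e U.F.B.pre[OF z] G.L_eps)
  }
qed (auto split: prod.splits)

end

sublocale tensor_data \<subseteq> LG: gen_action M C "Ract C" D "Lact D" T U N "act_fst D (Lact C)" "lgen N M C D T U"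
  "\<lambda>f (c, d). fm U (f \<odot>\<^bsub>Lact C\<^esub> Id C c, Id D d)" "\<lambda>(c, d). fm U (eta (Lact C) c, Id D d)"
  "\<lambda>n n' (c, d). fm U (mu (Lact C) n n' c, Id D d)"
  by (rule gen_action_L)

sublocale tensor_data \<subseteq> RG: gen_action M C "Ract C" D "Lact D" T U "mrev P" "act_snd C (Ract D)" "rgen M P C D T U"
  "\<lambda>f (c, d). fm U (Id C c, f \<odot>\<^bsub>Ract D\<^esub> Id D d)" "\<lambda>(c, d). fm U (Id C c, eta (Ract D) d)"
  "\<lambda>p p' (c, d). fm U (Id C c, mu (Ract D) p p' d)"
  by (rule gen_action_R)

section \<open>Strict commutation of the two actions on the tensor product\<close>

context tensor_data
begin

abbreviation "TB \<equiv> tensor_biact N M P C D T U"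

lemma TB_simps [simp]:
  "Ob TB = Ob T" "Arr TB = Arr T" "Dom TB = Dom T" "Cod TB = Cod T" "Id TB = Id T" "Comp TB = Comp T"
  "iso_arr TB = iso_arr T" "inv_arr TB = inv_arr T" "hom TB = hom T" "category TB = category T"
  "left_actegory K TB A = left_actegory K T A" "cat_functor TB Y F = cat_functor T Y F"
  by (simp_all add: tensor_biact_def cat_functor_def cat_functor_axioms_def)

lemma TB_act: "Lact TB = LG.ACT" "Ract TB = RG.ACT"
  by (simp_all add: tensor_biact_def cat.extend_def)

lemmas RG_simps [simp] = RG.L_simps [unfolded mrev_simps] RG.L_U [unfolded mrev_simps]
  RG.act_trans_arr [unfolded mrev_simps] RG.act_trans_nat(2) [unfolded mrev_simps]
  RG.eta_ACT_arr [unfolded mrev_simps] RG.mu_ACT_arr [unfolded mrev_simps] RG.mu_nat_trans(2) [unfolded mrev_simps]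
  RG.act_trans_Id [unfolded mrev_simps] RG.ACT_Id [unfolded mrev_simps] RG.ACT_tr [unfolded mrev_simps]
lemmas RG_L_functor = RG.L_functor [unfolded mrev_simps]
lemmas RG_tr_natural = RG.act_trans_natural [unfolded mrev_simps]
lemmas RG_mu_natural = RG.mu_ACT_natural [unfolded mrev_simps]
lemmas RG_eta_natural = RG.eta_ACT_natural [unfolded mrev_simps]

text \<open>In both orders \<open>(c, d)\<close> goes to
  \<open>U(n \<bullet> c, d \<star> p)\<close>, and the balancing is that of \<open>U\<close> there,
  preceded by the bimodulator of \<open>C\<close> and followed by that of \<open>D\<close>: the two
  live in different variables and do not interfere.\<close>

lemma gen_commute:
  assumes "n \<in> Ob N" "p \<in> Ob P"
  shows "bal_comp M C D (rg p) (LG.L n) = bal_comp M C D (lg n) (RG.L p)"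
  using assms by (auto simp: bal_comp_def LG.L_eps RG.L_eps intro!: restrict_ext)

lemma bal_comp_comp_fctr: "bal_comp M C D U (comp_fctr T G F) = bal_comp M C D (bal_comp M C D U F) G"
  by (auto simp: bal_comp_def intro!: restrict_ext)

text \<open>An equality of functors and not merely an isomorphism: both composites lift the same
  balanced functor, so uniqueness of lifts applies.\<close>

lemma L_commute:
  assumes "n \<in> Ob N" "p \<in> Ob P"
  shows "comp_fctr T (LG.L n) (RG.L p) = comp_fctr T (RG.L p) (LG.L n)"
proof (rule functor_eqI)
  show "cat_functor T T (comp_fctr T (LG.L n) (RG.L p))" "cat_functor T T (comp_fctr T (RG.L p) (LG.L n))"
    using assms by (simp_all add: cat_functor_comp_fctr[OF RG_L_functor LG.L_functor] cat_functor_comp_fctr[OF LG.L_functor RG_L_functor])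
  show "bal_comp M C D U (comp_fctr T (LG.L n) (RG.L p)) = bal_comp M C D U (comp_fctr T (RG.L p) (LG.L n))"
    using assms by (simp add: bal_comp_comp_fctr LG.L_in(2) RG.L_in(2) gen_commute)
qed simp_all

text \<open>Oriented so that the left translation ends up outermost.\<close>

lemma LR_commute [simp]:
  assumes "n \<in> Ob N" "p \<in> Ob P"
  shows "t \<in> Ob T \<Longrightarrow> fo (RG.L p) (fo (LG.L n) t) = fo (LG.L n) (fo (RG.L p) t)"
    "f \<in> Arr T \<Longrightarrow> fm (RG.L p) (fm (LG.L n) f) = fm (LG.L n) (fm (RG.L p) f)"
  using fun_cong[OF arg_cong[OF L_commute[OF assms], of fo], of t]
    fun_cong[OF arg_cong[OF L_commute[OF assms], of fm], of f] by simp_all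

lemma LR_functor: "n \<in> Ob N \<Longrightarrow> p \<in> Ob P \<Longrightarrow> cat_functor T T (comp_fctr T (LG.L n) (RG.L p))"
  by (rule cat_functor_comp_fctr[OF RG_L_functor LG.L_functor])

text \<open>By \<open>gen_commute\<close> the source and target of the family defining
  \<open>zeta\<close> coincide, and a family of identities lifts to identities.\<close>

lemma zeta_TB [simp]:
  assumes "n \<in> Ob N" "p \<in> Ob P" "t \<in> Ob T"
  shows "zeta TB n t p = Id T (fo (LG.L n) (fo (RG.L p) t))"
proof -
  let ?H = "comp_fctr T (LG.L n) (RG.L p)" and ?S = "bal_comp M C D (rg p) (LG.L n)"
    and ?\<beta> = "\<lambda>(c, d). Id T (fo U (n \<bullet>\<^sub>C c, p \<bullet>\<^bsub>Ract D\<^esub> d))"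
  note H = LR_functor[OF assms(1,2)]
  have S: "bal_comp M C D U ?H = ?S"
    using assms by (simp add: bal_comp_comp_fctr RG.L_in(2))
  have H_in: "?H \<in> Ob (Cat T T)" using H by (simp add: Ob_Cat)
  have 1: "?\<beta> (c, d) \<in> Arr T \<and> Dom T (?\<beta> (c, d)) = fo ?S (c, d) \<and> Cod T (?\<beta> (c, d)) = fo ?S (c, d)"
    if "c \<in> Ob C" "d \<in> Ob D" for c d
    using that assms by (simp add: bal_comp_def)
  have 2: "?\<beta> (Cod C f, Cod D g) \<cdot>\<^sub>T fm ?S (f, g) = fm ?S (f, g) \<cdot>\<^sub>T ?\<beta> (Dom C f, Dom D g)"
    if "f \<in> Arr C" "g \<in> Arr D" for f g
    using that assms by (simp add: bal_comp_def)
  have 3: "eps ?S (c, m, d) \<cdot>\<^sub>T ?\<beta> (m \<bullet>\<^sup>C c, d) = ?\<beta> (c, m \<bullet>\<^bsub>Lact D\<^esub> d) \<cdot>\<^sub>T eps ?S (c, m, d)"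
    if "c \<in> Ob C" "m \<in> Ob M" "d \<in> Ob D" for c m d
    using that assms by (simp add: bal_comp_def LG.L_eps)
  have eq: "zeta TB n = (\<lambda>t p. lift_trans M C D T U \<lparr>Src = bal_comp M C D (rg p) (LG.L n),
      Tgt = bal_comp M C D (lg n) (RG.L p), Cmp = restrict (\<lambda>(c, d). Id T (fo U (n \<bullet>\<^sub>C c, p \<bullet>\<^bsub>Ract D\<^esub> d))) (Ob C \<times> Ob D)\<rparr> t)"
    by (simp add: tensor_biact_def cat.extend_def)
  note \<zeta> = lift_trans_nat[OF H_in H_in S S 1 2 3]
  have "lift_trans M C D T U \<lparr>Src = ?S, Tgt = ?S, Cmp = restrict ?\<beta> (Ob C \<times> Ob D)\<rparr> t = Id T (fo (LG.L n) (fo (RG.L p) t))"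
    by (rule nat_eqI'[OF H H \<zeta>(1) _ _ assms(3)]) (use assms \<zeta>(2) in \<open>auto simp: nat_trans_iff\<close>)
  then show ?thesis using assms by (simp add: eq gen_commute)
qed

text \<open>On generators \<open>f\<close> and \<open>h\<close> act on different variables of
  \<open>U\<close>, so both sides are \<open>U\<close> of the same pair.\<close>

lemma act_trans_commute:
  assumes "f \<in> Arr N" "h \<in> Arr P" "t \<in> Ob T"
  shows "LG.act_trans f (fo (RG.L (Cod P h)) t) \<cdot>\<^sub>T fm (LG.L (Dom N f)) (RG.act_trans h t) =
    RG.act_trans h (fo (LG.L (Cod N f)) t) \<cdot>\<^sub>T fm (RG.L (Dom P h)) (LG.act_trans f t)"
proof (rule nat_eqI'[OF LR_functor[of "Dom N f" "Dom P h"] LR_functor[of "Cod N f" "Cod P h"] _ _ _ assms(3)])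
  have L: "fm (LG.L (Dom N f)) (RG.act_trans h y) \<cdot>\<^sub>T fm (LG.L (Dom N f)) (fm (RG.L (Dom P h)) g) =
     fm (LG.L (Dom N f)) (fm (RG.L (Cod P h)) g) \<cdot>\<^sub>T fm (LG.L (Dom N f)) (RG.act_trans h (Dom T g))"
    if "g \<in> Arr T" "y = Cod T g" for g y
    using assms that RG_tr_natural[of h g y] by (simp flip: LG.L_simps(6))
  show "nat_trans T T (comp_fctr T (LG.L (Dom N f)) (RG.L (Dom P h))) (comp_fctr T (LG.L (Cod N f)) (RG.L (Cod P h)))
    (\<lambda>t. LG.act_trans f (fo (RG.L (Cod P h)) t) \<cdot>\<^sub>T fm (LG.L (Dom N f)) (RG.act_trans h t))"
    using assms by (simp add: nat_trans_iff L U.F.B.pre[OF LG.act_trans_natural])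
  have R: "fm (RG.L (Dom P h)) (LG.act_trans f y) \<cdot>\<^sub>T fm (LG.L (Dom N f)) (fm (RG.L (Dom P h)) g) =
     fm (LG.L (Cod N f)) (fm (RG.L (Dom P h)) g) \<cdot>\<^sub>T fm (RG.L (Dom P h)) (LG.act_trans f (Dom T g))"
    if "g \<in> Arr T" "y = Cod T g" for g y
  proof -
    have "fm (RG.L (Dom P h)) (LG.act_trans f y \<cdot>\<^sub>T fm (LG.L (Dom N f)) g) =
     fm (RG.L (Dom P h)) (fm (LG.L (Cod N f)) g \<cdot>\<^sub>T LG.act_trans f (Dom T g))"
      using assms that by (simp only: LG.act_trans_natural)
    then show ?thesis using assms that by simp
  qed
  have R': "RG.act_trans h y \<cdot>\<^sub>T fm (LG.L n) (fm (RG.L (Dom P h)) g) =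
     fm (LG.L n) (fm (RG.L (Cod P h)) g) \<cdot>\<^sub>T RG.act_trans h (fo (LG.L n) (Dom T g))"
    if "g \<in> Arr T" "n \<in> Ob N" "y = fo (LG.L n) (Cod T g)" for g y n
    using RG_tr_natural[of h "fm (LG.L n) g" y] assms that by simp
  show "nat_trans T T (comp_fctr T (LG.L (Dom N f)) (RG.L (Dom P h))) (comp_fctr T (LG.L (Cod N f)) (RG.L (Cod P h)))
    (\<lambda>t. RG.act_trans h (fo (LG.L (Cod N f)) t) \<cdot>\<^sub>T fm (RG.L (Dom P h)) (LG.act_trans f t))"
    using assms by (simp add: nat_trans_iff R U.F.B.pre[OF R'])
  fix x assume "x \<in> Ob C \<times> Ob D"
  then obtain c d where x: "x = (c, d)" "c \<in> Ob C" "d \<in> Ob D" by auto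
  have "fm U (f \<odot>\<^sub>C Id C c, Id D (Cod P h \<bullet>\<^bsub>Ract D\<^esub> d)) \<cdot>\<^sub>T fm U (Id C (Dom N f \<bullet>\<^sub>C c), h \<odot>\<^bsub>Ract D\<^esub> Id D d) =
    fm U (Id C (Cod N f \<bullet>\<^sub>C c), h \<odot>\<^bsub>Ract D\<^esub> Id D d) \<cdot>\<^sub>T fm U (f \<odot>\<^sub>C Id C c, Id D (Dom P h \<bullet>\<^bsub>Ract D\<^esub> d))"
    using assms x by (simp add: U.bi_merge)
  then show "LG.act_trans f (fo (RG.L (Cod P h)) (fo U x)) \<cdot>\<^sub>T fm (LG.L (Dom N f)) (RG.act_trans h (fo U x)) =
    RG.act_trans h (fo (LG.L (Cod N f)) (fo U x)) \<cdot>\<^sub>T fm (RG.L (Dom P h)) (LG.act_trans f (fo U x))"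
    using assms x by simp
qed (use assms in simp_all)

text \<open>With an identity bimodulator this is the law \<open>zeta_left\<close> for
  \<open>T\<close>; the next three lemmas are the other coherence laws. Each compares two natural
  families that agree on generators, because structure and translation touch different variables of
  \<open>U\<close>.\<close>

lemma mu_L_commute:
  assumes "m \<in> Ob N" "n \<in> Ob N" "p \<in> Ob P" "t \<in> Ob T"
  shows "fm (RG.L p) (mu LG.ACT m n t) = mu LG.ACT m n (fo (RG.L p) t)"
proof (rule nat_eqI'[OF cat_functor_comp_fctr[OF LR_functor[of n p] LG.L_functor[of m]] LR_functor[of "m \<otimes>\<^bsub>N\<^esub> n" p] _ _ _ assms(4)])
  have R: "fm (RG.L p) (mu LG.ACT m n y) \<cdot>\<^sub>T fm (LG.L m) (fm (LG.L n) (fm (RG.L p) g)) =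
     fm (LG.L (m \<otimes>\<^bsub>N\<^esub> n)) (fm (RG.L p) g) \<cdot>\<^sub>T fm (RG.L p) (mu LG.ACT m n (Dom T g))"
    if "g \<in> Arr T" "y = Cod T g" for g y
  proof -
    have "fm (RG.L p) (mu LG.ACT m n y \<cdot>\<^sub>T fm (LG.L m) (fm (LG.L n) g)) =
     fm (RG.L p) (fm (LG.L (m \<otimes>\<^bsub>N\<^esub> n)) g \<cdot>\<^sub>T mu LG.ACT m n (Dom T g))"
      using assms that by (simp only: LG.mu_ACT_natural)
    then show ?thesis using assms that by simp
  qed
  show "nat_trans T T (comp_fctr T (LG.L m) (comp_fctr T (LG.L n) (RG.L p))) (comp_fctr T (LG.L (m \<otimes>\<^bsub>N\<^esub> n)) (RG.L p))
    (\<lambda>t. fm (RG.L p) (mu LG.ACT m n t))"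
    using assms by (simp add: nat_trans_iff R)
  show "nat_trans T T (comp_fctr T (LG.L m) (comp_fctr T (LG.L n) (RG.L p))) (comp_fctr T (LG.L (m \<otimes>\<^bsub>N\<^esub> n)) (RG.L p))
    (\<lambda>t. mu LG.ACT m n (fo (RG.L p) t))"
    using assms by (simp add: nat_trans_iff LG.mu_ACT_natural)
qed (use assms in auto)

lemma mu_R_commute:
  assumes "p \<in> Ob P" "q \<in> Ob P" "n \<in> Ob N" "t \<in> Ob T"
  shows "fm (LG.L n) (mu RG.ACT p q t) = mu RG.ACT p q (fo (LG.L n) t)"
proof (rule nat_eqI'[OF cat_functor_comp_fctr[OF cat_functor_comp_fctr[OF RG_L_functor[of q] RG_L_functor[of p]] LG.L_functor[of n]]
      LR_functor[of n "q \<otimes>\<^bsub>P\<^esub> p"] _ _ _ assms(4)])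
  have R: "fm (LG.L n) (mu RG.ACT p q y) \<cdot>\<^sub>T fm (LG.L n) (fm (RG.L p) (fm (RG.L q) g)) =
     fm (LG.L n) (fm (RG.L (q \<otimes>\<^bsub>P\<^esub> p)) g) \<cdot>\<^sub>T fm (LG.L n) (mu RG.ACT p q (Dom T g))"
    if "g \<in> Arr T" "y = Cod T g" for g y
    using assms that RG_mu_natural[of p q g y] by (simp flip: LG.L_simps(6))
  show "nat_trans T T (comp_fctr T (LG.L n) (comp_fctr T (RG.L p) (RG.L q))) (comp_fctr T (LG.L n) (RG.L (q \<otimes>\<^bsub>P\<^esub> p)))
    (\<lambda>t. fm (LG.L n) (mu RG.ACT p q t))"
    using assms by (simp add: nat_trans_iff R)
  have R': "mu RG.ACT p q y \<cdot>\<^sub>T fm (LG.L n) (fm (RG.L p) (fm (RG.L q) g)) =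
     fm (LG.L n) (fm (RG.L (q \<otimes>\<^bsub>P\<^esub> p)) g) \<cdot>\<^sub>T mu RG.ACT p q (fo (LG.L n) (Dom T g))"
    if "g \<in> Arr T" "y = fo (LG.L n) (Cod T g)" for g y
    using RG_mu_natural[of p q "fm (LG.L n) g" y] assms that by simp
  show "nat_trans T T (comp_fctr T (LG.L n) (comp_fctr T (RG.L p) (RG.L q))) (comp_fctr T (LG.L n) (RG.L (q \<otimes>\<^bsub>P\<^esub> p)))
    (\<lambda>t. mu RG.ACT p q (fo (LG.L n) t))"
    using assms by (simp add: nat_trans_iff R')
qed (use assms in auto)

lemma eta_L_commute:
  assumes "p \<in> Ob P" "t \<in> Ob T"
  shows "fm (RG.L p) (eta LG.ACT t) = eta LG.ACT (fo (RG.L p) t)"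
proof (rule nat_eqI'[OF RG_L_functor[of p] LR_functor[of "j\<^bsub>N\<^esub>" p] _ _ _ assms(2)])
  have R: "fm (RG.L p) (eta LG.ACT y) \<cdot>\<^sub>T fm (RG.L p) g =
     fm (LG.L j\<^bsub>N\<^esub>) (fm (RG.L p) g) \<cdot>\<^sub>T fm (RG.L p) (eta LG.ACT (Dom T g))"
    if "g \<in> Arr T" "y = Cod T g" for g y
  proof -
    have "fm (RG.L p) (eta LG.ACT y \<cdot>\<^sub>T g) = fm (RG.L p) (fm (LG.L j\<^bsub>N\<^esub>) g \<cdot>\<^sub>T eta LG.ACT (Dom T g))"
      using assms that by (simp only: LG.eta_ACT_natural)
    then show ?thesis using assms that by simp
  qed
  show "nat_trans T T (RG.L p) (comp_fctr T (LG.L j\<^bsub>N\<^esub>) (RG.L p)) (\<lambda>t. fm (RG.L p) (eta LG.ACT t))"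
    using assms by (simp add: nat_trans_iff R)
  show "nat_trans T T (RG.L p) (comp_fctr T (LG.L j\<^bsub>N\<^esub>) (RG.L p)) (\<lambda>t. eta LG.ACT (fo (RG.L p) t))"
    using assms by (simp add: nat_trans_iff LG.eta_ACT_natural)
qed (use assms in auto)

lemma eta_R_commute:
  assumes "n \<in> Ob N" "t \<in> Ob T"
  shows "fm (LG.L n) (eta RG.ACT t) = eta RG.ACT (fo (LG.L n) t)"
proof (rule nat_eqI'[OF LG.L_functor[of n] LR_functor[of n "j\<^bsub>P\<^esub>"] _ _ _ assms(2)])
  have R: "fm (LG.L n) (eta RG.ACT y) \<cdot>\<^sub>T fm (LG.L n) g =
     fm (LG.L n) (fm (RG.L j\<^bsub>P\<^esub>) g) \<cdot>\<^sub>T fm (LG.L n) (eta RG.ACT (Dom T g))"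
    if "g \<in> Arr T" "y = Cod T g" for g y
    using assms that RG_eta_natural[of g y] by (simp flip: LG.L_simps(6))
  show "nat_trans T T (LG.L n) (comp_fctr T (LG.L n) (RG.L j\<^bsub>P\<^esub>)) (\<lambda>t. fm (LG.L n) (eta RG.ACT t))"
    using assms by (simp add: nat_trans_iff R)
  have R': "eta RG.ACT y \<cdot>\<^sub>T fm (LG.L n) g = fm (LG.L n) (fm (RG.L j\<^bsub>P\<^esub>) g) \<cdot>\<^sub>T eta RG.ACT (fo (LG.L n) (Dom T g))"
    if "g \<in> Arr T" "y = fo (LG.L n) (Cod T g)" for g y
    using RG_eta_natural[of "fm (LG.L n) g" y] assms that by simp
  show "nat_trans T T (LG.L n) (comp_fctr T (LG.L n) (RG.L j\<^bsub>P\<^esub>)) (\<lambda>t. eta RG.ACT (fo (LG.L n) t))"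
    using assms by (simp add: nat_trans_iff R')
qed (use assms in auto)

lemma biactegory_tensor: "biactegory N P TB"
proof (rule biactegoryI)
  show "left_actegory N TB (Lact TB)" "left_actegory (mrev P) TB (Ract TB)"
    using LG.left_actegory_induced RG.left_actegory_induced by (simp_all add: TB_act)
  show "monoidal_category P" by unfold_locales
  fix f g h assume f: "f \<in> Arr N" "g \<in> Arr TB" "h \<in> Arr P"
  then have g: "g \<in> Arr T" by simp
  \<comment> \<open>Each action on arrows is a transformation after a lifted functor;
    \<open>act_trans_commute\<close> exchanges the transformations, \<open>LR_commute\<close> the
    functors.\<close>
  have R: "RG.act_trans h (fo (LG.L (Cod N f)) (Cod T g)) \<cdot>\<^sub>T fm (RG.L (Dom P h)) (LG.act_trans f (Cod T g)) \<cdot>\<^sub>T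
      fm (RG.L (Dom P h)) (fm (LG.L (Dom N f)) g) =
    LG.act_trans f (fo (RG.L (Cod P h)) (Cod T g)) \<cdot>\<^sub>T fm (LG.L (Dom N f)) (RG.act_trans h (Cod T g)) \<cdot>\<^sub>T
      fm (LG.L (Dom N f)) (fm (RG.L (Dom P h)) g)"
    using f g U.F.B.pre[OF act_trans_commute[of f h "Cod T g", symmetric], of "fm (LG.L (Dom N f)) (fm (RG.L (Dom P h)) g)"] by simp
  show "zeta TB (Cod N f) (Cod TB g) (Cod P h) \<cdot>\<^bsub>TB\<^esub> (f \<odot>\<^bsub>Lact TB\<^esub> h \<odot>\<^bsub>Ract TB\<^esub> g) =
      (h \<odot>\<^bsub>Ract TB\<^esub> f \<odot>\<^bsub>Lact TB\<^esub> g) \<cdot>\<^bsub>TB\<^esub> zeta TB (Dom N f) (Dom TB g) (Dom P h)"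
    using f g R by (simp add: TB_act LG.ACT_a RG.ACT_a)
qed (simp_all add: TB_act mu_L_commute mu_R_commute eta_L_commute eta_R_commute)

end

section \<open>Categories of bilinear functors\<close>

text \<open>Stated for arbitrary biactegories, since it is used both for functors from
  \<open>T\<close> to \<open>E\<close> and for functors from \<open>C\<close> to the functor
  biactegory.\<close>

locale act_cat = X: biactegory N P X + Y: biactegory N P Y
  for N :: "('no, 'na) monoidal" and P :: "('po, 'pa) monoidal"
    and X :: "('no, 'na, 'po, 'pa, 'xo, 'xa) biact" and Y :: "('no, 'na, 'po, 'pa, 'yo, 'ya) biact"
begin

abbreviation "AC \<equiv> Act N P X Y"

lemma AC_simps [simp]:
  "Dom AC = Src" "Cod AC = Tgt"
  "Id AC F = \<lparr>Src = F, Tgt = F, Cmp = \<lambda>x\<in>Ob X. Id Y (fo F x)\<rparr>"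
  "\<tau> \<cdot>\<^bsub>AC\<^esub> \<sigma> = \<lparr>Src = Src \<sigma>, Tgt = Tgt \<tau>, Cmp = \<lambda>x\<in>Ob X. Cmp \<tau> x \<cdot>\<^bsub>Y\<^esub> Cmp \<sigma> x\<rparr>"
  by (simp_all add: Act_def)

lemma Ob_AC_I:
  assumes "cat_functor X Y F" "fo F \<in> extensional (Ob X)" "fm F \<in> extensional (Arr X)"
    "bl F \<in> extensional (Ob N \<times> Ob X)" "br F \<in> extensional (Ob X \<times> Ob P)"
    and "\<And>n x. n \<in> Ob N \<Longrightarrow> x \<in> Ob X \<Longrightarrow> iso_arr Y (bl F (n, x)) \<and> Dom Y (bl F (n, x)) = n \<bullet>\<^bsub>Lact Y\<^esub> fo F x \<and>
      Cod Y (bl F (n, x)) = fo F (n \<bullet>\<^bsub>Lact X\<^esub> x)"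
    and "\<And>f g. f \<in> Arr N \<Longrightarrow> g \<in> Arr X \<Longrightarrow> bl F (Cod N f, Cod X g) \<cdot>\<^bsub>Y\<^esub> (f \<odot>\<^bsub>Lact Y\<^esub> fm F g) =
      fm F (f \<odot>\<^bsub>Lact X\<^esub> g) \<cdot>\<^bsub>Y\<^esub> bl F (Dom N f, Dom X g)"
    and "\<And>m n x. m \<in> Ob N \<Longrightarrow> n \<in> Ob N \<Longrightarrow> x \<in> Ob X \<Longrightarrow>
      fm F (mu (Lact X) m n x) \<cdot>\<^bsub>Y\<^esub> bl F (m, n \<bullet>\<^bsub>Lact X\<^esub> x) \<cdot>\<^bsub>Y\<^esub> (Id N m \<odot>\<^bsub>Lact Y\<^esub> bl F (n, x)) =
      bl F (m \<otimes>\<^bsub>N\<^esub> n, x) \<cdot>\<^bsub>Y\<^esub> mu (Lact Y) m n (fo F x)"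
    and "\<And>x. x \<in> Ob X \<Longrightarrow> bl F (j\<^bsub>N\<^esub>, x) \<cdot>\<^bsub>Y\<^esub> eta (Lact Y) (fo F x) = fm F (eta (Lact X) x)"
    and "\<And>p x. p \<in> Ob P \<Longrightarrow> x \<in> Ob X \<Longrightarrow> iso_arr Y (br F (x, p)) \<and> Dom Y (br F (x, p)) = p \<bullet>\<^bsub>Ract Y\<^esub> fo F x \<and>
      Cod Y (br F (x, p)) = fo F (p \<bullet>\<^bsub>Ract X\<^esub> x)"
    and "\<And>f g. f \<in> Arr P \<Longrightarrow> g \<in> Arr X \<Longrightarrow> br F (Cod X g, Cod P f) \<cdot>\<^bsub>Y\<^esub> (f \<odot>\<^bsub>Ract Y\<^esub> fm F g) =
      fm F (f \<odot>\<^bsub>Ract X\<^esub> g) \<cdot>\<^bsub>Y\<^esub> br F (Dom X g, Dom P f)"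
    and "\<And>p q x. p \<in> Ob P \<Longrightarrow> q \<in> Ob P \<Longrightarrow> x \<in> Ob X \<Longrightarrow>
      fm F (mu (Ract X) p q x) \<cdot>\<^bsub>Y\<^esub> br F (q \<bullet>\<^bsub>Ract X\<^esub> x, p) \<cdot>\<^bsub>Y\<^esub> (Id P p \<odot>\<^bsub>Ract Y\<^esub> br F (x, q)) =
      br F (x, q \<otimes>\<^bsub>P\<^esub> p) \<cdot>\<^bsub>Y\<^esub> mu (Ract Y) p q (fo F x)"
    and "\<And>x. x \<in> Ob X \<Longrightarrow> br F (x, j\<^bsub>P\<^esub>) \<cdot>\<^bsub>Y\<^esub> eta (Ract Y) (fo F x) = fm F (eta (Ract X) x)"
    and "\<And>n x p. n \<in> Ob N \<Longrightarrow> x \<in> Ob X \<Longrightarrow> p \<in> Ob P \<Longrightarrow>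
      br F (n \<bullet>\<^bsub>Lact X\<^esub> x, p) \<cdot>\<^bsub>Y\<^esub> (Id P p \<odot>\<^bsub>Ract Y\<^esub> bl F (n, x)) \<cdot>\<^bsub>Y\<^esub> zeta Y n (fo F x) p =
      fm F (zeta X n x p) \<cdot>\<^bsub>Y\<^esub> bl F (n, p \<bullet>\<^bsub>Ract X\<^esub> x) \<cdot>\<^bsub>Y\<^esub> (Id N n \<odot>\<^bsub>Lact Y\<^esub> br F (x, p))"
  shows "F \<in> Ob AC"
proof -
  have "left_linear_axioms N X (Lact X) Y (Lact Y) F (bl F)"
    using assms(6-9) by unfold_locales (auto simp: hom_iff Y.L.C.iso_arr_arr)
  moreover have "left_linear_axioms (mrev P) X (Ract X) Y (Ract Y) F (\<lambda>(p, x). br F (x, p))"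
    using assms(10-13) by unfold_locales (auto simp: hom_iff Y.L.C.iso_arr_arr)
  ultimately show ?thesis
    using assms(1-5,14) X.L.left_actegory_axioms X.R.left_actegory_axioms
      Y.L.left_actegory_axioms Y.R.left_actegory_axioms
    by (simp add: Act_def bilinear_functor_def left_linear_def ext_functor_def)
qed

context
  fixes F assumes F: "F \<in> Ob AC"
begin

lemma AC_ext: "fo F \<in> extensional (Ob X)" "fm F \<in> extensional (Arr X)"
    "bl F \<in> extensional (Ob N \<times> Ob X)" "br F \<in> extensional (Ob X \<times> Ob P)"
  using F by (simp_all add: Act_def ext_functor_def)

lemma AC_left: "left_linear N X (Lact X) Y (Lact Y) F (bl F)"
  and AC_right: "left_linear (mrev P) X (Ract X) Y (Ract Y) F (\<lambda>(p, x). br F (x, p))"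
  using F by (simp_all add: Act_def bilinear_functor_def)

lemma AC_functor: "cat_functor X Y F"
  using AC_left by (simp add: left_linear_def)

lemma AC_functor_simps:
  "x \<in> Ob X \<Longrightarrow> fo F x \<in> Ob Y"
  "f \<in> Arr X \<Longrightarrow> fm F f \<in> Arr Y" "f \<in> Arr X \<Longrightarrow> Dom Y (fm F f) = fo F (Dom X f)"
  "f \<in> Arr X \<Longrightarrow> Cod Y (fm F f) = fo F (Cod X f)"
  "x \<in> Ob X \<Longrightarrow> fm F (Id X x) = Id Y (fo F x)"
  "f \<in> Arr X \<Longrightarrow> g \<in> Arr X \<Longrightarrow> Cod X f = Dom X g \<Longrightarrow> fm F (g \<cdot>\<^bsub>X\<^esub> f) = fm F g \<cdot>\<^bsub>Y\<^esub> fm F f"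
  "iso_arr X f \<Longrightarrow> iso_arr Y (fm F f)" "iso_arr X f \<Longrightarrow> inv_arr Y (fm F f) = fm F (inv_arr X f)"
proof -
  interpret cat_functor X Y F by (rule AC_functor)
  show "x \<in> Ob X \<Longrightarrow> fo F x \<in> Ob Y"
    "f \<in> Arr X \<Longrightarrow> fm F f \<in> Arr Y" "f \<in> Arr X \<Longrightarrow> Dom Y (fm F f) = fo F (Dom X f)"
    "f \<in> Arr X \<Longrightarrow> Cod Y (fm F f) = fo F (Cod X f)"
    "x \<in> Ob X \<Longrightarrow> fm F (Id X x) = Id Y (fo F x)"
    "f \<in> Arr X \<Longrightarrow> g \<in> Arr X \<Longrightarrow> Cod X f = Dom X g \<Longrightarrow> fm F (g \<cdot>\<^bsub>X\<^esub> f) = fm F g \<cdot>\<^bsub>Y\<^esub> fm F f"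
    "iso_arr X f \<Longrightarrow> iso_arr Y (fm F f)" "iso_arr X f \<Longrightarrow> inv_arr Y (fm F f) = fm F (inv_arr X f)"
    by simp_all
qed

lemma bl_arr:
  assumes "n \<in> Ob N" "x \<in> Ob X"
  shows "iso_arr Y (bl F (n, x))" "bl F (n, x) \<in> Arr Y" "Dom Y (bl F (n, x)) = n \<bullet>\<^bsub>Lact Y\<^esub> fo F x"
    "Cod Y (bl F (n, x)) = fo F (n \<bullet>\<^bsub>Lact X\<^esub> x)"
  using left_linear.lin_hom[OF AC_left assms] left_linear.lin_iso[OF AC_left assms] by (auto simp: hom_iff)

lemma bl_natural:
  assumes "f \<in> Arr N" "g \<in> Arr X" "n = Cod N f" "x = Cod X g"
  shows "bl F (n, x) \<cdot>\<^bsub>Y\<^esub> (f \<odot>\<^bsub>Lact Y\<^esub> fm F g) = fm F (f \<odot>\<^bsub>Lact X\<^esub> g) \<cdot>\<^bsub>Y\<^esub> bl F (Dom N f, Dom X g)"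
  using left_linear.lin_nat[OF AC_left, of f _ n g _ x] assms by (simp add: hom_iff)

lemma bl_mu:
  assumes "m \<in> Ob N" "n \<in> Ob N" "x \<in> Ob X"
  shows "fm F (mu (Lact X) m n x) \<cdot>\<^bsub>Y\<^esub> bl F (m, n \<bullet>\<^bsub>Lact X\<^esub> x) \<cdot>\<^bsub>Y\<^esub> (Id N m \<odot>\<^bsub>Lact Y\<^esub> bl F (n, x)) =
      bl F (m \<otimes>\<^bsub>N\<^esub> n, x) \<cdot>\<^bsub>Y\<^esub> mu (Lact Y) m n (fo F x)"
  using left_linear.lin_mu[OF AC_left assms] .

lemma bl_eta: "x \<in> Ob X \<Longrightarrow> bl F (j\<^bsub>N\<^esub>, x) \<cdot>\<^bsub>Y\<^esub> eta (Lact Y) (fo F x) = fm F (eta (Lact X) x)"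
  using left_linear.lin_eta[OF AC_left] .

lemma br_arr:
  assumes "p \<in> Ob P" "x \<in> Ob X"
  shows "iso_arr Y (br F (x, p))" "br F (x, p) \<in> Arr Y" "Dom Y (br F (x, p)) = p \<bullet>\<^bsub>Ract Y\<^esub> fo F x"
    "Cod Y (br F (x, p)) = fo F (p \<bullet>\<^bsub>Ract X\<^esub> x)"
  using left_linear.lin_hom[OF AC_right, of p x] left_linear.lin_iso[OF AC_right, of p x] assms
  by (auto simp: hom_iff)

lemma br_natural:
  assumes "f \<in> Arr P" "g \<in> Arr X" "p = Cod P f" "x = Cod X g"
  shows "br F (x, p) \<cdot>\<^bsub>Y\<^esub> (f \<odot>\<^bsub>Ract Y\<^esub> fm F g) = fm F (f \<odot>\<^bsub>Ract X\<^esub> g) \<cdot>\<^bsub>Y\<^esub> br F (Dom X g, Dom P f)"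
  using left_linear.lin_nat[OF AC_right, of f _ p g _ x] assms by (simp add: hom_iff)

lemma br_mu:
  assumes "p \<in> Ob P" "q \<in> Ob P" "x \<in> Ob X"
  shows "fm F (mu (Ract X) p q x) \<cdot>\<^bsub>Y\<^esub> br F (q \<bullet>\<^bsub>Ract X\<^esub> x, p) \<cdot>\<^bsub>Y\<^esub> (Id P p \<odot>\<^bsub>Ract Y\<^esub> br F (x, q)) =
      br F (x, q \<otimes>\<^bsub>P\<^esub> p) \<cdot>\<^bsub>Y\<^esub> mu (Ract Y) p q (fo F x)"
  using left_linear.lin_mu[OF AC_right, of p q x] assms by simp

lemma br_eta: "x \<in> Ob X \<Longrightarrow> br F (x, j\<^bsub>P\<^esub>) \<cdot>\<^bsub>Y\<^esub> eta (Ract Y) (fo F x) = fm F (eta (Ract X) x)"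
  using left_linear.lin_eta[OF AC_right, of x] by simp

lemma bilinear:
  assumes "n \<in> Ob N" "x \<in> Ob X" "p \<in> Ob P"
  shows "br F (n \<bullet>\<^bsub>Lact X\<^esub> x, p) \<cdot>\<^bsub>Y\<^esub> (Id P p \<odot>\<^bsub>Ract Y\<^esub> bl F (n, x)) \<cdot>\<^bsub>Y\<^esub> zeta Y n (fo F x) p =
      fm F (zeta X n x p) \<cdot>\<^bsub>Y\<^esub> bl F (n, p \<bullet>\<^bsub>Ract X\<^esub> x) \<cdot>\<^bsub>Y\<^esub> (Id N n \<odot>\<^bsub>Lact Y\<^esub> br F (x, p))"
  using F assms by (simp add: Act_def bilinear_functor_def)

end

lemma Arr_AC: "\<xi> \<in> Arr AC \<longleftrightarrow> Src \<xi> \<in> Ob AC \<and> Tgt \<xi> \<in> Ob AC \<and> Cmp \<xi> \<in> extensional (Ob X) \<and>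
    (\<forall>x\<in>Ob X. Cmp \<xi> x \<in> Arr Y \<and> Dom Y (Cmp \<xi> x) = fo (Src \<xi>) x \<and> Cod Y (Cmp \<xi> x) = fo (Tgt \<xi>) x) \<and>
    (\<forall>f\<in>Arr X. Cmp \<xi> (Cod X f) \<cdot>\<^bsub>Y\<^esub> fm (Src \<xi>) f = fm (Tgt \<xi>) f \<cdot>\<^bsub>Y\<^esub> Cmp \<xi> (Dom X f)) \<and>
    (\<forall>n\<in>Ob N. \<forall>x\<in>Ob X. Cmp \<xi> (n \<bullet>\<^bsub>Lact X\<^esub> x) \<cdot>\<^bsub>Y\<^esub> bl (Src \<xi>) (n, x) =
       bl (Tgt \<xi>) (n, x) \<cdot>\<^bsub>Y\<^esub> (Id N n \<odot>\<^bsub>Lact Y\<^esub> Cmp \<xi> x)) \<and>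
    (\<forall>p\<in>Ob P. \<forall>x\<in>Ob X. Cmp \<xi> (p \<bullet>\<^bsub>Ract X\<^esub> x) \<cdot>\<^bsub>Y\<^esub> br (Src \<xi>) (x, p) =
       br (Tgt \<xi>) (x, p) \<cdot>\<^bsub>Y\<^esub> (Id P p \<odot>\<^bsub>Ract Y\<^esub> Cmp \<xi> x))"
  unfolding Act_def Arr_fun_cat nat_trans_iff left_linear_trans_def fun_cat_simps mrev_simps prod.case
  by blast

lemma Arr_AC_I:
  assumes "Src \<xi> \<in> Ob AC" "Tgt \<xi> \<in> Ob AC" "Cmp \<xi> \<in> extensional (Ob X)"
    "\<And>x. x\<in>Ob X \<Longrightarrow> Cmp \<xi> x \<in> Arr Y \<and> Dom Y (Cmp \<xi> x) = fo (Src \<xi>) x \<and> Cod Y (Cmp \<xi> x) = fo (Tgt \<xi>) x"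
    "\<And>f. f\<in>Arr X \<Longrightarrow> Cmp \<xi> (Cod X f) \<cdot>\<^bsub>Y\<^esub> fm (Src \<xi>) f = fm (Tgt \<xi>) f \<cdot>\<^bsub>Y\<^esub> Cmp \<xi> (Dom X f)"
    "\<And>n x. n\<in>Ob N \<Longrightarrow> x\<in>Ob X \<Longrightarrow> Cmp \<xi> (n \<bullet>\<^bsub>Lact X\<^esub> x) \<cdot>\<^bsub>Y\<^esub> bl (Src \<xi>) (n, x) =
       bl (Tgt \<xi>) (n, x) \<cdot>\<^bsub>Y\<^esub> (Id N n \<odot>\<^bsub>Lact Y\<^esub> Cmp \<xi> x)"
    "\<And>p x. p\<in>Ob P \<Longrightarrow> x\<in>Ob X \<Longrightarrow> Cmp \<xi> (p \<bullet>\<^bsub>Ract X\<^esub> x) \<cdot>\<^bsub>Y\<^esub> br (Src \<xi>) (x, p) =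
       br (Tgt \<xi>) (x, p) \<cdot>\<^bsub>Y\<^esub> (Id P p \<odot>\<^bsub>Ract Y\<^esub> Cmp \<xi> x)"
  shows "\<xi> \<in> Arr AC"
  unfolding Arr_AC using assms by blast

lemma AC_Cmp:
  assumes "\<xi> \<in> Arr AC"
  shows "Src \<xi> \<in> Ob AC" "Tgt \<xi> \<in> Ob AC" "Cmp \<xi> \<in> extensional (Ob X)"
    "x \<in> Ob X \<Longrightarrow> Cmp \<xi> x \<in> Arr Y" "x \<in> Ob X \<Longrightarrow> Dom Y (Cmp \<xi> x) = fo (Src \<xi>) x"
    "x \<in> Ob X \<Longrightarrow> Cod Y (Cmp \<xi> x) = fo (Tgt \<xi>) x"
  using assms unfolding Arr_AC by blast+

lemma AC_Cmp_natural: "\<xi> \<in> Arr AC \<Longrightarrow> f \<in> Arr X \<Longrightarrow> x = Cod X f \<Longrightarrow>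
    Cmp \<xi> x \<cdot>\<^bsub>Y\<^esub> fm (Src \<xi>) f = fm (Tgt \<xi>) f \<cdot>\<^bsub>Y\<^esub> Cmp \<xi> (Dom X f)"
  unfolding Arr_AC by blast

lemma AC_Cmp_left: "\<xi> \<in> Arr AC \<Longrightarrow> n \<in> Ob N \<Longrightarrow> x \<in> Ob X \<Longrightarrow>
    Cmp \<xi> (n \<bullet>\<^bsub>Lact X\<^esub> x) \<cdot>\<^bsub>Y\<^esub> bl (Src \<xi>) (n, x) = bl (Tgt \<xi>) (n, x) \<cdot>\<^bsub>Y\<^esub> (Id N n \<odot>\<^bsub>Lact Y\<^esub> Cmp \<xi> x)"
  unfolding Arr_AC by blast

lemma AC_Cmp_right: "\<xi> \<in> Arr AC \<Longrightarrow> p \<in> Ob P \<Longrightarrow> x \<in> Ob X \<Longrightarrow>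
    Cmp \<xi> (p \<bullet>\<^bsub>Ract X\<^esub> x) \<cdot>\<^bsub>Y\<^esub> br (Src \<xi>) (x, p) = br (Tgt \<xi>) (x, p) \<cdot>\<^bsub>Y\<^esub> (Id P p \<odot>\<^bsub>Ract Y\<^esub> Cmp \<xi> x)"
  unfolding Arr_AC by blast

lemma category_AC: "category AC"
proof (rule categoryI)
  note [simp] = AC_functor_simps bl_arr br_arr AC_Cmp
  fix f assume f: "f \<in> Arr AC"
  then show "Dom AC f \<in> Ob AC" "Cod AC f \<in> Ob AC" by simp_all
  show "Id AC (Cod AC f) \<cdot>\<^bsub>AC\<^esub> f = f" "f \<cdot>\<^bsub>AC\<^esub> Id AC (Dom AC f) = f"
    using f by (auto intro!: trans_eqI[where X="Ob X"])
next
  note [simp] = AC_functor_simps bl_arr br_arr AC_Cmp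
  fix F assume "F \<in> Ob AC"
  then show "Id AC F \<in> Arr AC \<and> Dom AC (Id AC F) = F \<and> Cod AC (Id AC F) = F"
    by (auto intro!: Arr_AC_I)
next
  note [simp] = AC_functor_simps bl_arr br_arr AC_Cmp
  fix f g assume fg: "f \<in> Arr AC" "g \<in> Arr AC" "Cod AC f = Dom AC g"
  have l: "Cmp g (n \<bullet>\<^bsub>Lact X\<^esub> x) \<cdot>\<^bsub>Y\<^esub> Cmp f (n \<bullet>\<^bsub>Lact X\<^esub> x) \<cdot>\<^bsub>Y\<^esub> bl (Src f) (n, x) =
    bl (Tgt g) (n, x) \<cdot>\<^bsub>Y\<^esub> (Id N n \<odot>\<^bsub>Lact Y\<^esub> Cmp g x) \<cdot>\<^bsub>Y\<^esub> (Id N n \<odot>\<^bsub>Lact Y\<^esub> Cmp f x)"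
    if "n \<in> Ob N" "x \<in> Ob X" for n x
    using fg that AC_Cmp_left[of f n x] Y.L.C.pre[OF AC_Cmp_left[of g n x]] by simp
  have r: "Cmp g (p \<bullet>\<^bsub>Ract X\<^esub> x) \<cdot>\<^bsub>Y\<^esub> Cmp f (p \<bullet>\<^bsub>Ract X\<^esub> x) \<cdot>\<^bsub>Y\<^esub> br (Src f) (x, p) =
    br (Tgt g) (x, p) \<cdot>\<^bsub>Y\<^esub> (Id P p \<odot>\<^bsub>Ract Y\<^esub> Cmp g x) \<cdot>\<^bsub>Y\<^esub> (Id P p \<odot>\<^bsub>Ract Y\<^esub> Cmp f x)"
    if "p \<in> Ob P" "x \<in> Ob X" for p x
    using fg that AC_Cmp_right[of f p x] Y.L.C.pre[OF AC_Cmp_right[of g p x]] by simp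
  have nat: "Cmp g (Cod X h) \<cdot>\<^bsub>Y\<^esub> Cmp f (Cod X h) \<cdot>\<^bsub>Y\<^esub> fm (Src f) h =
     fm (Tgt g) h \<cdot>\<^bsub>Y\<^esub> Cmp g (Dom X h) \<cdot>\<^bsub>Y\<^esub> Cmp f (Dom X h)" if "h \<in> Arr X" for h
    using fg that AC_Cmp_natural[of f h] Y.L.C.pre[OF AC_Cmp_natural[of g h]] by simp
  have "g \<cdot>\<^bsub>AC\<^esub> f \<in> Arr AC" using fg l r nat by (intro Arr_AC_I) simp_all
  then show "g \<cdot>\<^bsub>AC\<^esub> f \<in> Arr AC \<and> Dom AC (g \<cdot>\<^bsub>AC\<^esub> f) = Dom AC f \<and> Cod AC (g \<cdot>\<^bsub>AC\<^esub> f) = Cod AC g"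
    by simp
next
  note [simp] = AC_functor_simps bl_arr br_arr AC_Cmp
  fix f g h assume "f \<in> Arr AC" "g \<in> Arr AC" "h \<in> Arr AC" "Cod AC f = Dom AC g" "Cod AC g = Dom AC h"
  then show "(h \<cdot>\<^bsub>AC\<^esub> g) \<cdot>\<^bsub>AC\<^esub> f = h \<cdot>\<^bsub>AC\<^esub> (g \<cdot>\<^bsub>AC\<^esub> f)"
    by (auto intro!: restrict_ext)
qed

end

section \<open>The isomorphism\<close>

text \<open>The universal property is present twice: with target \<open>T\<close> inside
  \<open>tensor_data\<close>, and with target \<open>E\<close> under the prefix
  \<open>UE\<close>.\<close>

locale adjunction = tensor_data N M P C D T U + UE: tensor_univ M C "Ract C" D "Lact D" T U E + hom_data N M P D E
  for N :: "('no, 'na) monoidal" and M :: "('mo, 'ma) monoidal" and P :: "('po, 'pa) monoidal"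
    and C :: "('no, 'na, 'mo, 'ma, 'co, 'ca) biact" and D :: "('mo, 'ma, 'po, 'pa, 'do, 'da) biact"
    and E :: "('no, 'na, 'po, 'pa, 'eo, 'ea) biact"
    and T :: "('to, 'ta) cat" and U :: "('co, 'ca, 'do, 'da, 'mo, 'to, 'ta) bal"
begin

abbreviation "LL \<equiv> LG.L"
abbreviation "RR \<equiv> RG.L"
abbreviation "TE \<equiv> Act N P TB E"
abbreviation "CH \<equiv> Act N M C HB"
abbreviation "eps_inv c m d \<equiv> inv_arr T (eps U (c, m, d))"

lemma act_cat_TE: "act_cat N P TB E"
  by (intro act_cat.intro biactegory_tensor E.biactegory_axioms)

lemma act_cat_CH: "act_cat N M C HB"
  by (intro act_cat.intro biactegory_hom C.biactegory_axioms)

lemmas TE_functor = act_cat.AC_functor [OF act_cat_TE, unfolded TB_simps]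
lemmas TE_ext = act_cat.AC_ext [OF act_cat_TE, unfolded TB_simps]
lemmas TE_arr [simp] =
  act_cat.AC_functor_simps [OF act_cat_TE, unfolded TB_simps]
  act_cat.bl_arr [OF act_cat_TE, unfolded TB_simps TB_act LG.ACT_o]
  act_cat.br_arr [OF act_cat_TE, unfolded TB_simps TB_act RG.ACT_o]
  act_cat.AC_Cmp [OF act_cat_TE, unfolded TB_simps]
lemmas TE_bl_natural = act_cat.bl_natural [OF act_cat_TE, unfolded TB_simps TB_act]
lemmas TE_br_natural = act_cat.br_natural [OF act_cat_TE, unfolded TB_simps TB_act]
lemmas TE_bl_mu = act_cat.bl_mu [OF act_cat_TE, unfolded TB_simps TB_act LG.ACT_o]
lemmas TE_br_mu = act_cat.br_mu [OF act_cat_TE, unfolded TB_simps TB_act RG.ACT_o]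
lemmas TE_bl_eta = act_cat.bl_eta [OF act_cat_TE, unfolded TB_simps TB_act]
lemmas TE_br_eta = act_cat.br_eta [OF act_cat_TE, unfolded TB_simps TB_act]
lemmas TE_bilinear = act_cat.bilinear [OF act_cat_TE, unfolded TB_act LG.ACT_o RG.ACT_o]
lemmas TE_natural = act_cat.AC_Cmp_natural [OF act_cat_TE, unfolded TB_simps]
lemmas TE_left = act_cat.AC_Cmp_left [OF act_cat_TE, unfolded TB_simps TB_act LG.ACT_o]
lemmas TE_right = act_cat.AC_Cmp_right [OF act_cat_TE, unfolded TB_simps TB_act RG.ACT_o]

section \<open>Generating arrows and the inverse balancing of U\<close>

lemma LACT_U [simp]: "f \<in> Arr N \<Longrightarrow> g \<in> Arr C \<Longrightarrow> h \<in> Arr D \<Longrightarrow> f \<odot>\<^bsub>LG.ACT\<^esub> fm U (g, h) = fm U (f \<odot>\<^sub>C g, h)"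
  by (simp add: LG.ACT_a U.bi_merge C.L.act_merge)

lemma RACT_U [simp]: "f \<in> Arr P \<Longrightarrow> g \<in> Arr C \<Longrightarrow> h \<in> Arr D \<Longrightarrow> f \<odot>\<^bsub>RG.ACT\<^esub> fm U (g, h) = fm U (g, f \<odot>\<^sup>D h)"
  using D.R.act_merge(1)[of f h "Cod D h" "Dom P f"] by (simp add: RG.ACT_a U.bi_merge)

text \<open>Inverts \<open>L_eps\<close>: the lift preserves inverses, and the balancing of
  \<open>lgen\<close> is a composite of two invertible arrows.\<close>

lemma eps_inv_L:
  assumes "n \<in> Ob N" "c \<in> Ob C" "m \<in> Ob M" "d \<in> Ob D"
  shows "fm (LL n) (eps_inv c m d) = fm U (inv_arr C (zeta C n c m), Id D d) \<cdot>\<^sub>T eps_inv (n \<bullet>\<^sub>C c) m d"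
  using cat_functor.fm_iso(2)[OF LG.L_functor, of n "eps U (c, m, d)"] assms
  by (simp add: LG.L_eps U.F.B.iso_comp)

lemma eps_inv_R:
  assumes "p \<in> Ob P" "c \<in> Ob C" "m \<in> Ob M" "d \<in> Ob D"
  shows "fm (RR p) (eps_inv c m d) = eps_inv c m (p \<bullet>\<^sup>D d) \<cdot>\<^sub>T fm U (Id C c, inv_arr D (zeta D m d p))"
  using cat_functor.fm_iso(2)[OF RG_L_functor, of p "eps U (c, m, d)"] assms
  by (simp add: RG.L_eps U.F.B.iso_comp)

lemma eps_inv_natural:
  assumes "f \<in> Arr C" "g \<in> Arr M" "h \<in> Arr D" "c = Cod C f" "m = Cod M g" "d = Cod D h"
  shows "eps_inv c m d \<cdot>\<^sub>T fm U (f, g \<odot>\<^sub>D h) = fm U (g \<odot>\<^sup>C f, h) \<cdot>\<^sub>T eps_inv (Dom C f) (Dom M g) (Dom D h)"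
  using assms by (intro U.F.B.inv_square) (simp_all add: U.eps_natural)

text \<open>The inverse balancing \<open>U(c, m \<bullet> d) \<rightarrow> U(c \<star> m, d)\<close>
  has the direction of a right linear structure on \<open>c \<mapsto> U(c, -)\<close>. Its
  naturality above, this law and the unit law below are the axioms of such a structure.\<close>

lemma eps_inv_mu:
  assumes "c \<in> Ob C" "m \<in> Ob M" "n \<in> Ob M" "d \<in> Ob D"
  shows "eps_inv c (m \<otimes>\<^bsub>M\<^esub> n) d \<cdot>\<^sub>T fm U (Id C c, mu (Lact D) m n d) =
    fm U (mu (Ract C) n m c, Id D d) \<cdot>\<^sub>T eps_inv (m \<bullet>\<^sup>C c) n d \<cdot>\<^sub>T eps_inv c m (n \<bullet>\<^sub>D d)"
  using U.F.B.inv_square[of "eps U (c, m, n \<bullet>\<^sub>D d) \<cdot>\<^sub>T eps U (m \<bullet>\<^sup>C c, n, d)"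
      "eps U (c, m \<otimes>\<^bsub>M\<^esub> n, d)" "fm U (mu (Ract C) n m c, Id D d)" "fm U (Id C c, mu (Lact D) m n d)"]
    assms U.eps_mu[OF assms] by (simp add: U.F.B.iso_comp)

lemma eps_inv_eta:
  assumes "c \<in> Ob C" "d \<in> Ob D"
  shows "eps_inv c j\<^bsub>M\<^esub> d \<cdot>\<^sub>T fm U (Id C c, eta (Lact D) d) = fm U (eta (Ract C) c, Id D d)"
  using assms by (simp flip: U.eps_eta)

text \<open>The field \<open>rs\<close> has the required type because
  \<open>U(c, d) \<star> p = U(c, d \<star> p)\<close> holds strictly in \<open>T\<close>.\<close>

definition curry_at :: "('to, 'ta, 'eo, 'ea, 'no, 'po) bilin \<Rightarrow> 'co \<Rightarrow> ('do, 'da, 'eo, 'ea, 'po) rlin" where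
  "curry_at H c = \<lparr>fo = \<lambda>d\<in>Ob D. fo H (fo U (c, d)), fm = \<lambda>g\<in>Arr D. fm H (fm U (Id C c, g)),
     rs = \<lambda>(d, p)\<in>Ob D \<times> Ob P. br H (fo U (c, d), p)\<rparr>"

definition curry_o :: "('to, 'ta, 'eo, 'ea, 'no, 'po) bilin \<Rightarrow>
    ('co, 'ca, ('do, 'da, 'eo, 'ea, 'po) rlin, (('do, 'da, 'eo, 'ea, 'po) rlin, 'do, 'ea) trans, 'no, 'mo) bilin" where
  "curry_o H = \<lparr>fo = \<lambda>c\<in>Ob C. curry_at H c,
     fm = \<lambda>f\<in>Arr C. \<lparr>Src = curry_at H (Dom C f), Tgt = curry_at H (Cod C f), Cmp = \<lambda>d\<in>Ob D. fm H (fm U (f, Id D d))\<rparr>,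
     bl = \<lambda>(n, c)\<in>Ob N \<times> Ob C. \<lparr>Src = lH n (curry_at H c), Tgt = curry_at H (n \<bullet>\<^sub>C c),
       Cmp = \<lambda>d\<in>Ob D. bl H (n, fo U (c, d))\<rparr>,
     br = \<lambda>(c, m)\<in>Ob C \<times> Ob M. \<lparr>Src = rH (curry_at H c) m, Tgt = curry_at H (m \<bullet>\<^sup>C c),
       Cmp = \<lambda>d\<in>Ob D. fm H (eps_inv c m d)\<rparr>\<rparr>"

definition curry_a :: "(('to, 'ta, 'eo, 'ea, 'no, 'po) bilin, 'to, 'ea) trans \<Rightarrow>
    (('co, 'ca, ('do, 'da, 'eo, 'ea, 'po) rlin, (('do, 'da, 'eo, 'ea, 'po) rlin, 'do, 'ea) trans, 'no, 'mo) bilin,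
     'co, (('do, 'da, 'eo, 'ea, 'po) rlin, 'do, 'ea) trans) trans" where
  "curry_a \<xi> = \<lparr>Src = curry_o (Src \<xi>), Tgt = curry_o (Tgt \<xi>),
     Cmp = \<lambda>c\<in>Ob C. \<lparr>Src = curry_at (Src \<xi>) c, Tgt = curry_at (Tgt \<xi>) c, Cmp = \<lambda>d\<in>Ob D. Cmp \<xi> (fo U (c, d))\<rparr>\<rparr>"

lemma curry_at_simps [simp]:
  "d \<in> Ob D \<Longrightarrow> fo (curry_at H c) d = fo H (fo U (c, d))"
  "g \<in> Arr D \<Longrightarrow> fm (curry_at H c) g = fm H (fm U (Id C c, g))"
  "d \<in> Ob D \<Longrightarrow> p \<in> Ob P \<Longrightarrow> rs (curry_at H c) (d, p) = br H (fo U (c, d), p)"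
  by (simp_all add: curry_at_def)

lemma curry_o_simps [simp]:
  "c \<in> Ob C \<Longrightarrow> fo (curry_o H) c = curry_at H c"
  "f \<in> Arr C \<Longrightarrow> fm (curry_o H) f = \<lparr>Src = curry_at H (Dom C f), Tgt = curry_at H (Cod C f), Cmp = \<lambda>d\<in>Ob D. fm H (fm U (f, Id D d))\<rparr>"
  "n \<in> Ob N \<Longrightarrow> c \<in> Ob C \<Longrightarrow> bl (curry_o H) (n, c) = \<lparr>Src = lH n (curry_at H c), Tgt = curry_at H (n \<bullet>\<^sub>C c),
       Cmp = \<lambda>d\<in>Ob D. bl H (n, fo U (c, d))\<rparr>"
  "m \<in> Ob M \<Longrightarrow> c \<in> Ob C \<Longrightarrow> br (curry_o H) (c, m) = \<lparr>Src = rH (curry_at H c) m, Tgt = curry_at H (m \<bullet>\<^sup>C c),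
       Cmp = \<lambda>d\<in>Ob D. fm H (eps_inv c m d)\<rparr>"
  by (simp_all add: curry_o_def)

section \<open>Currying a bilinear functor out of the tensor product\<close>

context
  fixes H assumes H [simp]: "H \<in> Ob TE"
begin

interpretation H: cat_functor T E H
  by (rule TE_functor[OF H])

text \<open>The axioms are those of the right structure of \<open>H\<close> read at the objects
  \<open>U(c, d)\<close>, where the action of \<open>P\<close> on \<open>T\<close> is its action on
  \<open>D\<close>.\<close>

lemma curry_at_in [simp]:
  assumes [simp]: "c \<in> Ob C" shows "curry_at H c \<in> Ob RL"
proof (rule Ob_RL_I)
  show "cat_functor D E (curry_at H c)"
    by (intro cat_functorI) (simp_all add: D.L.C.category_axioms UE.X.category_axioms)
  show "fo (curry_at H c) \<in> extensional (Ob D)" "fm (curry_at H c) \<in> extensional (Arr D)"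
    "rs (curry_at H c) \<in> extensional (Ob D \<times> Ob P)"
    by (simp_all add: curry_at_def)
next
  fix f g assume fg: "f \<in> Arr P" "g \<in> Arr D"
  then show "rs (curry_at H c) (Cod D g, Cod P f) \<cdot>\<^sub>E (f \<odot>\<^sup>E fm (curry_at H c) g) =
    fm (curry_at H c) (f \<odot>\<^sup>D g) \<cdot>\<^sub>E rs (curry_at H c) (Dom D g, Dom P f)"
    using TE_br_natural[OF H, of f "fm U (Id C c, g)"] by simp
next
  fix p q d assume "p \<in> Ob P" "q \<in> Ob P" "d \<in> Ob D"
  then show "fm (curry_at H c) (mu (Ract D) p q d) \<cdot>\<^sub>E rs (curry_at H c) (q \<bullet>\<^sup>D d, p) \<cdot>\<^sub>E (Id P p \<odot>\<^sup>E rs (curry_at H c) (d, q)) =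
       rs (curry_at H c) (d, q \<otimes>\<^bsub>P\<^esub> p) \<cdot>\<^sub>E mu (Ract E) p q (fo (curry_at H c) d)"
    using TE_br_mu[OF H, of p q "fo U (c, d)"] by simp
next
  fix d assume "d \<in> Ob D"
  then show "rs (curry_at H c) (d, j\<^bsub>P\<^esub>) \<cdot>\<^sub>E eta (Ract E) (fo (curry_at H c) d) = fm (curry_at H c) (eta (Ract D) d)"
    using TE_br_eta[OF H, of "fo U (c, d)"] by simp
qed simp

text \<open>Naturality is interchange of the two variables of \<open>U\<close>; right linearity is
  naturality of \<open>br H\<close> at an arrow that is an identity in the second variable.\<close>

lemma curry_fm_arr:
  assumes [simp]: "f \<in> Arr C" shows "fm (curry_o H) f \<in> Arr RL"
proof (rule Arr_RL_I)
  fix g assume "g \<in> Arr D"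
  then have "fm H (fm U (f, Id D (Cod D g)) \<cdot>\<^sub>T fm U (Id C (Dom C f), g)) = fm H (fm U (Id C (Cod C f), g) \<cdot>\<^sub>T fm U (f, Id D (Dom D g)))"
    by (simp add: U.bi_merge del: H.fm_comp)
  with \<open>g \<in> Arr D\<close> show "Cmp (fm (curry_o H) f) (Cod D g) \<cdot>\<^sub>E fm (Src (fm (curry_o H) f)) g =
    fm (Tgt (fm (curry_o H) f)) g \<cdot>\<^sub>E Cmp (fm (curry_o H) f) (Dom D g)" by simp
next
  fix d p assume "d \<in> Ob D" "p \<in> Ob P"
  then show "Cmp (fm (curry_o H) f) (p \<bullet>\<^sup>D d) \<cdot>\<^sub>E rs (Src (fm (curry_o H) f)) (d, p) =
       rs (Tgt (fm (curry_o H) f)) (d, p) \<cdot>\<^sub>E (Id P p \<odot>\<^sup>E Cmp (fm (curry_o H) f) d)"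
    using TE_br_natural[OF H, of "Id P p" "fm U (f, Id D d)"] by simp
qed simp_all

text \<open>Right linearity is the compatibility of the two structures of \<open>H\<close>: the
  bimodulator of \<open>T\<close> there is an identity, and that of \<open>E\<close> is moved to the
  other side, where \<open>lhom\<close> has its inverse.\<close>

lemma curry_bl_arr:
  assumes [simp]: "n \<in> Ob N" "c \<in> Ob C"
  shows "bl (curry_o H) (n, c) \<in> Arr RL" "iso_arr RL (bl (curry_o H) (n, c))"
proof -
  show 1: "bl (curry_o H) (n, c) \<in> Arr RL"
  proof (rule Arr_RL_I)
    fix g assume "g \<in> Arr D"
    then show "Cmp (bl (curry_o H) (n, c)) (Cod D g) \<cdot>\<^sub>E fm (Src (bl (curry_o H) (n, c))) g =
      fm (Tgt (bl (curry_o H) (n, c))) g \<cdot>\<^sub>E Cmp (bl (curry_o H) (n, c)) (Dom D g)"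
      using TE_bl_natural[OF H, of "Id N n" "fm U (Id C c, g)"] by simp
  next
    fix d p assume [simp]: "d \<in> Ob D" "p \<in> Ob P"
    let ?t = "fo U (c, d)" and ?z = "zeta E n (fo H (fo U (c, d))) p"
    have "bl H (n, fo (RR p) ?t) \<cdot>\<^sub>E (Id N n \<odot>\<^sub>E br H (?t, p)) =
      br H (fo (LL n) ?t, p) \<cdot>\<^sub>E (Id P p \<odot>\<^sup>E bl H (n, ?t)) \<cdot>\<^sub>E ?z"
      using TE_bilinear[OF H, of n ?t p] by simp
    then show "Cmp (bl (curry_o H) (n, c)) (p \<bullet>\<^sup>D d) \<cdot>\<^sub>E rs (Src (bl (curry_o H) (n, c))) (d, p) =
       rs (Tgt (bl (curry_o H) (n, c))) (d, p) \<cdot>\<^sub>E (Id P p \<odot>\<^sup>E Cmp (bl (curry_o H) (n, c)) d)"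
      using UE.X.pre[of "bl H (n, fo (RR p) ?t)" "Id N n \<odot>\<^sub>E br H (?t, p)"
          "br H (fo (LL n) ?t, p) \<cdot>\<^sub>E (Id P p \<odot>\<^sup>E bl H (n, ?t)) \<cdot>\<^sub>E ?z" "inv_arr E ?z"] by simp
  qed simp_all
  show "iso_arr RL (bl (curry_o H) (n, c))"
    by (intro iso_RL(1)[OF 1]) simp
qed

text \<open>Naturality in \<open>d\<close> is that of the inverse balancing; right linearity is
  naturality of \<open>br H\<close> at the inverse balancing, rewritten by
  \<open>eps_inv_R\<close>.\<close>

lemma curry_br_arr:
  assumes [simp]: "m \<in> Ob M" "c \<in> Ob C"
  shows "br (curry_o H) (c, m) \<in> Arr RL" "iso_arr RL (br (curry_o H) (c, m))"
proof -
  show 1: "br (curry_o H) (c, m) \<in> Arr RL"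
  proof (rule Arr_RL_I)
    fix g assume [simp]: "g \<in> Arr D"
    have "fm H (eps_inv c m (Cod D g) \<cdot>\<^sub>T fm U (Id C c, Id M m \<odot>\<^sub>D g)) = fm H (fm U (Id C (m \<bullet>\<^sup>C c), g) \<cdot>\<^sub>T eps_inv c m (Dom D g))"
      by (simp add: eps_inv_natural del: H.fm_comp)
    then show "Cmp (br (curry_o H) (c, m)) (Cod D g) \<cdot>\<^sub>E fm (Src (br (curry_o H) (c, m))) g =
      fm (Tgt (br (curry_o H) (c, m))) g \<cdot>\<^sub>E Cmp (br (curry_o H) (c, m)) (Dom D g)" by simp
  next
    fix d p assume [simp]: "d \<in> Ob D" "p \<in> Ob P"
    have "br H (fo U (m \<bullet>\<^sup>C c, d), p) \<cdot>\<^sub>E (Id P p \<odot>\<^sup>E fm H (eps_inv c m d)) =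
      fm H (fm (RR p) (eps_inv c m d)) \<cdot>\<^sub>E br H (fo U (c, m \<bullet>\<^sub>D d), p)"
      using TE_br_natural[OF H, of "Id P p" "eps_inv c m d"] by simp
    then show "Cmp (br (curry_o H) (c, m)) (p \<bullet>\<^sup>D d) \<cdot>\<^sub>E rs (Src (br (curry_o H) (c, m))) (d, p) =
       rs (Tgt (br (curry_o H) (c, m))) (d, p) \<cdot>\<^sub>E (Id P p \<odot>\<^sup>E Cmp (br (curry_o H) (c, m)) d)"
      by (simp add: eps_inv_R)
  qed simp_all
  show "iso_arr RL (br (curry_o H) (c, m))"
    by (intro iso_RL(1)[OF 1]) simp
qed

text \<open>The left laws are those of \<open>H\<close> at generators, the right laws are those of
  the inverse balancing under \<open>H\<close>, and the compatibility of both is naturality of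
  \<open>bl H\<close> at the inverse balancing.\<close>

lemma curry_o_in: "curry_o H \<in> Ob CH"
proof (rule act_cat.Ob_AC_I[OF act_cat_CH])
  show "cat_functor C HB (curry_o H)"
  proof (rule cat_functorI)
    fix f assume f: "f \<in> Arr C"
    show "fm (curry_o H) f \<in> Arr HB \<and> Dom HB (fm (curry_o H) f) = fo (curry_o H) (Dom C f) \<and>
      Cod HB (fm (curry_o H) f) = fo (curry_o H) (Cod C f)"
      using curry_fm_arr[OF f] f by simp
  qed (auto intro!: restrict_ext simp: C.L.C.category_axioms RC.category_axioms hom_biact_def)
  show "fo (curry_o H) \<in> extensional (Ob C)" "fm (curry_o H) \<in> extensional (Arr C)"
    "bl (curry_o H) \<in> extensional (Ob N \<times> Ob C)" "br (curry_o H) \<in> extensional (Ob C \<times> Ob M)"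
    by (simp_all add: curry_o_def)
next
  fix n c assume "n \<in> Ob N" "c \<in> Ob C"
  with curry_bl_arr[OF this] show "iso_arr HB (bl (curry_o H) (n, c)) \<and> Dom HB (bl (curry_o H) (n, c)) = n \<bullet>\<^bsub>Lact HB\<^esub> fo (curry_o H) c \<and>
      Cod HB (bl (curry_o H) (n, c)) = fo (curry_o H) (n \<bullet>\<^sub>C c)" by simp
next
  fix m c assume "m \<in> Ob M" "c \<in> Ob C"
  with curry_br_arr[OF this] show "iso_arr HB (br (curry_o H) (c, m)) \<and> Dom HB (br (curry_o H) (c, m)) = m \<bullet>\<^bsub>Ract HB\<^esub> fo (curry_o H) c \<and>
      Cod HB (br (curry_o H) (c, m)) = fo (curry_o H) (m \<bullet>\<^sup>C c)" by simp
next
  fix f g assume [simp]: "f \<in> Arr N" "g \<in> Arr C"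
  have "bl H (Cod N f, fo U (Cod C g, d)) \<cdot>\<^sub>E (f \<odot>\<^sub>E fm H (fm U (g, Id D d))) =
     fm H (fm U (f \<odot>\<^sub>C g, Id D d)) \<cdot>\<^sub>E bl H (Dom N f, fo U (Dom C g, d))" if "d \<in> Ob D" for d
    using TE_bl_natural[OF H, of f "fm U (g, Id D d)"] that by simp
  then show "bl (curry_o H) (Cod N f, Cod C g) \<cdot>\<^bsub>HB\<^esub> (f \<odot>\<^bsub>Lact HB\<^esub> fm (curry_o H) g) =
      fm (curry_o H) (f \<odot>\<^sub>C g) \<cdot>\<^bsub>HB\<^esub> bl (curry_o H) (Dom N f, Dom C g)"
    by (auto intro!: restrict_ext)
next
  fix m n c assume [simp]: "m \<in> Ob N" "n \<in> Ob N" "c \<in> Ob C"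
  have "fm H (fm U (mu (Lact C) m n c, Id D d)) \<cdot>\<^sub>E bl H (m, fo U (n \<bullet>\<^sub>C c, d)) \<cdot>\<^sub>E
     (Id N m \<odot>\<^sub>E bl H (n, fo U (c, d))) =
     bl H (m \<otimes>\<^bsub>N\<^esub> n, fo U (c, d)) \<cdot>\<^sub>E mu (Lact E) m n (fo H (fo U (c, d)))" if "d \<in> Ob D" for d
    using TE_bl_mu[OF H, of m n "fo U (c, d)"] that by simp
  then show "fm (curry_o H) (mu (Lact C) m n c) \<cdot>\<^bsub>HB\<^esub> bl (curry_o H) (m, n \<bullet>\<^sub>C c) \<cdot>\<^bsub>HB\<^esub> (Id N m \<odot>\<^bsub>Lact HB\<^esub> bl (curry_o H) (n, c)) =
      bl (curry_o H) (m \<otimes>\<^bsub>N\<^esub> n, c) \<cdot>\<^bsub>HB\<^esub> mu (Lact HB) m n (fo (curry_o H) c)"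
    by (auto intro!: restrict_ext)
next
  fix c assume [simp]: "c \<in> Ob C"
  have "bl H (j\<^bsub>N\<^esub>, fo U (c, d)) \<cdot>\<^sub>E eta (Lact E) (fo H (fo U (c, d))) = fm H (fm U (eta (Lact C) c, Id D d))" if "d \<in> Ob D" for d
    using TE_bl_eta[OF H, of "fo U (c, d)"] that by simp
  then show "bl (curry_o H) (j\<^bsub>N\<^esub>, c) \<cdot>\<^bsub>HB\<^esub> eta (Lact HB) (fo (curry_o H) c) = fm (curry_o H) (eta (Lact C) c)"
    by (auto intro!: restrict_ext)
  have "fm H (eps_inv c j\<^bsub>M\<^esub> d \<cdot>\<^sub>T fm U (Id C c, eta (Lact D) d)) = fm H (fm U (eta (Ract C) c, Id D d))" if "d \<in> Ob D" for d
    using that by (simp only: eps_inv_eta \<open>c \<in> Ob C\<close>)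
  then show "br (curry_o H) (c, j\<^bsub>M\<^esub>) \<cdot>\<^bsub>HB\<^esub> eta (Ract HB) (fo (curry_o H) c) = fm (curry_o H) (eta (Ract C) c)"
    by (auto intro!: restrict_ext)
next
  fix f g assume [simp]: "f \<in> Arr M" "g \<in> Arr C"
  have "fm H (eps_inv (Cod C g) (Cod M f) d) \<cdot>\<^sub>E fm H (fm U (Id C (Cod C g), f \<odot>\<^sub>D Id D d)) \<cdot>\<^sub>E fm H (fm U (g, Id D (Dom M f \<bullet>\<^sub>D d))) =
     fm H (fm U (f \<odot>\<^sup>C g, Id D d)) \<cdot>\<^sub>E fm H (eps_inv (Dom C g) (Dom M f) d)" if [simp]: "d \<in> Ob D" for d
  proof -
    have "fm U (Id C (Cod C g), f \<odot>\<^sub>D Id D d) \<cdot>\<^sub>T fm U (g, Id D (Dom M f \<bullet>\<^sub>D d)) = fm U (g, f \<odot>\<^sub>D Id D d)"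
      by (simp add: U.bi_merge)
    then have "fm H (eps_inv (Cod C g) (Cod M f) d \<cdot>\<^sub>T fm U (Id C (Cod C g), f \<odot>\<^sub>D Id D d) \<cdot>\<^sub>T fm U (g, Id D (Dom M f \<bullet>\<^sub>D d))) =
      fm H (fm U (f \<odot>\<^sup>C g, Id D d) \<cdot>\<^sub>T eps_inv (Dom C g) (Dom M f) d)"
      using eps_inv_natural[of g f "Id D d"] by simp
    then show ?thesis by simp
  qed
  then show "br (curry_o H) (Cod C g, Cod M f) \<cdot>\<^bsub>HB\<^esub> (f \<odot>\<^bsub>Ract HB\<^esub> fm (curry_o H) g) =
      fm (curry_o H) (f \<odot>\<^sup>C g) \<cdot>\<^bsub>HB\<^esub> br (curry_o H) (Dom C g, Dom M f)"
    by (auto intro!: restrict_ext)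
next
  fix m n c assume [simp]: "m \<in> Ob M" "n \<in> Ob M" "c \<in> Ob C"
  have "fm H (fm U (mu (Ract C) m n c, Id D d) \<cdot>\<^sub>T eps_inv (n \<bullet>\<^sup>C c) m d \<cdot>\<^sub>T eps_inv c n (m \<bullet>\<^sub>D d)) =
     fm H (eps_inv c (n \<otimes>\<^bsub>M\<^esub> m) d \<cdot>\<^sub>T fm U (Id C c, mu (Lact D) n m d))" if "d \<in> Ob D" for d
    using that by (simp add: eps_inv_mu)
  then show "fm (curry_o H) (mu (Ract C) m n c) \<cdot>\<^bsub>HB\<^esub> br (curry_o H) (n \<bullet>\<^sup>C c, m) \<cdot>\<^bsub>HB\<^esub> (Id M m \<odot>\<^bsub>Ract HB\<^esub> br (curry_o H) (c, n)) =
      br (curry_o H) (c, n \<otimes>\<^bsub>M\<^esub> m) \<cdot>\<^bsub>HB\<^esub> mu (Ract HB) m n (fo (curry_o H) c)"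
    by (auto intro!: restrict_ext)
next
  fix n c m assume [simp]: "n \<in> Ob N" "c \<in> Ob C" "m \<in> Ob M"
  have "fm H (eps_inv (n \<bullet>\<^sub>C c) m d) \<cdot>\<^sub>E bl H (n, fo U (c, m \<bullet>\<^sub>D d)) =
    fm H (fm U (zeta C n c m, Id D d)) \<cdot>\<^sub>E bl H (n, fo U (m \<bullet>\<^sup>C c, d)) \<cdot>\<^sub>E (Id N n \<odot>\<^sub>E fm H (eps_inv c m d))"
    if [simp]: "d \<in> Ob D" for d
  proof -
    \<comment> \<open>\<open>eps_inv_L\<close> produces the inverse bimodulator of \<open>C\<close>,
      which cancels the bimodulator in the compatibility law.\<close>
    have "fm U (zeta C n c m, Id D d) \<cdot>\<^sub>T fm (LL n) (eps_inv c m d) = eps_inv (n \<bullet>\<^sub>C c) m d"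
      by (simp add: eps_inv_L U.F.B.pre[OF U.bi_comp_left[symmetric]])
    then have *: "fm H (fm U (zeta C n c m, Id D d) \<cdot>\<^sub>T fm (LL n) (eps_inv c m d)) = fm H (eps_inv (n \<bullet>\<^sub>C c) m d)"
      by simp
    have "bl H (n, fo U (m \<bullet>\<^sup>C c, d)) \<cdot>\<^sub>E (Id N n \<odot>\<^sub>E fm H (eps_inv c m d)) =
      fm H (fm (LL n) (eps_inv c m d)) \<cdot>\<^sub>E bl H (n, fo U (c, m \<bullet>\<^sub>D d))"
      using TE_bl_natural[OF H, of "Id N n" "eps_inv c m d"] by simp
    then show ?thesis using * by (simp flip: UE.X.assoc)
  qed
  then show "br (curry_o H) (n \<bullet>\<^sub>C c, m) \<cdot>\<^bsub>HB\<^esub> (Id M m \<odot>\<^bsub>Ract HB\<^esub> bl (curry_o H) (n, c)) \<cdot>\<^bsub>HB\<^esub> zeta HB n (fo (curry_o H) c) m =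
      fm (curry_o H) (zeta C n c m) \<cdot>\<^bsub>HB\<^esub> bl (curry_o H) (n, m \<bullet>\<^sup>C c) \<cdot>\<^bsub>HB\<^esub> (Id N n \<odot>\<^bsub>Lact HB\<^esub> br (curry_o H) (c, m))"
    by (auto intro!: restrict_ext)
qed

end

end

text \<open>The lifting lemmas are stated for bare \<open>fctr\<close> records, while a bilinear
  functor extends such a record by its linear structures; these are forgotten here.\<close>

definition plain :: "('o1, 'a1, 'o2, 'a2, 'z) fctr_scheme \<Rightarrow> ('o1, 'a1, 'o2, 'a2) fctr" where
  "plain F = \<lparr>fo = fo F, fm = fm F\<rparr>"

lemma plain_simps [simp]: "fo (plain F) = fo F" "fm (plain F) = fm F"
  by (simp_all add: plain_def)

lemma cat_functor_plain: "cat_functor A B F \<Longrightarrow> cat_functor A B (plain F)"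
  by (simp add: cat_functor_def cat_functor_axioms_def)

context adjunction
begin

text \<open>The source of \<open>bl H (n, -)\<close> seen as a transformation in \<open>t\<close>,
  its target being a \<open>precomp\<close>. Left unrestricted, because \<open>nat_lift\<close> and
  \<open>nat_eqI\<close> pass to \<open>restr\<close> themselves.\<close>

definition postL :: "'no \<Rightarrow> ('to, 'ta, 'eo, 'ea) fctr \<Rightarrow> ('to, 'ta, 'eo, 'ea) fctr" where
  "postL n F = \<lparr>fo = \<lambda>t. n \<bullet>\<^sub>E fo F t, fm = \<lambda>g. Id N n \<odot>\<^sub>E fm F g\<rparr>"

definition postR :: "'po \<Rightarrow> ('to, 'ta, 'eo, 'ea) fctr \<Rightarrow> ('to, 'ta, 'eo, 'ea) fctr" where
  "postR p F = \<lparr>fo = \<lambda>t. p \<bullet>\<^sup>E fo F t, fm = \<lambda>g. Id P p \<odot>\<^sup>E fm F g\<rparr>"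

definition precomp :: "('to, 'ta, 'to, 'ta) fctr \<Rightarrow> ('to, 'ta, 'eo, 'ea) fctr \<Rightarrow> ('to, 'ta, 'eo, 'ea) fctr" where
  "precomp G F = \<lparr>fo = \<lambda>t. fo F (fo G t), fm = \<lambda>g. fm F (fm G g)\<rparr>"

lemma post_simps [simp]:
  "fo (postL n F) t = n \<bullet>\<^sub>E fo F t" "fm (postL n F) g = Id N n \<odot>\<^sub>E fm F g"
  "fo (postR p F) t = p \<bullet>\<^sup>E fo F t" "fm (postR p F) g = Id P p \<odot>\<^sup>E fm F g"
  "fo (precomp G F) t = fo F (fo G t)" "fm (precomp G F) g = fm F (fm G g)"
  by (simp_all add: postL_def postR_def precomp_def)

lemma postL_functor:
  assumes "cat_functor T E F" "n \<in> Ob N" shows "cat_functor T E (postL n F)"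
proof -
  interpret F: cat_functor T E F by fact
  show ?thesis using assms(2) by (intro cat_functorI) (simp_all add: U.F.B.category_axioms UE.X.category_axioms)
qed

lemma postR_functor:
  assumes "cat_functor T E F" "p \<in> Ob P" shows "cat_functor T E (postR p F)"
proof -
  interpret F: cat_functor T E F by fact
  show ?thesis using assms(2) by (intro cat_functorI) (simp_all add: U.F.B.category_axioms UE.X.category_axioms)
qed

lemma precomp_functor:
  assumes "cat_functor T E F" "cat_functor T T G" shows "cat_functor T E (precomp G F)"
proof -
  interpret F: cat_functor T E F by fact
  interpret G: cat_functor T T G by fact
  show ?thesis by (intro cat_functorI) (simp_all add: U.F.B.category_axioms UE.X.category_axioms)
qed

lemma curry_c_arr:
  assumes \<xi> [simp]: "\<xi> \<in> Arr TE" and c [simp]: "c \<in> Ob C"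
  shows "\<lparr>Src = curry_at (Src \<xi>) c, Tgt = curry_at (Tgt \<xi>) c, Cmp = \<lambda>d\<in>Ob D. Cmp \<xi> (fo U (c, d))\<rparr> \<in> Arr RL"
proof (rule Arr_RL_I; simp)
  fix g assume "g \<in> Arr D"
  then show "Cmp \<xi> (fo U (c, Cod D g)) \<cdot>\<^sub>E fm (Src \<xi>) (fm U (Id C c, g)) =
    fm (Tgt \<xi>) (fm U (Id C c, g)) \<cdot>\<^sub>E Cmp \<xi> (fo U (c, Dom D g))"
    using TE_natural[OF \<xi>, of "fm U (Id C c, g)"] by simp
next
  fix d p assume "d \<in> Ob D" "p \<in> Ob P"
  then show "Cmp \<xi> (fo U (c, p \<bullet>\<^sup>D d)) \<cdot>\<^sub>E br (Src \<xi>) (fo U (c, d), p) =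
    br (Tgt \<xi>) (fo U (c, d), p) \<cdot>\<^sub>E (Id P p \<odot>\<^sup>E Cmp \<xi> (fo U (c, d)))"
    using TE_right[OF \<xi>, of p "fo U (c, d)"] by simp
qed

lemma curry_a_simps [simp]:
  "Src (curry_a \<xi>) = curry_o (Src \<xi>)" "Tgt (curry_a \<xi>) = curry_o (Tgt \<xi>)"
  "c \<in> Ob C \<Longrightarrow> Cmp (curry_a \<xi>) c = \<lparr>Src = curry_at (Src \<xi>) c, Tgt = curry_at (Tgt \<xi>) c, Cmp = \<lambda>d\<in>Ob D. Cmp \<xi> (fo U (c, d))\<rparr>"
  by (simp_all add: curry_a_def)

text \<open>Left linearity over \<open>N\<close> comes from that of \<xi>, and right linearity over
  \<open>M\<close> is naturality of \<xi> at the inverse balancing. Right linearity over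
  \<open>P\<close> has gone into making each component an arrow of \<open>RL\<close>.\<close>

lemma curry_a_in:
  assumes \<xi> [simp]: "\<xi> \<in> Arr TE" shows "curry_a \<xi> \<in> Arr CH"
proof (rule act_cat.Arr_AC_I[OF act_cat_CH])
  show "Src (curry_a \<xi>) \<in> Ob CH" "Tgt (curry_a \<xi>) \<in> Ob CH" by (simp_all add: curry_o_in)
  show "Cmp (curry_a \<xi>) \<in> extensional (Ob C)" by (simp add: curry_a_def)
  fix c assume c: "c \<in> Ob C"
  show "Cmp (curry_a \<xi>) c \<in> Arr HB \<and> Dom HB (Cmp (curry_a \<xi>) c) = fo (Src (curry_a \<xi>)) c \<and>
    Cod HB (Cmp (curry_a \<xi>) c) = fo (Tgt (curry_a \<xi>)) c"
    using curry_c_arr[OF \<xi> c] c by simp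
next
  fix f assume [simp]: "f \<in> Arr C"
  have "Cmp \<xi> (fo U (Cod C f, d)) \<cdot>\<^sub>E fm (Src \<xi>) (fm U (f, Id D d)) = fm (Tgt \<xi>) (fm U (f, Id D d)) \<cdot>\<^sub>E Cmp \<xi> (fo U (Dom C f, d))"
    if "d \<in> Ob D" for d
    using TE_natural[OF \<xi>, of "fm U (f, Id D d)"] that by simp
  then show "Cmp (curry_a \<xi>) (Cod C f) \<cdot>\<^bsub>HB\<^esub> fm (Src (curry_a \<xi>)) f = fm (Tgt (curry_a \<xi>)) f \<cdot>\<^bsub>HB\<^esub> Cmp (curry_a \<xi>) (Dom C f)"
    by (auto intro!: restrict_ext)
next
  fix n c assume [simp]: "n \<in> Ob N" "c \<in> Ob C"
  have "Cmp \<xi> (fo U (n \<bullet>\<^sub>C c, d)) \<cdot>\<^sub>E bl (Src \<xi>) (n, fo U (c, d)) = bl (Tgt \<xi>) (n, fo U (c, d)) \<cdot>\<^sub>E (Id N n \<odot>\<^sub>E Cmp \<xi> (fo U (c, d)))"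
    if "d \<in> Ob D" for d
    using TE_left[OF \<xi>, of n "fo U (c, d)"] that by simp
  then show "Cmp (curry_a \<xi>) (n \<bullet>\<^sub>C c) \<cdot>\<^bsub>HB\<^esub> bl (Src (curry_a \<xi>)) (n, c) =
       bl (Tgt (curry_a \<xi>)) (n, c) \<cdot>\<^bsub>HB\<^esub> (Id N n \<odot>\<^bsub>Lact HB\<^esub> Cmp (curry_a \<xi>) c)"
    by (auto intro!: restrict_ext)
next
  fix m c assume [simp]: "m \<in> Ob M" "c \<in> Ob C"
  have "Cmp \<xi> (fo U (m \<bullet>\<^sup>C c, d)) \<cdot>\<^sub>E fm (Src \<xi>) (eps_inv c m d) = fm (Tgt \<xi>) (eps_inv c m d) \<cdot>\<^sub>E Cmp \<xi> (fo U (c, m \<bullet>\<^sub>D d))"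
    if "d \<in> Ob D" for d
    using TE_natural[OF \<xi>, of "eps_inv c m d"] that by simp
  then show "Cmp (curry_a \<xi>) (m \<bullet>\<^sup>C c) \<cdot>\<^bsub>HB\<^esub> br (Src (curry_a \<xi>)) (c, m) =
       br (Tgt (curry_a \<xi>)) (c, m) \<cdot>\<^bsub>HB\<^esub> (Id M m \<odot>\<^bsub>Ract HB\<^esub> Cmp (curry_a \<xi>) c)"
    by (auto intro!: restrict_ext)
qed

lemmas TE_simps [simp] = act_cat.AC_simps [OF act_cat_TE, unfolded TB_simps]
lemmas CH_simps [simp] = act_cat.AC_simps [OF act_cat_CH]

lemma curry_functor: "cat_functor TE CH \<lparr>fo = curry_o, fm = curry_a\<rparr>"
proof (rule cat_functorI)
  show "category TE" "category CH"
    using act_cat.category_AC[OF act_cat_TE] act_cat.category_AC[OF act_cat_CH] .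
  fix \<xi> assume "\<xi> \<in> Arr TE"
  then show "fm \<lparr>fo = curry_o, fm = curry_a\<rparr> \<xi> \<in> Arr CH \<and>
      Dom CH (fm \<lparr>fo = curry_o, fm = curry_a\<rparr> \<xi>) = fo \<lparr>fo = curry_o, fm = curry_a\<rparr> (Dom TE \<xi>) \<and>
      Cod CH (fm \<lparr>fo = curry_o, fm = curry_a\<rparr> \<xi>) = fo \<lparr>fo = curry_o, fm = curry_a\<rparr> (Cod TE \<xi>)"
    using curry_a_in by simp
qed (auto simp: curry_o_in curry_a_def intro!: restrict_ext)

section \<open>Injectivity of currying\<close>

lemma TE_plain: "H \<in> Ob TE \<Longrightarrow> cat_functor T E (plain H)"
  by (simp add: cat_functor_plain TE_functor)

lemma bl_nat_trans:
  "H \<in> Ob TE \<Longrightarrow> n \<in> Ob N \<Longrightarrow> nat_trans T E (postL n (plain H)) (precomp (LL n) (plain H)) (\<lambda>t. bl H (n, t))"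
  using TE_bl_natural[of H "Id N n"] by (simp add: nat_trans_iff)

lemma br_nat_trans:
  "H \<in> Ob TE \<Longrightarrow> p \<in> Ob P \<Longrightarrow> nat_trans T E (postR p (plain H)) (precomp (RR p) (plain H)) (\<lambda>t. br H (t, p))"
  using TE_br_natural[of H "Id P p"] by (simp add: nat_trans_iff)

text \<open>Fields of equal records agree, and the remaining values are rebuilt from these:
  \<open>U(f, g)\<close> as a composite of arrows in one variable each, the balancing as the inverse
  of its inverse.\<close>

lemma curry_o_eqD:
  assumes H: "H \<in> Ob TE" "H' \<in> Ob TE" and eq: "curry_o H = curry_o H'"
  shows "c \<in> Ob C \<Longrightarrow> d \<in> Ob D \<Longrightarrow> fo H (fo U (c, d)) = fo H' (fo U (c, d))"
    "f \<in> Arr C \<Longrightarrow> g \<in> Arr D \<Longrightarrow> fm H (fm U (f, g)) = fm H' (fm U (f, g))"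
    "n \<in> Ob N \<Longrightarrow> c \<in> Ob C \<Longrightarrow> d \<in> Ob D \<Longrightarrow> bl H (n, fo U (c, d)) = bl H' (n, fo U (c, d))"
    "p \<in> Ob P \<Longrightarrow> c \<in> Ob C \<Longrightarrow> d \<in> Ob D \<Longrightarrow> br H (fo U (c, d), p) = br H' (fo U (c, d), p)"
    "m \<in> Ob M \<Longrightarrow> c \<in> Ob C \<Longrightarrow> d \<in> Ob D \<Longrightarrow> fm H (eps U (c, m, d)) = fm H' (eps U (c, m, d))"
proof -
  note [simp] = H
  have K: "curry_at H c = curry_at H' c" if "c \<in> Ob C" for c
    using arg_cong[OF eq, of "\<lambda>K. fo K c"] that by simp
  show "fo H (fo U (c, d)) = fo H' (fo U (c, d))" if "c \<in> Ob C" "d \<in> Ob D" for c d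
    using arg_cong[OF K, of c "\<lambda>K. fo K d"] that by simp
  show "br H (fo U (c, d), p) = br H' (fo U (c, d), p)" if "p \<in> Ob P" "c \<in> Ob C" "d \<in> Ob D" for c d p
    using arg_cong[OF K, of c "\<lambda>K. rs K (d, p)"] that by simp
  show "bl H (n, fo U (c, d)) = bl H' (n, fo U (c, d))" if "n \<in> Ob N" "c \<in> Ob C" "d \<in> Ob D" for c d n
    using arg_cong[OF eq, of "\<lambda>K. Cmp (bl K (n, c)) d"] that by simp
  have 1: "fm H (fm U (Id C c, g)) = fm H' (fm U (Id C c, g))" if "c \<in> Ob C" "g \<in> Arr D" for c g
    using arg_cong[OF K, of c "\<lambda>K. fm K g"] that by simp
  have 2: "fm H (fm U (f, Id D d)) = fm H' (fm U (f, Id D d))" if "f \<in> Arr C" "d \<in> Ob D" for f d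
    using arg_cong[OF eq, of "\<lambda>K. Cmp (fm K f) d"] that by simp
  show "fm H (fm U (f, g)) = fm H' (fm U (f, g))" if [simp]: "f \<in> Arr C" "g \<in> Arr D" for f g
  proof -
    have "fm U (f, g) = fm U (f, Id D (Cod D g)) \<cdot>\<^sub>T fm U (Id C (Dom C f), g)" by (simp add: U.bi_merge)
    then show ?thesis by (simp add: 1 2)
  qed
  show "fm H (eps U (c, m, d)) = fm H' (eps U (c, m, d))" if "m \<in> Ob M" "c \<in> Ob C" "d \<in> Ob D" for c m d
  proof -
    have "fm H (eps_inv c m d) = fm H' (eps_inv c m d)"
      using arg_cong[OF eq, of "\<lambda>K. Cmp (br K (c, m)) d"] that by simp
    then have "inv_arr E (fm H (eps_inv c m d)) = inv_arr E (fm H' (eps_inv c m d))" by simp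
    then show ?thesis using that by (simp del: UE.X.inv_arr_arr)
  qed
qed

text \<open>Agreement on generators gives equal underlying functors by uniqueness of lifts. Only
  then do the linear structures of \<open>H\<close> and \<open>H'\<close> have common source and
  target functors, so that \<open>nat_eqI\<close> can compare them.\<close>

lemma curry_o_inj: "inj_on curry_o (Ob TE)"
proof (rule inj_onI)
  fix H H' assume H [simp]: "H \<in> Ob TE" "H' \<in> Ob TE" and eq: "curry_o H = curry_o H'"
  note [simp] = curry_o_eqD[OF H eq]
  have "plain H = plain H'"
    by (rule UE.functor_eqI) (auto simp: TE_plain TE_ext bal_comp_def intro!: restrict_ext)
  then have fo: "fo H = fo H'" "fm H = fm H'" by (simp_all add: plain_def)
  then have p: "plain H = plain H'" by (simp add: plain_def)
  have "bl H (n, t) = bl H' (n, t)" if [simp]: "n \<in> Ob N" "t \<in> Ob T" for n t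
    by (rule UE.nat_eqI[OF postL_functor precomp_functor bl_nat_trans[of H n] bl_nat_trans[of H' n, folded p]])
      (simp_all add: TE_plain LG.L_functor)
  then have bl: "bl H = bl H'"
    using TE_ext(3)[of H] TE_ext(3)[of H'] by (intro extensionalityI[of _ "Ob N \<times> Ob T"]) auto
  have "br H (t, p) = br H' (t, p)" if [simp]: "p \<in> Ob P" "t \<in> Ob T" for p t
    by (rule UE.nat_eqI[OF postR_functor precomp_functor br_nat_trans[of H p] br_nat_trans[of H' p, folded p]])
      (simp_all add: TE_plain RG_L_functor)
  then have "br H = br H'"
    using TE_ext(4)[of H] TE_ext(4)[of H'] by (intro extensionalityI[of _ "Ob T \<times> Ob P"]) auto
  with fo bl show "H = H'" by simp
qed

lemma curry_a_inj: "inj_on curry_a (Arr TE)"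
proof (rule inj_onI)
  fix \<xi> \<xi>' assume \<xi> [simp]: "\<xi> \<in> Arr TE" "\<xi>' \<in> Arr TE" and eq: "curry_a \<xi> = curry_a \<xi>'"
  have S: "Src \<xi> = Src \<xi>'" "Tgt \<xi> = Tgt \<xi>'"
    using arg_cong[OF eq, of Src] arg_cong[OF eq, of Tgt] curry_o_inj by (auto dest: inj_onD)
  have c: "Cmp \<xi> (fo U (c, d)) = Cmp \<xi>' (fo U (c, d))" if "c \<in> Ob C" "d \<in> Ob D" for c d
    using arg_cong[OF eq, of "\<lambda>\<xi>. Cmp (Cmp \<xi> c) d"] that by simp
  have "nat_trans T E (plain (Src \<xi>)) (plain (Tgt \<xi>)) (Cmp \<xi>)" "nat_trans T E (plain (Src \<xi>)) (plain (Tgt \<xi>)) (Cmp \<xi>')"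
    using TE_natural[OF \<xi>(1)] TE_natural[OF \<xi>(2)] by (simp_all add: nat_trans_iff S)
  note n = UE.nat_eqI[OF TE_plain TE_plain this c]
  show "\<xi> = \<xi>'"
    by (rule trans_eqI[where X="Ob T"]) (use S n in simp_all)
qed


text \<open>Inverse arrows of \<open>RL\<close> have inverse components. This converse of
  \<open>iso_RL\<close> makes the components of \<open>br K\<close> invertible in \<open>E\<close>,
  so that a balancing can be defined from them.\<close>

lemma iso_RL_Cmp:
  assumes "iso_arr RL \<tau>" "d \<in> Ob D" shows "iso_arr E (Cmp \<tau> d)"
proof -
  note i = RC.inv_arr_arr[OF assms(1)] RC.iso_arr_arr[OF assms(1)]
  have "Cmp (inv_arr RL \<tau> \<cdot>\<^bsub>RL\<^esub> \<tau>) d = Cmp (Id RL (Src \<tau>)) d" "Cmp (\<tau> \<cdot>\<^bsub>RL\<^esub> inv_arr RL \<tau>) d = Cmp (Id RL (Tgt \<tau>)) d"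
    using RC.inv_comp[OF assms(1)] by (simp_all only: RL_simps)
  then show ?thesis using i assms(2) by (intro UE.X.iso_arrI(1)[of _ "Cmp (inv_arr RL \<tau>) d"]) simp_all
qed

section \<open>Component laws of a bilinear functor into the functor biactegory\<close>

lemmas CH_ext = act_cat.AC_ext [OF act_cat_CH]
lemmas CH_arr = act_cat.AC_functor_simps(1-6) [OF act_cat_CH, unfolded HB_simps]
lemmas CH_bl = act_cat.bl_arr [OF act_cat_CH, unfolded HB_simps HB_left(1)]
lemmas CH_br = act_cat.br_arr [OF act_cat_CH, unfolded HB_simps HB_right(1)]

abbreviation "kf K f d \<equiv> Cmp (fm K f) d"
abbreviation "kl K n c d \<equiv> Cmp (bl K (n, c)) d"
abbreviation "kr K c m d \<equiv> Cmp (br K (c, m)) d"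

lemma CH_simps' [simp]:
  assumes "K \<in> Ob CH"
  shows "c \<in> Ob C \<Longrightarrow> fo K c \<in> Ob RL" "f \<in> Arr C \<Longrightarrow> fm K f \<in> Arr RL"
    "f \<in> Arr C \<Longrightarrow> Src (fm K f) = fo K (Dom C f)" "f \<in> Arr C \<Longrightarrow> Tgt (fm K f) = fo K (Cod C f)"
    "n \<in> Ob N \<Longrightarrow> c \<in> Ob C \<Longrightarrow> bl K (n, c) \<in> Arr RL" "n \<in> Ob N \<Longrightarrow> c \<in> Ob C \<Longrightarrow> Src (bl K (n, c)) = lH n (fo K c)"
    "n \<in> Ob N \<Longrightarrow> c \<in> Ob C \<Longrightarrow> Tgt (bl K (n, c)) = fo K (n \<bullet>\<^sub>C c)"
    "m \<in> Ob M \<Longrightarrow> c \<in> Ob C \<Longrightarrow> br K (c, m) \<in> Arr RL" "m \<in> Ob M \<Longrightarrow> c \<in> Ob C \<Longrightarrow> Src (br K (c, m)) = rH (fo K c) m"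
    "m \<in> Ob M \<Longrightarrow> c \<in> Ob C \<Longrightarrow> Tgt (br K (c, m)) = fo K (m \<bullet>\<^sup>C c)"
    "n \<in> Ob N \<Longrightarrow> c \<in> Ob C \<Longrightarrow> d \<in> Ob D \<Longrightarrow> iso_arr E (kl K n c d)"
    "m \<in> Ob M \<Longrightarrow> c \<in> Ob C \<Longrightarrow> d \<in> Ob D \<Longrightarrow> iso_arr E (kr K c m d)"
  using CH_arr[OF assms] CH_bl[OF assms] CH_br[OF assms] iso_RL_Cmp by auto

context
  fixes K assumes K [simp]: "K \<in> Ob CH"
begin

lemma kf_Id [simp]: "c \<in> Ob C \<Longrightarrow> d \<in> Ob D \<Longrightarrow> kf K (Id C c) d = Id E (fo (fo K c) d)"
  using CH_arr(5)[OF K, of c] by simp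

lemma kf_comp [simp]: "f \<in> Arr C \<Longrightarrow> g \<in> Arr C \<Longrightarrow> Cod C f = Dom C g \<Longrightarrow> d \<in> Ob D \<Longrightarrow> kf K (g \<cdot>\<^sub>C f) d = kf K g d \<cdot>\<^sub>E kf K f d"
  using CH_arr(6)[OF K, of f g] by simp

lemma kf_natural: "f \<in> Arr C \<Longrightarrow> g \<in> Arr D \<Longrightarrow> c = Dom C f \<Longrightarrow> d = Cod D g \<Longrightarrow>
    kf K f d \<cdot>\<^sub>E fm (fo K c) g = fm (fo K (Cod C f)) g \<cdot>\<^sub>E kf K f (Dom D g)"
  using RL_Cmp_natural[of "fm K f" g] by simp

lemma kf_linear: "f \<in> Arr C \<Longrightarrow> d \<in> Ob D \<Longrightarrow> p \<in> Ob P \<Longrightarrow> c = Dom C f \<Longrightarrow>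
    kf K f (p \<bullet>\<^sup>D d) \<cdot>\<^sub>E rs (fo K c) (d, p) = rs (fo K (Cod C f)) (d, p) \<cdot>\<^sub>E (Id P p \<odot>\<^sup>E kf K f d)"
  using RL_Cmp_linear[of "fm K f" d p] by simp

lemma kl_natural_d: "n \<in> Ob N \<Longrightarrow> c \<in> Ob C \<Longrightarrow> g \<in> Arr D \<Longrightarrow> d = Cod D g \<Longrightarrow>
    kl K n c d \<cdot>\<^sub>E (Id N n \<odot>\<^sub>E fm (fo K c) g) = fm (fo K (n \<bullet>\<^sub>C c)) g \<cdot>\<^sub>E kl K n c (Dom D g)"
  using RL_Cmp_natural[of "bl K (n, c)" g] by simp

text \<open>Linearity of the arrow \<open>bl K (n, c)\<close>, with the inverse bimodulator
  contained in \<open>lhom\<close> cleared. In this form it is the compatibility law that the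
  uncurried functor must satisfy on generators.\<close>

lemma kl_linear:
  assumes [simp]: "n \<in> Ob N" "c \<in> Ob C" "d \<in> Ob D" "p \<in> Ob P"
  shows "kl K n c (p \<bullet>\<^sup>D d) \<cdot>\<^sub>E (Id N n \<odot>\<^sub>E rs (fo K c) (d, p)) =
    rs (fo K (n \<bullet>\<^sub>C c)) (d, p) \<cdot>\<^sub>E (Id P p \<odot>\<^sup>E kl K n c d) \<cdot>\<^sub>E zeta E n (fo (fo K c) d) p"
proof -
  let ?z = "zeta E n (fo (fo K c) d) p"
  have "(kl K n c (p \<bullet>\<^sup>D d) \<cdot>\<^sub>E (Id N n \<odot>\<^sub>E rs (fo K c) (d, p)) \<cdot>\<^sub>E inv_arr E ?z) \<cdot>\<^sub>E ?z =
    (rs (fo K (n \<bullet>\<^sub>C c)) (d, p) \<cdot>\<^sub>E (Id P p \<odot>\<^sup>E kl K n c d)) \<cdot>\<^sub>E ?z"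
    using RL_Cmp_linear[of "bl K (n, c)" d p] by simp
  then show ?thesis by simp
qed

text \<open>An equation between arrows of \<open>RL\<close> is evaluated at the component
  \<open>d\<close>; most laws below for \<open>kl\<close> and \<open>kr\<close> are obtained in this
  way.\<close>

lemma kl_natural:
  assumes [simp]: "f \<in> Arr N" "g \<in> Arr C" "d \<in> Ob D"
  shows "kl K (Cod N f) (Cod C g) d \<cdot>\<^sub>E (f \<odot>\<^sub>E kf K g d) = kf K (f \<odot>\<^sub>C g) d \<cdot>\<^sub>E kl K (Dom N f) (Dom C g) d"
  using arg_cong[OF act_cat.bl_natural[OF act_cat_CH K, of f g "Cod N f" "Cod C g"], of "\<lambda>\<tau>. Cmp \<tau> d"] by simp

lemma kl_mu:
  assumes [simp]: "m \<in> Ob N" "n \<in> Ob N" "c \<in> Ob C" "d \<in> Ob D"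
  shows "kf K (mu (Lact C) m n c) d \<cdot>\<^sub>E kl K m (n \<bullet>\<^sub>C c) d \<cdot>\<^sub>E (Id N m \<odot>\<^sub>E kl K n c d) =
    kl K (m \<otimes>\<^bsub>N\<^esub> n) c d \<cdot>\<^sub>E mu (Lact E) m n (fo (fo K c) d)"
  using arg_cong[OF act_cat.bl_mu[OF act_cat_CH K, of m n c], of "\<lambda>\<tau>. Cmp \<tau> d"] by simp

lemma kl_eta:
  assumes [simp]: "c \<in> Ob C" "d \<in> Ob D"
  shows "kl K j\<^bsub>N\<^esub> c d \<cdot>\<^sub>E eta (Lact E) (fo (fo K c) d) = kf K (eta (Lact C) c) d"
  using arg_cong[OF act_cat.bl_eta[OF act_cat_CH K, of c], of "\<lambda>\<tau>. Cmp \<tau> d"] by simp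

lemma kr_natural_d: "m \<in> Ob M \<Longrightarrow> c \<in> Ob C \<Longrightarrow> g \<in> Arr D \<Longrightarrow> d = Cod D g \<Longrightarrow>
    kr K c m d \<cdot>\<^sub>E fm (fo K c) (Id M m \<odot>\<^sub>D g) = fm (fo K (m \<bullet>\<^sup>C c)) g \<cdot>\<^sub>E kr K c m (Dom D g)"
  using RL_Cmp_natural[of "br K (c, m)" g] by simp

lemma kr_linear:
  assumes [simp]: "m \<in> Ob M" "c \<in> Ob C" "d \<in> Ob D" "p \<in> Ob P"
  shows "kr K c m (p \<bullet>\<^sup>D d) \<cdot>\<^sub>E fm (fo K c) (inv_arr D (zeta D m d p)) \<cdot>\<^sub>E rs (fo K c) (m \<bullet>\<^sub>D d, p) =
    rs (fo K (m \<bullet>\<^sup>C c)) (d, p) \<cdot>\<^sub>E (Id P p \<odot>\<^sup>E kr K c m d)"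
  using RL_Cmp_linear[of "br K (c, m)" d p] by simp

lemma kr_natural:
  assumes [simp]: "f \<in> Arr M" "g \<in> Arr C" "d \<in> Ob D"
  shows "kr K (Cod C g) (Cod M f) d \<cdot>\<^sub>E fm (fo K (Cod C g)) (f \<odot>\<^sub>D Id D d) \<cdot>\<^sub>E kf K g (Dom M f \<bullet>\<^sub>D d) =
    kf K (f \<odot>\<^sup>C g) d \<cdot>\<^sub>E kr K (Dom C g) (Dom M f) d"
  using arg_cong[OF act_cat.br_natural[OF act_cat_CH K, of f g "Cod M f" "Cod C g"], of "\<lambda>\<tau>. Cmp \<tau> d"] by simp

lemma kr_mu:
  assumes [simp]: "m \<in> Ob M" "n \<in> Ob M" "c \<in> Ob C" "d \<in> Ob D"
  shows "kf K (mu (Ract C) n m c) d \<cdot>\<^sub>E kr K (m \<bullet>\<^sup>C c) n d \<cdot>\<^sub>E kr K c m (n \<bullet>\<^sub>D d) =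
    kr K c (m \<otimes>\<^bsub>M\<^esub> n) d \<cdot>\<^sub>E fm (fo K c) (mu (Lact D) m n d)"
  using arg_cong[OF act_cat.br_mu[OF act_cat_CH K, of n m c], of "\<lambda>\<tau>. Cmp \<tau> d"] by simp

lemma kr_eta:
  assumes [simp]: "c \<in> Ob C" "d \<in> Ob D"
  shows "kr K c j\<^bsub>M\<^esub> d \<cdot>\<^sub>E fm (fo K c) (eta (Lact D) d) = kf K (eta (Ract C) c) d"
  using arg_cong[OF act_cat.br_eta[OF act_cat_CH K, of c], of "\<lambda>\<tau>. Cmp \<tau> d"] by simp

text \<open>The compatibility law of \<open>K\<close>, from which the bimodulator of the functor
  biactegory drops out as an identity.\<close>

lemma kl_kr:
  assumes [simp]: "n \<in> Ob N" "c \<in> Ob C" "m \<in> Ob M" "d \<in> Ob D"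
  shows "kr K (n \<bullet>\<^sub>C c) m d \<cdot>\<^sub>E kl K n c (m \<bullet>\<^sub>D d) =
    kf K (zeta C n c m) d \<cdot>\<^sub>E kl K n (m \<bullet>\<^sup>C c) d \<cdot>\<^sub>E (Id N n \<odot>\<^sub>E kr K c m d)"
  using arg_cong[OF act_cat.bilinear[OF act_cat_CH K, of n c m], of "\<lambda>\<tau>. Cmp \<tau> d"] by simp

text \<open>An order of the two variables is chosen for arrows; by \<open>kf_natural\<close> the
  other order gives the same. The balancing inverts \<open>kr\<close> because it runs against the
  right linear structure.\<close>

definition uncurry_bal :: "('co, 'ca, 'do, 'da, 'mo, 'eo, 'ea) bal" where
  "uncurry_bal = \<lparr>fo = \<lambda>(c, d)\<in>Ob C \<times> Ob D. fo (fo K c) d,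
     fm = \<lambda>(f, g)\<in>Arr C \<times> Arr D. kf K f (Cod D g) \<cdot>\<^sub>E fm (fo K (Dom C f)) g,
     eps = \<lambda>(c, m, d)\<in>Ob C \<times> Ob M \<times> Ob D. inv_arr E (kr K c m d)\<rparr>"

lemma uncurry_bal_simps [simp]:
  "c \<in> Ob C \<Longrightarrow> d \<in> Ob D \<Longrightarrow> fo uncurry_bal (c, d) = fo (fo K c) d"
  "f \<in> Arr C \<Longrightarrow> g \<in> Arr D \<Longrightarrow> fm uncurry_bal (f, g) = kf K f (Cod D g) \<cdot>\<^sub>E fm (fo K (Dom C f)) g"
  "c \<in> Ob C \<Longrightarrow> m \<in> Ob M \<Longrightarrow> d \<in> Ob D \<Longrightarrow> eps uncurry_bal (c, m, d) = inv_arr E (kr K c m d)"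
  by (simp_all add: uncurry_bal_def)

text \<open>The balancing laws are the laws of \<open>kr\<close> inverted: naturality from
  \<open>kr_natural\<close> and \<open>kr_natural_d\<close>, multiplication from
  \<open>kr_mu\<close>, unit from \<open>kr_eta\<close>. Functoriality is
  \<open>kf_natural\<close>.\<close>

lemma uncurry_bal_balanced: "balanced_functor M C (Ract C) D (Lact D) E uncurry_bal"
proof (rule balanced_functorI)
  show "left_actegory (mrev M) C (Ract C)" "left_actegory M D (Lact D)" by unfold_locales
  have comp: "kf K f' (Cod D g') \<cdot>\<^sub>E kf K f (Cod D g') \<cdot>\<^sub>E fm (fo K (Dom C f)) g' \<cdot>\<^sub>E fm (fo K (Dom C f)) g =
     kf K f' (Cod D g') \<cdot>\<^sub>E fm (fo K (Dom C f')) g' \<cdot>\<^sub>E kf K f (Cod D g) \<cdot>\<^sub>E fm (fo K (Dom C f)) g"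
    if "f \<in> Arr C" "f' \<in> Arr C" "g \<in> Arr D" "g' \<in> Arr D" "Cod C f = Dom C f'" "Cod D g = Dom D g'" for f f' g g'
    using that by (simp add: UE.X.pre[OF kf_natural])
  show "cat_functor (prod_cat C D) E uncurry_bal"
    by (intro cat_functorI) (auto simp: U.F.A.category_axioms UE.X.category_axioms comp)
next
  fix f g h assume [simp]: "f \<in> Arr C" "g \<in> Arr M" "h \<in> Arr D"
  let ?m = "Dom M g" and ?m' = "Cod M g" and ?c = "Dom C f" and ?c' = "Cod C f" and ?d = "Dom D h" and ?d' = "Cod D h"
  \<comment> \<open>\<open>kr_natural\<close> covers arrows of \<open>M\<close> and \<open>C\<close>
    at a fixed \<open>d\<close>, \<open>kr_natural_d\<close> arrows of \<open>D\<close> at a fixed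
    \<open>m\<close>; the joint action of \<open>g\<close> and \<open>h\<close> is factored
    accordingly.\<close>
  have "fm (fo K ?c) (g \<odot>\<^sub>D h) = fm (fo K ?c) ((g \<odot>\<^sub>D Id D ?d') \<cdot>\<^sub>D (Id M ?m \<odot>\<^sub>D h))"
    by (simp only: D.L.act_merge \<open>g \<in> Arr M\<close> \<open>h \<in> Arr D\<close>)
  also have "\<dots> = fm (fo K ?c) (g \<odot>\<^sub>D Id D ?d') \<cdot>\<^sub>E fm (fo K ?c) (Id M ?m \<odot>\<^sub>D h)" by simp
  finally have gh: "fm (fo K ?c) (g \<odot>\<^sub>D h) =
    fm (fo K ?c) (g \<odot>\<^sub>D Id D ?d') \<cdot>\<^sub>E fm (fo K ?c) (Id M ?m \<odot>\<^sub>D h)" .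
  have "kr K ?c' ?m' ?d' \<cdot>\<^sub>E kf K f (?m' \<bullet>\<^sub>D ?d') \<cdot>\<^sub>E fm (fo K ?c) (g \<odot>\<^sub>D h) =
    (kr K ?c' ?m' ?d' \<cdot>\<^sub>E fm (fo K ?c') (g \<odot>\<^sub>D Id D ?d') \<cdot>\<^sub>E kf K f (?m \<bullet>\<^sub>D ?d')) \<cdot>\<^sub>E fm (fo K ?c) (Id M ?m \<odot>\<^sub>D h)"
    by (simp add: gh UE.X.pre[OF kf_natural])
  also have "\<dots> = (kf K (g \<odot>\<^sup>C f) ?d' \<cdot>\<^sub>E kr K ?c ?m ?d') \<cdot>\<^sub>E fm (fo K ?c) (Id M ?m \<odot>\<^sub>D h)"
    by (subst kr_natural) simp_all
  also have "\<dots> = (kf K (g \<odot>\<^sup>C f) ?d' \<cdot>\<^sub>E fm (fo K (?m \<bullet>\<^sup>C ?c)) h) \<cdot>\<^sub>E kr K ?c ?m ?d"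
    by (simp add: kr_natural_d)
  finally have "inv_arr E (kr K ?c' ?m' ?d') \<cdot>\<^sub>E kf K (g \<odot>\<^sup>C f) ?d' \<cdot>\<^sub>E fm (fo K (?m \<bullet>\<^sup>C ?c)) h =
    (kf K f (?m' \<bullet>\<^sub>D ?d') \<cdot>\<^sub>E fm (fo K ?c) (g \<odot>\<^sub>D h)) \<cdot>\<^sub>E inv_arr E (kr K ?c ?m ?d)"
    by (intro UE.X.inv_square) simp_all
  then show "eps uncurry_bal (Cod C f, Cod M g, Cod D h) \<cdot>\<^sub>E fm uncurry_bal (g \<odot>\<^sup>C f, h) =
    fm uncurry_bal (f, g \<odot>\<^sub>D h) \<cdot>\<^sub>E eps uncurry_bal (Dom C f, Dom M g, Dom D h)" by simp
next
  fix c m n d assume [simp]: "c \<in> Ob C" "m \<in> Ob M" "n \<in> Ob M" "d \<in> Ob D"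
  have "inv_arr E (kr K c (m \<otimes>\<^bsub>M\<^esub> n) d) \<cdot>\<^sub>E kf K (mu (Ract C) n m c) d =
     fm (fo K c) (mu (Lact D) m n d) \<cdot>\<^sub>E inv_arr E (kr K (m \<bullet>\<^sup>C c) n d \<cdot>\<^sub>E kr K c m (n \<bullet>\<^sub>D d))"
    by (rule UE.X.inv_square) (simp_all add: UE.X.iso_comp kr_mu)
  then show "fm uncurry_bal (Id C c, mu (Lact D) m n d) \<cdot>\<^sub>E eps uncurry_bal (c, m, n \<bullet>\<^sub>D d) \<cdot>\<^sub>E eps uncurry_bal (m \<bullet>\<^sup>C c, n, d) =
    eps uncurry_bal (c, m \<otimes>\<^bsub>M\<^esub> n, d) \<cdot>\<^sub>E fm uncurry_bal (mu (Ract C) n m c, Id D d)"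
    by (simp add: UE.X.iso_comp)
next
  fix c d assume "c \<in> Ob C" "d \<in> Ob D"
  then show "eps uncurry_bal (c, j\<^bsub>M\<^esub>, d) \<cdot>\<^sub>E fm uncurry_bal (eta (Ract C) c, Id D d) = fm uncurry_bal (Id C c, eta (Lact D) d)"
    by (simp flip: kr_eta)
qed simp_all

lemma uncurry_bal_in: "uncurry_bal \<in> Ob (Bal M C (Ract C) D (Lact D) E)"
  using uncurry_bal_balanced by (simp add: UE.Ob_Bal uncurry_bal_def)

end


lemmas TE_I = act_cat.Ob_AC_I [OF act_cat_TE, unfolded TB_simps TB_act LG.ACT_o RG.ACT_o]

lemma RL_ext: "F \<in> Ob RL \<Longrightarrow> fo F \<in> extensional (Ob D) \<and> fm F \<in> extensional (Arr D) \<and> rs F \<in> extensional (Ob D \<times> Ob P)"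
  unfolding Ob_RL by blast

section \<open>Uncurrying: lifting the linear structures to the tensor product\<close>

context
  fixes K and H :: "('to, 'ta, 'eo, 'ea) fctr"
  assumes K [simp]: "K \<in> Ob CH"
    and H_functor: "cat_functor T E H" and H_ext: "fo H \<in> extensional (Ob T)" "fm H \<in> extensional (Arr T)"
    and H_U: "bal_comp M C D U H = uncurry_bal K"
begin

interpretation H: cat_functor T E H by (rule H_functor)

lemma H_o [simp]: "c \<in> Ob C \<Longrightarrow> d \<in> Ob D \<Longrightarrow> fo H (fo U (c, d)) = fo (fo K c) d"
  using arg_cong[OF H_U, of "\<lambda>F. fo F (c, d)"] by (simp add: bal_comp_def uncurry_bal_simps[OF K])

lemma H_m [simp]: "f \<in> Arr C \<Longrightarrow> g \<in> Arr D \<Longrightarrow> fm H (fm U (f, g)) = kf K f (Cod D g) \<cdot>\<^sub>E fm (fo K (Dom C f)) g"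
  using arg_cong[OF H_U, of "\<lambda>F. fm F (f, g)"] by (simp add: bal_comp_def uncurry_bal_simps[OF K])

lemma H_e [simp]: "c \<in> Ob C \<Longrightarrow> m \<in> Ob M \<Longrightarrow> d \<in> Ob D \<Longrightarrow> fm H (eps U (c, m, d)) = inv_arr E (kr K c m d)"
  using arg_cong[OF H_U, of "\<lambda>F. eps F (c, m, d)"] by (simp add: bal_comp_def uncurry_bal_simps[OF K])

text \<open>The components of \<open>bl K\<close> are natural in both variables and balanced, the
  latter being \<open>kl_kr\<close> with \<open>kr\<close> inverted; hence they extend to all of
  \<open>T\<close>.\<close>

lemma lift_bl_exists:
  assumes [simp]: "n \<in> Ob N"
  shows "\<exists>\<xi>. nat_trans T E (postL n H) (precomp (LL n) H) \<xi> \<and> (\<forall>c\<in>Ob C. \<forall>d\<in>Ob D. \<xi> (fo U (c, d)) = kl K n c d)"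
proof (rule UE.nat_lift)
  show "cat_functor T E (postL n H)" "cat_functor T E (precomp (LL n) H)"
    by (simp_all add: postL_functor precomp_functor H_functor LG.L_functor)
next
  fix f g assume [simp]: "f \<in> Arr C" "g \<in> Arr D"
  have "kl K n (Cod C f) (Cod D g) \<cdot>\<^sub>E (Id N n \<odot>\<^sub>E kf K f (Cod D g)) \<cdot>\<^sub>E (Id N n \<odot>\<^sub>E fm (fo K (Dom C f)) g) =
    kf K (Id N n \<odot>\<^sub>C f) (Cod D g) \<cdot>\<^sub>E fm (fo K (n \<bullet>\<^sub>C Dom C f)) g \<cdot>\<^sub>E kl K n (Dom C f) (Dom D g)"
    using UE.X.pre[OF kl_natural[OF K, of "Id N n" f "Cod D g"]] by (simp add: kl_natural_d[OF K])
  then show "kl K n (Cod C f) (Cod D g) \<cdot>\<^sub>E fm (postL n H) (fm U (f, g)) =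
      fm (precomp (LL n) H) (fm U (f, g)) \<cdot>\<^sub>E kl K n (Dom C f) (Dom D g)" by simp
next
  fix c m d assume [simp]: "c \<in> Ob C" "m \<in> Ob M" "d \<in> Ob D"
  have "inv_arr E (kr K (n \<bullet>\<^sub>C c) m d) \<cdot>\<^sub>E kf K (zeta C n c m) d \<cdot>\<^sub>E kl K n (m \<bullet>\<^sup>C c) d =
    kl K n c (m \<bullet>\<^sub>D d) \<cdot>\<^sub>E inv_arr E (Id N n \<odot>\<^sub>E kr K c m d)"
    by (rule UE.X.inv_square) (simp_all add: kl_kr[OF K])
  then show "fm (precomp (LL n) H) (eps U (c, m, d)) \<cdot>\<^sub>E kl K n (m \<bullet>\<^sup>C c) d =
    kl K n c (m \<bullet>\<^sub>D d) \<cdot>\<^sub>E fm (postL n H) (eps U (c, m, d))"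
    by (simp add: LG.L_eps)
qed simp

text \<open>The data are the right linear structures of the single functors \<open>K(c)\<close>.
  Naturality in \<open>c\<close> holds because \<open>fm K f\<close> is right linear, balancedness
  because \<open>br K (c, m)\<close> is (\<open>kr_linear\<close>).\<close>

lemma lift_br_exists:
  assumes [simp]: "p \<in> Ob P"
  shows "\<exists>\<xi>. nat_trans T E (postR p H) (precomp (RR p) H) \<xi> \<and> (\<forall>c\<in>Ob C. \<forall>d\<in>Ob D. \<xi> (fo U (c, d)) = rs (fo K c) (d, p))"
proof (rule UE.nat_lift)
  show "cat_functor T E (postR p H)" "cat_functor T E (precomp (RR p) H)"
    by (simp_all add: postR_functor precomp_functor H_functor RG_L_functor)
next
  fix f g assume [simp]: "f \<in> Arr C" "g \<in> Arr D"
  have "rs (fo K (Cod C f)) (Cod D g, p) \<cdot>\<^sub>E (Id P p \<odot>\<^sup>E kf K f (Cod D g)) \<cdot>\<^sub>E (Id P p \<odot>\<^sup>E fm (fo K (Dom C f)) g) =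
    kf K f (p \<bullet>\<^sup>D Cod D g) \<cdot>\<^sub>E fm (fo K (Dom C f)) (Id P p \<odot>\<^sup>D g) \<cdot>\<^sub>E rs (fo K (Dom C f)) (Dom D g, p)"
    using UE.X.pre[OF kf_linear[OF K, of f "Cod D g" p, symmetric]] by (simp add: rs_natural)
  then show "rs (fo K (Cod C f)) (Cod D g, p) \<cdot>\<^sub>E fm (postR p H) (fm U (f, g)) =
      fm (precomp (RR p) H) (fm U (f, g)) \<cdot>\<^sub>E rs (fo K (Dom C f)) (Dom D g, p)" by simp
next
  fix c m d assume [simp]: "c \<in> Ob C" "m \<in> Ob M" "d \<in> Ob D"
  have "inv_arr E (kr K c m (p \<bullet>\<^sup>D d) \<cdot>\<^sub>E fm (fo K c) (inv_arr D (zeta D m d p))) \<cdot>\<^sub>E rs (fo K (m \<bullet>\<^sup>C c)) (d, p) =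
    rs (fo K c) (m \<bullet>\<^sub>D d, p) \<cdot>\<^sub>E inv_arr E (Id P p \<odot>\<^sup>E kr K c m d)"
    by (rule UE.X.inv_square) (simp_all add: UE.X.iso_comp kr_linear[OF K])
  then show "fm (precomp (RR p) H) (eps U (c, m, d)) \<cdot>\<^sub>E rs (fo K (m \<bullet>\<^sup>C c)) (d, p) =
    rs (fo K c) (m \<bullet>\<^sub>D d, p) \<cdot>\<^sub>E fm (postR p H) (eps U (c, m, d))"
    by (simp add: RG.L_eps UE.X.iso_comp)
qed simp

text \<open>Any choice will do: by \<open>nat_eqI\<close> the values on \<open>Ob T\<close> are
  determined by those on generators.\<close>

definition lift_bl where "lift_bl n = (SOME \<xi>. nat_trans T E (postL n H) (precomp (LL n) H) \<xi> \<and> (\<forall>c\<in>Ob C. \<forall>d\<in>Ob D. \<xi> (fo U (c, d)) = kl K n c d))"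
definition lift_br where "lift_br p = (SOME \<xi>. nat_trans T E (postR p H) (precomp (RR p) H) \<xi> \<and> (\<forall>c\<in>Ob C. \<forall>d\<in>Ob D. \<xi> (fo U (c, d)) = rs (fo K c) (d, p)))"

lemma lift_bl:
  assumes "n \<in> Ob N"
  shows "nat_trans T E (postL n H) (precomp (LL n) H) (lift_bl n)" "\<And>c d. c \<in> Ob C \<Longrightarrow> d \<in> Ob D \<Longrightarrow> lift_bl n (fo U (c, d)) = kl K n c d"
  using someI_ex[OF lift_bl_exists[OF assms]] unfolding lift_bl_def by blast+

lemma lift_br:
  assumes "p \<in> Ob P"
  shows "nat_trans T E (postR p H) (precomp (RR p) H) (lift_br p)" "\<And>c d. c \<in> Ob C \<Longrightarrow> d \<in> Ob D \<Longrightarrow> lift_br p (fo U (c, d)) = rs (fo K c) (d, p)"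
  using someI_ex[OF lift_br_exists[OF assms]] unfolding lift_br_def by blast+

lemma lift_bl_arr [simp]:
  assumes "n \<in> Ob N" "t \<in> Ob T"
  shows "lift_bl n t \<in> Arr E" "Dom E (lift_bl n t) = n \<bullet>\<^sub>E fo H t" "Cod E (lift_bl n t) = fo H (fo (LL n) t)"
  using lift_bl(1)[OF assms(1)] assms(2) by (simp_all add: nat_trans_iff)

lemma lift_br_arr [simp]:
  assumes "p \<in> Ob P" "t \<in> Ob T"
  shows "lift_br p t \<in> Arr E" "Dom E (lift_br p t) = p \<bullet>\<^sup>E fo H t" "Cod E (lift_br p t) = fo H (fo (RR p) t)"
  using lift_br(1)[OF assms(1)] assms(2) by (simp_all add: nat_trans_iff)

lemma lift_bl_natural: "n \<in> Ob N \<Longrightarrow> g \<in> Arr T \<Longrightarrow> t = Cod T g \<Longrightarrow>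
    lift_bl n t \<cdot>\<^sub>E (Id N n \<odot>\<^sub>E fm H g) = fm H (fm (LL n) g) \<cdot>\<^sub>E lift_bl n (Dom T g)"
  using lift_bl(1)[of n] by (simp add: nat_trans_iff)

lemma lift_br_natural: "p \<in> Ob P \<Longrightarrow> g \<in> Arr T \<Longrightarrow> t = Cod T g \<Longrightarrow>
    lift_br p t \<cdot>\<^sub>E (Id P p \<odot>\<^sup>E fm H g) = fm H (fm (RR p) g) \<cdot>\<^sub>E lift_br p (Dom T g)"
  using lift_br(1)[of p] by (simp add: nat_trans_iff)

declare lift_bl(2) [simp] lift_br(2) [simp]

lemma lift_bl_iso [simp]: "n \<in> Ob N \<Longrightarrow> t \<in> Ob T \<Longrightarrow> iso_arr E (lift_bl n t)"
  by (rule UE.nat_isoI[OF _ _ lift_bl(1)]) (simp_all add: postL_functor precomp_functor H_functor LG.L_functor)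

lemma lift_br_iso [simp]: "p \<in> Ob P \<Longrightarrow> t \<in> Ob T \<Longrightarrow> iso_arr E (lift_br p t)"
  by (rule UE.nat_isoI[OF _ _ lift_br(1)]) (simp_all add: postR_functor precomp_functor H_functor RG_L_functor)

text \<open>\<open>H\<close> applied to a commuting square of \<open>T\<close>, in the split form
  that rewriting expects.\<close>

lemma H_swap: "fm H a \<cdot>\<^sub>E fm H b = fm H c \<cdot>\<^sub>E fm H d" if "a \<cdot>\<^sub>T b = c \<cdot>\<^sub>T d"
    "a \<in> Arr T" "b \<in> Arr T" "c \<in> Arr T" "d \<in> Arr T" "Cod T b = Dom T a" "Cod T d = Dom T c"
  using arg_cong[OF that(1), of "fm H"] that(2-) by simp

text \<open>Naturality in \<open>N\<close>, which the lift for a fixed \<open>n\<close> does not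
  contain; on generators it is \<open>kl_natural\<close> at an identity of \<open>C\<close>.\<close>

lemma lift_bl_tr:
  assumes [simp]: "f \<in> Arr N" and t: "t \<in> Ob T"
  shows "lift_bl (Cod N f) t \<cdot>\<^sub>E (f \<odot>\<^sub>E Id E (fo H t)) = fm H (LG.act_trans f t) \<cdot>\<^sub>E lift_bl (Dom N f) t"
proof (rule UE.nat_eqI[OF postL_functor[OF H_functor, of "Dom N f"] precomp_functor[OF H_functor LG.L_functor[of "Cod N f"]] _ _ _ t])
  have s: "(f \<odot>\<^sub>E Id E (fo H y)) \<cdot>\<^sub>E (Id N (Dom N f) \<odot>\<^sub>E fm H g) =
     (Id N (Cod N f) \<odot>\<^sub>E fm H g) \<cdot>\<^sub>E (f \<odot>\<^sub>E Id E (fo H (Dom T g)))"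
    if "g \<in> Arr T" "y = Cod T g" for g y
    using that by (simp add: E.L.act_merge)
  show "nat_trans T E (postL (Dom N f) H) (precomp (LL (Cod N f)) H) (\<lambda>t. lift_bl (Cod N f) t \<cdot>\<^sub>E (f \<odot>\<^sub>E Id E (fo H t)))"
    by (simp add: nat_trans_iff s UE.X.pre[OF lift_bl_natural])
  show "nat_trans T E (postL (Dom N f) H) (precomp (LL (Cod N f)) H) (\<lambda>t. fm H (LG.act_trans f t) \<cdot>\<^sub>E lift_bl (Dom N f) t)"
    by (simp add: nat_trans_iff lift_bl_natural UE.X.pre[OF H_swap[OF LG.act_trans_natural]])
  fix c d assume [simp]: "c \<in> Ob C" "d \<in> Ob D"
  show "lift_bl (Cod N f) (fo U (c, d)) \<cdot>\<^sub>E (f \<odot>\<^sub>E Id E (fo H (fo U (c, d)))) =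
    fm H (LG.act_trans f (fo U (c, d))) \<cdot>\<^sub>E lift_bl (Dom N f) (fo U (c, d))"
    using kl_natural[OF K, of f "Id C c" d] by simp
qed simp_all

lemma lift_br_tr:
  assumes [simp]: "f \<in> Arr P" and t: "t \<in> Ob T"
  shows "lift_br (Cod P f) t \<cdot>\<^sub>E (f \<odot>\<^sup>E Id E (fo H t)) = fm H (RG.act_trans f t) \<cdot>\<^sub>E lift_br (Dom P f) t"
proof (rule UE.nat_eqI[OF postR_functor[OF H_functor, of "Dom P f"] precomp_functor[OF H_functor RG_L_functor[of "Cod P f"]] _ _ _ t])
  have s: "(f \<odot>\<^sup>E Id E (fo H y)) \<cdot>\<^sub>E (Id P (Dom P f) \<odot>\<^sup>E fm H g) =
     (Id P (Cod P f) \<odot>\<^sup>E fm H g) \<cdot>\<^sub>E (f \<odot>\<^sup>E Id E (fo H (Dom T g)))"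
    if "g \<in> Arr T" "y = Cod T g" for g y
    using that E.R.act_merge[of f "fm H g" _ "Dom P f"] E.R.act_merge[of f "fm H g" _ "Cod P f"] by simp
  show "nat_trans T E (postR (Dom P f) H) (precomp (RR (Cod P f)) H) (\<lambda>t. lift_br (Cod P f) t \<cdot>\<^sub>E (f \<odot>\<^sup>E Id E (fo H t)))"
    by (simp add: nat_trans_iff s UE.X.pre[OF lift_br_natural])
  show "nat_trans T E (postR (Dom P f) H) (precomp (RR (Cod P f)) H) (\<lambda>t. fm H (RG.act_trans f t) \<cdot>\<^sub>E lift_br (Dom P f) t)"
    by (simp add: nat_trans_iff lift_br_natural UE.X.pre[OF H_swap[OF RG_tr_natural]])
  fix c d assume [simp]: "c \<in> Ob C" "d \<in> Ob D"
  show "lift_br (Cod P f) (fo U (c, d)) \<cdot>\<^sub>E (f \<odot>\<^sup>E Id E (fo H (fo U (c, d)))) =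
    fm H (RG.act_trans f (fo U (c, d))) \<cdot>\<^sub>E lift_br (Dom P f) (fo U (c, d))"
    using rs_natural[of "fo K c" f "Id D d"] by simp
qed simp_all

text \<open>Both sides are natural in \<open>t\<close>, and on generators the law is
  \<open>kl_mu\<close>. The right-hand version below reduces to \<open>rs_mu\<close> of the functors
  \<open>K(c)\<close>.\<close>

lemma lift_bl_mu:
  assumes [simp]: "m \<in> Ob N" "n \<in> Ob N" and t: "t \<in> Ob T"
  shows "fm H (mu LG.ACT m n t) \<cdot>\<^sub>E lift_bl m (fo (LL n) t) \<cdot>\<^sub>E (Id N m \<odot>\<^sub>E lift_bl n t) =
    lift_bl (m \<otimes>\<^bsub>N\<^esub> n) t \<cdot>\<^sub>E mu (Lact E) m n (fo H t)"
proof (rule UE.nat_eqI[OF postL_functor[OF postL_functor[OF H_functor, of n], of m] precomp_functor[OF H_functor LG.L_functor[of "m \<otimes>\<^bsub>N\<^esub> n"]] _ _ _ t])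
  show "nat_trans T E (postL m (postL n H)) (precomp (LL (m \<otimes>\<^bsub>N\<^esub> n)) H)
    (\<lambda>t. fm H (mu LG.ACT m n t) \<cdot>\<^sub>E lift_bl m (fo (LL n) t) \<cdot>\<^sub>E (Id N m \<odot>\<^sub>E lift_bl n t))"
    by (simp add: nat_trans_iff E.L.act_eq[OF lift_bl_natural] UE.X.pre[OF lift_bl_natural] UE.X.pre[OF H_swap[OF LG.mu_ACT_natural]])
  show "nat_trans T E (postL m (postL n H)) (precomp (LL (m \<otimes>\<^bsub>N\<^esub> n)) H)
    (\<lambda>t. lift_bl (m \<otimes>\<^bsub>N\<^esub> n) t \<cdot>\<^sub>E mu (Lact E) m n (fo H t))"
    by (simp add: nat_trans_iff E.L.mu_natural UE.X.pre[OF lift_bl_natural])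
  fix c d assume [simp]: "c \<in> Ob C" "d \<in> Ob D"
  show "fm H (mu LG.ACT m n (fo U (c, d))) \<cdot>\<^sub>E lift_bl m (fo (LL n) (fo U (c, d))) \<cdot>\<^sub>E (Id N m \<odot>\<^sub>E lift_bl n (fo U (c, d))) =
    lift_bl (m \<otimes>\<^bsub>N\<^esub> n) (fo U (c, d)) \<cdot>\<^sub>E mu (Lact E) m n (fo H (fo U (c, d)))"
    using kl_mu[OF K, of m n c d] by simp
qed simp_all

lemma lift_br_mu:
  assumes [simp]: "p \<in> Ob P" "q \<in> Ob P" and t: "t \<in> Ob T"
  shows "fm H (mu RG.ACT p q t) \<cdot>\<^sub>E lift_br p (fo (RR q) t) \<cdot>\<^sub>E (Id P p \<odot>\<^sup>E lift_br q t) =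
    lift_br (q \<otimes>\<^bsub>P\<^esub> p) t \<cdot>\<^sub>E mu (Ract E) p q (fo H t)"
proof (rule UE.nat_eqI[OF postR_functor[OF postR_functor[OF H_functor, of q], of p] precomp_functor[OF H_functor RG_L_functor[of "q \<otimes>\<^bsub>P\<^esub> p"]] _ _ _ t])
  show "nat_trans T E (postR p (postR q H)) (precomp (RR (q \<otimes>\<^bsub>P\<^esub> p)) H)
    (\<lambda>t. fm H (mu RG.ACT p q t) \<cdot>\<^sub>E lift_br p (fo (RR q) t) \<cdot>\<^sub>E (Id P p \<odot>\<^sup>E lift_br q t))"
    by (simp add: nat_trans_iff E.R_eq[OF lift_br_natural] UE.X.pre[OF lift_br_natural] UE.X.pre[OF H_swap[OF RG_mu_natural]])
  show "nat_trans T E (postR p (postR q H)) (precomp (RR (q \<otimes>\<^bsub>P\<^esub> p)) H)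
    (\<lambda>t. lift_br (q \<otimes>\<^bsub>P\<^esub> p) t \<cdot>\<^sub>E mu (Ract E) p q (fo H t))"
    by (simp add: nat_trans_iff E.R_natural UE.X.pre[OF lift_br_natural])
  fix c d assume [simp]: "c \<in> Ob C" "d \<in> Ob D"
  show "fm H (mu RG.ACT p q (fo U (c, d))) \<cdot>\<^sub>E lift_br p (fo (RR q) (fo U (c, d))) \<cdot>\<^sub>E (Id P p \<odot>\<^sup>E lift_br q (fo U (c, d))) =
    lift_br (q \<otimes>\<^bsub>P\<^esub> p) (fo U (c, d)) \<cdot>\<^sub>E mu (Ract E) p q (fo H (fo U (c, d)))"
    using rs_mu[of "fo K c" p q d] by simp
qed simp_all

lemma lift_bl_eta:
  assumes t: "t \<in> Ob T"
  shows "lift_bl j\<^bsub>N\<^esub> t \<cdot>\<^sub>E eta (Lact E) (fo H t) = fm H (eta LG.ACT t)"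
proof (rule UE.nat_eqI[OF H_functor precomp_functor[OF H_functor LG.L_functor[of "j\<^bsub>N\<^esub>"]] _ _ _ t])
  show "nat_trans T E H (precomp (LL j\<^bsub>N\<^esub>) H) (\<lambda>t. lift_bl j\<^bsub>N\<^esub> t \<cdot>\<^sub>E eta (Lact E) (fo H t))"
    by (simp add: nat_trans_iff E.L.eta_natural UE.X.pre[OF lift_bl_natural])
  show "nat_trans T E H (precomp (LL j\<^bsub>N\<^esub>) H) (\<lambda>t. fm H (eta LG.ACT t))"
    by (simp add: nat_trans_iff H_swap[OF LG.eta_ACT_natural])
qed (simp_all add: kl_eta[OF K])

lemma lift_br_eta:
  assumes t: "t \<in> Ob T"
  shows "lift_br j\<^bsub>P\<^esub> t \<cdot>\<^sub>E eta (Ract E) (fo H t) = fm H (eta RG.ACT t)"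
proof (rule UE.nat_eqI[OF H_functor precomp_functor[OF H_functor RG_L_functor[of "j\<^bsub>P\<^esub>"]] _ _ _ t])
  show "nat_trans T E H (precomp (RR j\<^bsub>P\<^esub>) H) (\<lambda>t. lift_br j\<^bsub>P\<^esub> t \<cdot>\<^sub>E eta (Ract E) (fo H t))"
    by (simp add: nat_trans_iff E.R_natural UE.X.pre[OF lift_br_natural])
  show "nat_trans T E H (precomp (RR j\<^bsub>P\<^esub>) H) (\<lambda>t. fm H (eta RG.ACT t))"
    by (simp add: nat_trans_iff H_swap[OF RG_eta_natural])
qed (simp_all add: rs_eta)

text \<open>Compatibility of the two lifted structures, with the identity bimodulator of
  \<open>T\<close> suppressed; on generators it is \<open>kl_linear\<close>.\<close>

lemma lift_bl_BR:
  assumes [simp]: "n \<in> Ob N" "p \<in> Ob P" and t: "t \<in> Ob T"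
  shows "lift_br p (fo (LL n) t) \<cdot>\<^sub>E (Id P p \<odot>\<^sup>E lift_bl n t) \<cdot>\<^sub>E zeta E n (fo H t) p =
    lift_bl n (fo (RR p) t) \<cdot>\<^sub>E (Id N n \<odot>\<^sub>E lift_br p t)"
proof (rule UE.nat_eqI[OF postL_functor[OF postR_functor[OF H_functor, of p], of n]
      precomp_functor[OF precomp_functor[OF H_functor LG.L_functor[of n]] RG_L_functor[of p]] _ _ _ t])
  have R: "lift_br p y \<cdot>\<^sub>E (Id P p \<odot>\<^sup>E fm H (fm (LL n) g)) = fm H (fm (LL n) (fm (RR p) g)) \<cdot>\<^sub>E lift_br p (fo (LL n) (Dom T g))"
    if "g \<in> Arr T" "y = fo (LL n) (Cod T g)" for g y
    using lift_br_natural[of p "fm (LL n) g"] that by simp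
  have z: "zeta E n x p \<cdot>\<^sub>E (Id N n \<odot>\<^sub>E Id P p \<odot>\<^sup>E fm H g) =
     (Id P p \<odot>\<^sup>E Id N n \<odot>\<^sub>E fm H g) \<cdot>\<^sub>E zeta E n (fo H (Dom T g)) p"
    if "g \<in> Arr T" "x = fo H (Cod T g)" for g x
    using that by (simp add: E.zeta_natural)
  show "nat_trans T E (postL n (postR p H)) (precomp (RR p) (precomp (LL n) H))
    (\<lambda>t. lift_br p (fo (LL n) t) \<cdot>\<^sub>E (Id P p \<odot>\<^sup>E lift_bl n t) \<cdot>\<^sub>E zeta E n (fo H t) p)"
    by (simp add: nat_trans_iff z UE.X.pre[OF E.R_eq[OF lift_bl_natural]] UE.X.pre[OF R])
  show "nat_trans T E (postL n (postR p H)) (precomp (RR p) (precomp (LL n) H))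
    (\<lambda>t. lift_bl n (fo (RR p) t) \<cdot>\<^sub>E (Id N n \<odot>\<^sub>E lift_br p t))"
    by (simp add: nat_trans_iff E.L.act_eq[OF lift_br_natural] UE.X.pre[OF lift_bl_natural])
qed (simp_all add: kl_linear[OF K])

definition "uncurry_bilin = \<lparr>fo = fo H, fm = fm H, bl = \<lambda>(n, t)\<in>Ob N \<times> Ob T. lift_bl n t, br = \<lambda>(t, p)\<in>Ob T \<times> Ob P. lift_br p t\<rparr>"

lemma uncurry_bilin_simps [simp]:
  "fo uncurry_bilin = fo H" "fm uncurry_bilin = fm H"
  "n \<in> Ob N \<Longrightarrow> t \<in> Ob T \<Longrightarrow> bl uncurry_bilin (n, t) = lift_bl n t" "p \<in> Ob P \<Longrightarrow> t \<in> Ob T \<Longrightarrow> br uncurry_bilin (t, p) = lift_br p t"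
  by (simp_all add: uncurry_bilin_def)

lemma uncurry_bilin_in: "uncurry_bilin \<in> Ob TE"
proof (rule TE_I)
  show "cat_functor T E uncurry_bilin" using H_functor by (simp add: cat_functor_def cat_functor_axioms_def)
  show "fo uncurry_bilin \<in> extensional (Ob T)" "fm uncurry_bilin \<in> extensional (Arr T)" by (simp_all add: H_ext)
  show "bl uncurry_bilin \<in> extensional (Ob N \<times> Ob T)" "br uncurry_bilin \<in> extensional (Ob T \<times> Ob P)" by (simp_all add: uncurry_bilin_def)
next
  fix f g assume [simp]: "f \<in> Arr N" "g \<in> Arr T"
  \<comment> \<open>Joint naturality is split into an arrow of \<open>N\<close>
    (\<open>lift_bl_tr\<close>) and an arrow of \<open>T\<close> (\<open>lift_bl_natural\<close>),
    matching the form of the induced action on arrows.\<close>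
  have "lift_bl (Cod N f) (Cod T g) \<cdot>\<^sub>E (f \<odot>\<^sub>E fm H g) =
    (lift_bl (Cod N f) (Cod T g) \<cdot>\<^sub>E (f \<odot>\<^sub>E Id E (fo H (Cod T g)))) \<cdot>\<^sub>E (Id N (Dom N f) \<odot>\<^sub>E fm H g)"
    by (simp add: E.L.act_merge)
  also have "\<dots> = (fm H (LG.act_trans f (Cod T g)) \<cdot>\<^sub>E fm H (fm (LL (Dom N f)) g)) \<cdot>\<^sub>E lift_bl (Dom N f) (Dom T g)"
    by (simp add: lift_bl_tr lift_bl_natural)
  finally show "bl uncurry_bilin (Cod N f, Cod T g) \<cdot>\<^sub>E (f \<odot>\<^sub>E fm uncurry_bilin g) = fm uncurry_bilin (f \<odot>\<^bsub>LG.ACT\<^esub> g) \<cdot>\<^sub>E bl uncurry_bilin (Dom N f, Dom T g)"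
    by (simp add: LG.ACT_a)
next
  fix f g assume [simp]: "f \<in> Arr P" "g \<in> Arr T"
  have "lift_br (Cod P f) (Cod T g) \<cdot>\<^sub>E (f \<odot>\<^sup>E fm H g) =
    (lift_br (Cod P f) (Cod T g) \<cdot>\<^sub>E (f \<odot>\<^sup>E Id E (fo H (Cod T g)))) \<cdot>\<^sub>E (Id P (Dom P f) \<odot>\<^sup>E fm H g)"
    using E.R.act_merge(1)[of f "fm H g" _ "Dom P f"] by simp
  also have "\<dots> = (fm H (RG.act_trans f (Cod T g)) \<cdot>\<^sub>E fm H (fm (RR (Dom P f)) g)) \<cdot>\<^sub>E lift_br (Dom P f) (Dom T g)"
    by (simp add: lift_br_tr lift_br_natural)
  finally show "br uncurry_bilin (Cod T g, Cod P f) \<cdot>\<^sub>E (f \<odot>\<^sup>E fm uncurry_bilin g) = fm uncurry_bilin (f \<odot>\<^bsub>RG.ACT\<^esub> g) \<cdot>\<^sub>E br uncurry_bilin (Dom T g, Dom P f)"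
    by (simp add: RG.ACT_a)
qed (simp_all add: lift_bl_mu lift_br_mu lift_bl_eta lift_br_eta lift_bl_BR)

text \<open>\<open>lift_br\<close> was chosen to take the values of \<open>rs (fo K c)\<close> on
  generators, so the right linear structure is recovered as well; extensionality of both sides turns
  this into an equality.\<close>

lemma curry_at_uncurry: assumes [simp]: "c \<in> Ob C" shows "curry_at uncurry_bilin c = fo K c"
proof -
  have ext: "fo (fo K c) \<in> extensional (Ob D)" "fm (fo K c) \<in> extensional (Arr D)" "rs (fo K c) \<in> extensional (Ob D \<times> Ob P)"
    using RL_ext[of "fo K c"] by simp_all
  have "fo (curry_at uncurry_bilin c) = fo (fo K c)"
    by (rule extensionalityI[OF _ ext(1)]) (simp_all add: curry_at_def)
  moreover have "fm (curry_at uncurry_bilin c) = fm (fo K c)"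
    by (rule extensionalityI[OF _ ext(2)]) (simp_all add: curry_at_def kf_Id[OF K])
  moreover have "rs (curry_at uncurry_bilin c) = rs (fo K c)"
    by (rule extensionalityI[OF _ ext(3)]) (auto simp: curry_at_def)
  ultimately show ?thesis by simp
qed

text \<open>Extensionality reduces each of the four fields to its values, and arrows of
  \<open>RL\<close> to their components, which are values at generators.\<close>

lemma curry_uncurry: "curry_o uncurry_bilin = K"
proof -
  note [simp] = uncurry_bilin_in curry_at_uncurry kf_Id[OF K]
  have "fo (curry_o uncurry_bilin) = fo K"
    by (rule extensionalityI[OF _ CH_ext(1)[OF K]]) (simp_all add: curry_o_def)
  moreover have "fm (curry_o uncurry_bilin) = fm K"
  proof (rule extensionalityI[OF _ CH_ext(2)[OF K]])
    show "fm (curry_o uncurry_bilin) f = fm K f" if "f \<in> Arr C" for f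
      using curry_fm_arr[OF uncurry_bilin_in that] that by (intro RL_eqI) simp_all
  qed (simp add: curry_o_def)
  moreover have "bl (curry_o uncurry_bilin) = bl K"
  proof (rule extensionalityI[OF _ CH_ext(3)[OF K]])
    show "bl (curry_o uncurry_bilin) x = bl K x" if x: "x \<in> Ob N \<times> Ob C" for x
    proof -
      obtain n c where [simp]: "x = (n, c)" "n \<in> Ob N" "c \<in> Ob C" using x by auto
      show ?thesis using curry_bl_arr(1)[OF uncurry_bilin_in, of n c] by (intro RL_eqI) simp_all
    qed
  qed (simp add: curry_o_def)
  moreover have "br (curry_o uncurry_bilin) = br K"
  proof (rule extensionalityI[OF _ CH_ext(4)[OF K]])
    show "br (curry_o uncurry_bilin) x = br K x" if x: "x \<in> Ob C \<times> Ob M" for x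
    proof -
      obtain m c where [simp]: "x = (c, m)" "m \<in> Ob M" "c \<in> Ob C" using x by auto
      \<comment> \<open>\<open>H\<close> sends the balancing to the inverse of \<open>kr\<close>,
        hence the inverse balancing to \<open>kr\<close> itself.\<close>
      have "fm H (eps_inv c m d) = kr K c m d" if "d \<in> Ob D" for d
        using that by (simp flip: H.fm_iso(2))
      then show ?thesis using curry_br_arr(1)[OF uncurry_bilin_in, of m c] by (intro RL_eqI) simp_all
    qed
  qed (simp add: curry_o_def)
  ultimately show ?thesis by simp
qed

end

section \<open>Surjectivity of currying\<close>

lemma curry_o_surj:
  assumes "K \<in> Ob CH" shows "\<exists>H\<in>Ob TE. curry_o H = K"
  using UE.lift_exists[OF uncurry_bal_in[OF assms]] uncurry_bilin_in[OF assms] curry_uncurry[OF assms] by blast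

text \<open>Source and target are curried forms by surjectivity on objects. The components of
  \<theta> then form a balanced family, its balancedness being the right linearity of \<theta> over
  \<open>M\<close>, inverted.\<close>

lemma curry_a_surj:
  assumes \<theta>: "\<theta> \<in> Arr CH" shows "\<exists>\<xi>\<in>Arr TE. curry_a \<xi> = \<theta>"
proof -
  note CH_Cmp = act_cat.AC_Cmp[OF act_cat_CH \<theta>, unfolded HB_simps]
  obtain H H' where H [simp]: "H \<in> Ob TE" "H' \<in> Ob TE" and Phi: "Src \<theta> = curry_o H" "Tgt \<theta> = curry_o H'"
    using curry_o_surj CH_Cmp(1,2) by metis
  have \<theta>c [simp]: "Cmp \<theta> c \<in> Arr RL" "Src (Cmp \<theta> c) = curry_at H c" "Tgt (Cmp \<theta> c) = curry_at H' c" if "c \<in> Ob C" for c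
    using CH_Cmp(4-6)[OF that] that by (simp_all add: Phi)
  have "\<exists>\<xi>. nat_trans T E (plain H) (plain H') \<xi> \<and> (\<forall>c\<in>Ob C. \<forall>d\<in>Ob D. \<xi> (fo U (c, d)) = Cmp (Cmp \<theta> c) d)"
  proof (rule UE.nat_lift[OF TE_plain TE_plain])
    fix f g assume [simp]: "f \<in> Arr C" "g \<in> Arr D"
    \<comment> \<open>Naturality in \<open>c\<close> comes from \<theta>, naturality in
      \<open>d\<close> from its components being arrows of \<open>RL\<close>; a pair of arrows is a
      composite of the two cases.\<close>
    have 1: "Cmp (Cmp \<theta> (Cod C f)) d \<cdot>\<^sub>E fm H (fm U (f, Id D d)) = fm H' (fm U (f, Id D d)) \<cdot>\<^sub>E Cmp (Cmp \<theta> (Dom C f)) d"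
      if "d \<in> Ob D" for d
      using arg_cong[OF act_cat.AC_Cmp_natural[OF act_cat_CH \<theta>, of f "Cod C f"], of "\<lambda>\<tau>. Cmp \<tau> d"] that by (simp add: Phi)
    have 2: "Cmp (Cmp \<theta> (Dom C f)) (Cod D g) \<cdot>\<^sub>E fm H (fm U (Id C (Dom C f), g)) =
        fm H' (fm U (Id C (Dom C f), g)) \<cdot>\<^sub>E Cmp (Cmp \<theta> (Dom C f)) (Dom D g)"
      using RL_Cmp_natural[of "Cmp \<theta> (Dom C f)" g] by simp
    have fg: "fm U (f, g) = fm U (f, Id D (Cod D g)) \<cdot>\<^sub>T fm U (Id C (Dom C f), g)" by (simp add: U.bi_merge)
    show "Cmp (Cmp \<theta> (Cod C f)) (Cod D g) \<cdot>\<^sub>E fm (plain H) (fm U (f, g)) =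
      fm (plain H') (fm U (f, g)) \<cdot>\<^sub>E Cmp (Cmp \<theta> (Dom C f)) (Dom D g)"
      by (simp add: fg 2 UE.X.pre[OF 1])
  next
    fix c m d assume [simp]: "c \<in> Ob C" "m \<in> Ob M" "d \<in> Ob D"
    have "Cmp (Cmp \<theta> (m \<bullet>\<^sup>C c)) d \<cdot>\<^sub>E fm H (eps_inv c m d) = fm H' (eps_inv c m d) \<cdot>\<^sub>E Cmp (Cmp \<theta> c) (m \<bullet>\<^sub>D d)"
      using arg_cong[OF act_cat.AC_Cmp_right[OF act_cat_CH \<theta>, of m c], of "\<lambda>\<tau>. Cmp \<tau> d"] by (simp add: Phi)
    then have "inv_arr E (fm H' (eps_inv c m d)) \<cdot>\<^sub>E Cmp (Cmp \<theta> (m \<bullet>\<^sup>C c)) d =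
      Cmp (Cmp \<theta> c) (m \<bullet>\<^sub>D d) \<cdot>\<^sub>E inv_arr E (fm H (eps_inv c m d))"
      by (intro UE.X.inv_square) simp_all
    then show "fm (plain H') (eps U (c, m, d)) \<cdot>\<^sub>E Cmp (Cmp \<theta> (m \<bullet>\<^sup>C c)) d =
      Cmp (Cmp \<theta> c) (m \<bullet>\<^sub>D d) \<cdot>\<^sub>E fm (plain H) (eps U (c, m, d))" by simp
  qed simp_all
  then obtain \<xi> where \<xi>: "nat_trans T E (plain H) (plain H') \<xi>"
    and [simp]: "\<And>c d. c \<in> Ob C \<Longrightarrow> d \<in> Ob D \<Longrightarrow> \<xi> (fo U (c, d)) = Cmp (Cmp \<theta> c) d" by blast
  then have [simp]: "\<xi> t \<in> Arr E" "Dom E (\<xi> t) = fo H t" "Cod E (\<xi> t) = fo H' t" if "t \<in> Ob T" for t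
    using that by (simp_all add: nat_trans_iff)
  have \<xi>n: "\<xi> t \<cdot>\<^sub>E fm H g = fm H' g \<cdot>\<^sub>E \<xi> (Dom T g)" if "g \<in> Arr T" "t = Cod T g" for g t
    using \<xi> that by (simp add: nat_trans_iff)
  \<comment> \<open>On generators this is left linearity of \<theta> over \<open>N\<close>. The
    companion \<open>r\<close> reduces to right linearity over \<open>P\<close> of the single
    components of \<theta>.\<close>
  have l: "\<xi> (fo (LL n) t) \<cdot>\<^sub>E bl H (n, t) = bl H' (n, t) \<cdot>\<^sub>E (Id N n \<odot>\<^sub>E \<xi> t)"
    if [simp]: "n \<in> Ob N" and t: "t \<in> Ob T" for n t
  proof (rule UE.nat_eqI[OF postL_functor[OF TE_plain[OF H(1)], of n] precomp_functor[OF TE_plain[OF H(2)] LG.L_functor[of n]] _ _ _ t])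
    note nH = TE_bl_natural[of _ "Id N n" _ n, simplified]
    show "nat_trans T E (postL n (plain H)) (precomp (LL n) (plain H')) (\<lambda>t. \<xi> (fo (LL n) t) \<cdot>\<^sub>E bl H (n, t))"
      by (simp add: nat_trans_iff nH UE.X.pre[OF \<xi>n])
    show "nat_trans T E (postL n (plain H)) (precomp (LL n) (plain H')) (\<lambda>t. bl H' (n, t) \<cdot>\<^sub>E (Id N n \<odot>\<^sub>E \<xi> t))"
      by (simp add: nat_trans_iff E.L.act_eq[OF \<xi>n] UE.X.pre[OF nH])
    fix c d assume [simp]: "c \<in> Ob C" "d \<in> Ob D"
    show "\<xi> (fo (LL n) (fo U (c, d))) \<cdot>\<^sub>E bl H (n, fo U (c, d)) = bl H' (n, fo U (c, d)) \<cdot>\<^sub>E (Id N n \<odot>\<^sub>E \<xi> (fo U (c, d)))"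
      using arg_cong[OF act_cat.AC_Cmp_left[OF act_cat_CH \<theta>, of n c], of "\<lambda>\<tau>. Cmp \<tau> d"] by (simp add: Phi)
  qed simp_all
  have r: "\<xi> (fo (RR p) t) \<cdot>\<^sub>E br H (t, p) = br H' (t, p) \<cdot>\<^sub>E (Id P p \<odot>\<^sup>E \<xi> t)"
    if [simp]: "p \<in> Ob P" and t: "t \<in> Ob T" for p t
  proof (rule UE.nat_eqI[OF postR_functor[OF TE_plain[OF H(1)], of p] precomp_functor[OF TE_plain[OF H(2)] RG_L_functor[of p]] _ _ _ t])
    note nH = TE_br_natural[of _ "Id P p" _ p, simplified]
    show "nat_trans T E (postR p (plain H)) (precomp (RR p) (plain H')) (\<lambda>t. \<xi> (fo (RR p) t) \<cdot>\<^sub>E br H (t, p))"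
      by (simp add: nat_trans_iff nH UE.X.pre[OF \<xi>n])
    show "nat_trans T E (postR p (plain H)) (precomp (RR p) (plain H')) (\<lambda>t. br H' (t, p) \<cdot>\<^sub>E (Id P p \<odot>\<^sup>E \<xi> t))"
      by (simp add: nat_trans_iff E.R_eq[OF \<xi>n] UE.X.pre[OF nH])
    fix c d assume [simp]: "c \<in> Ob C" "d \<in> Ob D"
    show "\<xi> (fo (RR p) (fo U (c, d))) \<cdot>\<^sub>E br H (fo U (c, d), p) = br H' (fo U (c, d), p) \<cdot>\<^sub>E (Id P p \<odot>\<^sup>E \<xi> (fo U (c, d)))"
      using RL_Cmp_linear[of "Cmp \<theta> c" d p] by simp
  qed simp_all
  let ?\<xi> = "\<lparr>Src = H, Tgt = H', Cmp = restrict \<xi> (Ob T)\<rparr>"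
  have \<xi>_in: "?\<xi> \<in> Arr TE"
    by (rule act_cat.Arr_AC_I[OF act_cat_TE, unfolded TB_simps TB_act LG.ACT_o RG.ACT_o]) (simp_all add: \<xi>n l r)
  have "curry_a ?\<xi> = \<theta>"
  proof (rule trans_eqI[where X="Ob C"])
    show "Cmp (curry_a ?\<xi>) c = Cmp \<theta> c" if "c \<in> Ob C" for c
      using that curry_c_arr[OF \<xi>_in that] by (intro RL_eqI) simp_all
  qed (simp_all add: Phi CH_Cmp curry_a_def)
  with \<xi>_in show ?thesis by blast
qed

lemma curry_iso: "cat_iso TE CH \<lparr>fo = curry_o, fm = curry_a\<rparr>"
  unfolding cat_iso_def
proof (intro conjI)
  show "cat_functor TE CH \<lparr>fo = curry_o, fm = curry_a\<rparr>" by (rule curry_functor)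
  show "bij_betw (fo \<lparr>fo = curry_o, fm = curry_a\<rparr>) (Ob TE) (Ob CH)"
    using curry_o_inj curry_o_in curry_o_surj by (auto simp: bij_betw_def)
  show "bij_betw (fm \<lparr>fo = curry_o, fm = curry_a\<rparr>) (Arr TE) (Arr CH)"
    using curry_a_inj curry_a_in curry_a_surj by (auto simp: bij_betw_def)
qed

end

theorem proposition4p4p7:
  fixes N :: "('no, 'na) monoidal" and M :: "('mo, 'ma) monoidal" and P :: "('po, 'pa) monoidal"
    and C :: "('no, 'na, 'mo, 'ma, 'co, 'ca) biact"
    and D :: "('mo, 'ma, 'po, 'pa, 'do, 'da) biact"
    and E :: "('no, 'na, 'po, 'pa, 'eo, 'ea) biact"
    and T :: "('to, 'ta) cat" and U :: "('co, 'ca, 'do, 'da, 'mo, 'to, 'ta) bal"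
  assumes "monoidal_category M" and "monoidal_category N" and "monoidal_category P"
    and "biactegory N M C" and "biactegory M P D" and "biactegory N P E"
    and "category T"
    and "U \<in> Ob (Bal M C (Ract C) D (Lact D) T)"
    and "\<And>X :: ('to, 'ta) cat. category X \<Longrightarrow> represents_Bal M C (Ract C) D (Lact D) T U X"
    and "\<And>X :: ('eo, 'ea) cat. category X \<Longrightarrow> represents_Bal M C (Ract C) D (Lact D) T U X"
  shows "biactegory N M (hom_biact N M P D E) \<and>
         biactegory N P (tensor_biact N M P C D T U) \<and>
         Act N P (tensor_biact N M P C D T U) E \<cong> Act N M C (hom_biact N M P D E)"
proof -
  interpret C: biactegory N M C by fact
  interpret D: biactegory M P D by fact
  interpret E: biactegory N P E by fact
  interpret U: balanced_functor M C "Ract C" D "Lact D" T U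
    using assms(8) by (simp add: Bal_def)
  \<comment> \<open>The universal property is invoked at the bare categories underlying
    \<open>T\<close> and \<open>E\<close>, the form in which \<open>tensor_univ\<close> expects
    it.\<close>
  have "represents_Bal M C (Ract C) D (Lact D) T U (cat.truncate T)"
    "represents_Bal M C (Ract C) D (Lact D) T U (cat.truncate E)"
    using assms(9)[of "cat.truncate T"] assms(10)[of "cat.truncate E"] assms(7) E.L.C.category_axioms
    by (simp_all add: truncate_iff)
  then interpret adjunction N M P C D E T U
    using assms(8) by unfold_locales
  show ?thesis
    using biactegory_hom biactegory_tensor curry_iso by (auto simp: isomorphic_cats_def)
qed

end
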